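(* Let $D\subset\mathfrak X$ be a Greenian open set. (a) Suppose that $z_0\in\partial D$. Assume that there exists $0<R\le R_0$ such that C1$(z_0,R)$ and E1$(z_0,R)$ hold, and that $\widehat X$ satisfies F1$(z_0,R)$. Then there is only one Martin boundary point associated with $z_0$. (b) Assume further that G holds, that $X$ satisfies F1$(z_0,R)$, that for all $r\in(0,R]$ $$\sup_{x\in D\cap B(z_0,r/2)}\ \sup_{y\in\mathfrak X\setminus B(z_0,r)}\max\big(G_D(x,y),\widehat G_D(x,y)\big)=:c(r)<\infty,$$ and, in case $D$ is unbounded, that for all $r\in(0,R]$ $$\lim_{x\to\infty}G_D(x,y)=0\quad\text{for all }y\in D\cap B(z_0,r).$$ Then the Martin boundary point associated with $z_0\in\partial D$ is minimal if and only if $z_0$ is accessible from $D$ with respect to $X$.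
   Context: Setting. $(\mathfrak X,d,m)$ is a metric measure space with a countable base such that all bounded closed sets are compact and $m$ has full support; $B(x,r)$ is the ball with center $x$ and radius $r$, $\overline B(x,r)$ its closure, $A^c$ the complement of $A$ in $\mathfrak X$. $R_0\in(0,\infty]$ (the localization radius) is such that $\mathfrak X\setminus B(x,2r)\ne\emptyset$ for all $x\in\mathfrak X$ and all $r<R_0$. $X=(X_t,\mathcal F_t,\mathbb P_x)$ is a Hunt process on $\mathfrak X$ with lifetime $\zeta$ and cemetery $\partial$ (convention: $X_\zeta=\partial$ and $u(\partial)=0$ for every function $u$). Standing assumptions: $X$ admits a strong dual process $\widehat X$ with respect to $m$, which is also a Hunt process; the transition semigroups of $X$ and $\widehat X$ are both Feller and strong Feller; every semi-polar set of $X$ is polar. $X$ has a Lévy system $(J,H)$ with $H_t=t$, i.e. $\mathbb E_x\sum_{0<s\le T}f(X_{s-},X_s)=\mathbb E_x\int_0^T\int f(X_s,y)J(X_s,dy)\,ds$ for every $f:\mathfrak X\times\mathfrak X\to[0,\infty)$ vanishing on the diagonal and every stopping time $T$; similarly for $\widehat X$ with $\widehat J$; and $J(x,dy)=j(x,y)m(dy)$, $\widehat J(x,dy)=\widehat j(x,y)m(dy)$, with $j(x,y)=\widehat j(y,x)>0$ for all $x\ne y$. Objects related to $\widehat X$ carry a hat. For an open set $D$: $\tau_D=\inf\{t>0:X_t\notin D\}$; $X^D$ is $X$ killed at $\tau_D$; $G_D(x,y)$ is the Green function of $X^D$, i.e. $\mathbb E_x\int_0^{\tau_D}f(X_t)dt=\int_DG_D(x,y)f(y)m(dy)$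 for Borel $f\ge0$, with $G_D(x,y)=\widehat G_D(y,x)$ and $G_D=0$ off $D\times D$; $D$ is Greenian if $G_D$ is finite away from the diagonal. $P_D(x,z)=\int_DG_D(x,y)j(y,z)m(dy)$ for $x\in D$, $z\in D^c$. $D^{\mathrm{reg}}$ is the set of $z\in\partial D$ with $\mathbb P_z(\tau_D=0)=1$ and $\widehat D^{\mathrm{reg}}$ its analogue for $\widehat X$. $f:\mathfrak X\to[0,\infty)$ is regular harmonic in $D$ with respect to $X$ if $f(x)=\mathbb E_x[f(X_{\tau_D}),\tau_D<\zeta]$ for all $x\in D$ (similarly for $\widehat X$). $f:D\to[0,\infty)$ is harmonic with respect to $X^D$ if for every relatively compact open $U\subset\overline U\subset D$, $f(x)=\mathbb E_x[f(X^D_{\tau_U}),\tau_U<\zeta]$ for all $x\in U$; it is minimal harmonic if moreover every harmonic $g$ (with respect to $X^D$) with $0\le g\le f$ is a constant multiple of $f$. A point $z\in\partial D$ is accessible from $D$ with respect to $X$ if $P_D(x,z)=\infty$ for all $x\in D$, and inaccessible otherwise. $x\to\infty$ means that the distance of $x$ to a fixed point tends to $\infty$. Martin boundary. Fix $x_0\in D$ and put $M_D(x,y)=G_D(x,y)/G_D(x_0,y)$, $x,y\in D$, $y\neq x_0$. $\partial_MD$ is the Martin boundary of $D$ with respect to $X^D$ in the sense of Kunita–Watanabe; it satisfies: (M1) $D\cup\partial_MD$ is a compact metric space; (M2) $D$ is open and dense in $D\cup\partial_MD$ and its relative topology is its original topology; (M3) $M_D(x,\cdot)$ extends uniquely to $\partial_MD$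 so that $M_D(x,y)\to M_D(x,w)$ as $y\to w\in\partial_MD$ in the Martin topology, $x\mapsto M_D(x,w)$ is excessive for $X^D$ for each $w\in D\cup\partial_MD$, $(x,w)\mapsto M_D(x,w)$ is jointly continuous on $D\times((D\setminus\{x_0\})\cup\partial_MD)$, and $M_D(\cdot,w_1)\ne M_D(\cdot,w_2)$ for distinct $w_1,w_2\in\partial_MD$. A point $w\in\partial_MD$ is minimal if $M_D(\cdot,w)$ is a minimal harmonic function with respect to $X^D$. $w\in\partial_MD$ is associated with $z_0\in\partial D$ if some sequence $(y_n)\subset D$ converges to $w$ in the Martin topology and to $z_0$ in $\mathfrak X$. C1$(z_0,R)$ ($R\le R_0$): for all $0<r_1<r_2<R$ there is $c=c(z_0,r_2/r_1)>0$ such that for all $x\in B(z_0,r_1)$, $y\in\mathfrak X\setminus B(z_0,r_2)$: $c^{-1}j(z_0,y)\le j(x,y)\le c\,j(z_0,y)$ and $c^{-1}\widehat j(z_0,y)\le\widehat j(x,y)\le c\,\widehat j(z_0,y)$. E1$(z_0,R)$: for every $r\in(0,R)$, $\lim_{d(z_0,y)\to0}\sup_{z:d(z_0,z)>r}\frac{j(z,z_0)}{j(z,y)}=\lim_{d(z_0,y)\to0}\inf_{z:d(z_0,z)>r}\frac{j(z,z_0)}{j(z,y)}=1$. F1$(z_0,R)$ for $X$ ($R\le R_0$): for any $\frac12<a<1$ there is $C(a)=C(z_0,R,a)\ge1$ such that for every $r\in(0,R)$, every open $D\subset B(z_0,r)$, every nonnegative $f$ on $\mathfrak X$ which is regular harmonic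 in $D$ with respect to $X$ and vanishes on $B(z_0,r)\cap(\overline D^{\,c}\cup D^{\mathrm{reg}})$, and all $x\in D\cap B(z_0,r/8)$, $$C(a)^{-1}\mathbb E_x[\tau_D]\int_{\overline B(z_0,ar/2)^c}j(z_0,y)f(y)m(dy)\le f(x)\le C(a)\mathbb E_x[\tau_D]\int_{\overline B(z_0,ar/2)^c}j(z_0,y)f(y)m(dy).$$ "$\widehat X$ satisfies F1" means the same with $X,\tau_D,j,D^{\mathrm{reg}}$ replaced by $\widehat X,\widehat\tau_D,\widehat j,\widehat D^{\mathrm{reg}}$. G: $\lim_{D\ni x\to z}G_D(x,y)=0$ for every $z\in D^{\mathrm{reg}}$ and every $y\in D$. *)

theory Defs
  imports "HOL-Probability.Probability"
begin

section \<open>State space with cemetery\<close>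

text \<open>The cemetery is \<^const>\<open>None\<close>. In \<open>Alexandroff_compactification\<close> it is the point at infinity,
  and an isolated point if the state space is compact.\<close>

abbreviation onept :: "'a::topological_space option topology" where
  "onept \<equiv> Alexandroff_compactification euclidean"

definition cem_borel :: "'a::topological_space option measure" where
  "cem_borel = sigma UNIV {U. openin onept U}"

text \<open>The convention $u(\partial) = 0$.\<close>

definition ext0 :: "('a \<Rightarrow> 'b::zero) \<Rightarrow> 'a option \<Rightarrow> 'b" where
  "ext0 u z = (case z of None \<Rightarrow> 0 | Some x \<Rightarrow> u x)"

definition metric_measure_space :: "'a::{metric_space, second_countable_topology} measure \<Rightarrow> bool" where
  "metric_measure_space m \<longleftrightarrow>
     sets m = sets borel \<and>
     (\<forall>K. compact K \<longrightarrow> emeasure m K < \<infinity>) \<and>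
     (\<forall>U. open U \<and> U \<noteq> {} \<longrightarrow> 0 < emeasure m U) \<and>
     (\<forall>S::'a set. bounded S \<and> closed S \<longrightarrow> compact S)"

definition localization_radius :: "'a::metric_space itself \<Rightarrow> ereal \<Rightarrow> bool" where
  "localization_radius _ R0 \<longleftrightarrow> 0 < R0 \<and> (\<forall>(x::'a) r. ereal r < R0 \<longrightarrow> - ball x (2 * r) \<noteq> {})"

section \<open>Hunt processes\<close>

text \<open>Time runs through $[0,\infty]$, with the convention $X_\infty = \partial$. The measures
  \<open>law X x\<close> live on the uncompleted $\sigma$-algebra generated by the process.\<close>

record ('w, 'a) proc =
  sample :: "'w set"
  path :: "ennreal \<Rightarrow> 'w \<Rightarrow> 'a option"
  law :: "'a \<Rightarrow> 'w measure"

definition natural_filt :: "('w, 'a::topological_space) proc \<Rightarrow> ennreal \<Rightarrow> 'w measure" where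
  "natural_filt X t =
     sigma (sample X) {path X s -` A \<inter> sample X | s A. s \<le> t \<and> A \<in> sets cem_borel}"

definition law_from :: "('w, 'a::topological_space) proc \<Rightarrow> 'a measure \<Rightarrow> 'w measure" where
  "law_from X \<mu> = \<mu> \<bind> law X"

text \<open>The minimal augmented filtration: the intersection, over all initial distributions $\mu$, of
  the natural $\sigma$-algebra at time $t$ enlarged by the $\mathbb P_\mu$-null sets.\<close>

definition aug_filt :: "('w, 'a::topological_space) proc \<Rightarrow> ennreal \<Rightarrow> 'w measure" where
  "aug_filt X t = sigma (sample X)
     {A. A \<subseteq> sample X \<and>
         (\<forall>\<mu>\<in>space (prob_algebra borel). \<exists>C\<in>sets (natural_filt X t).
            \<exists>N\<in>null_sets (law_from X \<mu>). (A - C) \<union> (C - A) \<subseteq> N)}"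

definition expct :: "('w, 'a) proc \<Rightarrow> 'a \<Rightarrow> ('w \<Rightarrow> ennreal) \<Rightarrow> ennreal" where
  "expct X x Z = (\<integral>\<^sup>+\<omega>. Z \<omega> \<partial>completion (law X x))"

definition semigroup_op :: "('w, 'a) proc \<Rightarrow> ennreal \<Rightarrow> ('a \<Rightarrow> ennreal) \<Rightarrow> 'a \<Rightarrow> ennreal" where
  "semigroup_op X t f x = expct X x (\<lambda>\<omega>. ext0 f (path X t \<omega>))"

text \<open>The same operator on bounded real functions.\<close>

definition semigroup_real :: "('w, 'a) proc \<Rightarrow> ennreal \<Rightarrow> ('a \<Rightarrow> real) \<Rightarrow> 'a \<Rightarrow> real" where
  "semigroup_real X t f x = (\<integral>\<omega>. ext0 f (path X t \<omega>) \<partial>law X x)"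

definition strong_markov :: "('w, 'a::topological_space) proc \<Rightarrow> bool" where
  "strong_markov X \<longleftrightarrow>
     (\<forall>T. stopping_time (aug_filt X) T \<longrightarrow>
       (\<forall>A\<in>sets (filtration.pre_sigma (sample X) (aug_filt X) T).
        \<forall>f\<in>borel_measurable borel. \<forall>x t. t < \<infinity> \<longrightarrow>
          expct X x (\<lambda>\<omega>. indicator A \<omega> * ext0 f (path X (T \<omega> + t) \<omega>)) =
          expct X x (\<lambda>\<omega>. indicator A \<omega> * ext0 (semigroup_op X t f) (path X (T \<omega>) \<omega>))))"

definition quasi_left_continuous :: "('w, 'a::topological_space) proc \<Rightarrow> bool" where
  "quasi_left_continuous X \<longleftrightarrow>
     (\<forall>T :: nat \<Rightarrow> 'w \<Rightarrow> ennreal.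
        (\<forall>n. stopping_time (aug_filt X) (T n)) \<and> (\<forall>\<omega>\<in>sample X. incseq (\<lambda>n. T n \<omega>)) \<longrightarrow>
        (\<forall>x. AE \<omega> in law X x. (SUP n. T n \<omega>) < \<infinity> \<longrightarrow>
           limitin onept (\<lambda>n. path X (T n \<omega>) \<omega>) (path X (SUP n. T n \<omega>) \<omega>) sequentially))"

definition hunt_process :: "('w, 'a::topological_space) proc \<Rightarrow> bool" where
  "hunt_process X \<longleftrightarrow>
     law X \<in> borel \<rightarrow>\<^sub>M prob_algebra (natural_filt X \<infinity>) \<and>
     (\<forall>x. AE \<omega> in law X x. path X 0 \<omega> = Some x) \<and>
     (\<forall>\<omega>\<in>sample X. path X \<infinity> \<omega> = None) \<and>
     (\<forall>\<omega>\<in>sample X. \<forall>s t. s \<le> t \<and> path X s \<omega> = None \<longrightarrow> path X t \<omega> = None) \<and>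
     (\<forall>\<omega>\<in>sample X. \<forall>t<\<infinity>. limitin onept (\<lambda>s. path X s \<omega>) (path X t \<omega>) (at_right t)) \<and>
     (\<forall>\<omega>\<in>sample X. \<forall>t<\<infinity>. 0 < t \<longrightarrow> (\<exists>l. limitin onept (\<lambda>s. path X s \<omega>) l (at_left t))) \<and>
     (\<forall>t<\<infinity>. sets (aug_filt X t) = (\<Inter>s\<in>{t<..}. sets (aug_filt X s))) \<and>
     strong_markov X \<and>
     quasi_left_continuous X"

definition left_lim :: "('w, 'a::topological_space) proc \<Rightarrow> ennreal \<Rightarrow> 'w \<Rightarrow> 'a option" where
  "left_lim X t \<omega> = (THE l. limitin onept (\<lambda>s. path X s \<omega>) l (at_left t))"

definition lifetime :: "('w, 'a) proc \<Rightarrow> 'w \<Rightarrow> ennreal" where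
  "lifetime X \<omega> = Inf {t. path X t \<omega> = None}"

definition hit :: "('w, 'a) proc \<Rightarrow> 'a set \<Rightarrow> 'w \<Rightarrow> ennreal" where
  "hit X A \<omega> = Inf {t. 0 < t \<and> path X t \<omega> \<in> Some ` A}"

definition exit_time :: "('w, 'a) proc \<Rightarrow> 'a set \<Rightarrow> 'w \<Rightarrow> ennreal" where
  "exit_time X D \<omega> = Inf {t. 0 < t \<and> path X t \<omega> \<notin> Some ` D}"

definition killed_path :: "('w, 'a) proc \<Rightarrow> 'a set \<Rightarrow> ennreal \<Rightarrow> 'w \<Rightarrow> 'a option" where
  "killed_path X D t \<omega> = (if t < exit_time X D \<omega> then path X t \<omega> else None)"

section \<open>Feller properties, duality, exceptional sets\<close>

definition C_zero :: "('a::topological_space \<Rightarrow> real) \<Rightarrow> bool" where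
  "C_zero f \<longleftrightarrow> continuous_on UNIV f \<and> (\<forall>e>0. \<exists>K. compact K \<and> (\<forall>x. x \<notin> K \<longrightarrow> \<bar>f x\<bar> < e))"

definition feller :: "('w, 'a::topological_space) proc \<Rightarrow> bool" where
  "feller X \<longleftrightarrow> (\<forall>f. C_zero f \<longrightarrow>
     (\<forall>t<\<infinity>. C_zero (semigroup_real X t f)) \<and>
     uniform_limit UNIV (\<lambda>t. semigroup_real X t f) f (at_right 0))"

definition strong_feller :: "('w, 'a::topological_space) proc \<Rightarrow> bool" where
  "strong_feller X \<longleftrightarrow> (\<forall>f\<in>borel_measurable borel. bounded (range f) \<longrightarrow>
     (\<forall>t. 0 < t \<and> t < \<infinity> \<longrightarrow>
        continuous_on UNIV (semigroup_real X t f) \<and> bounded (range (semigroup_real X t f))))"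

definition resolvent :: "('w, 'a) proc \<Rightarrow> real \<Rightarrow> ('a \<Rightarrow> ennreal) \<Rightarrow> 'a \<Rightarrow> ennreal" where
  "resolvent X \<alpha> f x =
     (\<integral>\<^sup>+t\<in>{0..}. ennreal (exp (- \<alpha> * t)) * semigroup_op X (ennreal t) f x \<partial>lborel)"

text \<open>Strong duality in the sense of Blumenthal and Getoor, Chapter VI.\<close>

definition strong_duality ::
  "'a::topological_space measure \<Rightarrow> ('w, 'a) proc \<Rightarrow> ('v, 'a) proc \<Rightarrow> bool" where
  "strong_duality m X Xh \<longleftrightarrow> (\<forall>\<alpha>>0.
     (\<forall>f\<in>borel_measurable borel. \<forall>g\<in>borel_measurable borel.
        (\<integral>\<^sup>+x. f x * resolvent X \<alpha> g x \<partial>m) = (\<integral>\<^sup>+x. resolvent Xh \<alpha> f x * g x \<partial>m)) \<and>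
     (\<forall>x. \<forall>A\<in>null_sets m.
        resolvent X \<alpha> (indicator A) x = 0 \<and> resolvent Xh \<alpha> (indicator A) x = 0))"

definition nearly_borel :: "('w, 'a::topological_space) proc \<Rightarrow> 'a set \<Rightarrow> bool" where
  "nearly_borel X A \<longleftrightarrow> (\<forall>\<mu>\<in>space (prob_algebra borel).
     \<exists>B\<in>sets borel. \<exists>C\<in>sets borel. B \<subseteq> A \<and> A \<subseteq> C \<and>
       (AE \<omega> in law_from X \<mu>. \<forall>t. path X t \<omega> \<notin> Some ` (C - B)))"

definition polar :: "('w, 'a::topological_space) proc \<Rightarrow> 'a set \<Rightarrow> bool" where
  "polar X A \<longleftrightarrow> (\<exists>B. A \<subseteq> B \<and> nearly_borel X B \<and> (\<forall>x. AE \<omega> in law X x. hit X B \<omega> = \<infinity>))"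

definition thin :: "('w, 'a::topological_space) proc \<Rightarrow> 'a set \<Rightarrow> bool" where
  "thin X A \<longleftrightarrow> (\<exists>B. A \<subseteq> B \<and> nearly_borel X B \<and> (\<forall>x. \<not> (AE \<omega> in law X x. hit X B \<omega> = 0)))"

definition semipolar :: "('w, 'a::topological_space) proc \<Rightarrow> 'a set \<Rightarrow> bool" where
  "semipolar X A \<longleftrightarrow> (\<exists>S::nat \<Rightarrow> 'a set. (\<forall>n. thin X (S n)) \<and> A = (\<Union>n. S n))"

text \<open>A L\'evy system $(J,H)$ with $H_t = t$. Only jumps between points of the state space
  contribute, since $f$ is extended by 0 to the cemetery.\<close>

definition levy_system ::
  "('w, 'a::{metric_space, second_countable_topology}) proc \<Rightarrow> ('a \<Rightarrow> 'a measure) \<Rightarrow> bool" where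
  "levy_system X J \<longleftrightarrow>
     (\<forall>f :: 'a \<Rightarrow> 'a \<Rightarrow> ennreal. \<forall>T x.
        (\<lambda>(u, v). f u v) \<in> borel_measurable (borel \<Otimes>\<^sub>M borel) \<and>
        (\<forall>u v. f u v < \<infinity>) \<and> (\<forall>u. f u u = 0) \<and> stopping_time (aug_filt X) T \<longrightarrow>
        expct X x (\<lambda>\<omega>. \<Sum>\<^sub>\<infinity>s\<in>{s. 0 < s \<and> s \<le> T \<omega>}.
           ext0 (\<lambda>u. ext0 (f u) (path X s \<omega>)) (left_lim X s \<omega>)) =
        expct X x (\<lambda>\<omega>. \<integral>\<^sup>+s\<in>{s. 0 \<le> s \<and> ennreal s \<le> T \<omega>}.
           ext0 (\<lambda>u. \<integral>\<^sup>+v. f u v \<partial>J u) (path X (ennreal s) \<omega>) \<partial>lborel))"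

text \<open>The standing assumptions. Hatted objects carry the suffix \<open>h\<close>. The values of \<open>j\<close> and \<open>jh\<close> on
  the diagonal are irrelevant.\<close>

locale dual_setting =
  fixes m :: "'a::{metric_space, second_countable_topology} measure"
    and X :: "('w, 'a) proc" and Xh :: "('v, 'a) proc"
    and j jh :: "'a \<Rightarrow> 'a \<Rightarrow> real"
    and R0 :: ereal
  assumes mms: "metric_measure_space m"
    and radius: "localization_radius TYPE('a) R0"
    and hunt: "hunt_process X" "hunt_process Xh"
    and duality: "strong_duality m X Xh"
    and feller: "feller X" "feller Xh"
    and strong_feller: "strong_feller X" "strong_feller Xh"
    and semipolar_polar: "\<And>A. semipolar X A \<Longrightarrow> polar X A"
    and j_measurable: "(\<lambda>(x, y). j x y) \<in> borel_measurable (borel \<Otimes>\<^sub>M borel)"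
      "(\<lambda>(x, y). jh x y) \<in> borel_measurable (borel \<Otimes>\<^sub>M borel)"
    and j_dual: "\<And>x y. x \<noteq> y \<Longrightarrow> j x y = jh y x"
    and j_pos: "\<And>x y. x \<noteq> y \<Longrightarrow> 0 < j x y"
    and levy: "levy_system X (\<lambda>x. density m (\<lambda>y. ennreal (j x y)))"
      "levy_system Xh (\<lambda>x. density m (\<lambda>y. ennreal (jh x y)))"

section \<open>Potential theory of the killed process\<close>

definition reg_points :: "('w, 'a::topological_space) proc \<Rightarrow> 'a set \<Rightarrow> 'a set" where
  "reg_points X D = {z \<in> frontier D. AE \<omega> in law X z. exit_time X D \<omega> = 0}"

definition excessive :: "('w, 'a::topological_space) proc \<Rightarrow> 'a set \<Rightarrow> ('a \<Rightarrow> ennreal) \<Rightarrow> bool" where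
  "excessive X D h \<longleftrightarrow>
     h \<in> borel_measurable (restrict_space borel D) \<and>
     (\<forall>x\<in>D. (\<forall>t<\<infinity>. expct X x (\<lambda>\<omega>. ext0 h (killed_path X D t \<omega>)) \<le> h x) \<and>
            ((\<lambda>t. expct X x (\<lambda>\<omega>. ext0 h (killed_path X D t \<omega>))) \<longlongrightarrow> h x) (at_right 0))"

text \<open>The occupation density formula fixes $G_D(x,\cdot)$ only $m$-almost everywhere. Excessivity in
  the first variable, imposed on \<open>G\<close> for \<open>X\<close> and on its transpose for the dual process, selects the
  usual version.\<close>

definition green_function ::
  "'a::topological_space measure \<Rightarrow> ('w, 'a) proc \<Rightarrow> 'a set \<Rightarrow> ('a \<Rightarrow> 'a \<Rightarrow> ennreal) \<Rightarrow> bool" where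
  "green_function m X D G \<longleftrightarrow>
     (\<lambda>(x, y). G x y) \<in> borel_measurable (borel \<Otimes>\<^sub>M borel) \<and>
     (\<forall>x y. x \<notin> D \<or> y \<notin> D \<longrightarrow> G x y = 0) \<and>
     (\<forall>f\<in>borel_measurable borel. \<forall>x\<in>D.
        expct X x (\<lambda>\<omega>. \<integral>\<^sup>+t\<in>{t. 0 \<le> t \<and> ennreal t < exit_time X D \<omega>}.
           ext0 f (path X (ennreal t) \<omega>) \<partial>lborel) =
        (\<integral>\<^sup>+y\<in>D. G x y * f y \<partial>m)) \<and>
     (\<forall>y\<in>D. excessive X D (\<lambda>x. G x y))"

definition greenian :: "('a \<Rightarrow> 'a \<Rightarrow> ennreal) \<Rightarrow> bool" where
  "greenian G \<longleftrightarrow> (\<forall>x y. x \<noteq> y \<longrightarrow> G x y < \<infinity>)"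

definition poisson_kernel ::
  "'a measure \<Rightarrow> ('a \<Rightarrow> 'a \<Rightarrow> real) \<Rightarrow> 'a set \<Rightarrow> ('a \<Rightarrow> 'a \<Rightarrow> ennreal) \<Rightarrow> 'a \<Rightarrow> 'a \<Rightarrow> ennreal" where
  "poisson_kernel m j D G x z = (\<integral>\<^sup>+y\<in>D. G x y * ennreal (j y z) \<partial>m)"

definition accessible ::
  "'a measure \<Rightarrow> ('a \<Rightarrow> 'a \<Rightarrow> real) \<Rightarrow> 'a set \<Rightarrow> ('a \<Rightarrow> 'a \<Rightarrow> ennreal) \<Rightarrow> 'a \<Rightarrow> bool" where
  "accessible m j D G z \<longleftrightarrow> (\<forall>x\<in>D. poisson_kernel m j D G x z = \<infinity>)"

definition regular_harmonic ::
  "('w, 'a::topological_space) proc \<Rightarrow> 'a set \<Rightarrow> ('a \<Rightarrow> ennreal) \<Rightarrow> bool" where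
  "regular_harmonic X D f \<longleftrightarrow>
     f \<in> borel_measurable borel \<and> (\<forall>x. f x < \<infinity>) \<and>
     (\<forall>x\<in>D. f x = expct X x (\<lambda>\<omega>.
        if exit_time X D \<omega> < lifetime X \<omega> then ext0 f (path X (exit_time X D \<omega>) \<omega>) else 0))"

text \<open>A function $D \to [0,\infty)$; its values off \<open>D\<close> are never used.\<close>

definition harmonic ::
  "('w, 'a::topological_space) proc \<Rightarrow> 'a set \<Rightarrow> ('a \<Rightarrow> ennreal) \<Rightarrow> bool" where
  "harmonic X D f \<longleftrightarrow>
     f \<in> borel_measurable (restrict_space borel D) \<and> (\<forall>x\<in>D. f x < \<infinity>) \<and>
     (\<forall>U. open U \<and> compact (closure U) \<and> closure U \<subseteq> D \<longrightarrow>
        (\<forall>x\<in>U. f x = expct X x (\<lambda>\<omega>. if exit_time X U \<omega> < lifetime X \<omega>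
           then ext0 f (killed_path X D (exit_time X U \<omega>) \<omega>) else 0)))"

definition minimal_harmonic ::
  "('w, 'a::topological_space) proc \<Rightarrow> 'a set \<Rightarrow> ('a \<Rightarrow> ennreal) \<Rightarrow> bool" where
  "minimal_harmonic X D f \<longleftrightarrow> harmonic X D f \<and>
     (\<forall>g. harmonic X D g \<and> (\<forall>x\<in>D. g x \<le> f x) \<longrightarrow>
        (\<exists>c::real. 0 \<le> c \<and> (\<forall>x\<in>D. g x = ennreal c * f x)))"

section \<open>Martin boundary\<close>

text \<open>The Martin space $D \cup \partial_M D$ is the topology \<open>\<T>\<close> on \<open>Inl ` D \<union> Inr ` B\<close>, where \<open>B\<close> is the
  Martin boundary, and \<open>K x w\<close> is $M_D(x,w)$. These conditions determine the compactification up
  to a homeomorphism fixing \<open>D\<close>: a sequence in \<open>D\<close> converges to a boundary point iff it leaves every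
  compact subset of \<open>D\<close> and its Martin kernels converge to the kernel of that point. The value
  \<open>K x (Inl x0)\<close> is left unspecified.\<close>

definition martin_space ::
  "('w, 'a::topological_space) proc \<Rightarrow> 'a set \<Rightarrow> ('a \<Rightarrow> 'a \<Rightarrow> ennreal) \<Rightarrow> 'a \<Rightarrow>
   ('a + 'b) topology \<Rightarrow> 'b set \<Rightarrow> ('a \<Rightarrow> 'a + 'b \<Rightarrow> ennreal) \<Rightarrow> bool" where
  "martin_space X D G x0 \<T> B K \<longleftrightarrow>
     topspace \<T> = Inl ` D \<union> Inr ` B \<and>
     compact_space \<T> \<and> metrizable_space \<T> \<and>
     openin \<T> (Inl ` D) \<and> \<T> closure_of (Inl ` D) = topspace \<T> \<and>
     embedding_map (top_of_set D) \<T> Inl \<and>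
     (\<forall>x\<in>D. \<forall>y\<in>D - {x0}. K x (Inl y) = G x y / G x0 y) \<and>
     (\<forall>x\<in>D. \<forall>w\<in>B. limitin euclidean (K x) (K x (Inr w)) (atin_within \<T> (Inr w) (Inl ` D))) \<and>
     (\<forall>w\<in>topspace \<T> - {Inl x0}. excessive X D (\<lambda>x. K x w)) \<and>
     continuous_map (prod_topology (top_of_set D) (subtopology \<T> (topspace \<T> - {Inl x0})))
       euclidean (\<lambda>(x, w). K x w) \<and>
     (\<forall>w1\<in>B. \<forall>w2\<in>B. w1 \<noteq> w2 \<longrightarrow> (\<exists>x\<in>D. K x (Inr w1) \<noteq> K x (Inr w2)))"

definition martin_associated ::
  "'a::topological_space set \<Rightarrow> ('a + 'b) topology \<Rightarrow> 'b \<Rightarrow> 'a \<Rightarrow> bool" where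
  "martin_associated D \<T> w z \<longleftrightarrow>
     (\<exists>y::nat \<Rightarrow> 'a. range y \<subseteq> D \<and>
        limitin \<T> (\<lambda>n. Inl (y n)) (Inr w) sequentially \<and> y \<longlonglongrightarrow> z)"

definition martin_minimal ::
  "('w, 'a::topological_space) proc \<Rightarrow> 'a set \<Rightarrow> ('a \<Rightarrow> 'a + 'b \<Rightarrow> ennreal) \<Rightarrow> 'b \<Rightarrow> bool" where
  "martin_minimal X D K w \<longleftrightarrow> minimal_harmonic X D (\<lambda>x. K x (Inr w))"

section \<open>The conditions C1, E1, F1, G\<close>

text \<open>The constant of C1 depends on the radii only through their ratio.\<close>

definition C1 ::
  "('a::metric_space \<Rightarrow> 'a \<Rightarrow> real) \<Rightarrow> ('a \<Rightarrow> 'a \<Rightarrow> real) \<Rightarrow> 'a \<Rightarrow> ereal \<Rightarrow> bool" where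
  "C1 j jh z0 R \<longleftrightarrow> (\<exists>c :: real \<Rightarrow> real. \<forall>r1 r2.
     0 < r1 \<and> r1 < r2 \<and> ereal r2 < R \<longrightarrow> 0 < c (r2 / r1) \<and>
     (\<forall>x\<in>ball z0 r1. \<forall>y\<in>- ball z0 r2.
        inverse (c (r2 / r1)) * j z0 y \<le> j x y \<and> j x y \<le> c (r2 / r1) * j z0 y \<and>
        inverse (c (r2 / r1)) * jh z0 y \<le> jh x y \<and> jh x y \<le> c (r2 / r1) * jh z0 y))"

definition E1 :: "('a::metric_space \<Rightarrow> 'a \<Rightarrow> real) \<Rightarrow> 'a \<Rightarrow> ereal \<Rightarrow> bool" where
  "E1 j z0 R \<longleftrightarrow> (\<forall>r. 0 < r \<and> ereal r < R \<longrightarrow>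
     ((\<lambda>y. SUP z\<in>{z. r < dist z0 z}. ereal (j z z0 / j z y)) \<longlongrightarrow> 1) (at z0) \<and>
     ((\<lambda>y. INF z\<in>{z. r < dist z0 z}. ereal (j z z0 / j z y)) \<longlongrightarrow> 1) (at z0))"

definition F1 ::
  "'a::metric_space measure \<Rightarrow> ('w, 'a) proc \<Rightarrow> ('a \<Rightarrow> 'a \<Rightarrow> real) \<Rightarrow> 'a \<Rightarrow> ereal \<Rightarrow> bool" where
  "F1 m X j z0 R \<longleftrightarrow> (\<forall>a. 1 / 2 < a \<and> a < 1 \<longrightarrow> (\<exists>C::real. 1 \<le> C \<and>
     (\<forall>r D f. 0 < r \<and> ereal r < R \<and> open D \<and> D \<subseteq> ball z0 r \<and> regular_harmonic X D f \<and>
        (\<forall>x\<in>ball z0 r \<inter> (- closure D \<union> reg_points X D). f x = 0) \<longrightarrow>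
        (\<forall>x\<in>D \<inter> ball z0 (r / 8).
           let I = expct X x (exit_time X D) *
                   (\<integral>\<^sup>+y\<in>- closure (ball z0 (a * r / 2)). ennreal (j z0 y) * f y \<partial>m)
           in ennreal (inverse C) * I \<le> f x \<and> f x \<le> ennreal C * I))))"

definition cond_G ::
  "('w, 'a::topological_space) proc \<Rightarrow> 'a set \<Rightarrow> ('a \<Rightarrow> 'a \<Rightarrow> ennreal) \<Rightarrow> bool" where
  "cond_G X D G \<longleftrightarrow> (\<forall>z\<in>reg_points X D. \<forall>y\<in>D. ((\<lambda>x. G x y) \<longlongrightarrow> 0) (at z within D))"

end

theory Submission
  imports Defs "HOL-Real_Asymp.Real_Asymp"
begin

text \<open>For the dual process, \<open>f\<^sub>E(y) = \<integral>\<^sub>E G(x,y) m(dx)\<close> is regular harmonic near \<open>z\<^sub>0\<close>, and F1 yields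
  a boundary Harnack principle for such functions. Split the exit from \<open>D \<inter> B(z\<^sub>0,r)\<close> into jumps beyond a
  fixed distance (far part) and shorter ones (near part). If \<open>P\<^sub>D(\<cdot>,z\<^sub>0)\<close> is finite somewhere, the far part
  dominates and by E1 is asymptotically proportional to the mean exit time; otherwise it is negligible,
  and the boundary Harnack principle contracts the oscillation of ratios of near parts. Either way
  \<open>f\<^sub>E/f\<^sub>F\<close> has a limit at \<open>z\<^sub>0\<close>, which determines the integrals of a Martin kernel associated with \<open>z\<^sub>0\<close>.

  If \<open>z\<^sub>0\<close> is inaccessible, these integrals identify the Martin kernel with a multiple of \<open>P\<^sub>D(\<cdot>,z\<^sub>0)\<close>,
  a potential and not a harmonic function. If it is accessible, potentials of small neighbourhoods
  of \<open>z\<^sub>0\<close> are negligible against \<open>G(x\<^sub>0,\<cdot>)\<close> near \<open>z\<^sub>0\<close>, so that harmonicity away from \<open>z\<^sub>0\<close> passes from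
  \<open>G(\<cdot>,y)\<close> to the Martin kernel \<open>M\<close>. A harmonic \<open>h \<le> M\<close> is a limit of potentials of charges near \<open>z\<^sub>0\<close>,
  where \<open>G(x,\<cdot>)\<close> is close to \<open>M(x) G(x\<^sub>0,\<cdot>)\<close>; hence \<open>h \<le> h(x\<^sub>0) M\<close>, and the same bound for \<open>M - h\<close>
  gives equality.\<close>

text \<open>F1 bounds a harmonic function on both sides by a product of the mean exit time, which
  depends on the point alone, and an integral functional, which depends on the function alone.
  Cross-multiplying such bounds yields a boundary Harnack constant that is the same at all scales;
  this is why each step down in scale contracts the oscillation of ratios by a fixed factor. F1 is
  applied to the potentials \<open>fpot\<close>, since integrating out the pole removes exceptional
  sets: Dynkin's formula holds for them at every point, while for \<open>G\<close> itself it is at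
  first known only almost everywhere. Pointwise values of \<open>G\<close> return by averaging over
  shrinking balls, which rests on continuity in the pole, supplied by the Martin compactification.
  Minimality is proved without an integral representation of harmonic functions: the resolvent
  produces the approximating charges. Since the laws live on an uncompleted sigma-algebra and exit
  times are infima over uncountably many times, exits are read off rational times, and exit
  distributions, potentials and killed semigroups are expectations of measurable functionals on path
  space.\<close>

abbreviation bfun :: "('a::topological_space \<Rightarrow> 'b::topological_space) set" where "bfun \<equiv> borel_measurable borel"
abbreviation rn :: "nat \<Rightarrow> real" where "rn k \<equiv> 1 / real (Suc k)"
abbreviation ind :: "'a set \<Rightarrow> 'a \<Rightarrow> ennreal" where "ind \<equiv> indicator"

section \<open>Paths in the one-point compactification\<close>

lemma space_cem_borel [simp]: "space cem_borel = UNIV"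
  by (simp add: cem_borel_def space_measure_of_conv)

lemma Some_image_cem_borel:
  fixes B :: "'a::t2_space set"
  assumes "B \<in> sets borel"
  shows "Some ` B \<in> sets cem_borel"
proof -
  have op: "Some ` U \<in> sets (cem_borel :: 'a option measure)" if "open U" for U :: "'a set"
    unfolding cem_borel_def using that by (subst sets_measure_of) auto
  have "B \<in> sigma_sets UNIV {S. open S}"
    using assms by (simp add: sets_borel)
  then show ?thesis
  proof (induction rule: sigma_sets.induct)
    case (Compl B)
    have "Some ` (UNIV - B) = Some ` UNIV - Some ` B" by auto
    then show ?case using op[of UNIV] Compl.IH by auto
  next
    case (Union A)
    then show ?case by (auto simp: image_UN)
  qed (auto intro: op)
qed

text \<open>Open sets of the compactification trace open sets on the state space, and the cemetery
  is a Borel point; so measurability questions on the compactification reduce to the state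
  space.\<close>

lemma sets_cem_borel_iff:
  fixes A :: "'a::t2_space option set"
  shows "A \<in> sets cem_borel \<longleftrightarrow> Some -` A \<in> sets borel"
proof
  assume "A \<in> sets cem_borel"
  then have "A \<in> sigma_sets UNIV {U. openin onept U}"
    by (simp add: cem_borel_def)
  then show "Some -` A \<in> sets borel"
  proof (induction rule: sigma_sets.induct)
    case (Basic V)
    have "open (Some -` V)"
    proof -
      from Basic consider U where "open U" "V = Some ` U"
        | C where "closed C" "V = insert None (Some ` (UNIV - C))"
        by (auto simp: openin_Alexandroff_compactification)
      then show ?thesis
        by cases (auto simp: vimage_def image_def open_Diff closed_def set_diff_eq Compl_eq)
    qed
    then show ?case by simp
  next
    case (Compl a)
    then show ?case by (simp add: vimage_Diff)
  next
    case (Union a)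
    then show ?case by (simp add: vimage_UN)
  qed simp
next
  assume *: "Some -` A \<in> sets borel"
  have N: "{None} \<in> sets (cem_borel :: 'a option measure)"
  proof -
    have "{None :: 'a option} = space cem_borel - Some ` UNIV"
      by (auto simp: notin_range_Some)
    then show ?thesis using Some_image_cem_borel[of "UNIV :: 'a set"] by (metis sets.compl_sets space_in_borel)
  qed
  have "A = Some ` (Some -` A) \<union> (if None \<in> A then {None} else {})"
  proof (rule set_eqI)
    fix z show "z \<in> A \<longleftrightarrow> z \<in> Some ` (Some -` A) \<union> (if None \<in> A then {None} else {})"
      by (cases z) auto
  qed
  moreover have "Some ` (Some -` A) \<union> (if None \<in> A then {None} else {}) \<in> sets cem_borel"
    by (intro sets.Un Some_image_cem_borel * ) (use N in auto)
  ultimately show "A \<in> sets cem_borel" by simp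
qed

lemma measurable_from_cem:
  fixes g :: "'a::t2_space option \<Rightarrow> 'b"
  assumes "(\<lambda>x. g (Some x)) \<in> borel \<rightarrow>\<^sub>M N" "g None \<in> space N"
  shows "g \<in> cem_borel \<rightarrow>\<^sub>M N"
proof (rule measurableI)
  fix x :: "'a option" show "g x \<in> space N"
    using assms measurable_space[OF assms(1)] by (cases x) auto
next
  fix A assume "A \<in> sets N"
  from measurable_sets[OF assms(1) this]
  show "g -` A \<inter> space cem_borel \<in> sets cem_borel"
    by (simp add: sets_cem_borel_iff vimage_def)
qed

lemma measurable_Some_cem [measurable]: "Some \<in> (borel :: 'a::t2_space measure) \<rightarrow>\<^sub>M cem_borel"
  by (rule measurableI) (auto simp: sets_cem_borel_iff)

lemma measurable_the_cem [measurable]: "the \<in> cem_borel \<rightarrow>\<^sub>M (borel :: 'a::t2_space measure)"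
  by (rule measurable_from_cem) auto

lemma measurable_ext0 [measurable]:
  fixes f :: "'a::t2_space \<Rightarrow> ennreal"
  assumes "f \<in> bfun"
  shows "ext0 f \<in> cem_borel \<rightarrow>\<^sub>M borel"
  by (rule measurable_from_cem) (use assms in \<open>auto simp: ext0_def\<close>)

lemma pred_cem_None [measurable]: "Measurable.pred (cem_borel :: 'a::t2_space option measure) (\<lambda>z. z = None)"
  by (rule measurable_from_cem) auto

lemma pred_cem_Some [measurable]:
  fixes B :: "'a::t2_space set"
  assumes "B \<in> sets borel"
  shows "Measurable.pred cem_borel (\<lambda>z. z \<in> Some ` B)"
  using Some_image_cem_borel[OF assms] by (simp add: pred_def)

subsection \<open>Limits in the compactification\<close>

text \<open>A value is assigned to every sequence, convergent or not, so that taking limits becomes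
  a measurable operation. Sequences that are not Cauchy or keep visiting the cemetery are sent to
  the cemetery.\<close>

definition optlim :: "(nat \<Rightarrow> 'a::metric_space option) \<Rightarrow> 'a option" where
  "optlim z = (if (\<exists>N. \<forall>n\<ge>N. z n \<noteq> None) \<and> Cauchy (\<lambda>n. the (z n)) then Some (lim (\<lambda>n. the (z n))) else None)"

locale proper_space =
  fixes TY :: "'a::{metric_space, second_countable_topology} itself"
  assumes heine_borel: "\<And>S::'a set. bounded S \<Longrightarrow> closed S \<Longrightarrow> compact S"
begin

lemma Cauchy_convergent_proper: "Cauchy (z::nat \<Rightarrow> 'a) \<Longrightarrow> convergent z"
proof -
  assume C: "Cauchy z"
  have "bounded (range z)" by (rule cauchy_imp_bounded[OF C])
  then have "compact (closure (range z))" by (intro heine_borel) auto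
  then have "Topological_Spaces.complete (closure (range z))" by (rule compact_imp_complete)
  then obtain l where "z \<longlonglongrightarrow> l"
    using C unfolding complete_def by (meson UNIV_I closure_subset range_subsetD)
  then show ?thesis by (auto simp: convergent_def)
qed

lemma measurable_optlim:
  fixes f :: "nat \<Rightarrow> 'w \<Rightarrow> 'a option"
  assumes [measurable]: "\<And>n. f n \<in> M \<rightarrow>\<^sub>M cem_borel"
  shows "(\<lambda>x. optlim (\<lambda>n. f n x)) \<in> M \<rightarrow>\<^sub>M cem_borel"
proof -
  have [measurable]: "(\<lambda>x. the (f n x)) \<in> borel_measurable M" for n
    by (rule measurable_compose[OF assms measurable_the_cem])
  have [measurable]: "Measurable.pred M (\<lambda>x. Cauchy (\<lambda>n. the (f n x)))"
    unfolding pred_def by measurable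
  have [measurable]: "Measurable.pred M (\<lambda>x. f n x = None)" for n
    by (rule measurable_compose[OF assms pred_cem_None])
  define g where "g x = (if Cauchy (\<lambda>n. the (f n x)) then lim (\<lambda>n. the (f n x)) else undefined)" for x
  have [measurable]: "g \<in> borel_measurable M"
  proof (rule borel_measurable_LIMSEQ_metric)
    show "(\<lambda>n. if Cauchy (\<lambda>n. the (f n x)) then the (f n x) else undefined) \<longlonglongrightarrow> g x" for x
      using Cauchy_convergent_proper[of "\<lambda>n. the (f n x)"]
      by (auto simp: g_def convergent_LIMSEQ_iff)
  qed measurable
  have "(\<lambda>x. optlim (\<lambda>n. f n x)) = (\<lambda>x. if (\<exists>N. \<forall>n\<ge>N. f n x \<noteq> None) \<and> Cauchy (\<lambda>n. the (f n x)) then Some (g x) else None)"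
    by (auto simp: optlim_def g_def)
  also have "\<dots> \<in> M \<rightarrow>\<^sub>M cem_borel" by measurable
  finally show ?thesis .
qed

lemma limitin_Some_eventually:
  fixes z :: "'b \<Rightarrow> 'a option"
  assumes "limitin onept z (Some x) F" "open U" "x \<in> U"
  shows "eventually (\<lambda>s. z s \<in> Some ` U) F"
  using assms by (auto simp: limitin_def)

lemma limitin_None_eventually:
  fixes z :: "'b \<Rightarrow> 'a option"
  assumes "limitin onept z l F" "compact K" "l \<notin> Some ` K"
  shows "eventually (\<lambda>s. z s \<notin> Some ` K) F"
proof -
  have "closedin onept (Some ` K)"
    using assms(2) compact_imp_closed by auto
  then have "openin onept (topspace onept - Some ` K)" by blast
  moreover have "l \<in> topspace onept - Some ` K" using assms by (auto simp: limitin_def)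
  ultimately have "eventually (\<lambda>s. z s \<in> topspace onept - Some ` K) F"
    using assms(1) unfolding limitin_def by blast
  then show ?thesis by (rule eventually_mono) auto
qed

text \<open>The delicate case is the limit \<open>None\<close>: a Cauchy sequence of states
  converges, bounded closed sets being compact, and then stays in a compact ball, which a sequence
  tending to the cemetery must leave.\<close>

lemma optlim_eqI:
  fixes z :: "nat \<Rightarrow> 'a option"
  assumes "limitin onept z l sequentially"
  shows "optlim z = l"
proof (cases l)
  case (Some x)
  have N: "\<exists>N. \<forall>n\<ge>N. z n \<noteq> None"
    using limitin_Some_eventually[OF assms[unfolded Some], of UNIV]
    by (auto simp: eventually_sequentially) fastforce
  have "(\<lambda>n. the (z n)) \<longlonglongrightarrow> x"
  proof (rule topological_tendstoI)
    fix S assume "open S" "x \<in> S"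
    from limitin_Some_eventually[OF assms[unfolded Some] this]
    show "\<forall>\<^sub>F n in sequentially. the (z n) \<in> S" by (rule eventually_mono) auto
  qed
  then show ?thesis using N Some
    by (auto simp: optlim_def limI intro: LIMSEQ_imp_Cauchy)
next
  case None
  have "optlim z = None"
  proof (rule ccontr)
    assume "optlim z \<noteq> None"
    then have N: "\<exists>N. \<forall>n\<ge>N. z n \<noteq> None" and C: "Cauchy (\<lambda>n. the (z n))"
      by (auto simp: optlim_def split: if_splits)
    from Cauchy_convergent_proper[OF C] obtain x where x: "(\<lambda>n. the (z n)) \<longlonglongrightarrow> x"
      by (auto simp: convergent_def)
    have "eventually (\<lambda>n. the (z n) \<in> cball x 1) sequentially"
      by (rule eventually_mono[OF tendstoD[OF x, of 1]]) (auto simp: dist_commute)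
    moreover have "eventually (\<lambda>n. z n \<notin> Some ` cball x 1) sequentially"
      by (rule limitin_None_eventually[OF assms]) (auto simp: None intro: heine_borel)
    moreover have "eventually (\<lambda>n. z n \<noteq> None) sequentially"
      using N by (auto simp: eventually_sequentially)
    ultimately have "eventually (\<lambda>n. False) sequentially"
      by eventually_elim (auto simp: image_iff)
    then show False by simp
  qed
  then show ?thesis using None by simp
qed

end

subsection \<open>Exit times of right-continuous paths\<close>

text \<open>Properties shared by all sample paths without an exceptional set, so that the facts on
  exit times below are deterministic.\<close>

definition rc_path :: "(ennreal \<Rightarrow> 'a::topological_space option) \<Rightarrow> bool" where
  "rc_path p \<longleftrightarrow> (\<forall>t<\<infinity>. limitin onept p (p t) (at_right t)) \<and> p \<infinity> = None \<and>
     (\<forall>s t. s \<le> t \<and> p s = None \<longrightarrow> p t = None)"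

definition rat_times :: "ennreal set" where
  "rat_times = range (\<lambda>r::rat. ennreal (real_of_rat r))"

lemma countable_rat_times: "countable rat_times"
  by (auto simp: rat_times_def)

lemma rat_times_dense:
  fixes a b :: ennreal
  assumes "a < b"
  obtains q where "q \<in> rat_times" "a < q" "q < b"
  using ennreal_rat_dense[OF assms] by (auto simp: rat_times_def)

definition exit_rat :: "'a set \<Rightarrow> (ennreal \<Rightarrow> 'a option) \<Rightarrow> ennreal" where
  "exit_rat S p = Inf {q\<in>rat_times. p q \<notin> Some ` S}"

text \<open>Compact sets with interiors exhausting an open set \<open>D\<close>, increasing in \<open>D\<close> as well as in \<open>k\<close>.\<close>

definition cell :: "'a::metric_space set \<Rightarrow> nat \<Rightarrow> 'a set" where
  "cell D k = {x. ball x (rn k) \<subseteq> D \<and> dist undefined x \<le> real k}"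

abbreviation icell :: "'a::metric_space set \<Rightarrow> nat \<Rightarrow> 'a set" where "icell D k \<equiv> interior (cell D k)"

text \<open>Exit times through rational times only: they are measurable functionals of the path, and
  almost surely agree with the first exit time at or after time 0.\<close>

definition exit_path :: "'a::metric_space set \<Rightarrow> (ennreal \<Rightarrow> 'a option) \<Rightarrow> ennreal" where
  "exit_path D p = (SUP k. exit_rat (cell D k) p)"

lemma cell_mono: "W \<subseteq> D \<Longrightarrow> cell W k \<subseteq> cell D k"
  by (auto simp: cell_def)

lemma cell_subset: "cell D k \<subseteq> D"
  by (auto simp: cell_def)

lemma cell_subset_interior: "cell D k \<subseteq> icell D (Suc k)"
proof
  fix x assume x: "x \<in> cell D k"
  \<comment> \<open>The drop \<open>e\<close> between consecutive radii serves twice: it is what the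
    radius may lose, and being at most 1 it fits into the growth of the distance bound from
    \<open>k\<close> to \<open>Suc k\<close>.\<close>
  define e where "e = rn k - rn (Suc k)"
  have e: "0 < e" "e \<le> 1" unfolding e_def by (auto simp: field_simps add_pos_nonneg)
  have "ball x e \<subseteq> cell D (Suc k)"
  proof
    fix y assume y: "y \<in> ball x e"
    have "ball y (rn (Suc k)) \<subseteq> ball x (rn k)"
    proof
      fix z assume "z \<in> ball y (rn (Suc k))"
      then show "z \<in> ball x (rn k)"
        using y dist_triangle[of x z y] by (auto simp: e_def)
    qed
    moreover have "dist undefined y \<le> real (Suc k)"
      using x y e dist_triangle[of undefined y x] by (auto simp: cell_def)
    ultimately show "y \<in> cell D (Suc k)" using x by (auto simp: cell_def)
  qed
  then show "x \<in> icell D (Suc k)" using e by (auto simp: mem_interior)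
qed

lemma cell_incseq: "incseq (cell D)"
  by (rule incseq_SucI) (meson cell_subset_interior interior_subset order_trans)

lemma closed_cell: "closed (cell D k)"
proof -
  have "closed {x. ball x r \<subseteq> D}" for r
  proof (clarsimp simp: closed_sequential_limits)
    fix s x y assume s: "\<forall>n. ball (s n) r \<subseteq> D" "s \<longlonglongrightarrow> x" and y: "dist x y < r"
    have "(\<lambda>n. dist (s n) y) \<longlonglongrightarrow> dist x y" by (intro tendsto_intros s)
    then have "eventually (\<lambda>n. dist (s n) y < r) sequentially" using y by (rule order_tendstoD)
    then obtain n where "dist (s n) y < r" by (meson eventually_happens trivial_limit_sequentially)
    then show "y \<in> D" using s by (meson mem_ball subsetD)
  qed
  moreover have "closed (cball undefined (real k))" by simp
  ultimately have "closed ({x. ball x (rn k) \<subseteq> D} \<inter> cball undefined (real k))" by blast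
  moreover have "cell D k = {x. ball x (rn k) \<subseteq> D} \<inter> cball undefined (real k)"
    by (auto simp: cell_def)
  ultimately show ?thesis by metis
qed

lemma cell_exhaust:
  assumes "open D" "x \<in> D"
  obtains k where "x \<in> cell D k"
proof -
  from assms obtain e where e: "0 < e" "ball x e \<subseteq> D" by (meson open_contains_ball)
  obtain k1 where k1: "rn k1 < e" using e(1) nat_approx_posE by blast
  obtain k2 where k2: "dist undefined x \<le> real k2" using real_arch_simple by blast
  have "1 / real (Suc (max k1 k2)) \<le> rn k1" by (intro divide_left_mono) auto
  then have "ball x (1 / real (Suc (max k1 k2))) \<subseteq> ball x e" using k1 by (intro subset_ball) auto
  then have "x \<in> cell D (max k1 k2)" using e(2) k2 by (auto simp: cell_def)
  then show ?thesis by (rule that)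
qed

lemma exit_rat_mono: "S \<subseteq> S' \<Longrightarrow> exit_rat S p \<le> exit_rat S' p"
  unfolding exit_rat_def by (rule Inf_superset_mono) auto

lemma exit_path_mono: "W \<subseteq> D \<Longrightarrow> exit_path W p \<le> exit_path D p"
  unfolding exit_path_def by (intro SUP_mono) (meson UNIV_I cell_mono exit_rat_mono)

lemma exit_path_ge: "exit_rat (cell D k) p \<le> exit_path D p"
  unfolding exit_path_def by (rule SUP_upper) simp

lemma rc_path_right: "rc_path p \<Longrightarrow> t < \<infinity> \<Longrightarrow> limitin onept p (p t) (at_right t)"
  by (auto simp: rc_path_def)

lemma rc_path_infty: "rc_path p \<Longrightarrow> p \<infinity> = None"
  by (auto simp: rc_path_def)

lemma rc_path_absorb: "rc_path p \<Longrightarrow> p s = None \<Longrightarrow> s \<le> t \<Longrightarrow> p t = None"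
  unfolding rc_path_def by blast

lemma eventually_at_right_ennreal:
  "t < (\<infinity>::ennreal) \<Longrightarrow> eventually P (at_right t) \<longleftrightarrow> (\<exists>b>t. \<forall>y>t. y < b \<longrightarrow> P y)"
  by (rule eventually_at_right) simp

lemma filterlim_add_at_right_ennreal:
  fixes c t :: ennreal
  assumes "c < \<infinity>" "t < \<infinity>"
  shows "filterlim (\<lambda>s. c + s) (at_right (c + t)) (at_right t)"
  unfolding filterlim_at
proof
  show "((\<lambda>s. c + s) \<longlongrightarrow> c + t) (at_right t)" by (intro tendsto_intros)
  show "\<forall>\<^sub>F s in at_right t. c + s \<in> {c + t<..} \<and> c + s \<noteq> c + t"
  proof -
    have "c \<noteq> top" "t \<noteq> top" using assms by auto
    then show ?thesis by (simp add: eventually_at_filter)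
  qed
qed

lemma limitin_compose_filterlim:
  assumes "limitin X f l G" "filterlim g G F"
  shows "limitin X (\<lambda>x. f (g x)) l F"
  using assms by (auto simp: limitin_def filterlim_iff)

lemma rc_path_shift:
  assumes "rc_path p"
  shows "rc_path (\<lambda>s. p (c + s))"
proof (cases "c = \<infinity>")
  case True
  then show ?thesis using rc_path_infty[OF assms] by (auto simp: rc_path_def)
next
  case False
  then have c: "c < \<infinity>" by (simp add: less_top[symmetric])
  show ?thesis unfolding rc_path_def
  proof (intro conjI allI impI)
    fix t :: ennreal assume t: "t < \<infinity>"
    then have "c + t < \<infinity>" using c by simp
    from limitin_compose_filterlim[OF rc_path_right[OF assms this] filterlim_add_at_right_ennreal[OF c t]]
    show "limitin onept (\<lambda>s. p (c + s)) (p (c + t)) (at_right t)" .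
  next
    show "p (c + \<infinity>) = None" using rc_path_infty[OF assms] by simp
  next
    fix s t assume "s \<le> t \<and> p (c + s) = None"
    then show "p (c + t) = None" using rc_path_absorb[OF assms, of "c + s" "c + t"] by (auto intro: add_left_mono)
  qed
qed

context proper_space begin

lemma compact_cell: "compact (cell (D::'a set) k)"
proof (rule heine_borel[OF _ closed_cell])
  have "cell D k \<subseteq> cball undefined (real k)" by (auto simp: cell_def)
  then show "bounded (cell D k)" by (rule bounded_subset[rotated]) simp
qed

text \<open>A path outside a compact set stays outside for a short while, by right-continuity, and
  that while contains a rational time. Hence restricting the infimum to rational times misses no
  exit.\<close>

lemma exit_rat_le:
  fixes p :: "ennreal \<Rightarrow> 'a option"
  assumes p: "rc_path p" and S: "compact S" and s: "p s \<notin> Some ` S"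
  shows "exit_rat S p \<le> s"
proof (cases "s = \<infinity>")
  case False
  then have s': "s < \<infinity>" by (simp add: less_top[symmetric])
  have "eventually (\<lambda>u. p u \<notin> Some ` S) (at_right s)"
    by (rule limitin_None_eventually[OF rc_path_right[OF p s'] S s])
  then obtain b where b: "b > s" "\<And>y. y > s \<Longrightarrow> y < b \<Longrightarrow> p y \<notin> Some ` S"
    by (auto simp: eventually_at_right_ennreal[OF s'])
  show ?thesis
  proof (rule dense_ge)
    fix c assume "s < c"
    then have "s < min b c" using b by simp
    then obtain q where "q \<in> rat_times" "s < q" "q < min b c" by (rule rat_times_dense)
    then show "exit_rat S p \<le> c"
      unfolding exit_rat_def using b by (intro Inf_lower2[of q]) auto
  qed
qed simp

lemma before_exit_rat:
  fixes p :: "ennreal \<Rightarrow> 'a option"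
  assumes "rc_path p" "compact S" "s < exit_rat S p"
  shows "p s \<in> Some ` S"
  using exit_rat_le[OF assms(1,2)] assms(3) by (meson leD)

text \<open>From the interior the path could not leave at once. Only the interior is excluded,
  because a path may sit on the boundary of \<open>S\<close> at this time and leave immediately
  afterwards.\<close>

lemma at_exit_rat:
  fixes p :: "ennreal \<Rightarrow> 'a option"
  assumes p: "rc_path p" and S: "compact S"
  shows "p (exit_rat S p) \<notin> Some ` interior S"
proof
  let ?T = "exit_rat S p"
  assume "p ?T \<in> Some ` interior S"
  then obtain x where x: "p ?T = Some x" "x \<in> interior S" by auto
  then have T: "?T < \<infinity>" using rc_path_infty[OF p] by (metis infinity_ennreal_def option.distinct(1) top.not_eq_extremum)
  have "eventually (\<lambda>u. p u \<in> Some ` interior S) (at_right ?T)"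
    by (rule limitin_Some_eventually) (use rc_path_right[OF p T] x in auto)
  then obtain b where b: "b > ?T" "\<And>y. y > ?T \<Longrightarrow> y < b \<Longrightarrow> p y \<in> Some ` interior S"
    by (auto simp: eventually_at_right_ennreal[OF T])
  have "b \<le> exit_rat S p"
    unfolding exit_rat_def
  proof (rule Inf_greatest)
    fix q assume q: "q \<in> {q \<in> rat_times. p q \<notin> Some ` S}"
    then have "?T \<le> q" unfolding exit_rat_def by (intro Inf_lower)
    moreover have "q \<noteq> ?T" using x q interior_subset by auto
    ultimately have "?T < q" by simp
    moreover have "p q \<notin> Some ` interior S" using q interior_subset[of S] by blast
    ultimately show "b \<le> q" using b(2)[of q] by force
  qed
  then show False using b(1) by auto
qed

lemma before_exit_path:
  fixes p :: "ennreal \<Rightarrow> 'a option"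
  assumes "rc_path p" "s < exit_path D p"
  shows "p s \<in> Some ` D"
proof -
  from assms(2) obtain k where "s < exit_rat (cell D k) p"
    unfolding exit_path_def by (auto simp: less_SUP_iff)
  then show ?thesis using before_exit_rat[OF assms(1) compact_cell] cell_subset by blast
qed

lemma exit_rat_shift:
  fixes p :: "ennreal \<Rightarrow> 'a option"
  assumes p: "rc_path p" and S: "compact S" and c: "c \<le> exit_rat S p" "c < \<infinity>"
  shows "exit_rat S p = c + exit_rat S (\<lambda>s. p (c + s))"
proof (rule antisym)
  have "exit_rat S p \<le> c + q" if "p (c + q) \<notin> Some ` S" for q
    by (rule exit_rat_le[OF p S that])
  then have *: "exit_rat S p - c \<le> q" if "p (c + q) \<notin> Some ` S" for q
    using that c(2) by (auto simp: ennreal_minus_le_iff)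
  have "exit_rat S p - c \<le> exit_rat S (\<lambda>s. p (c + s))"
    unfolding exit_rat_def[of _ "\<lambda>s. p (c + s)"] by (rule Inf_greatest) (use * in auto)
  then show "exit_rat S p \<le> c + exit_rat S (\<lambda>s. p (c + s))"
    by (simp add: ennreal_minus_le_iff)
  have "c + exit_rat S (\<lambda>s. p (c + s)) \<le> q" if q: "p q \<notin> Some ` S" for q
  proof -
    have "c \<le> q" using exit_rat_le[OF p S q] c by order
    then have eq: "c + (q - c) = q" by (simp add: add_diff_inverse_ennreal)
    have "exit_rat S (\<lambda>s. p (c + s)) \<le> q - c"
      using q by (intro exit_rat_le[OF rc_path_shift[OF p] S]) (simp only: eq not_False_eq_True)
    then show ?thesis using eq by (metis add_left_mono)
  qed
  then show "c + exit_rat S (\<lambda>s. p (c + s)) \<le> exit_rat S p"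
    unfolding exit_rat_def[of _ p] by (intro Inf_greatest) auto
qed

text \<open>The strict inequality puts \<open>c\<close> before the exit from some cell
  \<open>k0\<close>; the shift identity then holds for all larger cells and passes to their
  supremum.\<close>

lemma exit_path_shift:
  fixes p :: "ennreal \<Rightarrow> 'a option"
  assumes p: "rc_path p" and c: "c < exit_path D p"
  shows "exit_path D p = c + exit_path D (\<lambda>s. p (c + s))"
proof -
  from c obtain k0 where k0: "c < exit_rat (cell D k0) p"
    unfolding exit_path_def by (auto simp: less_SUP_iff)
  have c': "c < \<infinity>" using k0 by (simp add: less_le_trans[OF _ top_greatest])
  have mono: "exit_rat (cell D k) q \<le> exit_rat (cell D (max k k0)) q" for k and q :: "ennreal \<Rightarrow> 'a option"
    by (intro exit_rat_mono) (use cell_incseq[of D] in \<open>auto simp: incseq_def\<close>)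
  have ge: "c \<le> exit_rat (cell D (max k k0)) p" for k
  proof -
    have "exit_rat (cell D k0) p \<le> exit_rat (cell D (max k k0)) p"
      by (intro exit_rat_mono) (use cell_incseq[of D] in \<open>auto simp: incseq_def\<close>)
    then show ?thesis using k0 by simp
  qed
  note eq = exit_rat_shift[OF p compact_cell ge c']
  show ?thesis
  proof (rule antisym)
    show "exit_path D p \<le> c + exit_path D (\<lambda>s. p (c + s))"
      unfolding exit_path_def[of D p]
    proof (rule SUP_least)
      fix k
      have "exit_rat (cell D k) p \<le> exit_rat (cell D (max k k0)) p" by (rule mono)
      also have "\<dots> = c + exit_rat (cell D (max k k0)) (\<lambda>s. p (c + s))" by (rule eq)
      also have "\<dots> \<le> c + exit_path D (\<lambda>s. p (c + s))" by (intro add_left_mono exit_path_ge)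
      finally show "exit_rat (cell D k) p \<le> \<dots>" .
    qed
    have "c + exit_path D (\<lambda>s. p (c + s)) = (SUP k. c + exit_rat (cell D k) (\<lambda>s. p (c + s)))"
      unfolding exit_path_def by (simp add: ennreal_SUP_add_right)
    also have "\<dots> \<le> exit_path D p"
    proof (rule SUP_least)
      fix k
      have "c + exit_rat (cell D k) (\<lambda>s. p (c + s)) \<le> c + exit_rat (cell D (max k k0)) (\<lambda>s. p (c + s))"
        by (intro add_left_mono mono)
      also have "\<dots> = exit_rat (cell D (max k k0)) p" by (rule eq[symmetric])
      also have "\<dots> \<le> exit_path D p" by (rule exit_path_ge)
      finally show "c + exit_rat (cell D k) (\<lambda>s. p (c + s)) \<le> exit_path D p" .
    qed
    finally show "c + exit_path D (\<lambda>s. p (c + s)) \<le> exit_path D p" .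
  qed
qed

lemma exit_path_start:
  fixes p :: "ennreal \<Rightarrow> 'a option"
  assumes "rc_path p" "p 0 \<notin> Some ` D"
  shows "exit_path D p = 0"
proof -
  have "\<not> 0 < exit_path D p" using before_exit_path[OF assms(1), of 0 D] assms(2) by blast
  then show ?thesis by (meson not_gr_zero)
qed

lemma exit_path_pos:
  fixes p :: "ennreal \<Rightarrow> 'a option"
  assumes p: "rc_path p" and D: "open D" "p 0 \<in> Some ` D"
  shows "0 < exit_path D p"
proof -
  from D obtain x where x: "p 0 = Some x" "x \<in> D" by auto
  obtain k where "x \<in> cell D k" using cell_exhaust[OF D(1) x(2)] .
  then have "x \<in> icell D (Suc k)" using cell_subset_interior by blast
  then have "exit_rat (cell D (Suc k)) p \<noteq> 0"
    using at_exit_rat[OF p compact_cell, of D "Suc k"] x by (metis imageI)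
  then have "0 < exit_rat (cell D (Suc k)) p" by (simp add: zero_less_iff_neq_zero)
  also have "\<dots> \<le> exit_path D p" by (rule exit_path_ge)
  finally show ?thesis .
qed

end

subsection \<open>Measurable path functionals\<close>

abbreviation path_space :: "(ennreal \<Rightarrow> 'a::topological_space option) measure" where
  "path_space \<equiv> PiM UNIV (\<lambda>_. cem_borel)"

text \<open>The next dyadic time strictly to the right: strictness (the \<open>+ 1\<close>) lets
  right-continuity apply along \<open>dyad n t\<close>, and having countably many values makes
  evaluation at a random time measurable.\<close>

definition dyad :: "nat \<Rightarrow> ennreal \<Rightarrow> ennreal" where
  "dyad n t = (if t = \<infinity> then \<infinity> else ennreal ((real_of_int \<lfloor>2 ^ n * enn2real t\<rfloor> + 1) / 2 ^ n))"

lemma dyad_greater: "t < \<infinity> \<Longrightarrow> t < dyad n t"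
proof -
  assume t: "t < \<infinity>"
  have "2 ^ n * enn2real t < real_of_int \<lfloor>2 ^ n * enn2real t\<rfloor> + 1"
    by linarith
  then have "enn2real t < (real_of_int \<lfloor>2 ^ n * enn2real t\<rfloor> + 1) / 2 ^ n"
    by (simp add: field_simps)
  then have "ennreal (enn2real t) < dyad n t" using t
    by (auto simp: dyad_def intro!: ennreal_lessI)
  then show ?thesis using t by simp
qed

lemma dyad_le: "dyad n t \<le> t + ennreal (1 / 2 ^ n)"
proof (cases "t = \<infinity>")
  case False
  then have t: "t = ennreal (enn2real t)" by (simp add: less_top[symmetric])
  have "real_of_int \<lfloor>2 ^ n * enn2real t\<rfloor> \<le> 2 ^ n * enn2real t"
    by (simp add: of_nat_nat)
  then have "(real_of_int \<lfloor>2 ^ n * enn2real t\<rfloor> + 1) / 2 ^ n \<le> enn2real t + 1 / 2 ^ n"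
    by (simp add: field_simps)
  then have "dyad n t \<le> ennreal (enn2real t + 1 / 2 ^ n)"
    using False unfolding dyad_def by (simp only: if_False infinity_ennreal_def ennreal_leI)
  also have "\<dots> = ennreal (enn2real t) + ennreal (1 / 2 ^ n)" by (rule ennreal_plus) auto
  finally show ?thesis using t by simp
qed simp

lemma dyad_tendsto: "(\<lambda>n. dyad n t) \<longlonglongrightarrow> t"
proof (rule tendsto_sandwich)
  show "\<forall>\<^sub>F n in sequentially. t \<le> dyad n t"
    by (rule always_eventually) (metis dyad_def dyad_greater infinity_ennreal_def order_less_imp_le order_refl top.not_eq_extremum)
  show "\<forall>\<^sub>F n in sequentially. dyad n t \<le> t + ennreal (1 / 2 ^ n)"
    by (rule always_eventually) (simp add: dyad_le)
  have "(\<lambda>n. (1/2::real) ^ n) \<longlonglongrightarrow> 0" by (rule LIMSEQ_power_zero) simp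
  then have "(\<lambda>n. 1 / 2 ^ n :: real) \<longlonglongrightarrow> 0" by (simp add: power_one_over)
  then have "(\<lambda>n. t + ennreal (1 / 2 ^ n)) \<longlonglongrightarrow> t + ennreal 0" by (intro tendsto_intros tendsto_ennrealI)
  then show "(\<lambda>n. t + ennreal (1 / 2 ^ n)) \<longlonglongrightarrow> t" by simp
qed simp

lemma dyad_filterlim: "t < \<infinity> \<Longrightarrow> filterlim (\<lambda>n. dyad n t) (at_right t) sequentially"
proof -
  assume t: "t < \<infinity>"
  have "dyad n t \<in> {t<..} \<and> dyad n t \<noteq> t" for n
    using dyad_greater[OF t, of n] by auto
  then show ?thesis unfolding filterlim_at using dyad_tendsto by simp
qed

definition dyads :: "nat \<Rightarrow> ennreal set" where
  "dyads n = insert \<infinity> (range (\<lambda>i::int. ennreal ((real_of_int i + 1) / 2 ^ n)))"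

lemma countable_dyads: "countable (dyads n)" by (simp add: dyads_def)

lemma dyad_in_dyads: "dyad n t \<in> dyads n" by (auto simp: dyad_def dyads_def)

lemma measurable_dyad [measurable]: "dyad n \<in> bfun"
  unfolding dyad_def by measurable

lemma measurable_dyad_count: "dyad n \<in> (borel :: ennreal measure) \<rightarrow>\<^sub>M count_space (dyads n)"
proof (subst measurable_count_space_eq_countable[OF countable_dyads], safe)
  fix t show "dyad n t \<in> dyads n" by (rule dyad_in_dyads)
next
  fix a
  show "dyad n -` {a} \<inter> space borel \<in> sets borel" by measurable
qed

text \<open>Evaluation is not jointly measurable in time and path on the full product space. This
  substitute is, and it agrees with evaluation on right-continuous paths.\<close>

definition eval_at :: "ennreal \<Rightarrow> (ennreal \<Rightarrow> 'a::metric_space option) \<Rightarrow> 'a option" where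
  "eval_at t p = optlim (\<lambda>n. p (dyad n t))"

lemma measurable_path_coord [measurable]: "(\<lambda>p. p t) \<in> path_space \<rightarrow>\<^sub>M cem_borel"
  by (rule measurable_component_singleton) simp

context proper_space begin

lemma eval_at_rc:
  fixes p :: "ennreal \<Rightarrow> 'a option"
  assumes "rc_path p"
  shows "eval_at t p = p t"
proof (cases "t = \<infinity>")
  case True
  then show ?thesis using rc_path_infty[OF assms] by (auto simp: eval_at_def dyad_def optlim_def)
next
  case False
  then have t: "t < \<infinity>" by (simp add: less_top[symmetric])
  show ?thesis unfolding eval_at_def
    by (rule optlim_eqI) (rule limitin_compose_filterlim[OF rc_path_right[OF assms t] dyad_filterlim[OF t]])
qed

lemma measurable_eval_at:
  fixes F :: "'w \<Rightarrow> ennreal \<Rightarrow> 'a option"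
  assumes T: "T \<in> borel_measurable M" and F: "\<And>s. (\<lambda>w. F w s) \<in> M \<rightarrow>\<^sub>M cem_borel"
  shows "(\<lambda>w. eval_at (T w) (F w)) \<in> M \<rightarrow>\<^sub>M cem_borel"
  unfolding eval_at_def
proof (rule measurable_optlim)
  fix n
  show "(\<lambda>w. F w (dyad n (T w))) \<in> M \<rightarrow>\<^sub>M cem_borel"
    by (rule measurable_compose_countable'[where g = "\<lambda>w. dyad n (T w)" and I = "dyads n"])
       (use F countable_dyads measurable_compose[OF T measurable_dyad_count] in auto)
qed

lemma exit_rat_less_iff: "exit_rat S p < t \<longleftrightarrow> (\<exists>q\<in>rat_times. q < t \<and> p q \<notin> Some ` S)"
  unfolding exit_rat_def by (auto simp: Inf_less_iff)

lemma measurable_exit_rat: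
  fixes F :: "'w \<Rightarrow> ennreal \<Rightarrow> 'a option"
  assumes S: "S \<in> sets borel" and [measurable]: "\<And>s. (\<lambda>w. F w s) \<in> M \<rightarrow>\<^sub>M cem_borel"
  shows "(\<lambda>w. exit_rat S (F w)) \<in> borel_measurable M"
proof (rule borel_measurableI_less)
  fix t
  have [measurable]: "Measurable.pred M (\<lambda>w. F w s \<in> Some ` S)" for s
    by (rule measurable_compose[OF _ pred_cem_Some[OF S]]) measurable
  have "Measurable.pred M (\<lambda>w. \<exists>q\<in>rat_times. q < t \<and> F w q \<notin> Some ` S)"
    unfolding rat_times_def Set.bex_simps by measurable
  then show "{w \<in> space M. exit_rat S (F w) < t} \<in> sets M"
    by (simp add: exit_rat_less_iff pred_def)
qed

lemma measurable_exit_path: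
  fixes F :: "'w \<Rightarrow> ennreal \<Rightarrow> 'a option"
  assumes "\<And>s. (\<lambda>w. F w s) \<in> M \<rightarrow>\<^sub>M cem_borel"
  shows "(\<lambda>w. exit_path D (F w)) \<in> borel_measurable M"
  unfolding exit_path_def
  by (intro borel_measurable_SUP measurable_exit_rat borel_closed closed_cell assms) simp

end

section \<open>Hunt processes as measures on path space\<close>

lemma expct_eq: "expct X x Z = (\<integral>\<^sup>+w. Z w \<partial>law X x)"
  by (simp add: expct_def nn_integral_completion)

lemma ennreal_add_less_iff:
  fixes a c t :: ennreal
  assumes "c < t"
  shows "a + c < t \<longleftrightarrow> a < t - c"
proof -
  have "c + (t - c) = t" using assms by (intro add_diff_inverse_ennreal) simp
  moreover have "c \<noteq> \<infinity>" using assms by auto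
  ultimately show ?thesis using ennreal_add_left_cancel_less[of c a "t - c"] add.commute[of a c] by argo
qed

lemma ennreal_diff_add_diff:
  fixes a b c :: ennreal
  assumes "a \<le> b" "b \<le> c" "b < \<infinity>"
  shows "(b - a) + (c - b) = c - a"
proof -
  have "a + ((b - a) + (c - b)) = c"
    using assms by (simp add: add.assoc[symmetric] add_diff_inverse_ennreal)
  moreover have "a + (c - a) = c" using assms by (simp add: add_diff_inverse_ennreal)
  moreover have "a \<noteq> \<infinity>" using assms by auto
  ultimately show ?thesis by (metis ennreal_add_left_cancel)
qed

lemma of_bool_conj_eq:
  assumes "Q \<longleftrightarrow> Q1 \<and> Q2" "Q1 \<Longrightarrow> R" "Q1 \<Longrightarrow> R'"
  shows "of_bool a * of_bool R * of_bool Q = (of_bool (a \<and> Q1) * of_bool R' * of_bool Q2 :: ennreal)"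
  using assms by (cases a; cases Q1; cases Q2; cases R; cases R') auto

locale hunt_proc = proper_space TY for TY :: "'a::{metric_space, second_countable_topology} itself" +
  fixes X :: "('w, 'a) proc"
  assumes hunt: "hunt_process X"
begin

abbreviation pth :: "'w \<Rightarrow> ennreal \<Rightarrow> 'a option" where
  "pth w \<equiv> (\<lambda>s. path X s w)"

lemma space_natural [simp]: "space (natural_filt X t) = sample X"
  by (simp add: natural_filt_def space_measure_of_conv)

lemma sets_natural:
  "sets (natural_filt X t) = sigma_sets (sample X) {path X s -` A \<inter> sample X | s A. s \<le> t \<and> A \<in> sets cem_borel}"
  unfolding natural_filt_def by (rule sets_measure_of) auto

lemma natural_mono: "s \<le> t \<Longrightarrow> sets (natural_filt X s) \<subseteq> sets (natural_filt X t)"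
  unfolding sets_natural by (rule sigma_sets_mono') (auto intro: order_trans)

lemma measurable_path: "s \<le> t \<Longrightarrow> path X s \<in> natural_filt X t \<rightarrow>\<^sub>M cem_borel"
  by (rule measurableI) (auto simp: sets_natural)

lemmas hunt_conj = hunt[unfolded hunt_process_def]
lemmas law_prob_algebra = hunt_conj[THEN conjunct1]
  and AE_start = hunt_conj[THEN conjunct2, THEN conjunct1, rule_format]
  and path_infty = hunt_conj[THEN conjunct2, THEN conjunct2, THEN conjunct1, rule_format]
  and path_absorb = hunt_conj[THEN conjunct2, THEN conjunct2, THEN conjunct2, THEN conjunct1]
  and path_right = hunt_conj[THEN conjunct2, THEN conjunct2, THEN conjunct2, THEN conjunct2, THEN conjunct1]
  and path_left = hunt_conj[THEN conjunct2, THEN conjunct2, THEN conjunct2, THEN conjunct2, THEN conjunct2, THEN conjunct1]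
  and aug_right = hunt_conj[THEN conjunct2, THEN conjunct2, THEN conjunct2, THEN conjunct2, THEN conjunct2, THEN conjunct2, THEN conjunct1]
  and hunt_strong_markov = hunt_conj[THEN conjunct2, THEN conjunct2, THEN conjunct2, THEN conjunct2, THEN conjunct2, THEN conjunct2, THEN conjunct2, THEN conjunct1]
  and hunt_qlc = hunt_conj[THEN conjunct2, THEN conjunct2, THEN conjunct2, THEN conjunct2, THEN conjunct2, THEN conjunct2, THEN conjunct2, THEN conjunct2]

lemma law_subprob [measurable]: "law X \<in> borel \<rightarrow>\<^sub>M subprob_algebra (natural_filt X \<infinity>)"
  by (rule measurable_prob_algebraD[OF law_prob_algebra])

lemma prob_space_law: "prob_space (law X x)"
  and sets_law: "sets (law X x) = sets (natural_filt X \<infinity>)"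
  using measurable_space[OF law_prob_algebra, of x] by (auto simp: space_prob_algebra)

lemma space_law [simp]: "space (law X x) = sample X"
  using sets_eq_imp_space_eq[OF sets_law] by simp

lemma measurable_law_eq: "measurable (law X x) N = measurable (natural_filt X \<infinity>) N"
  by (rule measurable_cong_sets) (auto simp: sets_law)

lemma emeasure_law_space [simp]: "emeasure (law X x) (sample X) = 1"
  using prob_space.emeasure_space_1[OF prob_space_law] by simp

lemma nn_integral_law_const [simp]: "(\<integral>\<^sup>+w. c \<partial>law X x) = c"
  by simp

lemma rc_pth: "w \<in> sample X \<Longrightarrow> rc_path (pth w)"
  unfolding rc_path_def
  by (rule conjI[OF bspec[OF path_right] conjI[OF path_infty bspec[OF path_absorb]]])

lemma measurable_path_law: "path X s \<in> law X x \<rightarrow>\<^sub>M cem_borel"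
  by (simp add: measurable_law_eq measurable_path)

lemma measurable_pth: "pth \<in> natural_filt X \<infinity> \<rightarrow>\<^sub>M path_space"
  by (rule measurable_PiM_single') (auto simp: measurable_path)

lemma measurable_expct_kernel:
  assumes "case_prod F \<in> borel_measurable (borel \<Otimes>\<^sub>M natural_filt X \<infinity>)"
  shows "(\<lambda>y. \<integral>\<^sup>+w. F y w \<partial>law X y) \<in> bfun"
  by (rule nn_integral_measurable_subprob_algebra2[OF _ law_subprob]) (use assms in simp)

lemma measurable_expct_path:
  assumes "\<Psi> \<in> borel_measurable path_space"
  shows "(\<lambda>y. \<integral>\<^sup>+w. \<Psi> (pth w) \<partial>law X y) \<in> bfun"
  by (rule measurable_expct_kernel) (use measurable_compose[OF measurable_compose[OF measurable_snd measurable_pth] assms] in \<open>simp add: case_prod_beta'\<close>)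

subsection \<open>Optional times\<close>

text \<open>Strict inequalities with the raw filtration: exits read off rational times satisfy this,
  and right-continuity of the augmented filtration turns such times into stopping times.\<close>

definition optional :: "('w \<Rightarrow> ennreal) \<Rightarrow> bool" where
  "optional T \<longleftrightarrow> (\<forall>t. {w\<in>sample X. T w < t} \<in> sets (natural_filt X t))"

text \<open>The events usually collected in F_{T+}, for the raw filtration.\<close>

definition past :: "('w \<Rightarrow> ennreal) \<Rightarrow> 'w set \<Rightarrow> bool" where
  "past T A \<longleftrightarrow> A \<in> sets (natural_filt X \<infinity>) \<and> (\<forall>t. {w\<in>A. T w < t} \<in> sets (natural_filt X t))"

lemma past_subset: "past T A \<Longrightarrow> A \<subseteq> sample X"
  using sets.sets_into_space[of A "natural_filt X \<infinity>"] unfolding past_def space_natural by blast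

lemma past_less: "past T A \<Longrightarrow> {w\<in>A. T w < t} \<in> sets (natural_filt X t)"
  unfolding past_def by blast

lemma past_space: "optional T \<Longrightarrow> past T (sample X)"
  using sets.top[of "natural_filt X \<infinity>"] unfolding past_def optional_def space_natural by blast

lemma optional_const: "optional (\<lambda>_. c)"
  unfolding optional_def
proof
  fix t
  show "{w \<in> sample X. c < t} \<in> sets (natural_filt X t)"
  proof (cases "c < t")
    case True
    then have "{w \<in> sample X. c < t} = sample X" by blast
    then show ?thesis using sets.top[of "natural_filt X t"] by (simp only: space_natural)
  next
    case False
    then have "{w \<in> sample X. c < t} = {}" by blast
    then show ?thesis by (simp only: sets.empty_sets)
  qed
qed

lemma past_add:
  assumes "past T A"
  shows "past (\<lambda>w. T w + c) A"
  unfolding past_def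
proof (intro conjI allI)
  show "A \<in> sets (natural_filt X \<infinity>)" using assms by (simp add: past_def)
  fix t
  show "{w \<in> A. T w + c < t} \<in> sets (natural_filt X t)"
  proof (cases "c < t")
    case True
    have "{w \<in> A. T w + c < t} = {w \<in> A. T w < t - c}"
      by (simp add: ennreal_add_less_iff[OF True])
    also have "\<dots> \<in> sets (natural_filt X (t - c))" using assms by (simp add: past_def)
    also have "\<dots> \<subseteq> sets (natural_filt X t)" by (rule natural_mono) simp
    finally show ?thesis .
  next
    case False
    then have "\<not> T w + c < t" for w
    proof -
      have "t \<le> c" using False by simp
      also have "c \<le> T w + c" by simp
      finally show ?thesis by (rule leD)
    qed
    then have "{w \<in> A. T w + c < t} = {}" by blast
    then show ?thesis by (simp only: sets.empty_sets)
  qed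
qed

lemma optional_iff_past: "optional T \<longleftrightarrow> past T (sample X)"
  unfolding past_def optional_def using sets.top[of "natural_filt X \<infinity>"] unfolding space_natural by blast

lemma optional_add: "optional T \<Longrightarrow> optional (\<lambda>w. T w + c)"
  using past_add by (simp add: optional_iff_past)

lemma countable_rat_Collect: "countable {r\<in>rat_times. P r}"
  by (rule countable_subset[OF _ countable_rat_times]) blast

lemma le_iff_rat_times:
  fixes a b u :: ennreal
  assumes "b < u"
  shows "a \<le> b \<longleftrightarrow> (\<forall>r\<in>rat_times. b < r \<and> r < u \<longrightarrow> a < r)"
proof
  assume *: "\<forall>r\<in>rat_times. b < r \<and> r < u \<longrightarrow> a < r"
  show "a \<le> b"
  proof (rule ccontr)
    assume "\<not> a \<le> b"
    then have "b < min a u" using assms by simp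
    then obtain r where "r \<in> rat_times" "b < r" "r < min a u" by (rule rat_times_dense)
    with * show False by auto
  qed
qed auto

text \<open>\<open>T \<le> s\<close> means \<open>T < r\<close> for every rational \<open>r\<close>
  between \<open>s\<close> and \<open>t\<close>, and each of these events is known by time
  \<open>t\<close>.\<close>

lemma past_le:
  assumes A: "past T A" and "s < t"
  shows "{w\<in>A. T w \<le> s} \<in> sets (natural_filt X t)"
proof -
  have "{w\<in>A. T w \<le> s} = {w\<in>A. T w < t} \<inter> (\<Inter>r\<in>{r\<in>rat_times. s < r \<and> r < t}. {w\<in>A. T w < r})"
  proof (intro set_eqI iffI)
    fix w assume *: "w \<in> {w\<in>A. T w < t} \<inter> (\<Inter>r\<in>{r\<in>rat_times. s < r \<and> r < t}. {w\<in>A. T w < r})"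
    have "T w \<le> s"
    proof (rule le_iff_rat_times[OF \<open>s < t\<close>, THEN iffD2], intro ballI impI)
      fix r assume "r \<in> rat_times" "s < r \<and> r < t"
      then show "T w < r" using * by simp
    qed
    then show "w \<in> {w\<in>A. T w \<le> s}" using * by blast
  next
    fix w assume *: "w \<in> {w\<in>A. T w \<le> s}"
    have "T w \<le> s" using * by simp
    show "w \<in> {w\<in>A. T w < t} \<inter> (\<Inter>r\<in>{r\<in>rat_times. s < r \<and> r < t}. {w\<in>A. T w < r})"
    proof (intro IntI INT_I CollectI conjI)
      show "T w < t" using \<open>T w \<le> s\<close> \<open>s < t\<close> by (rule le_less_trans)
      fix r assume "r \<in> {r\<in>rat_times. s < r \<and> r < t}"
      then have "s < r" by simp
      with \<open>T w \<le> s\<close> show "T w < r" by (rule le_less_trans)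
    next
      show "w \<in> A" using * by simp
      then show "w \<in> A" .
    qed
  qed
  also have "\<dots> \<in> sets (natural_filt X t)"
  proof (rule sets.Int)
    show "{w\<in>A. T w < t} \<in> sets (natural_filt X t)" by (rule past_less[OF A])
    obtain r where r: "r \<in> rat_times" "s < r" "r < t" by (rule rat_times_dense[OF \<open>s < t\<close>])
    show "(\<Inter>r\<in>{r\<in>rat_times. s < r \<and> r < t}. {w\<in>A. T w < r}) \<in> sets (natural_filt X t)"
    proof (rule sets.countable_INT'[OF countable_rat_Collect])
      show "{r\<in>rat_times. s < r \<and> r < t} \<noteq> {}" using r by blast
      show "(\<lambda>r. {w\<in>A. T w < r}) ` {r\<in>rat_times. s < r \<and> r < t} \<subseteq> sets (natural_filt X t)"
      proof (rule image_subsetI)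
        fix r assume "r \<in> {r\<in>rat_times. s < r \<and> r < t}"
        then have "r \<le> t" by (simp add: less_imp_le)
        from natural_mono[OF this] past_less[OF A, of r]
        show "{w\<in>A. T w < r} \<in> sets (natural_filt X t)" by (rule subsetD)
      qed
    qed
  qed
  finally show ?thesis .
qed

lemma optional_exit_rat:
  assumes "closed S"
  shows "optional (\<lambda>w. exit_rat S (pth w))"
  unfolding optional_def
proof
  fix t
  have "{w \<in> sample X. exit_rat S (pth w) < t} =
      (\<Union>q\<in>{q\<in>rat_times. q < t}. sample X - {w\<in>sample X. path X q w \<in> Some ` S})"
    by (auto simp: exit_rat_less_iff)
  also have "\<dots> \<in> sets (natural_filt X t)"
  proof (rule sets.countable_UN'')
    fix q assume "q \<in> {q\<in>rat_times. q < t}"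
    then have "path X q \<in> natural_filt X t \<rightarrow>\<^sub>M cem_borel" by (intro measurable_path) auto
    from measurable_sets[OF this Some_image_cem_borel[OF borel_closed[OF assms]]]
    have "{w\<in>sample X. path X q w \<in> Some ` S} \<in> sets (natural_filt X t)"
      by (simp add: vimage_def Int_def conj_commute)
    then show "sample X - {w\<in>sample X. path X q w \<in> Some ` S} \<in> sets (natural_filt X t)"
      using sets.compl_sets[of _ "natural_filt X t"] by simp
  qed (rule countable_rat_Collect)
  finally show "{w \<in> sample X. exit_rat S (pth w) < t} \<in> sets (natural_filt X t)" .
qed

text \<open>A supremum below \<open>t\<close> leaves room for a rational \<open>q\<close> below
  \<open>t\<close> that bounds all \<open>T k\<close>; \<open>past_le\<close> then applies to each
  of them.\<close>

lemma optional_SUP: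
  fixes T :: "nat \<Rightarrow> 'w \<Rightarrow> ennreal"
  assumes "\<And>k. optional (T k)"
  shows "optional (\<lambda>w. SUP k. T k w)"
  unfolding optional_def
proof
  fix t
  have "{w \<in> sample X. (SUP k. T k w) < t} =
     (\<Union>q\<in>{q\<in>rat_times. q < t}. (\<Inter>k. {w\<in>sample X. T k w \<le> q}))"
  proof (intro set_eqI iffI)
    fix w assume "w \<in> {w \<in> sample X. (SUP k. T k w) < t}"
    then have w: "w \<in> sample X" "(SUP k. T k w) < t" by auto
    from w(2) obtain q where q: "q \<in> rat_times" "(SUP k. T k w) < q" "q < t" by (rule rat_times_dense)
    then have "T k w \<le> q" for k by (meson SUP_lessD UNIV_I order_less_imp_le)
    then show "w \<in> (\<Union>q\<in>{q\<in>rat_times. q < t}. (\<Inter>k. {w\<in>sample X. T k w \<le> q}))"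
      using q w by auto
  next
    fix w assume "w \<in> (\<Union>q\<in>{q\<in>rat_times. q < t}. (\<Inter>k. {w\<in>sample X. T k w \<le> q}))"
    then obtain q where q: "q < t" "\<And>k. T k w \<le> q" "w \<in> sample X" by auto
    then have "(SUP k. T k w) \<le> q" by (intro SUP_least)
    then show "w \<in> {w \<in> sample X. (SUP k. T k w) < t}" using q by auto
  qed
  also have "\<dots> \<in> sets (natural_filt X t)"
  proof (rule sets.countable_UN'')
    fix q assume "q \<in> {q\<in>rat_times. q < t}"
    then show "(\<Inter>k. {w\<in>sample X. T k w \<le> q}) \<in> sets (natural_filt X t)"
      using past_le[OF past_space[OF assms], of q t] by (intro sets.countable_INT) auto
  qed (rule countable_rat_Collect)
  finally show "{w \<in> sample X. (SUP k. T k w) < t} \<in> sets (natural_filt X t)" .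
qed

lemma optional_exit_path: "optional (\<lambda>w. exit_path D (pth w))"
  unfolding exit_path_def by (intro optional_SUP optional_exit_rat closed_cell)

lemma optional_measurable: "optional T \<Longrightarrow> T \<in> borel_measurable (natural_filt X \<infinity>)"
proof (rule borel_measurableI_less)
  fix t assume "optional T"
  then show "{w \<in> space (natural_filt X \<infinity>). T w < t} \<in> sets (natural_filt X \<infinity>)"
    using natural_mono[of t \<infinity>] by (auto simp: optional_def)
qed

lemma space_aug [simp]: "space (aug_filt X t) = sample X"
  by (simp add: aug_filt_def space_measure_of_conv)

lemma sets_aug: "sets (aug_filt X t) = sigma_sets (sample X)
     {A. A \<subseteq> sample X \<and>
         (\<forall>\<mu>\<in>space (prob_algebra borel). \<exists>C\<in>sets (natural_filt X t).
            \<exists>N\<in>null_sets (law_from X \<mu>). (A - C) \<union> (C - A) \<subseteq> N)}"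
  unfolding aug_filt_def by (rule sets_measure_of) auto

lemma natural_subset_aug: "sets (natural_filt X t) \<subseteq> sets (aug_filt X t)"
proof
  fix A assume A: "A \<in> sets (natural_filt X t)"
  then have "A \<subseteq> sample X" using sets.sets_into_space[OF A] by simp
  then show "A \<in> sets (aug_filt X t)"
    unfolding sets_aug
  proof (intro sigma_sets.Basic CollectI conjI ballI)
    fix \<mu> assume "\<mu> \<in> space (prob_algebra (borel :: 'a measure))"
    show "\<exists>C\<in>sets (natural_filt X t). \<exists>N\<in>null_sets (law_from X \<mu>). A - C \<union> (C - A) \<subseteq> N"
      by (rule bexI[OF _ A], rule bexI[of _ "{}"]) auto
  qed
qed

lemma aug_filtration: "filtration (sample X) (aug_filt X)"
proof
  fix s t :: ennreal assume "s \<le> t"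
  show "sets (aug_filt X s) \<subseteq> sets (aug_filt X t)"
    unfolding sets_aug
  proof (rule sigma_sets_mono', rule subsetI, elim CollectE conjE, intro CollectI conjI ballI)
    fix A \<mu> assume *: "\<forall>\<mu>\<in>space (prob_algebra borel).
      \<exists>C\<in>sets (natural_filt X s). \<exists>N\<in>null_sets (law_from X \<mu>). A - C \<union> (C - A) \<subseteq> N"
      and "\<mu> \<in> space (prob_algebra (borel :: 'a measure))"
    then obtain C N where "C\<in>sets (natural_filt X s)" "N\<in>null_sets (law_from X \<mu>)" "A - C \<union> (C - A) \<subseteq> N"
      by blast
    then show "\<exists>C\<in>sets (natural_filt X t). \<exists>N\<in>null_sets (law_from X \<mu>). A - C \<union> (C - A) \<subseteq> N"
      using natural_mono[OF \<open>s \<le> t\<close>] by blast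
  qed
qed simp

text \<open>The event is known at every later time, and the augmented filtration is
  right-continuous. Right-continuity speaks of finite times, hence the separate case of infinite
  \<open>t\<close>.\<close>

lemma past_aug:
  assumes "past T A"
  shows "{w\<in>A. T w \<le> t} \<in> sets (aug_filt X t)"
proof (cases "t = \<infinity>")
  case True
  then have "{w\<in>A. T w \<le> t} = A" by auto
  then show ?thesis using assms natural_subset_aug[of \<infinity>] True by (auto simp: past_def)
next
  case False
  then have t: "t < \<infinity>" by (simp add: less_top[symmetric])
  have "sets (aug_filt X t) = (\<Inter>s\<in>{t<..}. sets (aug_filt X s))"
    using aug_right t by blast
  moreover have "{w\<in>A. T w \<le> t} \<in> sets (aug_filt X s)" if "s \<in> {t<..}" for s
    using past_le[OF assms, of t s] that natural_subset_aug[of s] by auto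
  ultimately show ?thesis by auto
qed

lemma optional_stopping_time: "optional T \<Longrightarrow> stopping_time (aug_filt X) T"
  by (rule stopping_timeI) (use past_aug[OF past_space] in \<open>auto simp: pred_def\<close>)

lemma past_pre_sigma:
  assumes "optional T" "past T A"
  shows "A \<in> sets (filtration.pre_sigma (sample X) (aug_filt X) T)"
  using filtration.sets_pre_sigmaI[OF aug_filtration optional_stopping_time[OF assms(1)]] past_aug[OF assms(2)]
  by blast

lemma measurable_path_time:
  assumes "T \<in> borel_measurable (natural_filt X \<infinity>)"
  shows "(\<lambda>w. path X (T w) w) \<in> natural_filt X \<infinity> \<rightarrow>\<^sub>M cem_borel"
proof -
  have "(\<lambda>w. eval_at (T w) (pth w)) \<in> natural_filt X \<infinity> \<rightarrow>\<^sub>M cem_borel"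
    by (rule measurable_eval_at[OF assms]) (simp add: measurable_path)
  then show ?thesis
    by (rule measurable_cong[THEN iffD1, rotated]) (simp add: eval_at_rc rc_pth)
qed

lemma past_path:
  assumes T: "optional T" and A: "past T A" and B: "B \<in> sets borel"
  shows "past T {w\<in>A. path X (T w) w \<in> Some ` B}"
  unfolding past_def
proof (intro conjI allI)
  have "(\<lambda>w. path X (T w) w) -` Some ` B \<inter> sample X \<in> sets (natural_filt X \<infinity>)"
    using measurable_sets[OF measurable_path_time[OF optional_measurable[OF T]] Some_image_cem_borel[OF B]] by simp
  then have "A \<inter> ((\<lambda>w. path X (T w) w) -` Some ` B \<inter> sample X) \<in> sets (natural_filt X \<infinity>)"
    using A by (auto simp: past_def)
  moreover have "A \<inter> ((\<lambda>w. path X (T w) w) -` Some ` B \<inter> sample X) = {w\<in>A. path X (T w) w \<in> Some ` B}"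
    using past_subset[OF A] by auto
  ultimately show "{w\<in>A. path X (T w) w \<in> Some ` B} \<in> sets (natural_filt X \<infinity>)" by simp
next
  fix t
  \<comment> \<open>Truncation makes the approximating times measurable at time \<open>t\<close>.
    Values at dyadic times not below \<open>t\<close> are replaced by \<open>None\<close>, which on
    \<open>T < t\<close> concerns finitely many \<open>n\<close> and leaves the limit
    unchanged.\<close>
  define T' where "T' w = min (T w) t" for w
  have T': "T' \<in> borel_measurable (natural_filt X t)"
  proof (rule borel_measurableI_less)
    fix u show "{w \<in> space (natural_filt X t). T' w < u} \<in> sets (natural_filt X t)"
    proof (cases "u \<le> t")
      case True
      then have "{w \<in> space (natural_filt X t). T' w < u} = {w \<in> sample X. T w < u}"
        by (auto simp: T'_def min_less_iff_disj)
      then show ?thesis using T natural_mono[OF True] by (auto simp: optional_def)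
    next
      case False
      then have "{w \<in> space (natural_filt X t). T' w < u} = space (natural_filt X t)"
        by (auto simp: T'_def min_less_iff_disj not_le)
      then show ?thesis by (metis sets.top)
    qed
  qed
  define Z where "Z n w = (if dyad n (T' w) < t then path X (dyad n (T' w)) w else None)" for n w
  have Z: "Z n \<in> natural_filt X t \<rightarrow>\<^sub>M cem_borel" for n
    unfolding Z_def
  proof (rule measurable_compose_countable'[where g = "\<lambda>w. dyad n (T' w)" and I = "dyads n"])
    fix a show "(\<lambda>w. if a < t then path X a w else None) \<in> natural_filt X t \<rightarrow>\<^sub>M cem_borel"
      by (cases "a < t") (auto intro!: measurable_path)
  qed (use countable_dyads measurable_compose[OF T' measurable_dyad_count] in auto)
  have "optlim (\<lambda>n. Z n w) = path X (T w) w" if w: "w \<in> sample X" "T w < t" for w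
  proof -
    have t: "T w < \<infinity>" using w(2) by (simp add: less_le_trans[OF _ top_greatest])
    have "T' w = T w" using w by (simp add: T'_def)
    moreover have "eventually (\<lambda>n. dyad n (T w) < t) sequentially"
      by (rule order_tendstoD(2)[OF dyad_tendsto w(2)])
    ultimately have ev: "eventually (\<lambda>n. path X (dyad n (T w)) w = Z n w) sequentially"
      by (auto simp: Z_def elim: eventually_mono)
    have "limitin onept (\<lambda>n. path X (dyad n (T w)) w) (path X (T w) w) sequentially"
      by (rule limitin_compose_filterlim[OF rc_path_right[OF rc_pth[OF w(1)] t] dyad_filterlim[OF t]])
    then show ?thesis using ev by (intro optlim_eqI) (rule limitin_transform_eventually)
  qed
  then have "{w \<in> {w \<in> A. path X (T w) w \<in> Some ` B}. T w < t} =
      {w\<in>A. T w < t} \<inter> ((\<lambda>w. optlim (\<lambda>n. Z n w)) -` Some ` B \<inter> space (natural_filt X t))"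
    using past_subset[OF A] by auto
  also have "\<dots> \<in> sets (natural_filt X t)"
    using A measurable_sets[OF measurable_optlim[OF Z] Some_image_cem_borel[OF B]] by (auto simp: past_def)
  finally show "{w \<in> {w \<in> A. path X (T w) w \<in> Some ` B}. T w < t} \<in> sets (natural_filt X t)" .
qed

subsection \<open>The strong Markov property for path functionals\<close>

lemma measurable_semigroup_op:
  assumes "f \<in> bfun"
  shows "semigroup_op X t f \<in> bfun"
proof -
  have "(\<lambda>p. ext0 f (p t)) \<in> borel_measurable path_space"
    by (rule measurable_compose[OF measurable_path_coord measurable_ext0[OF assms]])
  from measurable_expct_path[OF this] show ?thesis
    unfolding semigroup_op_def[abs_def] expct_eq .
qed

lemma strong_markov_point:
  assumes "optional T" "past T A" "f \<in> bfun" "s < \<infinity>"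
  shows "(\<integral>\<^sup>+w. ind A w * ext0 f (path X (T w + s) w) \<partial>law X x) =
    (\<integral>\<^sup>+w. ind A w * ext0 (semigroup_op X s f) (path X (T w) w) \<partial>law X x)"
  using hunt_strong_markov[unfolded strong_markov_def expct_eq, rule_format,
    OF optional_stopping_time[OF assms(1)] past_pre_sigma[OF assms(1,2)] assms(3,4)] .

text \<open>The assumed strong Markov property involves a single later time. Going through the list,
  the constraint at the first time is put into the event \<open>A\<close>, so the induction needs
  one \<open>h\<close> that serves all \<open>T\<close> and \<open>A\<close>; it is composed of
  semigroup operators and indicators.\<close>

lemma strong_markov_list:
  assumes "sorted (a # ts)" "\<And>t. B t \<in> sets borel"
  shows "\<exists>h\<in>borel_measurable borel. \<forall>x T A. optional T \<and> past T A \<longrightarrow>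
    (\<integral>\<^sup>+w. ind A w * ind (range Some) (path X (T w) w) *
        ind {w. \<forall>t\<in>set ts. path X (T w + (t - a)) w \<in> Some ` B t} w \<partial>law X x) =
    (\<integral>\<^sup>+w. ind A w * ext0 h (path X (T w) w) \<partial>law X x)"
  using assms(1)
proof (induction ts arbitrary: a)
  case Nil
  have "ext0 (\<lambda>_. 1) z = (ind (range Some) z :: ennreal)" for z :: "'a option"
    by (cases z) (auto simp: ext0_def)
  then show ?case by (intro bexI[of _ "\<lambda>_. 1"]) auto
next
  case (Cons t1 ts)
  show ?case
  proof (cases "t1 = \<infinity>")
    case True
    have "(\<integral>\<^sup>+w. ind A w * ind (range Some) (path X (T w) w) *
        ind {w. \<forall>t\<in>set (t1 # ts). path X (T w + (t - a)) w \<in> Some ` B t} w \<partial>law X x) = 0" for x T A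
    proof -
      have "(\<integral>\<^sup>+w. ind A w * ind (range Some) (path X (T w) w) *
        ind {w. \<forall>t\<in>set (t1 # ts). path X (T w + (t - a)) w \<in> Some ` B t} w \<partial>law X x) = (\<integral>\<^sup>+w. 0 \<partial>law X x)"
      proof (rule nn_integral_cong)
        fix w assume "w \<in> space (law X x)"
        then have "path X (T w + (t1 - a)) w = None"
          using rc_path_infty[OF rc_pth, of w] True by simp
        then show "ind A w * ind (range Some) (path X (T w) w) *
          ind {w. \<forall>t\<in>set (t1 # ts). path X (T w + (t - a)) w \<in> Some ` B t} w = (0::ennreal)"
          by (auto simp: indicator_def)
      qed
      then show ?thesis by simp
    qed
    moreover have "ext0 (\<lambda>_. 0 :: ennreal) z = 0" for z :: "'a option" by (cases z) (auto simp: ext0_def)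
    ultimately show ?thesis by (intro bexI[of _ "\<lambda>_. 0"]) auto
  next
    case False
    then have t1: "t1 < \<infinity>" by (simp add: less_top[symmetric])
    have srt: "sorted (t1 # ts)" and a: "a \<le> t1" using Cons.prems by auto
    obtain h where h: "h \<in> bfun" and h_eq: "\<And>x T A. optional T \<Longrightarrow> past T A \<Longrightarrow>
      (\<integral>\<^sup>+w. ind A w * ind (range Some) (path X (T w) w) *
        ind {w. \<forall>t\<in>set ts. path X (T w + (t - t1)) w \<in> Some ` B t} w \<partial>law X x) =
      (\<integral>\<^sup>+w. ind A w * ext0 h (path X (T w) w) \<partial>law X x)"
      using Cons.IH[OF srt] by blast
    define s where "s = t1 - a"
    have s: "s < \<infinity>" using t1 by (simp add: s_def) (meson diff_le_self_ennreal le_less_trans)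
    define f where "f y = ind (B t1) y * h y" for y
    have f: "f \<in> bfun" unfolding f_def using h assms(2)[of t1] by measurable
    show ?thesis
    proof (intro bexI[of _ "semigroup_op X s f"] allI impI measurable_semigroup_op f)
      fix x T A assume TA: "optional T \<and> past T A"
      define T' where "T' w = T w + s" for w
      have T': "optional T'" unfolding T'_def using optional_add TA by blast
      have "past T' A" unfolding T'_def using past_add TA by blast
      from past_path[OF T' this assms(2)[of t1]]
      have A': "past T' {w\<in>A. path X (T' w) w \<in> Some ` B t1}" (is "past T' ?A'") .
      have "(\<integral>\<^sup>+w. ind A w * ind (range Some) (path X (T w) w) *
        ind {w. \<forall>t\<in>set (t1 # ts). path X (T w + (t - a)) w \<in> Some ` B t} w \<partial>law X x) =
        (\<integral>\<^sup>+w. ind ?A' w * ind (range Some) (path X (T' w) w) *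
          ind {w. \<forall>t\<in>set ts. path X (T' w + (t - t1)) w \<in> Some ` B t} w \<partial>law X x)"
      proof (rule nn_integral_cong)
        fix w assume w: "w \<in> space (law X x)"
        have eq: "T' w + (t - t1) = T w + (t - a)" if "t \<in> set ts" for t
          using ennreal_diff_add_diff[OF a _ t1, of t] that srt by (auto simp: T'_def s_def add.assoc)
        have *: "path X (T w) w \<in> range Some" if "path X (T' w) w \<in> Some ` B t1"
        proof (rule ccontr)
          assume "path X (T w) w \<notin> range Some"
          then have "path X (T w) w = None" by (metis not_None_eq rangeI)
          then have "path X (T' w) w = None"
            using rc_path_absorb[OF rc_pth, of w "T w" "T' w"] w by (simp add: T'_def)
          with that show False by auto
        qed
        show "ind A w * ind (range Some) (path X (T w) w) *
            ind {w. \<forall>t\<in>set (t1 # ts). path X (T w + (t - a)) w \<in> Some ` B t} w =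
          (ind ?A' w * ind (range Some) (path X (T' w) w) *
            ind {w. \<forall>t\<in>set ts. path X (T' w + (t - t1)) w \<in> Some ` B t} w :: ennreal)"
        proof -
          have "path X (T w + (t1 - a)) w = path X (T' w) w" by (simp only: T'_def s_def)
          then have "(\<forall>t\<in>set (t1 # ts). path X (T w + (t - a)) w \<in> Some ` B t) \<longleftrightarrow>
            path X (T' w) w \<in> Some ` B t1 \<and> (\<forall>t\<in>set ts. path X (T' w + (t - t1)) w \<in> Some ` B t)"
            by (simp add: eq cong: ball_cong)
          then show ?thesis unfolding indicator_def mem_Collect_eq
            by (rule of_bool_conj_eq) (use * in auto)
        qed
      qed
      also have "\<dots> = (\<integral>\<^sup>+w. ind ?A' w * ext0 h (path X (T' w) w) \<partial>law X x)"
        by (rule h_eq[OF T' A'])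
      also have "\<dots> = (\<integral>\<^sup>+w. ind A w * ext0 f (path X (T w + s) w) \<partial>law X x)"
        by (intro nn_integral_cong) (auto simp: indicator_def f_def ext0_def T'_def split: option.split)
      also have "\<dots> = (\<integral>\<^sup>+w. ind A w * ext0 (semigroup_op X s f) (path X (T w) w) \<partial>law X x)"
        by (rule strong_markov_point) (use TA f s in auto)
      finally show "(\<integral>\<^sup>+w. ind A w * ind (range Some) (path X (T w) w) *
        ind {w. \<forall>t\<in>set (t1 # ts). path X (T w + (t - a)) w \<in> Some ` B t} w \<partial>law X x) =
        (\<integral>\<^sup>+w. ind A w * ext0 (semigroup_op X s f) (path X (T w) w) \<partial>law X x)" .
    qed
  qed
qed

text \<open>Constraints lie inside the state space only, as \<open>ext0\<close> discards the
  cemetery. Sets involving the cemetery arise through complements, and the empty \<open>J\<close>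
  gives the whole space.\<close>

definition cylinders :: "(ennreal \<Rightarrow> 'a option) set set" where
  "cylinders = {{p. \<forall>t\<in>J. p t \<in> Some ` B t} | J B. finite J \<and> (\<forall>t. B t \<in> sets borel)}"

lemma cylinder_in_path_space:
  assumes "finite J" "\<And>t. B t \<in> sets borel"
  shows "{p. \<forall>t\<in>J. p t \<in> Some ` B t} \<in> sets (path_space :: (ennreal \<Rightarrow> 'a option) measure)"
proof -
  have "{p. p t \<in> Some ` B t} \<in> sets path_space" for t
    using measurable_sets[OF measurable_path_coord Some_image_cem_borel[OF assms(2)[of t]], of t]
    by (simp add: vimage_def space_PiM)
  moreover have "{p. \<forall>t\<in>J. p t \<in> Some ` B t} = space path_space \<inter> (\<Inter>t\<in>J. {p. p t \<in> Some ` B t})"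
    by (auto simp: space_PiM)
  ultimately show ?thesis
    using sets.top[of "path_space :: (ennreal \<Rightarrow> 'a option) measure"] assms(1)
    by (cases "J = {}") (auto intro!: sets.Int sets.finite_INT)
qed

lemma sets_path_space: "sets (path_space :: (ennreal \<Rightarrow> 'a option) measure) = sigma_sets UNIV cylinders"
proof
  have *: "{p. p t \<in> A} \<in> sigma_sets UNIV cylinders" if "A \<in> sets cem_borel" for t and A :: "'a option set"
  proof -
    have cyl: "{p. p t \<in> Some ` B} \<in> sigma_sets UNIV cylinders" if "B \<in> sets borel" for B :: "'a set"
      unfolding cylinders_def by (rule sigma_sets.Basic) (use that in \<open>auto intro!: exI[of _ "{t}"] exI[of _ "\<lambda>_. B"]\<close>)
    have B: "Some -` A \<in> sets borel" using that by (simp add: sets_cem_borel_iff)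
    have cU: "UNIV - {p :: ennreal \<Rightarrow> 'a option. p t \<in> Some ` UNIV} \<in> sigma_sets UNIV cylinders"
      by (rule sigma_sets.Compl[OF cyl]) simp
    interpret sa: sigma_algebra UNIV "sigma_sets UNIV (cylinders :: (ennreal \<Rightarrow> 'a option) set set)"
      by (rule sigma_algebra_sigma_sets) simp
    have "{p. p t \<in> A} = {p. p t \<in> Some ` (Some -` A)} \<union> (if None \<in> A then UNIV - {p. p t \<in> Some ` UNIV} else {})"
    proof (rule set_eqI)
      fix p show "p \<in> {p. p t \<in> A} \<longleftrightarrow> p \<in> {p. p t \<in> Some ` (Some -` A)} \<union> (if None \<in> A then UNIV - {p. p t \<in> Some ` UNIV} else {})"
        by (cases "p t") auto
    qed
    then show ?thesis using cyl[OF B] cU by (auto intro!: sa.Un)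
  qed
  show "sets (path_space :: (ennreal \<Rightarrow> 'a option) measure) \<subseteq> sigma_sets UNIV cylinders"
  proof -
    have "(\<Pi>\<^sub>E i\<in>(UNIV :: ennreal set). space (cem_borel :: 'a option measure)) = UNIV" by simp
    then show ?thesis unfolding sets_PiM_single by (simp only:) (intro sigma_sets_mono, use * in auto)
  qed
  show "sigma_sets UNIV cylinders \<subseteq> sets (path_space :: (ennreal \<Rightarrow> 'a option) measure)"
    using sets.sigma_sets_subset'[of cylinders "path_space :: (ennreal \<Rightarrow> 'a option) measure" UNIV]
      cylinder_in_path_space sets.top[of "path_space :: (ennreal \<Rightarrow> 'a option) measure"]
    by (auto simp: cylinders_def space_PiM)
qed

lemma Int_stable_cylinders: "Int_stable cylinders"
proof (rule Int_stableI)
  fix a b assume "a \<in> cylinders" "b \<in> cylinders"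
  then obtain J B J' B' where J: "finite J" "\<And>t. B t \<in> sets borel" "a = {p. \<forall>t\<in>J. p t \<in> Some ` B t}"
    and J': "finite J'" "\<And>t. B' t \<in> sets borel" "b = {p. \<forall>t\<in>J'. p t \<in> Some ` B' t}"
    unfolding cylinders_def by blast
  define C where "C t = (if t \<in> J then B t else UNIV) \<inter> (if t \<in> J' then B' t else UNIV)" for t
  have eq: "p t \<in> Some ` C t \<longleftrightarrow> (t \<in> J \<longrightarrow> p t \<in> Some ` B t) \<and> (t \<in> J' \<longrightarrow> p t \<in> Some ` B' t)"
    if "t \<in> J \<union> J'" for p :: "ennreal \<Rightarrow> 'a option" and t
    using that by (cases "t \<in> J"; cases "t \<in> J'"; cases "p t") (simp_all add: C_def image_iff)
  have "a \<inter> b = {p. \<forall>t\<in>J \<union> J'. p t \<in> Some ` C t}"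
  proof (rule set_eqI)
    fix p
    have "p \<in> {p. \<forall>t\<in>J \<union> J'. p t \<in> Some ` C t} \<longleftrightarrow>
      (\<forall>t\<in>J \<union> J'. (t \<in> J \<longrightarrow> p t \<in> Some ` B t) \<and> (t \<in> J' \<longrightarrow> p t \<in> Some ` B' t))"
      unfolding mem_Collect_eq by (intro ball_cong refl eq)
    also have "\<dots> \<longleftrightarrow> p \<in> a \<inter> b" unfolding J(3) J'(3) by blast
    finally show "p \<in> a \<inter> b \<longleftrightarrow> p \<in> {p. \<forall>t\<in>J \<union> J'. p t \<in> Some ` C t}" ..
  qed
  moreover have "C t \<in> sets borel" for t using J J' by (auto simp: C_def)
  ultimately show "a \<inter> b \<in> cylinders" unfolding cylinders_def using J(1) J'(1) by blast
qed

end

lemma ext0_simps [simp]: "ext0 f None = 0" "ext0 f (Some x) = f x"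
  by (auto simp: ext0_def)

context hunt_proc begin

lemma measurable_path_time_law:
  assumes "T \<in> borel_measurable (natural_filt X \<infinity>)"
  shows "(\<lambda>w. path X (T w) w) \<in> law X x \<rightarrow>\<^sub>M cem_borel"
  using measurable_path_time[OF assms] by (simp add: measurable_law_eq)

lemma optional_measurable_law: "optional T \<Longrightarrow> T \<in> borel_measurable (law X x)"
  using optional_measurable by (simp add: measurable_law_eq)

lemma measurable_shift_law:
  assumes "optional T"
  shows "(\<lambda>w s. path X (T w + s) w) \<in> law X x \<rightarrow>\<^sub>M path_space"
proof (rule measurable_PiM_single')
  fix s show "(\<lambda>w. path X (T w + s) w) \<in> law X x \<rightarrow>\<^sub>M cem_borel"
    by (rule measurable_path_time_law[OF optional_measurable[OF optional_add[OF assms]]])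
qed simp

lemma measurable_pth_law: "pth \<in> law X x \<rightarrow>\<^sub>M path_space"
  using measurable_pth by (simp add: measurable_law_eq)

lemma past_sets_law: "past T A \<Longrightarrow> A \<in> sets (law X x)"
  by (simp add: past_def sets_law)

text \<open>A finite measure, so that the Markov property becomes an identity of measures that can
  be checked on cylinders.\<close>

definition path_law :: "('w \<Rightarrow> ennreal) \<Rightarrow> 'w set \<Rightarrow> 'a \<Rightarrow> (ennreal \<Rightarrow> 'a option) measure" where
  "path_law T A x = distr (density (law X x) (\<lambda>w. ind A w * ind (range Some) (path X (T w) w)))
     path_space (\<lambda>w s. path X (T w + s) w)"

lemma indicator_Some_measurable:
  assumes "optional T"
  shows "(\<lambda>w. ind (range Some) (path X (T w) w) :: ennreal) \<in> borel_measurable (law X x)"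
proof -
  have "(ind (range Some) :: 'a option \<Rightarrow> ennreal) \<in> borel_measurable cem_borel"
    by (rule borel_measurable_indicator) (use Some_image_cem_borel[of UNIV] in simp)
  from measurable_compose[OF measurable_path_time_law[OF optional_measurable[OF assms]] this] show ?thesis .
qed

lemma nn_integral_path_law:
  assumes "optional T" "past T A" "\<Psi> \<in> borel_measurable path_space"
  shows "(\<integral>\<^sup>+p. \<Psi> p \<partial>path_law T A x) =
    (\<integral>\<^sup>+w. ind A w * ind (range Some) (path X (T w) w) * \<Psi> (\<lambda>s. path X (T w + s) w) \<partial>law X x)"
proof -
  note [measurable] = indicator_Some_measurable[OF assms(1), of x] measurable_shift_law[OF assms(1), of x]
    past_sets_law[OF assms(2)] assms(3)
  show ?thesis unfolding path_law_def
    by (subst nn_integral_distr) (auto simp: nn_integral_density measurable_density_eq1 intro!: nn_integral_density)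
qed

lemma sets_path_law [simp]: "sets (path_law T A x) = sets path_space"
  by (simp add: path_law_def)

lemma space_path_law [simp]: "space (path_law T A x) = UNIV"
  by (simp add: path_law_def space_PiM)

abbreviation expath :: "((ennreal \<Rightarrow> 'a option) \<Rightarrow> ennreal) \<Rightarrow> 'a \<Rightarrow> ennreal" where
  "expath \<Psi> y \<equiv> (\<integral>\<^sup>+w. \<Psi> (pth w) \<partial>law X y)"

lemma measurable_ext0_expath:
  assumes "\<Psi> \<in> borel_measurable path_space" "optional T"
  shows "(\<lambda>w. ext0 (expath \<Psi>) (path X (T w) w)) \<in> borel_measurable (law X x)"
  by (rule measurable_compose[OF measurable_path_time_law[OF optional_measurable[OF assms(2)]]
      measurable_ext0[OF measurable_expct_path[OF assms(1)]]])

lemma markov_cylinder: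
  assumes T: "optional T" "past T A" and S: "S \<in> cylinders"
  shows "emeasure (path_law T A x) S = (\<integral>\<^sup>+w. ind A w * ext0 (expath (ind S)) (path X (T w) w) \<partial>law X x)"
proof -
  from S obtain J B where J: "finite J" "\<And>t. B t \<in> sets borel" "S = {p. \<forall>t\<in>J. p t \<in> Some ` B t}"
    unfolding cylinders_def by blast
  define ts where "ts = sorted_list_of_set J"
  have ts: "set ts = J" "sorted (0 # ts)" using J(1) by (auto simp: ts_def)
  obtain h where h: "h \<in> bfun" and h_eq: "\<And>x T A. optional T \<Longrightarrow> past T A \<Longrightarrow>
    (\<integral>\<^sup>+w. ind A w * ind (range Some) (path X (T w) w) *
        ind {w. \<forall>t\<in>set ts. path X (T w + (t - 0)) w \<in> Some ` B t} w \<partial>law X x) =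
    (\<integral>\<^sup>+w. ind A w * ext0 h (path X (T w) w) \<partial>law X x)"
    using strong_markov_list[where B = B, OF ts(2) J(2)] by (elim bexE) blast
  have ind: "ind {w. \<forall>t\<in>set ts. path X (T w + (t - 0)) w \<in> Some ` B t} w =
      (ind S (\<lambda>s. path X (T w + s) w) :: ennreal)" for T w
    by (simp add: indicator_def J(3) ts(1))
  \<comment> \<open>The abstract \<open>h\<close> is identified by applying its defining identity at
    \<open>T = 0\<close>, where the path sits at the starting point \<open>y\<close>.\<close>
  have h_expath: "h y = expath (ind S) y" for y
  proof -
    have "h y = (\<integral>\<^sup>+w. ind (sample X) w * ext0 h (path X 0 w) \<partial>law X y)"
    proof -
      have "(\<integral>\<^sup>+w. ind (sample X) w * ext0 h (path X 0 w) \<partial>law X y) = (\<integral>\<^sup>+w. h y \<partial>law X y)"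
        by (rule nn_integral_cong_AE) (use AE_start[of y] AE_space[of "law X y"] in eventually_elim, auto)
      then show ?thesis by simp
    qed
    also have "\<dots> = (\<integral>\<^sup>+w. ind (sample X) w * ind (range Some) (path X 0 w) *
        ind S (\<lambda>s. path X (0 + s) w) \<partial>law X y)"
      using h_eq[OF optional_const[of 0] past_space[OF optional_const[of 0]], of y, symmetric] unfolding ind .
    also have "\<dots> = expath (ind S) y"
      by (rule nn_integral_cong_AE) (use AE_start[of y] AE_space[of "law X y"] in eventually_elim, auto)
    finally show ?thesis .
  qed
  have S': "S \<in> sets path_space" using S unfolding sets_path_space by (rule sigma_sets.Basic)
  then have "emeasure (path_law T A x) S = (\<integral>\<^sup>+p. ind S p \<partial>path_law T A x)" by simp
  also have "\<dots> = (\<integral>\<^sup>+w. ind A w * ind (range Some) (path X (T w) w) *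
      ind S (\<lambda>s. path X (T w + s) w) \<partial>law X x)"
    by (rule nn_integral_path_law[OF T]) (use S' in simp)
  also have "\<dots> = (\<integral>\<^sup>+w. ind A w * ext0 h (path X (T w) w) \<partial>law X x)"
    using h_eq[OF T, of x] unfolding ind .
  finally show ?thesis unfolding h_expath[abs_def] .
qed

lemma expath_indicator_Un:
  assumes "disjoint_family F" "\<And>i. F i \<in> sets path_space"
  shows "expath (ind (\<Union>i. F i)) y = (\<Sum>i::nat. expath (ind (F i)) y)"
proof -
  have "expath (ind (\<Union>i. F i)) y = (\<integral>\<^sup>+w. (\<Sum>i. ind (F i) (pth w)) \<partial>law X y)"
    by (simp add: suminf_indicator[OF assms(1)])
  also have "\<dots> = (\<Sum>i. expath (ind (F i)) y)"
    by (rule nn_integral_suminf) (rule measurable_compose[OF measurable_pth_law], use assms(2) in simp)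
  finally show ?thesis .
qed

lemma ext0_suminf: "ext0 (\<lambda>y. \<Sum>i. f i y) z = (\<Sum>i. ext0 (f i) z :: ennreal)"
  by (cases z) auto

lemma UNIV_path_space [simp]: "UNIV \<in> sets (path_space :: (ennreal \<Rightarrow> 'a option) measure)"
  using sets.top[of "path_space :: (ennreal \<Rightarrow> 'a option) measure"] by (simp add: space_PiM)

lemma subset_Pow_UNIV: "C \<subseteq> Pow UNIV" by simp

lemma markov_sets:
  assumes T: "optional T" "past T A" and S: "S \<in> sets path_space"
  shows "emeasure (path_law T A x) S = (\<integral>\<^sup>+w. ind A w * ext0 (expath (ind S)) (path X (T w) w) \<partial>law X x)"
  using S unfolding sets_path_space
proof (induction rule: sigma_sets_induct_disjoint[OF Int_stable_cylinders subset_Pow_UNIV, consumes 1, case_names basic empty compl union])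
  case (basic S)
  then show ?case by (rule markov_cylinder[OF T])
next
  case empty
  have "ext0 (expath (ind {})) z = 0" for z by (cases z) auto
  then show ?case by simp
next
  case (compl S)
  note 4 = compl
  have S: "S \<in> sets path_space" using 4 by (simp add: sets_path_space)
  have "UNIV = {p :: ennreal \<Rightarrow> 'a option. \<forall>t\<in>{}. p t \<in> Some ` UNIV}" by simp
  then have U: "UNIV \<in> cylinders" unfolding cylinders_def by (intro CollectI exI[of _ "{}"] exI[of _ "\<lambda>_. UNIV"]) auto
  let ?R = "\<lambda>S. (\<integral>\<^sup>+w. ind A w * ext0 (expath (ind S)) (path X (T w) w) \<partial>law X x)"
  have m: "(\<lambda>w. ind A w * ext0 (expath (ind S)) (path X (T w) w)) \<in> borel_measurable (law X x)"
    if "S \<in> sets path_space" for S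
    using measurable_ext0_expath[of "ind S", OF _ T(1)] past_sets_law[OF T(2)] that by measurable
  have S2: "UNIV - S \<in> sets path_space" using sets.compl_sets[OF S] by (simp add: space_PiM)
  have "expath (ind S) y + expath (ind (UNIV - S)) y = expath (ind UNIV) y" for y
  proof -
    have "expath (ind S) y + expath (ind (UNIV - S)) y = (\<integral>\<^sup>+w. ind S (pth w) + ind (UNIV - S) (pth w) \<partial>law X y)"
      by (rule nn_integral_add[symmetric]; rule measurable_compose[OF measurable_pth_law]) (use S S2 in auto)
    also have "\<dots> = expath (ind UNIV) y" by (intro nn_integral_cong) (auto simp: indicator_def)
    finally show ?thesis .
  qed
  then have e: "ext0 (expath (ind S)) z + ext0 (expath (ind (UNIV - S))) z = ext0 (expath (ind UNIV)) z" for z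
    by (cases z) auto
  have "?R S + ?R (UNIV - S) = ?R UNIV"
    by (subst nn_integral_add[symmetric, OF m[OF S] m[OF S2]]) (simp add: distrib_left[symmetric] e)
  also have "\<dots> = emeasure (path_law T A x) UNIV" by (rule markov_cylinder[OF T U, symmetric])
  also have "\<dots> = emeasure (path_law T A x) S + emeasure (path_law T A x) (UNIV - S)"
    using plus_emeasure[of S "path_law T A x" "UNIV - S"] S S2 by simp
  finally have eq: "emeasure (path_law T A x) S + ?R (UNIV - S) =
      emeasure (path_law T A x) S + emeasure (path_law T A x) (UNIV - S)"
    using 4 by simp
  \<comment> \<open>Total mass at most 1 allows the mass of \<open>S\<close> to be cancelled from
    both sides, which leaves the identity for the complement.\<close>
  have "emeasure (path_law T A x) S \<le> emeasure (path_law T A x) UNIV" by (rule emeasure_mono) auto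
  also have "\<dots> = ?R UNIV" by (rule markov_cylinder[OF T U])
  also have "\<dots> \<le> (\<integral>\<^sup>+w. 1 \<partial>law X x)"
    by (intro nn_integral_mono) (auto simp: indicator_def ext0_def split: option.split)
  finally have "emeasure (path_law T A x) S \<noteq> \<infinity>" by (auto simp: top_unique)
  with eq show ?case by (simp add: ennreal_add_left_cancel)
next
  case (union F)
  note 5 = union
  have F: "\<And>i. F i \<in> sets path_space" using 5 by (auto simp: sets_path_space)
  have m: "(\<lambda>w. ind A w * ext0 (expath (ind (F i))) (path X (T w) w)) \<in> borel_measurable (law X x)" for i
    using measurable_ext0_expath[of "ind (F i)", OF _ T(1)] past_sets_law[OF T(2)] F by measurable
  have "emeasure (path_law T A x) (\<Union>i. F i) = (\<Sum>i. emeasure (path_law T A x) (F i))"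
    using 5 F by (intro suminf_emeasure[symmetric]) auto
  also have "\<dots> = (\<Sum>i. \<integral>\<^sup>+w. ind A w * ext0 (expath (ind (F i))) (path X (T w) w) \<partial>law X x)"
    using 5 by simp
  also have "\<dots> = (\<integral>\<^sup>+w. (\<Sum>i. ind A w * ext0 (expath (ind (F i))) (path X (T w) w)) \<partial>law X x)"
    by (rule nn_integral_suminf[symmetric, OF m])
  also have "\<dots> = (\<integral>\<^sup>+w. ind A w * ext0 (expath (ind (\<Union>i. F i))) (path X (T w) w) \<partial>law X x)"
    unfolding expath_indicator_Un[OF 5(1) F] ext0_suminf by (simp add: ennreal_suminf_cmult)
  finally show ?case .
qed

lemma markov_path:
  assumes T: "optional T" "past T A" and \<Psi>: "\<Psi> \<in> borel_measurable path_space"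
  shows "(\<integral>\<^sup>+w. ind A w * ind (range Some) (path X (T w) w) * \<Psi> (\<lambda>s. path X (T w + s) w) \<partial>law X x) =
    (\<integral>\<^sup>+w. ind A w * ext0 (expath \<Psi>) (path X (T w) w) \<partial>law X x)"
proof -
  have "(\<integral>\<^sup>+p. \<Psi> p \<partial>path_law T A x) = (\<integral>\<^sup>+w. ind A w * ext0 (expath \<Psi>) (path X (T w) w) \<partial>law X x)"
    using \<Psi>
  proof (induction rule: borel_measurable_induct)
    case (cong f g)
    then have "f = g" by (auto simp: space_PiM fun_eq_iff)
    then show ?case using cong by simp
  next
    case (set S)
    then show ?case using markov_sets[OF T set] by simp
  next
    case (mult u c)
    have "expath (\<lambda>p. c * u p) = (\<lambda>y. c * expath u y)"
      by (rule ext, rule nn_integral_cmult, rule measurable_compose[OF measurable_pth_law mult(2)])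
    then have "ext0 (expath (\<lambda>p. c * u p)) z = c * ext0 (expath u) z" for z by (cases z) auto
    moreover have "(\<integral>\<^sup>+w. ind A w * (c * ext0 (expath u) (path X (T w) w)) \<partial>law X x) =
       c * (\<integral>\<^sup>+w. ind A w * ext0 (expath u) (path X (T w) w) \<partial>law X x)"
      using measurable_ext0_expath[OF mult(2) T(1), of x] past_sets_law[OF T(2), of x]
      by (subst nn_integral_cmult[symmetric]) (auto simp: ac_simps)
    moreover have "u \<in> borel_measurable (path_law T A x)"
      using mult(2) by (simp add: measurable_cong_sets[OF sets_path_law refl])
    ultimately show ?case using mult by (simp add: nn_integral_cmult)
  next
    case (add u v)
    have "expath (\<lambda>p. v p + u p) = (\<lambda>y. expath v y + expath u y)"
      by (rule ext, rule nn_integral_add; rule measurable_compose[OF measurable_pth_law]) (use add in auto)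
    then have "ext0 (expath (\<lambda>p. v p + u p)) z = ext0 (expath v) z + ext0 (expath u) z" for z by (cases z) auto
    moreover have "(\<integral>\<^sup>+w. ind A w * (ext0 (expath v) (path X (T w) w) + ext0 (expath u) (path X (T w) w)) \<partial>law X x) =
       (\<integral>\<^sup>+w. ind A w * ext0 (expath v) (path X (T w) w) \<partial>law X x) +
       (\<integral>\<^sup>+w. ind A w * ext0 (expath u) (path X (T w) w) \<partial>law X x)"
      using measurable_ext0_expath[of u, OF _ T(1), of x] measurable_ext0_expath[of v, OF _ T(1), of x] past_sets_law[OF T(2), of x] add
      by (subst nn_integral_add[symmetric]) (auto simp: distrib_left)
    moreover have "u \<in> borel_measurable (path_law T A x)" "v \<in> borel_measurable (path_law T A x)"
      using add by (simp_all add: measurable_cong_sets[OF sets_path_law refl])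
    ultimately show ?case using add by (simp add: nn_integral_add)
  next
    case (seq U)
    have "expath (SUP i. U i) = (\<lambda>y. SUP i. expath (U i) y)"
    proof (rule ext)
      fix y
      have "expath (SUP i. U i) y = (\<integral>\<^sup>+w. (SUP i. U i (pth w)) \<partial>law X y)" by (simp add: image_comp)
      also have "\<dots> = (SUP i. expath (U i) y)"
        by (rule nn_integral_monotone_convergence_SUP)
           (use seq measurable_compose[OF measurable_pth_law[of y] seq(1)] in \<open>auto simp: incseq_def le_fun_def\<close>)
      finally show "expath (SUP i. U i) y = (SUP i. expath (U i) y)" .
    qed
    then have e: "ext0 (expath (SUP i. U i)) z = (SUP i. ext0 (expath (U i)) z)" for z by (cases z) auto
    have inc: "incseq (\<lambda>i w. ind A w * ext0 (expath (U i)) (path X (T w) w))"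
      using \<open>incseq U\<close> by (auto simp: incseq_def le_fun_def ext0_def split: option.split intro!: mult_left_mono nn_integral_mono)
    have "(\<integral>\<^sup>+w. ind A w * ext0 (expath (SUP i. U i)) (path X (T w) w) \<partial>law X x) =
       (\<integral>\<^sup>+w. (SUP i. ind A w * ext0 (expath (U i)) (path X (T w) w)) \<partial>law X x)"
      unfolding e by (simp add: SUP_mult_left_ennreal)
    also have "\<dots> = (SUP i. \<integral>\<^sup>+w. ind A w * ext0 (expath (U i)) (path X (T w) w) \<partial>law X x)"
      by (rule nn_integral_monotone_convergence_SUP[OF inc])
         (use measurable_ext0_expath[OF seq(1) T(1), of _ x] past_sets_law[OF T(2), of x] in measurable)
    also have "\<dots> = (SUP i. \<integral>\<^sup>+p. U i p \<partial>path_law T A x)" using seq by simp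
    also have "\<dots> = (\<integral>\<^sup>+p. (SUP i. U i p) \<partial>path_law T A x)"
      using seq by (intro nn_integral_monotone_convergence_SUP[symmetric])
        (auto simp: measurable_cong_sets[OF sets_path_law refl])
    also have "(\<lambda>p. SUP i. U i p) = (SUP i. U i)" by (simp add: fun_eq_iff image_comp)
    finally show ?case ..
  qed
  then show ?thesis using nn_integral_path_law[OF T \<Psi>] by simp
qed

subsection \<open>Exit positions\<close>

abbreviation exitt :: "'a set \<Rightarrow> 'w \<Rightarrow> ennreal" where
  "exitt D w \<equiv> exit_path D (pth w)"

text \<open>Quasi-left-continuity rules out that the path jumps back into \<open>D\<close> at the time at which it
  leaves all compact subsets of \<open>D\<close>.\<close>

lemma AE_exit_outside:
  assumes D: "open D"
  shows "AE w in law X x. path X (exitt D w) w \<notin> Some ` D"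
proof -
  define T where "T k w = exit_rat (cell D k) (pth w)" for k w
  have st: "\<forall>n. stopping_time (aug_filt X) (T n)"
    unfolding T_def by (intro allI optional_stopping_time optional_exit_rat closed_cell)
  have inc: "\<forall>w\<in>sample X. incseq (\<lambda>n. T n w)"
    unfolding T_def incseq_def by (intro ballI allI impI exit_rat_mono incseqD[OF cell_incseq])
  have SUP: "(SUP n. T n w) = exitt D w" for w by (simp add: T_def exit_path_def)
  have "AE w in law X x. exitt D w < \<infinity> \<longrightarrow>
     limitin onept (\<lambda>n. path X (T n w) w) (path X (exitt D w) w) sequentially"
    using hunt_qlc[unfolded quasi_left_continuous_def, rule_format, OF conjI[OF st inc], of x] unfolding SUP .
  then show ?thesis using AE_space
  proof eventually_elim
    fix w assume lim: "exitt D w < \<infinity> \<longrightarrow>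
     limitin onept (\<lambda>n. path X (T n w) w) (path X (exitt D w) w) sequentially"
      and w: "w \<in> space (law X x)"
    then have rc: "rc_path (pth w)" by (simp add: rc_pth)
    show "path X (exitt D w) w \<notin> Some ` D"
    proof
      assume "path X (exitt D w) w \<in> Some ` D"
      then obtain y where y: "path X (exitt D w) w = Some y" "y \<in> D" by auto
      then have "exitt D w \<noteq> \<infinity>" using rc_path_infty[OF rc] by auto
      then have lim': "limitin onept (\<lambda>n. path X (T n w) w) (Some y) sequentially"
        using lim y by (simp add: less_top[symmetric])
      obtain k where "y \<in> cell D k" using cell_exhaust[OF D y(2)] .
      then have "y \<in> icell D (Suc k)" using cell_subset_interior by blast
      from limitin_Some_eventually[OF lim' open_interior this]
      obtain N where N: "\<And>n. n \<ge> N \<Longrightarrow> path X (T n w) w \<in> Some ` icell D (Suc k)"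
        by (auto simp: eventually_sequentially)
      define n where "n = max N (Suc k)"
      have "icell D (Suc k) \<subseteq> icell D n"
        by (intro interior_mono incseqD[OF cell_incseq]) (simp add: n_def)
      then have "path X (T n w) w \<in> Some ` icell D n" using N[of n] by (auto simp: n_def)
      moreover have "path X (T n w) w \<notin> Some ` icell D n"
        unfolding T_def by (rule at_exit_rat[OF rc compact_cell])
      ultimately show False by simp
    qed
  qed
qed

text \<open>Before \<open>exitt\<close> the path is inside \<open>D\<close>, at \<open>exitt\<close>
  it is almost surely outside, and openness of \<open>D\<close> makes \<open>exitt\<close> positive.
  So the infimum over all positive times in \<open>exit_time\<close> is attained there, and a
  measurable functional replaces it.\<close>

lemma AE_exit_time:
  assumes D: "open D" "x \<in> D"
  shows "AE w in law X x. exit_time X D w = exitt D w \<and> 0 < exitt D w"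
  using AE_exit_outside[OF D(1)] AE_start[of x] AE_space
proof eventually_elim
  fix w assume 1: "path X (exitt D w) w \<notin> Some ` D" and 2: "path X 0 w = Some x" and "w \<in> space (law X x)"
  then have rc: "rc_path (pth w)" by (simp add: rc_pth)
  have pos: "0 < exitt D w" by (rule exit_path_pos[OF rc D(1)]) (use 2 D(2) in simp)
  have "exit_time X D w = exitt D w"
    unfolding exit_time_def
  proof (rule Inf_eqI)
    fix t assume t: "t \<in> {t. 0 < t \<and> path X t w \<notin> Some ` D}"
    show "exitt D w \<le> t"
    proof (rule ccontr)
      assume "\<not> exitt D w \<le> t"
      then have "path X t w \<in> Some ` D" using before_exit_path[OF rc, of t D] by simp
      with t show False by simp
    qed
  next
    fix u assume "\<And>t. t \<in> {t. 0 < t \<and> path X t w \<notin> Some ` D} \<Longrightarrow> u \<le> t"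
    from this[of "exitt D w"] show "u \<le> exitt D w" using pos 1 by simp
  qed
  with pos show "exit_time X D w = exitt D w \<and> 0 < exitt D w" by simp
qed

lemma AE_exit_less_iff:
  assumes "open D" "W \<subseteq> D"
  shows "AE w in law X x. exitt W w \<le> exitt D w \<and> (exitt W w < exitt D w \<longleftrightarrow> path X (exitt W w) w \<in> Some ` D)"
  using AE_exit_outside[OF assms(1)] AE_space
proof eventually_elim
  fix w assume 1: "path X (exitt D w) w \<notin> Some ` D" and "w \<in> space (law X x)"
  then have rc: "rc_path (pth w)" by (simp add: rc_pth)
  have le: "exitt W w \<le> exitt D w" by (rule exit_path_mono[OF assms(2)])
  show "exitt W w \<le> exitt D w \<and> (exitt W w < exitt D w \<longleftrightarrow> path X (exitt W w) w \<in> Some ` D)"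
    using le 1 before_exit_path[OF rc, of "exitt W w" D] by (metis order_le_less)
qed

text \<open>Leaving \<open>W\<close> before \<open>D\<close> means leaving \<open>W\<close> while still in a compact part of \<open>D\<close>.\<close>

lemma AE_exit_exhaust:
  assumes "open D" "open W" "W \<subseteq> D"
  shows "AE w in law X x. exitt W w < exitt D w \<longrightarrow>
    (\<forall>\<^sub>F k in sequentially. exitt (W \<inter> icell D k) w = exitt W w)"
proof -
  have "AE w in law X x. \<forall>k. path X (exitt (W \<inter> icell D k) w) w \<notin> Some ` (W \<inter> icell D k)"
    unfolding AE_all_countable by (intro allI AE_exit_outside open_Int assms open_interior)
  then show ?thesis using AE_space
  proof eventually_elim
    fix w assume 1: "\<forall>k. path X (exitt (W \<inter> icell D k) w) w \<notin> Some ` (W \<inter> icell D k)"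
      and "w \<in> space (law X x)"
    then have rc: "rc_path (pth w)" by (simp add: rc_pth)
    show "exitt W w < exitt D w \<longrightarrow> (\<forall>\<^sub>F k in sequentially. exitt (W \<inter> icell D k) w = exitt W w)"
    proof
      assume "exitt W w < exitt D w"
      then obtain k0 where k0: "exitt W w < exit_rat (cell D k0) (pth w)"
        unfolding exit_path_def[of D] by (auto simp: less_SUP_iff)
      have "exitt (W \<inter> icell D k) w = exitt W w" if "k \<ge> Suc k0" for k
      proof (rule ccontr)
        let ?\<sigma> = "exitt (W \<inter> icell D k) w"
        assume "?\<sigma> \<noteq> exitt W w"
        moreover have "?\<sigma> \<le> exitt W w" by (rule exit_path_mono) simp
        ultimately have less: "?\<sigma> < exitt W w" by simp
        then have "path X ?\<sigma> w \<in> Some ` W" by (rule before_exit_path[OF rc])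
        with 1[rule_format, of k] have n: "path X ?\<sigma> w \<notin> Some ` icell D k" by force
        have "cell D k0 \<subseteq> icell D (Suc k0)" by (rule cell_subset_interior)
        also have "\<dots> \<subseteq> icell D k" by (intro interior_mono incseqD[OF cell_incseq] that)
        finally have "path X ?\<sigma> w \<notin> Some ` cell D k0" using n by blast
        from exit_rat_le[OF rc compact_cell this] less k0 show False by (meson leD le_less_trans less_trans)
      qed
      then show "\<forall>\<^sub>F k in sequentially. exitt (W \<inter> icell D k) w = exitt W w"
        by (auto simp: eventually_sequentially)
    qed
  qed
qed

end

section \<open>Potentials and harmonic measures of the killed process\<close>

lemma ext0_mono: "(\<And>x. f x \<le> g x) \<Longrightarrow> ext0 f z \<le> (ext0 g z :: ennreal)"
  by (cases z) auto

lemma nn_integral_shift_ge: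
  fixes f :: "real \<Rightarrow> ennreal"
  assumes [measurable]: "f \<in> bfun"
  shows "(\<integral>\<^sup>+t. ind {r..} t * f t \<partial>lborel) = (\<integral>\<^sup>+t. ind {0..} t * f (r + t) \<partial>lborel)"
proof -
  have "(\<integral>\<^sup>+t. ind {r..} t * f t \<partial>lborel) = (\<integral>\<^sup>+t. ind {r..} (r + 1 * t) * f (r + 1 * t) \<partial>lborel)"
    using nn_integral_real_affine[of "\<lambda>t. ind {r..} t * f t" 1 r] by simp
  then show ?thesis by (simp add: indicator_def)
qed

context proper_space begin

text \<open>Here and in the next two definitions \<open>eval_at\<close> keeps the functionals
  measurable on all of path space; their expectations are the resolvent, the exit operator and the
  killed semigroup.\<close>

definition potf :: "'a set \<Rightarrow> real \<Rightarrow> ('a \<Rightarrow> ennreal) \<Rightarrow> (ennreal \<Rightarrow> 'a option) \<Rightarrow> ennreal" where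
  "potf D \<alpha> f p = (\<integral>\<^sup>+t. ind {0..} t * (if ennreal t < exit_path D p
     then ennreal (exp (- \<alpha> * t)) * ext0 f (eval_at (ennreal t) p) else 0) \<partial>lborel)"

definition exf :: "'a set \<Rightarrow> ('a \<Rightarrow> ennreal) \<Rightarrow> (ennreal \<Rightarrow> 'a option) \<Rightarrow> ennreal" where
  "exf D g p = ext0 g (eval_at (exit_path D p) p)"

definition killf :: "'a set \<Rightarrow> ennreal \<Rightarrow> ('a \<Rightarrow> ennreal) \<Rightarrow> (ennreal \<Rightarrow> 'a option) \<Rightarrow> ennreal" where
  "killf D t f p = (if t < exit_path D p then ext0 f (eval_at t p) else 0)"

lemma measurable_killf_joint:
  assumes f: "f \<in> bfun"
    and F [measurable]: "\<And>s. (\<lambda>w. F w s :: 'a option) \<in> M \<rightarrow>\<^sub>M cem_borel" and T [measurable]: "T \<in> borel_measurable M"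
  shows "(\<lambda>w. killf D (T w) f (F w)) \<in> borel_measurable M"
proof -
  have [measurable]: "(\<lambda>w. exit_path D (F w)) \<in> borel_measurable M" by (rule measurable_exit_path[OF F])
  have [measurable]: "(\<lambda>w. ext0 f (eval_at (T w) (F w))) \<in> borel_measurable M"
    by (rule measurable_compose[OF measurable_eval_at[OF T F] measurable_ext0[OF f]])
  show ?thesis unfolding killf_def by measurable
qed

lemma potf_killf: "potf D \<alpha> f p = (\<integral>\<^sup>+t. ind {0..} t * (ennreal (exp (- \<alpha> * t)) * killf D (ennreal t) f p) \<partial>lborel)"
  unfolding potf_def killf_def by (intro nn_integral_cong) auto

lemma measurable_path_coord_fst: "(\<lambda>x. fst x s) \<in> path_space \<Otimes>\<^sub>M N \<rightarrow>\<^sub>M (cem_borel :: 'a option measure)"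
  by (rule measurable_compose[OF measurable_fst measurable_path_coord])

lemma measurable_killf [measurable]:
  assumes "f \<in> bfun"
  shows "killf D t f \<in> borel_measurable path_space"
  by (rule measurable_killf_joint[OF assms]) auto

lemma measurable_killf_pair:
  assumes f: "f \<in> bfun"
  shows "(\<lambda>x. killf D (ennreal (snd x)) f (fst x)) \<in> borel_measurable (path_space \<Otimes>\<^sub>M borel)"
  by (rule measurable_killf_joint[OF f measurable_path_coord_fst]) simp

lemma measurable_potf [measurable]:
  assumes f: "f \<in> bfun"
  shows "potf D \<alpha> f \<in> borel_measurable path_space"
proof -
  note [measurable] = measurable_killf_pair[OF f]
  have "(\<lambda>p. \<integral>\<^sup>+t. ind {0..} t * (ennreal (exp (- \<alpha> * t)) * killf D (ennreal t) f p) \<partial>lborel) \<in> borel_measurable path_space"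
    by (rule sigma_finite_measure.borel_measurable_nn_integral[OF sigma_finite_lborel])
       (simp add: case_prod_beta')
  then show ?thesis unfolding potf_killf[abs_def] .
qed

lemma measurable_exf [measurable]:
  assumes f: "f \<in> bfun"
  shows "exf D f \<in> borel_measurable path_space"
proof -
  have E: "exit_path D \<in> borel_measurable (path_space :: (ennreal \<Rightarrow> 'a option) measure)"
    by (rule measurable_exit_path) simp
  show ?thesis unfolding exf_def
    by (rule measurable_compose[OF measurable_eval_at[OF E] measurable_ext0[OF f]]) simp
qed

lemma killf_rc: "rc_path p \<Longrightarrow> killf D t f p = (if t < exit_path D p then ext0 f (p t) else 0)"
  by (simp add: killf_def eval_at_rc)

lemma exf_rc: "rc_path p \<Longrightarrow> exf D f p = ext0 f (p (exit_path D p))"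
  by (simp add: exf_def eval_at_rc)

lemma killf_shift:
  fixes p :: "ennreal \<Rightarrow> 'a option"
  assumes p: "rc_path p" and c: "c < exit_path D p"
  shows "killf D (c + t) f p = killf D t f (\<lambda>s. p (c + s))"
proof -
  have "c \<noteq> \<infinity>" using c by auto
  then have "c + t < exit_path D p \<longleftrightarrow> t < exit_path D (\<lambda>s. p (c + s))"
    unfolding exit_path_shift[OF p c] by (simp add: ennreal_add_left_cancel_less)
  then show ?thesis using p by (simp add: killf_rc rc_path_shift)
qed

lemma measurable_killf_time:
  fixes p :: "ennreal \<Rightarrow> 'a option"
  assumes f: "f \<in> bfun"
  shows "(\<lambda>t. killf D (ennreal t) f p) \<in> bfun"
  by (rule measurable_killf_joint[OF f, of "\<lambda>_. p"]) auto

lemma potf_split: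
  fixes p :: "ennreal \<Rightarrow> 'a option"
  assumes p: "rc_path p" and c: "ennreal c < exit_path D p" "0 \<le> c" and f: "f \<in> bfun"
  shows "potf D \<alpha> f p = (\<integral>\<^sup>+t. ind {0..<c} t * (ennreal (exp (- \<alpha> * t)) * ext0 f (p (ennreal t))) \<partial>lborel) +
     ennreal (exp (- \<alpha> * c)) * potf D \<alpha> f (\<lambda>s. p (ennreal c + s))"
proof -
  note [measurable] = measurable_killf_time[OF f]
  let ?k = "\<lambda>t. ennreal (exp (- \<alpha> * t)) * killf D (ennreal t) f p"
  have "potf D \<alpha> f p = (\<integral>\<^sup>+t. ind {0..<c} t * ?k t + ind {c..} t * ?k t \<partial>lborel)"
    unfolding potf_killf using c(2) by (intro nn_integral_cong) (auto simp: indicator_def)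
  also have "\<dots> = (\<integral>\<^sup>+t. ind {0..<c} t * ?k t \<partial>lborel) + (\<integral>\<^sup>+t. ind {c..} t * ?k t \<partial>lborel)"
    by (rule nn_integral_add) measurable
  also have "(\<integral>\<^sup>+t. ind {c..} t * ?k t \<partial>lborel) = (\<integral>\<^sup>+t. ind {0..} t * ?k (c + t) \<partial>lborel)"
    by (rule nn_integral_shift_ge) measurable
  also have "\<dots> = (\<integral>\<^sup>+t. ennreal (exp (- \<alpha> * c)) * (ind {0..} t * (ennreal (exp (- \<alpha> * t)) * killf D (ennreal t) f (\<lambda>s. p (ennreal c + s)))) \<partial>lborel)"
  proof (rule nn_integral_cong)
    fix t :: real
    show "ind {0..} t * ?k (c + t) = ennreal (exp (- \<alpha> * c)) * (ind {0..} t * (ennreal (exp (- \<alpha> * t)) * killf D (ennreal t) f (\<lambda>s. p (ennreal c + s))))"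
    proof (cases "0 \<le> t")
      case True
      then have "ennreal (c + t) = ennreal c + ennreal t" using c(2) by simp
      moreover have "ennreal (exp (- \<alpha> * (c + t))) = ennreal (exp (- \<alpha> * c)) * ennreal (exp (- \<alpha> * t))"
        by (simp add: ennreal_mult'[symmetric] exp_add[symmetric] distrib_left)
      ultimately show ?thesis using killf_shift[OF p c(1), of "ennreal t" f] by (simp add: mult_ac)
    qed simp
  qed
  also have "\<dots> = ennreal (exp (- \<alpha> * c)) * potf D \<alpha> f (\<lambda>s. p (ennreal c + s))"
    unfolding potf_killf by (rule nn_integral_cmult) measurable
  also have "(\<integral>\<^sup>+t. ind {0..<c} t * ?k t \<partial>lborel) =
      (\<integral>\<^sup>+t. ind {0..<c} t * (ennreal (exp (- \<alpha> * t)) * ext0 f (p (ennreal t))) \<partial>lborel)"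
  proof (rule nn_integral_cong)
    fix t :: real
    have "ennreal t < exit_path D p" if "0 \<le> t" "t < c"
      by (rule le_less_trans[OF _ c(1)]) (use that in \<open>simp add: ennreal_leI\<close>)
    then show "ind {0..<c} t * ?k t = ind {0..<c} t * (ennreal (exp (- \<alpha> * t)) * ext0 f (p (ennreal t)))"
      using p by (auto simp: indicator_def killf_rc)
  qed
  finally show ?thesis .
qed

lemma potf_start:
  fixes p :: "ennreal \<Rightarrow> 'a option"
  assumes "rc_path p" "p 0 \<notin> Some ` D"
  shows "potf D \<alpha> f p = 0"
  using exit_path_start[OF assms] by (simp add: potf_def)

end

context hunt_proc begin

definition Rop :: "'a set \<Rightarrow> real \<Rightarrow> ('a \<Rightarrow> ennreal) \<Rightarrow> 'a \<Rightarrow> ennreal" where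
  "Rop D \<alpha> f = expath (potf D \<alpha> f)"

abbreviation Uop :: "'a set \<Rightarrow> ('a \<Rightarrow> ennreal) \<Rightarrow> 'a \<Rightarrow> ennreal" where
  "Uop D \<equiv> Rop D 0"

definition Hop :: "'a set \<Rightarrow> ('a \<Rightarrow> ennreal) \<Rightarrow> 'a \<Rightarrow> ennreal" where
  "Hop D g = expath (exf D g)"

definition Pop :: "'a set \<Rightarrow> ennreal \<Rightarrow> ('a \<Rightarrow> ennreal) \<Rightarrow> 'a \<Rightarrow> ennreal" where
  "Pop D t f = expath (killf D t f)"

lemma measurable_Rop [measurable]: "f \<in> bfun \<Longrightarrow> Rop D \<alpha> f \<in> bfun"
  unfolding Rop_def by (rule measurable_expct_path) measurable

lemma measurable_Hop [measurable]: "f \<in> bfun \<Longrightarrow> Hop D f \<in> bfun"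
  unfolding Hop_def by (rule measurable_expct_path) measurable

lemma measurable_Pop [measurable]: "f \<in> bfun \<Longrightarrow> Pop D t f \<in> bfun"
  unfolding Pop_def by (rule measurable_expct_path) measurable

lemma measurable_path_fun_law:
  "\<Psi> \<in> borel_measurable path_space \<Longrightarrow> (\<lambda>w. \<Psi> (pth w)) \<in> borel_measurable (law X x)"
  by (rule measurable_compose[OF measurable_pth_law])

lemma measurable_exitt: "(\<lambda>w. exitt D w) \<in> borel_measurable (law X x)"
  by (rule optional_measurable_law[OF optional_exit_path])

lemma Hop_path: "Hop D g x = (\<integral>\<^sup>+w. ext0 g (path X (exitt D w) w) \<partial>law X x)"
  unfolding Hop_def by (rule nn_integral_cong) (simp add: exf_rc rc_pth)

lemma Pop_path: "Pop D t f x = (\<integral>\<^sup>+w. (if t < exitt D w then ext0 f (path X t w) else 0) \<partial>law X x)"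
  unfolding Pop_def by (rule nn_integral_cong) (simp add: killf_rc rc_pth)

lemma Rop_path: "Rop D \<alpha> f x = (\<integral>\<^sup>+w. (\<integral>\<^sup>+t. ind {0..} t * (if ennreal t < exitt D w
     then ennreal (exp (- \<alpha> * t)) * ext0 f (path X (ennreal t) w) else 0) \<partial>lborel) \<partial>law X x)"
  unfolding Rop_def potf_def by (intro nn_integral_cong) (simp add: eval_at_rc rc_pth cong: if_cong)

lemma measurable_path_pair: "(\<lambda>x. path X s (fst x)) \<in> law X y \<Otimes>\<^sub>M N \<rightarrow>\<^sub>M cem_borel"
  by (rule measurable_compose[OF measurable_fst measurable_path_law])

lemma measurable_killf_law_pair:
  assumes f: "f \<in> bfun"
  shows "(\<lambda>x. killf D (ennreal (snd x)) f (pth (fst x))) \<in> borel_measurable (law X y \<Otimes>\<^sub>M borel)"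
  by (rule measurable_killf_joint[OF f measurable_path_pair]) simp

lemma Rop_Pop:
  assumes f: "f \<in> bfun"
  shows "Rop D \<alpha> f x = (\<integral>\<^sup>+t. ind {0..} t * (ennreal (exp (- \<alpha> * t)) * Pop D (ennreal t) f x) \<partial>lborel)"
proof -
  interpret L: prob_space "law X x" by (rule prob_space_law)
  interpret P: pair_sigma_finite "law X x" lborel
    by (simp add: pair_sigma_finite_def L.sigma_finite_measure_axioms sigma_finite_lborel)
  note [measurable] = measurable_killf_law_pair[OF f] measurable_path_fun_law[OF measurable_killf[OF f]]
  have "Rop D \<alpha> f x = (\<integral>\<^sup>+w. \<integral>\<^sup>+t. ind {0..} t * (ennreal (exp (- \<alpha> * t)) * killf D (ennreal t) f (pth w)) \<partial>lborel \<partial>law X x)"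
    unfolding Rop_def potf_killf ..
  also have "\<dots> = (\<integral>\<^sup>+t. \<integral>\<^sup>+w. ind {0..} t * (ennreal (exp (- \<alpha> * t)) * killf D (ennreal t) f (pth w)) \<partial>law X x \<partial>lborel)"
    by (rule P.Fubini'[symmetric]) (simp add: case_prod_beta')
  also have "\<dots> = (\<integral>\<^sup>+t. ind {0..} t * (ennreal (exp (- \<alpha> * t)) * Pop D (ennreal t) f x) \<partial>lborel)"
    unfolding Pop_def by (intro nn_integral_cong) (simp add: nn_integral_cmult)
  finally show ?thesis .
qed

text \<open>Dynkin's formula, from the strong Markov property at the exit from \<open>W\<close>. If
  the path leaves \<open>W\<close> to a point outside \<open>D\<close>, both exit times agree and no
  potential remains.\<close>

lemma Uop_split:
  assumes D: "open D" and W: "open W" "W \<subseteq> D" and f: "f \<in> bfun"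
  shows "Uop D f x = Uop W f x + Hop W (Uop D f) x"
proof -
  let ?T = "\<lambda>w. exitt W w"
  note mf = measurable_path_fun_law[OF measurable_potf[OF f]]
  have shift [measurable]: "(\<lambda>w. potf D 0 f (\<lambda>s. path X (?T w + s) w)) \<in> borel_measurable (law X x)"
    by (rule measurable_compose[OF measurable_shift_law[OF optional_exit_path] measurable_potf[OF f]])
  have [measurable]: "(\<lambda>w. ind (range Some) (path X (?T w) w) :: ennreal) \<in> borel_measurable (law X x)"
    by (rule indicator_Some_measurable[OF optional_exit_path])
  have "AE w in law X x. potf D 0 f (pth w) = potf W 0 f (pth w) +
      ind (range Some) (path X (?T w) w) * potf D 0 f (\<lambda>s. path X (?T w + s) w)"
    using AE_exit_less_iff[OF D W(2)] AE_space
  proof eventually_elim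
    fix w assume 1: "exitt W w \<le> exitt D w \<and> (exitt W w < exitt D w \<longleftrightarrow> path X (exitt W w) w \<in> Some ` D)"
      and "w \<in> space (law X x)"
    then have rc: "rc_path (pth w)" by (simp add: rc_pth)
    show "potf D 0 f (pth w) = potf W 0 f (pth w) +
      ind (range Some) (path X (?T w) w) * potf D 0 f (\<lambda>s. path X (?T w + s) w)"
    proof (cases "path X (?T w) w \<in> Some ` D")
      case True
      then have less: "?T w < exitt D w" using 1 by simp
      define c where "c = enn2real (?T w)"
      have "?T w < \<infinity>" using less by (simp add: less_le_trans[OF _ top_greatest])
      then have c: "ennreal c = ?T w" "0 \<le> c" by (auto simp: c_def)
      have "potf W 0 f (pth w) = (\<integral>\<^sup>+t. ind {0..<c} t * (ennreal (exp (- 0 * t)) * ext0 f (path X (ennreal t) w)) \<partial>lborel)"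
        unfolding potf_killf
      proof (rule nn_integral_cong)
        fix t :: real
        have "ennreal t < exitt W w \<longleftrightarrow> t < c" if "0 \<le> t"
          unfolding c(1)[symmetric] using that c(2) by (simp add: ennreal_less_iff)
        then show "ind {0..} t * (ennreal (exp (- 0 * t)) * killf W (ennreal t) f (pth w)) =
          ind {0..<c} t * (ennreal (exp (- 0 * t)) * ext0 f (path X (ennreal t) w))"
          using rc by (auto simp: indicator_def killf_rc)
      qed
      moreover have "ind (range Some) (path X (?T w) w) = (1 :: ennreal)" using True by auto
      ultimately show ?thesis
        using potf_split[OF rc, of c D f 0] c less f by simp
    next
      case False
      then have eq: "exitt D w = ?T w" using 1 by (metis order_le_less)
      have "potf D 0 f (\<lambda>s. path X (?T w + s) w) = 0"
        by (rule potf_start[OF rc_path_shift[OF rc]]) (use False in simp)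
      moreover have "potf D 0 f (pth w) = potf W 0 f (pth w)" unfolding potf_def eq ..
      ultimately show ?thesis by simp
    qed
  qed
  then have "Uop D f x = (\<integral>\<^sup>+w. potf W 0 f (pth w) +
      ind (range Some) (path X (?T w) w) * potf D 0 f (\<lambda>s. path X (?T w + s) w) \<partial>law X x)"
    unfolding Rop_def by (rule nn_integral_cong_AE)
  also have "\<dots> = Uop W f x + (\<integral>\<^sup>+w. ind (range Some) (path X (?T w) w) * potf D 0 f (\<lambda>s. path X (?T w + s) w) \<partial>law X x)"
    unfolding Rop_def by (rule nn_integral_add) (use mf in measurable)
  also have "(\<integral>\<^sup>+w. ind (range Some) (path X (?T w) w) * potf D 0 f (\<lambda>s. path X (?T w + s) w) \<partial>law X x) =
      (\<integral>\<^sup>+w. ind (sample X) w * ind (range Some) (path X (?T w) w) * potf D 0 f (\<lambda>s. path X (?T w + s) w) \<partial>law X x)"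
    by (rule nn_integral_cong) simp
  also have "\<dots> = (\<integral>\<^sup>+w. ind (sample X) w * ext0 (expath (potf D 0 f)) (path X (?T w) w) \<partial>law X x)"
    by (rule markov_path[OF optional_exit_path past_space[OF optional_exit_path] measurable_potf[OF f]])
  also have "\<dots> = Hop W (Uop D f) x"
    unfolding Hop_path Rop_def by (rule nn_integral_cong) simp
  finally show ?thesis .
qed

lemma past_before_exit: "past (\<lambda>_. t) {w\<in>sample X. t < exitt D w}"
proof -
  have P: "past (\<lambda>w. exitt D w) (sample X)" by (rule past_space[OF optional_exit_path])
  have *: "{w\<in>sample X. t < exitt D w} \<in> sets (natural_filt X u)" if "t < u" for u
  proof -
    have "{w\<in>sample X. t < exitt D w} = space (natural_filt X u) - {w\<in>sample X. exitt D w \<le> t}" by auto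
    also have "\<dots> \<in> sets (natural_filt X u)" by (intro sets.compl_sets past_le[OF P that])
    finally show ?thesis .
  qed
  show ?thesis unfolding past_def
  proof (intro conjI allI)
    show "{w \<in> sample X. t < exitt D w} \<in> sets (natural_filt X \<infinity>)"
    proof (cases "t = \<infinity>")
      case True then show ?thesis by simp
    next
      case False then show ?thesis by (intro *) (simp add: less_top[symmetric])
    qed
    fix u show "{w \<in> {w \<in> sample X. t < exitt D w}. t < u} \<in> sets (natural_filt X u)"
      using *[of u] by (cases "t < u") auto
  qed
qed

lemma Pop_semigroup:
  assumes f: "f \<in> bfun"
  shows "Pop D (s + t) f x = Pop D s (Pop D t f) x"
proof -
  let ?A = "{w\<in>sample X. s < exitt D w}"
  have "Pop D (s + t) f x = (\<integral>\<^sup>+w. ind ?A w * ind (range Some) (path X s w) * killf D t f (\<lambda>u. path X (s + u) w) \<partial>law X x)"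
    unfolding Pop_def
  proof (rule nn_integral_cong)
    fix w assume "w \<in> space (law X x)"
    then have rc: "rc_path (pth w)" and w: "w \<in> sample X" by (simp_all add: rc_pth)
    show "killf D (s + t) f (pth w) = ind ?A w * ind (range Some) (path X s w) * killf D t f (\<lambda>u. path X (s + u) w)"
    proof (cases "s < exitt D w")
      case True
      then have "path X s w \<in> range Some" using before_exit_path[OF rc True] by auto
      then show ?thesis using killf_shift[OF rc True, of t f] True w by simp
    next
      case False
      then have "\<not> s + t < exitt D w" by (meson add_increasing2 le_less_trans less_le_not_le linorder_not_less order_refl zero_le)
      then show ?thesis using False by (simp add: killf_def)
    qed
  qed
  also have "\<dots> = (\<integral>\<^sup>+w. ind ?A w * ext0 (expath (killf D t f)) (path X s w) \<partial>law X x)"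
    by (rule markov_path[OF optional_const past_before_exit measurable_killf[OF f]])
  also have "\<dots> = Pop D s (Pop D t f) x"
    unfolding Pop_path[of D s "Pop D t f"] unfolding Pop_def by (rule nn_integral_cong) (auto simp: indicator_def)
  finally show ?thesis .
qed

text \<open>Shifting a path by \<open>t\<close> before it exits does not change its exit
  position.\<close>

lemma exit_markov:
  assumes g: "g \<in> bfun"
  shows "Pop W t (Hop W g) x = (\<integral>\<^sup>+w. (if t < exitt W w then ext0 g (path X (exitt W w) w) else 0) \<partial>law X x)"
proof -
  let ?A = "{w\<in>sample X. t < exitt W w}"
  have "(\<integral>\<^sup>+w. (if t < exitt W w then ext0 g (path X (exitt W w) w) else 0) \<partial>law X x) =
    (\<integral>\<^sup>+w. ind ?A w * ind (range Some) (path X t w) * exf W g (\<lambda>u. path X (t + u) w) \<partial>law X x)"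
  proof (rule nn_integral_cong)
    fix w assume "w \<in> space (law X x)"
    then have rc: "rc_path (pth w)" and w: "w \<in> sample X" by (simp_all add: rc_pth)
    show "(if t < exitt W w then ext0 g (path X (exitt W w) w) else 0) =
      ind ?A w * ind (range Some) (path X t w) * exf W g (\<lambda>u. path X (t + u) w)"
    proof (cases "t < exitt W w")
      case True
      then have "path X t w \<in> range Some" using before_exit_path[OF rc True] by auto
      then show ?thesis using exit_path_shift[OF rc True] True w exf_rc[OF rc_path_shift[OF rc], of W g t] by simp
    qed simp
  qed
  also have "\<dots> = (\<integral>\<^sup>+w. ind ?A w * ext0 (expath (exf W g)) (path X t w) \<partial>law X x)"
    by (rule markov_path[OF optional_const past_before_exit measurable_exf[OF g]])
  also have "\<dots> = Pop W t (Hop W g) x"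
    unfolding Pop_path Hop_def by (rule nn_integral_cong) (auto simp: indicator_def)
  finally show ?thesis ..
qed

end

lemma infsum_single_nonzero:
  fixes f :: "'b \<Rightarrow> 'c::{comm_monoid_add, t2_space}"
  assumes "\<And>x. x \<in> S \<Longrightarrow> x \<noteq> a \<Longrightarrow> f x = 0" "a \<in> S"
  shows "infsum f S = f a"
proof -
  have "infsum f S = infsum f {a}" by (rule infsum_cong_neutral) (use assms in auto)
  then show ?thesis by simp
qed

lemma nn_integral_exp_Icc:
  assumes "0 < c" "0 \<le> u"
  shows "ennreal c * (\<integral>\<^sup>+s. ind {0..u} s * ennreal (exp (- c * s)) \<partial>lborel) = ennreal (1 - exp (- c * u))"
proof -
  have "(\<integral>\<^sup>+s. ennreal (c * exp (- c * s)) * ind {0..u} s \<partial>lborel) = ennreal ((- exp (- c * u)) - (- exp (- c * 0)))"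
    by (rule nn_integral_FTC_Icc) (use assms in \<open>auto intro!: derivative_eq_intros\<close>)
  moreover have "(\<integral>\<^sup>+s. ennreal (c * exp (- c * s)) * ind {0..u} s \<partial>lborel) =
      ennreal c * (\<integral>\<^sup>+s. ind {0..u} s * ennreal (exp (- c * s)) \<partial>lborel)"
    using assms by (subst nn_integral_cmult[symmetric]) (auto intro!: nn_integral_cong simp: ennreal_mult mult_ac)
  ultimately show ?thesis by simp
qed

section \<open>Exit, transition and occupation measures of the killed process\<close>

context hunt_proc begin

text \<open>Linearity, monotone convergence and Fubini for the three operators become facts on
  integrals against such kernels. The densities discard the paths that are dead or have left, where
  \<open>the\<close> would be arbitrary.\<close>

definition hm :: "'a set \<Rightarrow> 'a \<Rightarrow> 'a measure" where
  "hm W x = distr (density (law X x) (\<lambda>w. ind (range Some) (path X (exitt W w) w)))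
     borel (\<lambda>w. the (path X (exitt W w) w))"

definition pm :: "'a set \<Rightarrow> ennreal \<Rightarrow> 'a \<Rightarrow> 'a measure" where
  "pm W t x = distr (density (law X x) (ind {w. t < exitt W w})) borel (\<lambda>w. the (path X t w))"

definition om :: "'a set \<Rightarrow> real \<Rightarrow> 'a \<Rightarrow> 'a measure" where
  "om W \<alpha> x = distr (density (law X x \<Otimes>\<^sub>M lborel)
       (\<lambda>z. ind {0..} (snd z) * (if ennreal (snd z) < exitt W (fst z) then ennreal (exp (- \<alpha> * snd z)) else 0)))
     borel (\<lambda>z. the (eval_at (ennreal (snd z)) (pth (fst z))))"

lemma sets_kernels [simp]: "sets (hm W x) = sets borel" "sets (pm W t x) = sets borel" "sets (om W \<alpha> x) = sets borel"
  by (simp_all add: hm_def pm_def om_def)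

lemma space_kernels [simp]: "space (hm W x) = UNIV" "space (pm W t x) = UNIV" "space (om W \<alpha> x) = UNIV"
  by (simp_all add: hm_def pm_def om_def)

lemma measurable_kernels [simp]: "measurable (hm W x) N = measurable borel N"
  "measurable (pm W t x) N = measurable borel N" "measurable (om W \<alpha> x) N = measurable borel N"
  by (auto intro!: measurable_cong_sets)

lemma measurable_the_exit: "(\<lambda>w. the (path X (exitt W w) w)) \<in> borel_measurable (law X x)"
  by (rule measurable_compose[OF measurable_path_time_law[OF optional_measurable[OF optional_exit_path]] measurable_the_cem])

lemma Hop_hm:
  assumes [measurable]: "f \<in> bfun"
  shows "Hop W f x = (\<integral>\<^sup>+y. f y \<partial>hm W x)"
proof -
  note [measurable] = measurable_the_exit[of W x] indicator_Some_measurable[OF optional_exit_path[of W], of x]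
  have "(\<integral>\<^sup>+y. f y \<partial>hm W x) = (\<integral>\<^sup>+w. ind (range Some) (path X (exitt W w) w) * f (the (path X (exitt W w) w)) \<partial>law X x)"
    unfolding hm_def by (subst nn_integral_distr) (auto simp: nn_integral_density)
  also have "\<dots> = Hop W f x"
    unfolding Hop_path by (intro nn_integral_cong) (auto simp: indicator_def ext0_def split: option.split)
  finally show ?thesis ..
qed

lemma Pop_pm:
  assumes [measurable]: "f \<in> bfun"
  shows "Pop W t f x = (\<integral>\<^sup>+y. f y \<partial>pm W t x)"
proof -
  have [measurable]: "(\<lambda>w. the (path X t w)) \<in> borel_measurable (law X x)"
    by (rule measurable_compose[OF measurable_path_law measurable_the_cem])
  note [measurable] = measurable_exitt[of W x]
  have ind [measurable]: "(ind {w. t < exitt W w}) \<in> borel_measurable (law X x)"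
    by (subst measurable_cong[where g = "\<lambda>w. if t < exitt W w then 1 else 0"]) (auto simp: indicator_def)
  have "(\<integral>\<^sup>+y. f y \<partial>pm W t x) = (\<integral>\<^sup>+w. ind {w. t < exitt W w} w * f (the (path X t w)) \<partial>law X x)"
    unfolding pm_def by (subst nn_integral_distr) (auto simp: nn_integral_density)
  also have "\<dots> = Pop W t f x"
    unfolding Pop_path
  proof (rule nn_integral_cong)
    fix w assume "w \<in> space (law X x)"
    then have "rc_path (pth w)" by (simp add: rc_pth)
    from before_exit_path[OF this, of t W]
    show "ind {w. t < exitt W w} w * f (the (path X t w)) = (if t < exitt W w then ext0 f (path X t w) else 0)"
      by (auto simp: indicator_def)
  qed
  finally show ?thesis ..
qed

lemma Rop_om:
  assumes [measurable]: "f \<in> bfun"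
  shows "Rop W \<alpha> f x = (\<integral>\<^sup>+y. f y \<partial>om W \<alpha> x)"
proof -
  interpret L: prob_space "law X x" by (rule prob_space_law)
  interpret P: pair_sigma_finite "law X x" lborel
    by (simp add: pair_sigma_finite_def L.sigma_finite_measure_axioms sigma_finite_lborel)
  have [measurable]: "(\<lambda>z. eval_at (ennreal (snd z)) (pth (fst z))) \<in> law X x \<Otimes>\<^sub>M borel \<rightarrow>\<^sub>M cem_borel"
    by (rule measurable_eval_at[OF _ measurable_path_pair]) simp
  have [measurable]: "(\<lambda>z. the (eval_at (ennreal (snd z)) (pth (fst z)))) \<in> borel_measurable (law X x \<Otimes>\<^sub>M borel)"
    by (rule measurable_compose[OF _ measurable_the_cem]) measurable
  have [measurable]: "(\<lambda>z. exitt W (fst z)) \<in> borel_measurable (law X x \<Otimes>\<^sub>M borel)"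
    by (rule measurable_compose[OF measurable_fst measurable_exitt])
  let ?h = "\<lambda>z. ind {0..} (snd z) * (if ennreal (snd z) < exitt W (fst z) then ennreal (exp (- \<alpha> * snd z)) else 0)"
  have [measurable]: "?h \<in> borel_measurable (law X x \<Otimes>\<^sub>M borel)" by measurable
  have "(\<integral>\<^sup>+y. f y \<partial>om W \<alpha> x) = (\<integral>\<^sup>+z. ?h z * f (the (eval_at (ennreal (snd z)) (pth (fst z)))) \<partial>(law X x \<Otimes>\<^sub>M lborel))"
    unfolding om_def by (subst nn_integral_distr) (auto simp: nn_integral_density)
  also have "\<dots> = (\<integral>\<^sup>+w. \<integral>\<^sup>+t. ?h (w, t) * f (the (eval_at (ennreal t) (pth w))) \<partial>lborel \<partial>law X x)"
    using lborel.nn_integral_fst[of "\<lambda>z. ?h z * f (the (eval_at (ennreal (snd z)) (pth (fst z))))" "law X x"] by simp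
  also have "\<dots> = Rop W \<alpha> f x"
    unfolding Rop_path
  proof (intro nn_integral_cong)
    fix w t assume "w \<in> space (law X x)"
    then have rc: "rc_path (pth w)" by (simp add: rc_pth)
    from before_exit_path[OF this, of "ennreal t" W]
    show "?h (w, t) * f (the (eval_at (ennreal t) (pth w))) = ind {0..} t *
      (if ennreal t < exitt W w then ennreal (exp (- \<alpha> * t)) * ext0 f (path X (ennreal t) w) else 0)"
      by (auto simp: indicator_def eval_at_rc[OF rc])
  qed
  finally show ?thesis ..
qed

lemma Hop_mono: "(\<And>y. f y \<le> g y) \<Longrightarrow> Hop W f x \<le> Hop W g x"
  unfolding Hop_path by (intro nn_integral_mono ext0_mono)

lemma emeasure_hm: "emeasure (hm W x) UNIV \<le> 1"
proof -
  have "emeasure (hm W x) UNIV = Hop W (\<lambda>_. 1) x" by (subst Hop_hm) auto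
  also have "\<dots> \<le> (\<integral>\<^sup>+w. 1 \<partial>law X x)" unfolding Hop_path by (intro nn_integral_mono) (auto simp: ext0_def split: option.split)
  finally show ?thesis by simp
qed

lemma emeasure_pm: "emeasure (pm W t x) UNIV \<le> 1"
proof -
  have "emeasure (pm W t x) UNIV = Pop W t (\<lambda>_. 1) x" by (subst Pop_pm) auto
  also have "\<dots> \<le> (\<integral>\<^sup>+w. 1 \<partial>law X x)" unfolding Pop_path by (intro nn_integral_mono) (auto simp: ext0_def split: option.split)
  finally show ?thesis by simp
qed

lemma finite_hm: "finite_measure (hm W x)" and finite_pm: "finite_measure (pm W t x)"
  using emeasure_hm[of W x] emeasure_pm[of W t x] by (auto intro!: finite_measureI simp: top_unique)

lemma Pop_cong:
  assumes "\<And>y. y \<in> W \<Longrightarrow> f y = g y"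
  shows "Pop W t f x = Pop W t g x"
  unfolding Pop_path
proof (rule nn_integral_cong)
  fix w assume "w \<in> space (law X x)"
  then have "rc_path (pth w)" by (simp add: rc_pth)
  from before_exit_path[OF this, of t W] assms
  show "(if t < exitt W w then ext0 f (path X t w) else 0) = (if t < exitt W w then ext0 g (path X t w) else 0)" by auto
qed

lemma Rop_cong:
  assumes "\<And>y. y \<in> W \<Longrightarrow> f y = g y"
  shows "Rop W \<alpha> f x = Rop W \<alpha> g x"
  unfolding Rop_path
proof (intro nn_integral_cong)
  fix w t assume "w \<in> space (law X x)"
  then have "rc_path (pth w)" by (simp add: rc_pth)
  from before_exit_path[OF this, of "ennreal t" W] assms
  show "ind {0..} t * (if ennreal t < exitt W w then ennreal (exp (- \<alpha> * t)) * ext0 f (path X (ennreal t) w) else 0) =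
    ind {0..} t * (if ennreal t < exitt W w then ennreal (exp (- \<alpha> * t)) * ext0 g (path X (ennreal t) w) else 0)" by auto
qed

lemma Rop_mono_on:
  assumes "\<And>y. y \<in> W \<Longrightarrow> f y \<le> g y"
  shows "Rop W \<alpha> f x \<le> Rop W \<alpha> g x"
  unfolding Rop_path
proof (intro nn_integral_mono)
  fix w t assume "w \<in> space (law X x)"
  then have "rc_path (pth w)" by (simp add: rc_pth)
  from before_exit_path[OF this, of "ennreal t" W] assms
  show "ind {0..} t * (if ennreal t < exitt W w then ennreal (exp (- \<alpha> * t)) * ext0 f (path X (ennreal t) w) else 0) \<le>
    ind {0..} t * (if ennreal t < exitt W w then ennreal (exp (- \<alpha> * t)) * ext0 g (path X (ennreal t) w) else 0)"
    by (auto intro!: mult_left_mono)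
qed

lemma Hop_outside_cong:
  assumes W: "open W" and "\<And>y. y \<notin> W \<Longrightarrow> f y = g y"
  shows "Hop W f x = Hop W g x"
  unfolding Hop_path
proof (rule nn_integral_cong_AE)
  show "AE w in law X x. ext0 f (path X (exitt W w) w) = ext0 g (path X (exitt W w) w)"
    using AE_exit_outside[OF W, of x]
  proof eventually_elim
    fix w assume "path X (exitt W w) w \<notin> Some ` W"
    then show "ext0 f (path X (exitt W w) w) = ext0 g (path X (exitt W w) w)"
      using assms(2) by (cases "path X (exitt W w) w") auto
  qed
qed

lemma Pop_outside:
  assumes "x \<notin> W" shows "Pop W t f x = 0"
proof -
  have "Pop W t f x = (\<integral>\<^sup>+w. 0 \<partial>law X x)"
    unfolding Pop_path
  proof (rule nn_integral_cong_AE)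
    show "AE w in law X x. (if t < exitt W w then ext0 f (path X t w) else 0) = 0"
      using AE_start[of x] AE_space
    proof eventually_elim
      fix w assume "path X 0 w = Some x" "w \<in> space (law X x)"
      then have "exitt W w = 0" using exit_path_start[OF rc_pth, of w W] assms by auto
      then show "(if t < exitt W w then ext0 f (path X t w) else 0) = 0" by simp
    qed
  qed
  then show ?thesis by simp
qed

lemma Rop_outside: "x \<notin> W \<Longrightarrow> f \<in> bfun \<Longrightarrow> Rop W \<alpha> f x = 0"
  by (simp add: Rop_Pop Pop_outside)

text \<open>A path starting in an open set spends a time interval of positive length there.\<close>

lemma Uop_positive:
  assumes W: "open W" "x \<in> W" and f: "f \<in> bfun" "\<And>y. y \<in> W \<Longrightarrow> 0 < f y"
  shows "0 < Uop W f x"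
proof (rule ccontr)
  assume "\<not> 0 < Uop W f x"
  then have "Uop W f x = 0" by (simp add: not_gr_zero)
  then have "(\<integral>\<^sup>+w. potf W 0 f (pth w) \<partial>law X x) = 0" by (simp add: Rop_def)
  then have "AE w in law X x. potf W 0 f (pth w) = 0"
    by (subst (asm) nn_integral_0_iff_AE) (simp_all add: measurable_path_fun_law[OF measurable_potf[OF f(1)]])
  then have "AE w in law X x. False"
    using AE_start[of x] AE_space
  proof eventually_elim
    fix w assume 0: "potf W 0 f (pth w) = 0" and st: "path X 0 w = Some x" and w: "w \<in> space (law X x)"
    have rc: "rc_path (pth w)" using w by (simp add: rc_pth)
    have pos: "0 < exitt W w" by (rule exit_path_pos[OF rc W(1)]) (use st W in auto)
    then obtain r where r: "r \<in> rat_times" "0 < r" "r < exitt W w" using rat_times_dense by blast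
    define c where "c = enn2real r"
    have "r < \<infinity>" using r by (simp add: less_le_trans[OF _ top_greatest])
    then have c: "ennreal c = r" "0 < c" using r by (auto simp: c_def enn2real_positive_iff less_top)
    note [measurable] = measurable_killf_time[OF f(1)]
    have "AE t in lborel. ind {0..} t * (ennreal (exp (- 0 * t)) * killf W (ennreal t) f (pth w)) = 0"
      using 0 unfolding potf_killf by (subst (asm) nn_integral_0_iff_AE) auto
    then have "AE t in lborel. t \<notin> {0<..<c}"
    proof eventually_elim
      fix t :: real assume z: "ind {0..} t * (ennreal (exp (- 0 * t)) * killf W (ennreal t) f (pth w)) = 0"
      show "t \<notin> {0<..<c}"
      proof
        assume t: "t \<in> {0<..<c}"
        then have "ennreal t < ennreal c" by (auto simp: ennreal_less_iff)
        then have less: "ennreal t < exitt W w" using c r by simp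
        from before_exit_path[OF rc this] obtain y where "path X (ennreal t) w = Some y" "y \<in> W" by auto
        then have "0 < killf W (ennreal t) f (pth w)" using less f(2) by (simp add: killf_rc[OF rc])
        with z t show False by (auto simp: indicator_def)
      qed
    qed
    then have "emeasure lborel {0<..<c} = 0" by (subst (asm) AE_iff_measurable[of "{0<..<c}"]) auto
    then show False using c by simp
  qed
  then show False using prob_space.AE_False[OF prob_space_law] by blast
qed

subsection \<open>The resolvent\<close>

lemma measurable_Pop_pair:
  assumes f: "f \<in> bfun"
  shows "(\<lambda>z. Pop D (ennreal (fst z)) f (snd z)) \<in> borel_measurable (borel \<Otimes>\<^sub>M borel)"
  unfolding Pop_def
proof (rule nn_integral_measurable_subprob_algebra2[where N = "natural_filt X \<infinity>"])
  have "(\<lambda>x. killf D (ennreal (fst (fst x))) f (pth (snd x))) \<in> borel_measurable ((borel \<Otimes>\<^sub>M borel) \<Otimes>\<^sub>M natural_filt X \<infinity>)"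
    by (rule measurable_killf_joint[OF f]) (auto intro: measurable_compose[OF measurable_snd measurable_path])
  then show "(\<lambda>(x, w). killf D (ennreal (fst x)) f (pth w)) \<in> borel_measurable ((borel \<Otimes>\<^sub>M borel) \<Otimes>\<^sub>M natural_filt X \<infinity>)"
    by (simp add: case_prod_beta')
  show "(\<lambda>z. law X (snd z)) \<in> borel \<Otimes>\<^sub>M borel \<rightarrow>\<^sub>M subprob_algebra (natural_filt X \<infinity>)"
    by (rule measurable_compose[OF measurable_snd law_subprob])
qed

lemma measurable_Pop_time:
  assumes f: "f \<in> bfun"
  shows "(\<lambda>t. Pop D (ennreal t) f x) \<in> bfun"
  using measurable_compose[OF _ measurable_Pop_pair[OF f], of "\<lambda>t. (t, x)" borel D] by simp

lemma Pop_Rop: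
  assumes f: "f \<in> bfun"
  shows "Pop D s (Rop D \<alpha> f) x = (\<integral>\<^sup>+t. ind {0..} t * (ennreal (exp (- \<alpha> * t)) * Pop D (s + ennreal t) f x) \<partial>lborel)"
proof -
  interpret L: finite_measure "pm D s x" by (rule finite_pm)
  interpret P: pair_sigma_finite "pm D s x" lborel
    by (simp add: pair_sigma_finite_def L.sigma_finite_measure_axioms sigma_finite_lborel)
  have [measurable]: "(\<lambda>z. Pop D (ennreal (snd z)) f (fst z)) \<in> borel_measurable (pm D s x \<Otimes>\<^sub>M borel)"
    using measurable_compose[OF measurable_pair_swap' measurable_Pop_pair[OF f]]
    by (simp add: case_prod_beta' measurable_cong_sets[OF sets_pair_measure_cong[OF sets_kernels(2) refl] refl])
  have "Pop D s (Rop D \<alpha> f) x = (\<integral>\<^sup>+y. \<integral>\<^sup>+t. ind {0..} t * (ennreal (exp (- \<alpha> * t)) * Pop D (ennreal t) f y) \<partial>lborel \<partial>pm D s x)"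
    unfolding Pop_pm[OF measurable_Rop[OF f]] Rop_Pop[OF f] ..
  also have "\<dots> = (\<integral>\<^sup>+t. \<integral>\<^sup>+y. ind {0..} t * (ennreal (exp (- \<alpha> * t)) * Pop D (ennreal t) f y) \<partial>pm D s x \<partial>lborel)"
    by (rule P.Fubini'[symmetric]) (simp add: case_prod_beta')
  also have "\<dots> = (\<integral>\<^sup>+t. ind {0..} t * (ennreal (exp (- \<alpha> * t)) * Pop D (s + ennreal t) f x) \<partial>lborel)"
    unfolding Pop_semigroup[OF f] Pop_pm[OF measurable_Pop[OF f]]
    by (intro nn_integral_cong, unfold mult.assoc[symmetric], rule nn_integral_cmult) (simp add: measurable_Pop[OF f])
  finally show ?thesis .
qed

lemma resolvent_equation:
  assumes f: "f \<in> bfun" and ab: "0 \<le> \<alpha>" "\<alpha> < \<beta>"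
  shows "Rop D \<alpha> f x = Rop D \<beta> f x + ennreal (\<beta> - \<alpha>) * Rop D \<beta> (Rop D \<alpha> f) x"
proof -
  define F where "F t = Pop D (ennreal t) f x" for t
  have [measurable]: "F \<in> bfun" unfolding F_def by (rule measurable_Pop_time[OF f])
  define c where "c = \<beta> - \<alpha>"
  have c: "0 < c" using ab by (simp add: c_def)
  define E where "E c t = ennreal (exp (- c * t))" for c t :: real
  have [measurable]: "E c \<in> bfun" for c unfolding E_def by measurable
  have E_add: "E c (s + t) = E c s * E c t" for c s t
    by (simp add: E_def ennreal_mult[symmetric] exp_add[symmetric] algebra_simps)
  have E_beta: "E \<beta> s = E c s * E \<alpha> s" for s
    by (simp add: E_def c_def ennreal_mult[symmetric] exp_add[symmetric] algebra_simps)
  define H where "H u = E \<alpha> u * F u" for u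
  have [measurable]: "H \<in> bfun" unfolding H_def by measurable
  let ?k = "\<lambda>s u. ind {0..} s * E c s * (ind {s..} u * H u)"
  let ?I = "\<lambda>u. \<integral>\<^sup>+s. ind {0..u} s * E c s \<partial>lborel"
  have "Rop D \<beta> (Rop D \<alpha> f) x = (\<integral>\<^sup>+s. ind {0..} s * (E \<beta> s * (\<integral>\<^sup>+t. ind {0..} t * (E \<alpha> t * Pop D (ennreal s + ennreal t) f x) \<partial>lborel)) \<partial>lborel)"
    unfolding Rop_Pop[OF measurable_Rop[OF f], of D \<beta>] Pop_Rop[OF f] E_def ..
  also have "\<dots> = (\<integral>\<^sup>+s. \<integral>\<^sup>+u. ?k s u \<partial>lborel \<partial>lborel)"
  proof (rule nn_integral_cong)
    fix s :: real
    show "ind {0..} s * (E \<beta> s * (\<integral>\<^sup>+t. ind {0..} t * (E \<alpha> t * Pop D (ennreal s + ennreal t) f x) \<partial>lborel)) = (\<integral>\<^sup>+u. ?k s u \<partial>lborel)"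
    proof (cases "0 \<le> s")
      case True
      have "E \<beta> s * (\<integral>\<^sup>+t. ind {0..} t * (E \<alpha> t * Pop D (ennreal s + ennreal t) f x) \<partial>lborel) =
        E c s * (E \<alpha> s * (\<integral>\<^sup>+t. ind {0..} t * (E \<alpha> t * F (s + t)) \<partial>lborel))"
      proof -
        have "(\<integral>\<^sup>+t. ind {0..} t * (E \<alpha> t * Pop D (ennreal s + ennreal t) f x) \<partial>lborel) = (\<integral>\<^sup>+t. ind {0..} t * (E \<alpha> t * F (s + t)) \<partial>lborel)"
          using True by (intro nn_integral_cong) (auto simp: F_def indicator_def)
        then show ?thesis by (simp add: E_beta mult.assoc)
      qed
      also have "E \<alpha> s * (\<integral>\<^sup>+t. ind {0..} t * (E \<alpha> t * F (s + t)) \<partial>lborel) = (\<integral>\<^sup>+t. ind {0..} t * H (s + t) \<partial>lborel)"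
        by (subst nn_integral_cmult[symmetric]) (auto simp: H_def E_add mult_ac intro!: nn_integral_cong)
      also have "\<dots> = (\<integral>\<^sup>+u. ind {s..} u * H u \<partial>lborel)" by (rule nn_integral_shift_ge[symmetric]) measurable
      finally show ?thesis using True by (simp add: nn_integral_cmult)
    qed simp
  qed
  also have "\<dots> = (\<integral>\<^sup>+u. \<integral>\<^sup>+s. ?k s u \<partial>lborel \<partial>lborel)"
  proof (rule lborel_pair.Fubini')
    have "(\<lambda>(u, s). ?k s u) = (\<lambda>z. ind {0..} (snd z) * E c (snd z) * ((if snd z \<le> fst z then 1 else 0) * H (fst z)))"
      by (auto simp: indicator_def fun_eq_iff)
    also have "\<dots> \<in> borel_measurable (lborel \<Otimes>\<^sub>M lborel)" by measurable
    finally show "(\<lambda>(u, s). ?k s u) \<in> borel_measurable (lborel \<Otimes>\<^sub>M lborel)" .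
  qed
  also have "\<dots> = (\<integral>\<^sup>+u. ind {0..} u * H u * ?I u \<partial>lborel)"
    by (subst nn_integral_cmult[symmetric]) (auto simp: indicator_def mult_ac intro!: nn_integral_cong)
  finally have RR: "Rop D \<beta> (Rop D \<alpha> f) x = \<dots>" .
  have I: "ennreal c * ?I u + E c u = 1" if "0 \<le> u" for u
    unfolding E_def nn_integral_exp_Icc[OF c that] using that c by (subst ennreal_plus[symmetric]) auto
  have "(\<lambda>u. \<integral>\<^sup>+s. (if 0 \<le> s \<and> s \<le> u then 1 else 0) * E c s \<partial>lborel) \<in> bfun" by measurable
  then have [measurable]: "?I \<in> bfun"
    by (rule measurable_cong[THEN iffD1, rotated]) (auto intro!: nn_integral_cong simp: indicator_def)
  have "Rop D \<alpha> f x = (\<integral>\<^sup>+u. ind {0..} u * (E \<beta> u * F u) + ennreal c * (ind {0..} u * H u * ?I u) \<partial>lborel)"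
    unfolding Rop_Pop[OF f] F_def[symmetric] E_def[of \<alpha>, symmetric]
  proof (rule nn_integral_cong)
    fix u :: real
    show "ind {0..} u * (E \<alpha> u * F u) = ind {0..} u * (E \<beta> u * F u) + ennreal c * (ind {0..} u * H u * ?I u)"
    proof (cases "0 \<le> u")
      case True
      have "E \<beta> u * F u = E c u * H u" by (simp add: E_beta H_def mult.assoc)
      moreover have "E \<alpha> u * F u = E c u * H u + ennreal c * (H u * ?I u)"
        unfolding H_def[symmetric] using arg_cong[OF I[OF True], of "\<lambda>a. H u * a"]
        by (simp add: distrib_left mult_ac add.commute)
      ultimately show ?thesis using True by simp
    qed simp
  qed
  also have "\<dots> = Rop D \<beta> f x + ennreal c * Rop D \<beta> (Rop D \<alpha> f) x"
    unfolding RR Rop_Pop[OF f, of D \<beta>] F_def[symmetric] E_def[of \<beta>, symmetric] by (simp add: nn_integral_add nn_integral_cmult)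
  finally show ?thesis unfolding c_def .
qed

end

section \<open>Exhaustion of an open set by relatively compact open sets\<close>

context hunt_proc begin

lemma AE_exit_cells:
  assumes D: "open D"
  shows "AE w in law X x. (SUP k. exitt (icell D k) w) = exitt D w"
proof -
  have "AE w in law X x. \<forall>k. path X (exitt (icell D k) w) w \<notin> Some ` icell D k"
    unfolding AE_all_countable by (intro allI AE_exit_outside open_interior)
  then show ?thesis using AE_space
  proof eventually_elim
    fix w assume 1: "\<forall>k. path X (exitt (icell D k) w) w \<notin> Some ` icell D k"
      and "w \<in> space (law X x)"
    then have rc: "rc_path (pth w)" by (simp add: rc_pth)
    show "(SUP k. exitt (icell D k) w) = exitt D w"
    proof (rule antisym)
      show "(SUP k. exitt (icell D k) w) \<le> exitt D w"
        by (intro SUP_least exit_path_mono order_trans[OF interior_subset cell_subset])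
      show "exitt D w \<le> (SUP k. exitt (icell D k) w)"
        unfolding exit_path_def[of D]
      proof (rule SUP_mono)
        fix k
        have "path X (exitt (icell D (Suc k)) w) w \<notin> Some ` cell D k"
          using 1[rule_format, of "Suc k"] cell_subset_interior[of D k] by blast
        then have "exit_rat (cell D k) (pth w) \<le> exitt (icell D (Suc k)) w"
          by (rule exit_rat_le[OF rc compact_cell])
        then show "\<exists>n\<in>UNIV. exit_rat (cell D k) (pth w) \<le> exitt (icell D n) w" by blast
      qed
    qed
  qed
qed

lemma interior_cell_mono: "k \<le> n \<Longrightarrow> icell D k \<subseteq> icell D n"
  by (intro interior_mono incseqD[OF cell_incseq])

lemma Pop_exhaust:
  assumes D: "open D" and f: "f \<in> bfun"
  shows "Pop D t f x = (SUP k. Pop (icell D k) t f x)"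
proof -
  let ?g = "\<lambda>k w. if t < exitt (icell D k) w then ext0 f (path X t w) else 0"
  have mono: "exitt (icell D k) w \<le> exitt (icell D n) w" if "k \<le> n" for k n w
    by (intro exit_path_mono interior_cell_mono that)
  have "Pop D t f x = (\<integral>\<^sup>+w. (SUP k. ?g k w) \<partial>law X x)"
    unfolding Pop_path
  proof (rule nn_integral_cong_AE)
    show "AE w in law X x. (if t < exitt D w then ext0 f (path X t w) else 0) = (SUP k. ?g k w)"
      using AE_exit_cells[OF D, of x]
    proof eventually_elim
      fix w assume S: "(SUP k. exitt (icell D k) w) = exitt D w"
      show "(if t < exitt D w then ext0 f (path X t w) else 0) = (SUP k. ?g k w)"
      proof (cases "t < exitt D w")
        case True
        then obtain k0 where k0: "t < exitt (icell D k0) w"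
          unfolding S[symmetric] by (auto simp: less_SUP_iff)
        show ?thesis
        proof (rule antisym)
          show "(if t < exitt D w then ext0 f (path X t w) else 0) \<le> (SUP k. ?g k w)"
            by (rule SUP_upper2[of k0]) (use True k0 in auto)
          show "(SUP k. ?g k w) \<le> (if t < exitt D w then ext0 f (path X t w) else 0)"
            using True by (intro SUP_least) auto
        qed
      next
        case False
        have "?g k w = 0" for k
        proof -
          have "exitt (icell D k) w \<le> exitt D w" unfolding S[symmetric] by (rule SUP_upper) simp
          then show ?thesis using False by auto
        qed
        then show ?thesis using False by simp
      qed
    qed
  qed
  also have "\<dots> = (SUP k. Pop (icell D k) t f x)"
    unfolding Pop_path
  proof (rule nn_integral_monotone_convergence_SUP)
    show "incseq ?g"
    proof (rule incseq_SucI, rule le_funI)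
      fix k w
      show "?g k w \<le> ?g (Suc k) w" using mono[of k "Suc k" w] by auto
    qed
    fix k
    have "(\<lambda>w. killf (icell D k) t f (pth w)) \<in> borel_measurable (law X x)"
      by (rule measurable_path_fun_law[OF measurable_killf[OF f]])
    then show "?g k \<in> borel_measurable (law X x)"
      by (rule measurable_cong[THEN iffD1, rotated]) (simp add: killf_rc rc_pth)
  qed
  finally show ?thesis .
qed

subsection \<open>The definitions of the statement in terms of the operators\<close>

text \<open>Fatou's lemma: paths that leave \<open>W\<close> while still in \<open>D\<close> leave
  \<open>W\<close> and \<open>W \<inter> icell D k\<close> at the same time for large
  \<open>k\<close>, and on the other paths the exit value of \<open>g\<close> is 0.\<close>

lemma Hop_exhaust_liminf:
  assumes D: "open D" and W: "open W" "W \<subseteq> D" and g: "g \<in> bfun" "\<And>v. v \<notin> D \<Longrightarrow> g v = 0"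
  shows "Hop W g x \<le> liminf (\<lambda>k. Hop (W \<inter> icell D k) g x)"
proof -
  let ?W = "\<lambda>k. W \<inter> icell D k"
  have "Hop W g x \<le> (\<integral>\<^sup>+w. liminf (\<lambda>k. ext0 g (path X (exitt (?W k) w) w)) \<partial>law X x)"
    unfolding Hop_path
  proof (rule nn_integral_mono_AE)
    show "AE w in law X x. ext0 g (path X (exitt W w) w) \<le> liminf (\<lambda>k. ext0 g (path X (exitt (?W k) w) w))"
      using AE_exit_exhaust[OF D W] AE_exit_less_iff[OF D W(2)]
    proof eventually_elim
      fix w assume 1: "exitt W w < exitt D w \<longrightarrow> (\<forall>\<^sub>F k in sequentially. exitt (?W k) w = exitt W w)"
        and 2: "exitt W w \<le> exitt D w \<and> (exitt W w < exitt D w \<longleftrightarrow> path X (exitt W w) w \<in> Some ` D)"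
      show "ext0 g (path X (exitt W w) w) \<le> liminf (\<lambda>k. ext0 g (path X (exitt (?W k) w) w))"
      proof (cases "path X (exitt W w) w \<in> Some ` D")
        case True
        then have "\<forall>\<^sub>F k in sequentially. ext0 g (path X (exitt W w) w) \<le> ext0 g (path X (exitt (?W k) w) w)"
          using 1 2 by (auto elim: eventually_mono)
        then show ?thesis by (rule Liminf_bounded)
      next
        case False
        then show ?thesis using g(2) by (cases "path X (exitt W w) w") (auto simp: image_iff)
      qed
    qed
  qed
  also have "\<dots> \<le> liminf (\<lambda>k. Hop (?W k) g x)"
    unfolding Hop_path
    by (rule nn_integral_liminf, rule measurable_compose[OF measurable_path_time_law[OF optional_measurable[OF optional_exit_path]] measurable_ext0[OF g(1)]])
  finally show ?thesis .
qed

lemma compact_closure_cell: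
  fixes D W :: "'a set"
  shows "compact (closure (W \<inter> icell D k))" "closure (W \<inter> icell D k) \<subseteq> cell D k"
proof -
  show *: "closure (W \<inter> icell D k) \<subseteq> cell D k"
    by (rule closure_minimal[OF _ closed_cell]) (use interior_subset in blast)
  show "compact (closure (W \<inter> icell D k))"
    using compact_Int_closed[OF compact_cell[of D k] closed_closure[of "W \<inter> icell D k"]] * by (simp add: Int_absorb1)
qed

lemma lifetime_iff:
  assumes "w \<in> sample X"
  shows "T < lifetime X w \<longleftrightarrow> path X T w \<noteq> None"
proof
  assume "T < lifetime X w"
  then show "path X T w \<noteq> None" unfolding lifetime_def by (meson Inf_lower leD mem_Collect_eq)
next
  have rc: "rc_path (pth w)" by (rule rc_pth[OF assms])
  assume "path X T w \<noteq> None"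
  then obtain y where y: "path X T w = Some y" by auto
  then have T: "T < \<infinity>" using rc_path_infty[OF rc] by (cases "T = \<infinity>") (auto simp: less_top[symmetric])
  have "eventually (\<lambda>u. path X u w \<in> Some ` UNIV) (at_right T)"
    by (rule limitin_Some_eventually[where x = y]) (use rc_path_right[OF rc T] y in auto)
  then obtain b where b: "b > T" "\<And>u. u > T \<Longrightarrow> u < b \<Longrightarrow> path X u w \<in> Some ` UNIV"
    by (auto simp: eventually_at_right_ennreal[OF T])
  have "b \<le> lifetime X w" unfolding lifetime_def
  proof (rule Inf_greatest)
    fix u assume u: "u \<in> {t. path X t w = None}"
    show "b \<le> u"
    proof (rule ccontr)
      assume "\<not> b \<le> u"
      then have "\<not> T < u" using b(2)[of u] u by (auto simp: not_le)
      then show False using rc_path_absorb[OF rc, of u T] u y by (simp add: not_less)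
    qed
  qed
  with b(1) show "T < lifetime X w" by simp
qed

lemma expct_exit:
  assumes "open U" "x \<in> U"
  shows "expct X x (\<lambda>w. if exit_time X U w < lifetime X w then ext0 f (path X (exit_time X U w) w) else 0) = Hop U f x"
  unfolding expct_eq Hop_path
proof (rule nn_integral_cong_AE)
  show "AE w in law X x. (if exit_time X U w < lifetime X w then ext0 f (path X (exit_time X U w) w) else 0) =
      ext0 f (path X (exitt U w) w)"
    using AE_exit_time[OF assms] AE_space by eventually_elim (auto simp: lifetime_iff)
qed

lemma expct_killed_exit:
  assumes U: "open U" "x \<in> U" and D: "open D" "U \<subseteq> D"
  shows "expct X x (\<lambda>w. if exit_time X U w < lifetime X w then ext0 f (killed_path X D (exit_time X U w) w) else 0) =
    Hop U (\<lambda>y. f y * ind D y) x"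
  unfolding expct_eq Hop_path
proof (rule nn_integral_cong_AE)
  have "x \<in> D" using assms by auto
  show "AE w in law X x. (if exit_time X U w < lifetime X w then ext0 f (killed_path X D (exit_time X U w) w) else 0) =
      ext0 (\<lambda>y. f y * ind D y) (path X (exitt U w) w)"
    using AE_exit_time[OF U] AE_exit_time[OF D(1) \<open>x \<in> D\<close>] AE_exit_less_iff[OF D] AE_space
  proof eventually_elim
    fix w assume "exit_time X U w = exitt U w \<and> 0 < exitt U w" "exit_time X D w = exitt D w \<and> 0 < exitt D w"
      "exitt U w \<le> exitt D w \<and> (exitt U w < exitt D w \<longleftrightarrow> path X (exitt U w) w \<in> Some ` D)" "w \<in> space (law X x)"
    then show "(if exit_time X U w < lifetime X w then ext0 f (killed_path X D (exit_time X U w) w) else 0) =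
      ext0 (\<lambda>y. f y * ind D y) (path X (exitt U w) w)"
      by (cases "path X (exitt U w) w") (auto simp: killed_path_def lifetime_iff indicator_def)
  qed
qed

lemma expct_killed:
  assumes "open D" "x \<in> D"
  shows "expct X x (\<lambda>w. ext0 h (killed_path X D t w)) = Pop D t h x"
  unfolding expct_eq Pop_path
proof (rule nn_integral_cong_AE)
  show "AE w in law X x. ext0 h (killed_path X D t w) = (if t < exitt D w then ext0 h (path X t w) else 0)"
    using AE_exit_time[OF assms] by eventually_elim (auto simp: killed_path_def)
qed

lemma expct_occupation:
  assumes "open D" "x \<in> D"
  shows "expct X x (\<lambda>w. \<integral>\<^sup>+t\<in>{t. 0 \<le> t \<and> ennreal t < exit_time X D w}. ext0 f (path X (ennreal t) w) \<partial>lborel) = Uop D f x"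
  unfolding expct_eq Rop_path
proof (rule nn_integral_cong_AE)
  show "AE w in law X x. (\<integral>\<^sup>+t\<in>{t. 0 \<le> t \<and> ennreal t < exit_time X D w}. ext0 f (path X (ennreal t) w) \<partial>lborel) =
    (\<integral>\<^sup>+t. ind {0..} t * (if ennreal t < exitt D w then ennreal (exp (- 0 * t)) * ext0 f (path X (ennreal t) w) else 0) \<partial>lborel)"
    using AE_exit_time[OF assms] by eventually_elim (auto intro!: nn_integral_cong simp: indicator_def)
qed

lemma nn_integral_time_below: "(\<integral>\<^sup>+t. ind {0..} t * (if ennreal t < E then 1 else 0) \<partial>lborel) = E"
proof (cases "E = \<infinity>")
  case True
  have "(\<integral>\<^sup>+t. ind {0..} t * (if ennreal t < E then 1 else 0) \<partial>lborel) = (\<integral>\<^sup>+t. ind {0::real..} t \<partial>lborel)"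
    using True by (intro nn_integral_cong) auto
  moreover have "emeasure lborel {0::real..} = \<infinity>"
  proof (rule ccontr)
    assume "emeasure lborel {0::real..} \<noteq> \<infinity>"
    then obtain n where "emeasure lborel {0::real..} < of_nat n"
      using ennreal_Ex_less_of_nat by (auto simp: less_top)
    also have "of_nat n = emeasure lborel {0..real n}" by (simp add: ennreal_of_nat_eq_real_of_nat)
    also have "\<dots> \<le> emeasure lborel {0::real..}" by (rule emeasure_mono) auto
    finally show False by simp
  qed
  ultimately show ?thesis using True by simp
next
  case False
  then have E: "E = ennreal (enn2real E)" by (simp add: less_top[symmetric])
  have "(\<integral>\<^sup>+t. ind {0..} t * (if ennreal t < E then 1 else 0) \<partial>lborel) = (\<integral>\<^sup>+t. ind {0..<enn2real E} t \<partial>lborel)"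
    by (subst E, intro nn_integral_cong) (auto simp: indicator_def ennreal_less_iff)
  also have "\<dots> = ennreal (enn2real E)" by simp
  finally show ?thesis using E by simp
qed

lemma Uop_1: "Uop D (\<lambda>_. 1) x = (\<integral>\<^sup>+w. exitt D w \<partial>law X x)"
  unfolding Rop_path
proof (rule nn_integral_cong)
  fix w assume "w \<in> space (law X x)"
  then have rc: "rc_path (pth w)" by (simp add: rc_pth)
  have "(\<integral>\<^sup>+t. ind {0..} t * (if ennreal t < exitt D w then ennreal (exp (- 0 * t)) * ext0 (\<lambda>_. 1) (path X (ennreal t) w) else 0) \<partial>lborel) =
    (\<integral>\<^sup>+t. ind {0..} t * (if ennreal t < exitt D w then 1 else 0) \<partial>lborel)"
    using before_exit_path[OF rc, of _ D] by (intro nn_integral_cong) force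
  then show "(\<integral>\<^sup>+t. ind {0..} t * (if ennreal t < exitt D w then ennreal (exp (- 0 * t)) * ext0 (\<lambda>_. 1) (path X (ennreal t) w) else 0) \<partial>lborel) = exitt D w"
    unfolding nn_integral_time_below .
qed

lemma expct_exit_time:
  assumes "open D" "x \<in> D"
  shows "expct X x (exit_time X D) = Uop D (\<lambda>_. 1) x"
  unfolding expct_eq Uop_1
  by (rule nn_integral_cong_AE) (use AE_exit_time[OF assms] in eventually_elim, simp)

subsection \<open>Harmonic functions\<close>

lemma harmonic_measurable:
  assumes "harmonic X D h" "open D"
  shows "(\<lambda>y. h y * ind D y) \<in> bfun"
  using assms borel_measurable_restrict_space_iff_ennreal[of D borel h] by (simp add: harmonic_def)

lemma harmonic_Hop:
  assumes "harmonic X D h" "open D" "open U" "compact (closure U)" "closure U \<subseteq> D" "x \<in> U"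
  shows "h x = Hop U (\<lambda>y. h y * ind D y) x"
proof -
  have "U \<subseteq> D" using assms closure_subset by blast
  have "h x = expct X x (\<lambda>w. if exit_time X U w < lifetime X w then ext0 h (killed_path X D (exit_time X U w) w) else 0)"
    using assms unfolding harmonic_def by blast
  then show ?thesis using expct_killed_exit[OF assms(3,6,2) \<open>U \<subseteq> D\<close>] by simp
qed

text \<open>Inside \<open>W\<close> the function is its own exit integral, so the killed semigroup
  counts the exit values of the paths still in \<open>W\<close> at time \<open>t\<close>. In this
  form it is visibly decreasing in \<open>t\<close>.\<close>

lemma harmonic_Pop:
  assumes h: "harmonic X D h" "open D" and W: "open W" "compact (closure W)" "closure W \<subseteq> D"
  shows "Pop W t (\<lambda>y. h y * ind D y) x =
    (\<integral>\<^sup>+w. (if t < exitt W w then ext0 (\<lambda>y. h y * ind D y) (path X (exitt W w) w) else 0) \<partial>law X x)"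
proof -
  have WD: "W \<subseteq> D" using W closure_subset by blast
  have "Pop W t (\<lambda>y. h y * ind D y) x = Pop W t (Hop W (\<lambda>y. h y * ind D y)) x"
    by (rule Pop_cong) (use harmonic_Hop[OF h W] WD in auto)
  then show ?thesis using exit_markov[OF harmonic_measurable[OF h]] by simp
qed

text \<open>On relatively compact open sets the killed semigroup yields a part of the exit integral,
  and the whole of that integral is \<open>h x\<close>; exhaustion carries the bound to
  \<open>D\<close>.\<close>

lemma harmonic_Pop_le:
  assumes h: "harmonic X D h" "open D" and x: "x \<in> D"
  shows "Pop D t (\<lambda>y. h y * ind D y) x \<le> h x"
  unfolding Pop_exhaust[OF h(2) harmonic_measurable[OF h]]
proof (rule SUP_least)
  fix k
  let ?W = "icell D k"
  have cl: "closure ?W \<subseteq> cell D k" by (rule closure_minimal[OF interior_subset closed_cell])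
  have W: "open ?W" "compact (closure ?W)" "closure ?W \<subseteq> D"
    using cl cell_subset[of D k] compact_Int_closed[OF compact_cell[of D k] closed_closure[of ?W]]
    by (auto simp: Int_absorb1)
  show "Pop ?W t (\<lambda>y. h y * ind D y) x \<le> h x"
  proof (cases "x \<in> ?W")
    case True
    have "Pop ?W t (\<lambda>y. h y * ind D y) x \<le> Hop ?W (\<lambda>y. h y * ind D y) x"
      unfolding harmonic_Pop[OF h W] Hop_path by (intro nn_integral_mono) auto
    also have "\<dots> = h x" by (rule harmonic_Hop[OF h W True, symmetric])
    finally show ?thesis .
  qed (simp add: Pop_outside)
qed

text \<open>The measure with density \<open>n * exp (- n * t)\<close> concentrates near
  \<open>t = 0\<close>, where the semigroup killed on leaving a relatively compact \<open>W\<close>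
  inside \<open>A\<close> already recovers the exit integral of \<open>h\<close> over
  \<open>W\<close>.\<close>

lemma harmonic_resolvent_liminf:
  assumes h: "harmonic X D h" "open D" and A: "open A" "A \<subseteq> D" and v: "v \<in> A"
  shows "h v \<le> liminf (\<lambda>n. ennreal (real n) * Rop D (real n) (\<lambda>y. h y * ind A y) v)"
proof -
  let ?h = "\<lambda>y. h y * ind D y"
  note hm [measurable] = harmonic_measurable[OF h]
  let ?hA = "\<lambda>y. h y * ind A y"
  let ?R = "\<lambda>n. ennreal (real n) * Rop D (real n) ?hA v"
  obtain k where k: "v \<in> cell A k" using cell_exhaust[OF A(1) v] .
  define W where "W = icell A (Suc k)"
  let ?X = "\<lambda>w. path X (exitt W w) w"
  have vW: "v \<in> W" using k cell_subset_interior by (auto simp: W_def)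
  have cl: "closure W \<subseteq> cell A (Suc k)" unfolding W_def by (rule closure_minimal[OF interior_subset closed_cell])
  have W: "open W" "compact (closure W)" "closure W \<subseteq> D"
    using cl cell_subset[of A "Suc k"] A compact_Int_closed[OF compact_cell[of A "Suc k"] closed_closure[of W]]
    by (auto simp: Int_absorb1 W_def)
  have WA: "W \<subseteq> A" using cl cell_subset[of A "Suc k"] closure_subset by blast
  let ?p = "\<lambda>t. Pop W t ?h v"
  have p_anti: "?p t \<le> ?p s" if "s \<le> t" for s t
    unfolding harmonic_Pop[OF h W] by (intro nn_integral_mono) (use that in auto)
  have lower: "?p (ennreal s) * ennreal (1 - exp (- real n * s)) \<le> ?R n"
    if "0 < s" "0 < n" for s n
  proof -
    have [measurable]: "?hA \<in> bfun"
    proof -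
      have "?hA = (\<lambda>y. ?h y * ind A y)" using A by (auto simp: indicator_def fun_eq_iff)
      then show ?thesis using hm A(1) by simp
    qed
    have "?p (ennreal s) * ennreal (1 - exp (- real n * s)) =
      ?p (ennreal s) * (ennreal (real n) * (\<integral>\<^sup>+t. ind {0..s} t * ennreal (exp (- real n * t)) \<partial>lborel))"
      using nn_integral_exp_Icc[of "real n" s] that by simp
    also have "\<dots> = ennreal (real n) * (\<integral>\<^sup>+t. ind {0..s} t * ennreal (exp (- real n * t)) * ?p (ennreal s) \<partial>lborel)"
      by (subst nn_integral_multc) (auto simp: mult_ac)
    also have "\<dots> \<le> ennreal (real n) * (\<integral>\<^sup>+t. ind {0..} t * (ennreal (exp (- real n * t)) * Pop D (ennreal t) ?hA v) \<partial>lborel)"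
    proof (intro mult_left_mono nn_integral_mono)
      fix t :: real
      show "ind {0..s} t * ennreal (exp (- real n * t)) * ?p (ennreal s) \<le>
        ind {0..} t * (ennreal (exp (- real n * t)) * Pop D (ennreal t) ?hA v)"
      proof (cases "t \<in> {0..s}")
        case True
        have "?p (ennreal s) \<le> ?p (ennreal t)" using True by (intro p_anti ennreal_leI) auto
        also have "\<dots> = Pop W (ennreal t) ?hA v"
          using WA A by (intro Pop_cong) (auto simp: indicator_def)
        also have "\<dots> \<le> Pop D (ennreal t) ?hA v"
          unfolding Pop_path using exit_path_mono[of W D] WA A by (intro nn_integral_mono) (auto dest: less_le_trans)
        finally show ?thesis using True by (auto intro!: mult_left_mono)
      qed simp
    qed simp
    also have "\<dots> = ?R n"
      by (simp add: Rop_Pop)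
    finally show ?thesis .
  qed
  have le: "?p (ennreal s) \<le> liminf (\<lambda>n. ?R n)" if s: "0 < s" for s
  proof -
    have "(\<lambda>n. 1 - exp (- real n * s)) \<longlonglongrightarrow> 1 - 0"
    proof (intro tendsto_intros)
      have "(\<lambda>n. exp (- s) ^ n) \<longlonglongrightarrow> 0" using s by (intro LIMSEQ_power_zero) auto
      then show "(\<lambda>n. exp (- real n * s)) \<longlonglongrightarrow> 0" by (simp add: exp_of_nat_mult[symmetric])
    qed
    then have "(\<lambda>n. ?p (ennreal s) * ennreal (1 - exp (- real n * s))) \<longlonglongrightarrow> ?p (ennreal s) * ennreal (1 - 0)"
      by (intro tendsto_mult_ennreal tendsto_ennrealI tendsto_const) auto
    then have "liminf (\<lambda>n. ?p (ennreal s) * ennreal (1 - exp (- real n * s))) = ?p (ennreal s)"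
      by (intro lim_imp_Liminf) auto
    moreover have "liminf (\<lambda>n. ?p (ennreal s) * ennreal (1 - exp (- real n * s))) \<le>
      liminf (\<lambda>n. ?R n)"
      by (rule Liminf_mono, rule eventually_mono[OF eventually_gt_at_top[of 0]], rule lower[OF s])
    ultimately show ?thesis by simp
  qed
  have "h v = Hop W ?h v" by (rule harmonic_Hop[OF h W vW])
  \<comment> \<open>The exit from \<open>W\<close> happens at a strictly positive time, so
    discarding exits up to time \<open>rn k\<close> loses nothing in the limit.\<close>
  also have "\<dots> = (\<integral>\<^sup>+w. (SUP k. if ennreal (rn k) < exitt W w then ext0 ?h (?X w) else 0) \<partial>law X v)"
    unfolding Hop_path
  proof (rule nn_integral_cong_AE)
    show "AE w in law X v. ext0 ?h (?X w) =
      (SUP k. if ennreal (rn k) < exitt W w then ext0 ?h (?X w) else 0)"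
      using AE_exit_time[OF W(1) vW]
    proof eventually_elim
      fix w assume "exit_time X W w = exitt W w \<and> 0 < exitt W w"
      then have pos: "0 < exitt W w" by simp
      have "(\<lambda>k. ennreal (rn k)) \<longlonglongrightarrow> ennreal 0" by (intro tendsto_ennrealI LIMSEQ_Suc lim_1_over_n)
      then have "eventually (\<lambda>k. ennreal (rn k) < exitt W w) sequentially"
        using pos by (intro order_tendstoD(2)[where a = "exitt W w"]) auto
      then obtain k where k: "ennreal (rn k) < exitt W w"
        by (meson eventually_happens trivial_limit_sequentially)
      show "ext0 ?h (?X w) =
        (SUP k. if ennreal (rn k) < exitt W w then ext0 ?h (?X w) else 0)"
      proof (rule antisym)
        show "ext0 ?h (?X w) \<le> (SUP k. if ennreal (rn k) < exitt W w then ext0 ?h (?X w) else 0)"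
          by (rule SUP_upper2[of k]) (use k in auto)
      qed (rule SUP_least, simp)
    qed
  qed
  also have "\<dots> = (SUP k. \<integral>\<^sup>+w. (if ennreal (rn k) < exitt W w then ext0 ?h (?X w) else 0) \<partial>law X v)"
  proof (rule nn_integral_monotone_convergence_SUP)
    have e: "ennreal (rn (Suc k)) \<le> ennreal (rn k)" for k
      by (intro ennreal_leI divide_left_mono) auto
    show "incseq (\<lambda>k w. if ennreal (rn k) < exitt W w then ext0 ?h (?X w) else 0)"
    proof (intro incseq_SucI le_funI)
      fix n w
      show "(if ennreal (rn n) < exitt W w then ext0 ?h (?X w) else 0) \<le>
        (if ennreal (rn (Suc n)) < exitt W w then ext0 ?h (?X w) else 0)"
        using le_less_trans[OF e[of n], of "exitt W w"] by (simp del: of_nat_Suc)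
    qed
    have [measurable]: "(\<lambda>w. ext0 ?h (?X w)) \<in> borel_measurable (law X v)"
      by (rule measurable_compose[OF measurable_path_time_law[OF optional_measurable[OF optional_exit_path]] measurable_ext0[OF hm]])
    note [measurable] = measurable_exitt[of W v]
    show "(\<lambda>w. if ennreal (rn k) < exitt W w then ext0 ?h (?X w) else 0) \<in> borel_measurable (law X v)" for k
      by measurable
  qed
  also have "\<dots> = (SUP k. ?p (ennreal (rn k)))"
    unfolding harmonic_Pop[OF h W] ..
  also have "\<dots> \<le> liminf (\<lambda>n. ?R n)"
    by (rule SUP_least) (rule le, simp)
  finally show ?thesis .
qed

end

section \<open>Exit by jumps\<close>

lemma at_left_ennreal_neq_bot:
  fixes t :: ennreal
  assumes "0 < t"
  shows "at_left t \<noteq> bot"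
proof
  assume "at_left t = bot"
  then have "eventually (\<lambda>_. False) (at_left t)" by simp
  then obtain b where b: "b < t" "\<And>y. b < y \<Longrightarrow> y < t \<Longrightarrow> False"
    using eventually_at_left[OF assms] by auto
  obtain y where "b < y" "y < t" using dense[OF b(1)] by blast
  with b(2) show False by blast
qed

text \<open>The definite description in \<open>left_lim\<close> can be evaluated only if the left
  limit is unique: the compact set excludes the cemetery as a limit, and distinct states are
  separated by open sets.\<close>

lemma (in proper_space) left_limit_in_compact:
  fixes z :: "'b \<Rightarrow> 'a option"
  assumes K: "compact K" and ev: "eventually (\<lambda>s. z s \<in> Some ` K) F" and F: "F \<noteq> bot" and l: "limitin onept z l F"
  shows "(THE l. limitin onept z l F) = l" "l \<in> Some ` K"
proof -
  have in_K: "l' \<in> Some ` K" if "limitin onept z l' F" for l'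
  proof (rule ccontr)
    assume "l' \<notin> Some ` K"
    from eventually_conj[OF limitin_None_eventually[OF that K this] ev] have "eventually (\<lambda>_. False) F"
      by (auto elim: eventually_mono)
    then show False using F by (simp add: eventually_False)
  qed
  show "l \<in> Some ` K" by (rule in_K[OF l])
  then obtain x where x: "l = Some x" by auto
  have "l' = l" if l': "limitin onept z l' F" for l'
  proof -
    from in_K[OF l'] obtain y where y: "l' = Some y" by auto
    show ?thesis
    proof (rule ccontr)
      assume "l' \<noteq> l"
      then have "x \<noteq> y" using x y by auto
      then obtain U V where UV: "open U" "open V" "x \<in> U" "y \<in> V" "U \<inter> V = {}"
        using hausdorff by metis
      from eventually_conj[OF limitin_Some_eventually[OF l[unfolded x] UV(1,3)] limitin_Some_eventually[OF l'[unfolded y] UV(2,4)]]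
      have "eventually (\<lambda>_. False) F" by (rule eventually_mono) (use UV(5) in auto)
      then show False using F by (simp add: eventually_False)
    qed
  qed
  then show "(THE l. limitin onept z l F) = l" using l by blast
qed

locale levy_proc = hunt_proc TY X for TY :: "'a::{metric_space, second_countable_topology} itself" and X :: "('w, 'a) proc" +
  fixes m :: "'a measure" and j :: "'a \<Rightarrow> 'a \<Rightarrow> real"
  assumes sets_m: "sets m = sets borel"
    and measurable_j: "(\<lambda>(x, y). j x y) \<in> borel_measurable (borel \<Otimes>\<^sub>M borel)"
    and levy: "levy_system X (\<lambda>x. density m (\<lambda>y. ennreal (j x y)))"
    and compact_m: "compact K \<Longrightarrow> emeasure m K < \<infinity>"
    and open_m: "open U \<Longrightarrow> U \<noteq> {} \<Longrightarrow> 0 < emeasure m U"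
begin

lemma measurable_m [simp]: "measurable m N = measurable borel N"
  by (rule measurable_cong_sets) (auto simp: sets_m)

lemma space_m [simp]: "space m = UNIV"
  using sets_eq_imp_space_eq[OF sets_m] by simp

lemma sigma_finite_m: "sigma_finite_measure m"
proof
  have "countable (range (\<lambda>n::nat. cball (undefined::'a) (real n)))" by simp
  moreover have "range (\<lambda>n::nat. cball (undefined::'a) (real n)) \<subseteq> sets m" by (auto simp: sets_m)
  moreover have "\<Union> (range (\<lambda>n::nat. cball (undefined::'a) (real n))) = space m"
    using real_arch_simple by (auto simp: set_eq_iff)
  moreover have "emeasure m (cball undefined (real n)) \<noteq> \<infinity>" for n
    using compact_m[OF heine_borel[of "cball undefined (real n)"]] by (simp add: less_top)
  ultimately show "\<exists>A. countable A \<and> A \<subseteq> sets m \<and> \<Union> A = space m \<and> (\<forall>a\<in>A. emeasure m a \<noteq> \<infinity>)"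
    by (intro exI[of _ "range (\<lambda>n::nat. cball (undefined::'a) (real n))"]) auto
qed

lemma measurable_j_pair [measurable]: "(\<lambda>z. j (fst z) (snd z)) \<in> borel_measurable (borel \<Otimes>\<^sub>M borel)"
  using measurable_j by (simp add: case_prod_beta')

lemma measurable_j_left [measurable]: "(\<lambda>u. j u v) \<in> bfun"
  using measurable_compose[OF _ measurable_j_pair, of "\<lambda>u. (u, v)" borel] by simp

lemma measurable_j_right [measurable]: "(\<lambda>v. j u v) \<in> bfun"
  using measurable_compose[OF _ measurable_j_pair, of "\<lambda>v. (u, v)" borel] by simp

lemma measurable_jint:
  assumes [measurable]: "g \<in> bfun"
  shows "(\<lambda>u. \<integral>\<^sup>+v. ennreal (j u v) * g v \<partial>m) \<in> bfun"
proof -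
  interpret sigma_finite_measure m by (rule sigma_finite_m)
  have "(\<lambda>z. ennreal (j (fst z) (snd z)) * g (snd z)) \<in> borel_measurable (borel \<Otimes>\<^sub>M borel)" by measurable
  then have "(\<lambda>z. ennreal (j (fst z) (snd z)) * g (snd z)) \<in> borel_measurable (borel \<Otimes>\<^sub>M m)"
    by (simp add: measurable_cong_sets[OF sets_pair_measure_cong[OF refl sets_m] refl])
  from borel_measurable_nn_integral[of "\<lambda>u v. ennreal (j u v) * g v" borel] this show ?thesis
    by (simp add: case_prod_beta')
qed

text \<open>The Ikeda-Watanabe formula. The integrand of the Levy system asks for a jump from the
  closure of \<open>W\<close> into \<open>S\<close>; before the exit the path is in
  \<open>W\<close>, hence off \<open>S\<close>, so the only contribution to the sum comes from the
  exit time.\<close>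

lemma Hop_levy_finite:
  assumes W: "open W" "compact (closure W)" "x \<in> W" and S: "S \<in> sets borel" "S \<inter> closure W = {}"
    and g: "g \<in> bfun" "\<And>v. g v < \<infinity>"
  shows "Hop W (\<lambda>v. ind S v * g v) x = Uop W (\<lambda>u. \<integral>\<^sup>+v. ennreal (j u v) * (ind S v * g v) \<partial>m) x"
proof -
  define f where "f u v = (ind (closure W) u * (ind S v * g v) :: ennreal)" for u v
  have WS: "v \<notin> S" if "v \<in> W" for v using S(2) that closure_subset by blast
  have f_meas: "(\<lambda>(u, v). f u v) \<in> borel_measurable (borel \<Otimes>\<^sub>M borel)"
  proof -
    have [measurable]: "closure W \<in> sets borel" by simp
    note [measurable] = S(1) g(1)
    show ?thesis unfolding f_def case_prod_beta' by measurable
  qed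
  have f_fin: "\<forall>u v. f u v < \<infinity>" using g(2) by (auto simp: f_def indicator_def)
  have f_diag: "\<forall>u. f u u = 0" using S(2) by (auto simp: f_def indicator_def)
  have "expct X x (\<lambda>w. \<Sum>\<^sub>\<infinity>s\<in>{s. 0 < s \<and> s \<le> exitt W w}. ext0 (\<lambda>u. ext0 (f u) (path X s w)) (left_lim X s w)) =
      expct X x (\<lambda>w. \<integral>\<^sup>+s\<in>{s. 0 \<le> s \<and> ennreal s \<le> exitt W w}.
         ext0 (\<lambda>u. \<integral>\<^sup>+v. f u v \<partial>density m (\<lambda>y. ennreal (j u y))) (path X (ennreal s) w) \<partial>lborel)"
    using levy[unfolded levy_system_def, rule_format, OF conjI[OF f_meas conjI[OF f_fin conjI[OF f_diag optional_stopping_time[OF optional_exit_path]]]], of x] .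
  moreover have "expct X x (\<lambda>w. \<Sum>\<^sub>\<infinity>s\<in>{s. 0 < s \<and> s \<le> exitt W w}. ext0 (\<lambda>u. ext0 (f u) (path X s w)) (left_lim X s w)) =
      Hop W (\<lambda>v. ind S v * g v) x"
    unfolding expct_eq Hop_path
  proof (rule nn_integral_cong_AE)
    show "AE w in law X x. (\<Sum>\<^sub>\<infinity>s\<in>{s. 0 < s \<and> s \<le> exitt W w}. ext0 (\<lambda>u. ext0 (f u) (path X s w)) (left_lim X s w)) =
       ext0 (\<lambda>v. ind S v * g v) (path X (exitt W w) w)"
      using AE_exit_time[OF W(1,3)] AE_space
    proof eventually_elim
      fix w assume pos: "exit_time X W w = exitt W w \<and> 0 < exitt W w" and w: "w \<in> space (law X x)"
      have rc: "rc_path (pth w)" using w by (simp add: rc_pth)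
      let ?\<tau> = "exitt W w"
      let ?F = "\<lambda>s. ext0 (\<lambda>u. ext0 (f u) (path X s w)) (left_lim X s w)"
      have z1: "?F s = 0" if "s < ?\<tau>" for s
      proof -
        from before_exit_path[OF rc that] obtain v where v: "path X s w = Some v" "v \<in> W" by auto
        then have "ext0 (f u) (path X s w) = 0" for u using WS by (simp add: f_def)
        then show ?thesis by (simp add: ext0_def split: option.split)
      qed
      have "infsum ?F {s. 0 < s \<and> s \<le> ?\<tau>} = ?F ?\<tau>"
        by (rule infsum_single_nonzero) (use z1 pos in auto)
      also have "?F ?\<tau> = ext0 (\<lambda>v. ind S v * g v) (path X ?\<tau> w)"
      proof (cases "?\<tau> = \<infinity>")
        case True
        then have "path X ?\<tau> w = None" using rc_path_infty[OF rc] by simp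
        then show ?thesis by (simp add: ext0_def split: option.split)
      next
        case False
        then have fin: "?\<tau> < \<infinity>" by (simp add: less_top[symmetric])
        then obtain l where l: "limitin onept (\<lambda>s. path X s w) l (at_left ?\<tau>)"
          using path_left w pos by (auto simp del: infinity_ennreal_def)
        have "eventually (\<lambda>s. path X s w \<in> Some ` closure W) (at_left ?\<tau>)"
        proof -
          have "eventually (\<lambda>s. s < ?\<tau>) (at_left ?\<tau>)" by (simp add: eventually_at_filter)
          then show ?thesis by (rule eventually_mono) (use before_exit_path[OF rc, of _ W] closure_subset[of W] in blast)
        qed
        from left_limit_in_compact[OF W(2) this at_left_ennreal_neq_bot l] pos
        obtain u where "left_lim X ?\<tau> w = Some u" "u \<in> closure W" unfolding left_lim_def by auto
        then show ?thesis by (cases "path X ?\<tau> w") (auto simp: f_def)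
      qed
      finally show "infsum ?F {s. 0 < s \<and> s \<le> ?\<tau>} = ext0 (\<lambda>v. ind S v * g v) (path X ?\<tau> w)" .
    qed
  qed
  moreover have "expct X x (\<lambda>w. \<integral>\<^sup>+s\<in>{s. 0 \<le> s \<and> ennreal s \<le> exitt W w}.
         ext0 (\<lambda>u. \<integral>\<^sup>+v. f u v \<partial>density m (\<lambda>y. ennreal (j u y))) (path X (ennreal s) w) \<partial>lborel) =
      Uop W (\<lambda>u. \<integral>\<^sup>+v. ennreal (j u v) * (ind S v * g v) \<partial>m) x"
    unfolding expct_eq Rop_path
  proof (rule nn_integral_cong)
    fix w assume "w \<in> space (law X x)"
    then have rc: "rc_path (pth w)" by (simp add: rc_pth)
    let ?r = "enn2real (exitt W w)"
    have [measurable]: "S \<in> sets borel" by (rule S(1))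
    note [measurable] = g(1)
    have dens: "(\<integral>\<^sup>+v. f u v \<partial>density m (\<lambda>y. ennreal (j u y))) = (\<integral>\<^sup>+v. ennreal (j u v) * (ind S v * g v) \<partial>m)"
      if "u \<in> W" for u
    proof -
      have "(\<integral>\<^sup>+v. f u v \<partial>density m (\<lambda>y. ennreal (j u y))) = (\<integral>\<^sup>+v. ennreal (j u v) * f u v \<partial>m)"
        by (rule nn_integral_density) (simp_all add: f_def)
      then show ?thesis using that closure_subset[of W] by (auto simp: f_def indicator_def)
    qed
    show "(\<integral>\<^sup>+s\<in>{s. 0 \<le> s \<and> ennreal s \<le> exitt W w}.
         ext0 (\<lambda>u. \<integral>\<^sup>+v. f u v \<partial>density m (\<lambda>y. ennreal (j u y))) (path X (ennreal s) w) \<partial>lborel) =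
      (\<integral>\<^sup>+t. ind {0..} t * (if ennreal t < exitt W w then ennreal (exp (- 0 * t)) *
        ext0 (\<lambda>u. \<integral>\<^sup>+v. ennreal (j u v) * (ind S v * g v) \<partial>m) (path X (ennreal t) w) else 0) \<partial>lborel)"
    proof (rule nn_integral_cong_AE)
      \<comment> \<open>The Levy system integrates up to and including the exit time, the potential
        stops before it; the two differ at the single time \<open>?r\<close>.\<close>
      have "AE t in lborel. t \<noteq> ?r" by (rule AE_lborel_singleton)
      then show "AE t in lborel. ext0 (\<lambda>u. \<integral>\<^sup>+v. f u v \<partial>density m (\<lambda>y. ennreal (j u y))) (path X (ennreal t) w) *
          ind {s. 0 \<le> s \<and> ennreal s \<le> exitt W w} t =
        ind {0..} t * (if ennreal t < exitt W w then ennreal (exp (- 0 * t)) *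
          ext0 (\<lambda>u. \<integral>\<^sup>+v. ennreal (j u v) * (ind S v * g v) \<partial>m) (path X (ennreal t) w) else 0)"
      proof eventually_elim
        fix t assume t: "t \<noteq> ?r"
        show "ext0 (\<lambda>u. \<integral>\<^sup>+v. f u v \<partial>density m (\<lambda>y. ennreal (j u y))) (path X (ennreal t) w) *
            ind {s. 0 \<le> s \<and> ennreal s \<le> exitt W w} t =
          ind {0..} t * (if ennreal t < exitt W w then ennreal (exp (- 0 * t)) *
            ext0 (\<lambda>u. \<integral>\<^sup>+v. ennreal (j u v) * (ind S v * g v) \<partial>m) (path X (ennreal t) w) else 0)"
        proof (cases "0 \<le> t")
          case True
          have ne: "ennreal t \<noteq> exitt W w" using t True by (metis enn2real_ennreal)
          show ?thesis
          proof (cases "ennreal t < exitt W w")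
            case less: True
            from before_exit_path[OF rc less] obtain u where "path X (ennreal t) w = Some u" "u \<in> W" by auto
            then show ?thesis using dens less True by simp
          next
            case False
            then have "\<not> ennreal t \<le> exitt W w" using ne by simp
            then show ?thesis using False by simp
          qed
        qed simp
      qed
    qed
  qed
  ultimately show ?thesis by simp
qed

lemma Hop_SUP:
  assumes "incseq f" "\<And>i. f i \<in> bfun"
  shows "Hop W (\<lambda>y. SUP i. f i y) x = (SUP i. Hop W (f i) x)"
proof -
  have "(\<lambda>y. SUP i. f i y) \<in> bfun" using assms(2) by measurable
  then show ?thesis using assms by (simp add: Hop_hm nn_integral_monotone_convergence_SUP)
qed

lemma Rop_SUP:
  assumes "incseq f" "\<And>i. f i \<in> bfun"
  shows "Rop W \<alpha> (\<lambda>y. SUP i. f i y) x = (SUP i. Rop W \<alpha> (f i) x)"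
proof -
  have "(\<lambda>y. SUP i. f i y) \<in> bfun" using assms(2) by measurable
  then show ?thesis using assms by (simp add: Rop_om nn_integral_monotone_convergence_SUP)
qed

lemma SUP_min_nat: "(SUP n. min c (of_nat n)) = (c :: ennreal)"
proof (rule antisym)
  show "c \<le> (SUP n. min c (of_nat n))"
  proof (rule dense_le)
    fix y assume "y < c"
    then have "y < top" by (simp add: less_le_trans[OF _ top_greatest])
    then obtain n where "y < of_nat n" using ennreal_Ex_less_of_nat by auto
    then show "y \<le> (SUP n. min c (of_nat n))" using \<open>y < c\<close> by (intro SUP_upper2[of n]) auto
  qed
qed (auto intro: SUP_least)

text \<open>The Levy system is stated for finite integrands; truncating \<open>g\<close> at
  \<open>n\<close> and monotone convergence remove the restriction.\<close>

lemma Hop_levy: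
  assumes W: "open W" "compact (closure W)" "x \<in> W" and S: "S \<in> sets borel" "S \<inter> closure W = {}"
    and g: "g \<in> bfun"
  shows "Hop W (\<lambda>v. ind S v * g v) x = Uop W (\<lambda>u. \<integral>\<^sup>+v. ennreal (j u v) * (ind S v * g v) \<partial>m) x"
proof -
  define G where "G n v = min (g v) (of_nat n)" for n v
  have G [measurable]: "G n \<in> bfun" for n unfolding G_def using g by measurable
  note [measurable] = S(1)
  have inc: "incseq G" by (auto simp: incseq_def le_fun_def G_def min.coboundedI2)
  have SG: "ind S v * g v = (SUP n. ind S v * G n v)" for v
    unfolding G_def by (simp add: SUP_mult_left_ennreal[symmetric] SUP_min_nat)
  have inc2: "incseq (\<lambda>n v. ind S v * G n v)" using inc by (auto simp: incseq_def le_fun_def intro!: mult_left_mono)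
  have "Hop W (\<lambda>v. ind S v * g v) x = (SUP n. Hop W (\<lambda>v. ind S v * G n v) x)"
    unfolding SG by (rule Hop_SUP[OF inc2]) measurable
  also have "\<dots> = (SUP n. Uop W (\<lambda>u. \<integral>\<^sup>+v. ennreal (j u v) * (ind S v * G n v) \<partial>m) x)"
  proof (intro SUP_cong refl Hop_levy_finite W S G)
    show "G n v < \<infinity>" for n v unfolding G_def by (simp add: min_less_iff_disj of_nat_less_top)
  qed
  also have "\<dots> = Uop W (\<lambda>u. SUP n. \<integral>\<^sup>+v. ennreal (j u v) * (ind S v * G n v) \<partial>m) x"
  proof (rule Rop_SUP[symmetric])
    show "incseq (\<lambda>n u. \<integral>\<^sup>+v. ennreal (j u v) * (ind S v * G n v) \<partial>m)"
      using inc by (auto simp: incseq_def le_fun_def intro!: nn_integral_mono mult_left_mono)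
    show "(\<lambda>u. \<integral>\<^sup>+v. ennreal (j u v) * (ind S v * G n v) \<partial>m) \<in> bfun" for n
      by (rule measurable_jint) measurable
  qed
  also have "(\<lambda>u. SUP n. \<integral>\<^sup>+v. ennreal (j u v) * (ind S v * G n v) \<partial>m) =
    (\<lambda>u. \<integral>\<^sup>+v. ennreal (j u v) * (ind S v * g v) \<partial>m)"
  proof
    fix u
    have "(SUP n. \<integral>\<^sup>+v. ennreal (j u v) * (ind S v * G n v) \<partial>m) = (\<integral>\<^sup>+v. (SUP n. ennreal (j u v) * (ind S v * G n v)) \<partial>m)"
    proof (rule nn_integral_monotone_convergence_SUP[symmetric])
      show "incseq (\<lambda>n v. ennreal (j u v) * (ind S v * G n v))"
        using inc by (auto simp: incseq_def le_fun_def intro!: mult_left_mono)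
    qed simp
    also have "\<dots> = (\<integral>\<^sup>+v. ennreal (j u v) * (ind S v * g v) \<partial>m)"
      unfolding SG by (simp add: SUP_mult_left_ennreal)
    finally show "(SUP n. \<integral>\<^sup>+v. ennreal (j u v) * (ind S v * G n v) \<partial>m) = (\<integral>\<^sup>+v. ennreal (j u v) * (ind S v * g v) \<partial>m)" .
  qed
  finally show ?thesis .
qed

text \<open>If the jump density varies boundedly in its target near \<open>z0\<close>, the exit distribution of a set
  away from \<open>z0\<close> has a bounded density near \<open>z0\<close>. The bound on \<open>Uop W \<kappa>\<close> comes from the total mass 1.\<close>

lemma exit_density_bounded:
  assumes W: "open W" "compact (closure W)" "x \<in> W" and S: "open S" "S \<noteq> {}" "S \<inter> closure W = {}"
    and c: "0 < c" and \<kappa>: "\<kappa> \<in> bfun" "\<And>u v. u \<in> W \<Longrightarrow> v \<in> S \<Longrightarrow> inverse c * \<kappa> u \<le> j u v \<and> j u v \<le> c * \<kappa> u"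
    and g: "g \<in> bfun"
  shows "Hop W (\<lambda>v. ind S v * g v) x \<le> ennreal (c * c) / emeasure m S * (\<integral>\<^sup>+v. ind S v * g v \<partial>m)"
proof -
  have [measurable]: "S \<in> sets borel" using S by simp
  note [measurable] = \<kappa>(1) g
  define I where "I = (\<integral>\<^sup>+v. ind S v * g v \<partial>m)"
  define k where "k u = ennreal (\<kappa> u)" for u
  have [measurable]: "k \<in> bfun" unfolding k_def by measurable
  have "Hop W (\<lambda>v. ind S v * g v) x = Uop W (\<lambda>u. \<integral>\<^sup>+v. ennreal (j u v) * (ind S v * g v) \<partial>m) x"
    by (rule Hop_levy[OF W _ S(3) g]) simp
  also have "\<dots> \<le> Uop W (\<lambda>u. (ennreal c * I) * k u) x"
  proof (rule Rop_mono_on)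
    fix u assume u: "u \<in> W"
    have "(\<integral>\<^sup>+v. ennreal (j u v) * (ind S v * g v) \<partial>m) \<le> (\<integral>\<^sup>+v. ennreal (c * \<kappa> u) * (ind S v * g v) \<partial>m)"
    proof (rule nn_integral_mono)
      fix v show "ennreal (j u v) * (ind S v * g v) \<le> ennreal (c * \<kappa> u) * (ind S v * g v)"
        using \<kappa>(2)[OF u, of v] by (cases "v \<in> S") (auto intro!: mult_right_mono ennreal_leI)
    qed
    also have "\<dots> = (ennreal c * I) * k u"
      unfolding I_def k_def using c by (subst nn_integral_cmult) (auto simp: ennreal_mult' mult_ac)
    finally show "(\<integral>\<^sup>+v. ennreal (j u v) * (ind S v * g v) \<partial>m) \<le> (ennreal c * I) * k u" .
  qed
  also have "\<dots> = ennreal c * I * Uop W k x"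
    by (simp add: Rop_om nn_integral_cmult)
  finally have upper: "Hop W (\<lambda>v. ind S v * g v) x \<le> ennreal c * I * Uop W k x" .
  have "Uop W (\<lambda>u. ennreal (inverse c) * emeasure m S * k u) x \<le> Uop W (\<lambda>u. \<integral>\<^sup>+v. ennreal (j u v) * (ind S v * 1) \<partial>m) x"
  proof (rule Rop_mono_on)
    fix u assume u: "u \<in> W"
    have "ennreal (inverse c) * emeasure m S * k u = (\<integral>\<^sup>+v. ennreal (inverse c * \<kappa> u) * ind S v \<partial>m)"
      using c by (subst nn_integral_cmult_indicator) (simp_all add: sets_m k_def ennreal_mult' mult_ac)
    also have "\<dots> \<le> (\<integral>\<^sup>+v. ennreal (j u v) * (ind S v * 1) \<partial>m)"
    proof (rule nn_integral_mono)
      fix v show "ennreal (inverse c * \<kappa> u) * ind S v \<le> ennreal (j u v) * (ind S v * 1)"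
        using \<kappa>(2)[OF u, of v] by (cases "v \<in> S") (auto intro!: ennreal_leI)
    qed
    finally show "ennreal (inverse c) * emeasure m S * k u \<le> (\<integral>\<^sup>+v. ennreal (j u v) * (ind S v * 1) \<partial>m)" .
  qed
  also have "\<dots> = Hop W (\<lambda>v. ind S v * 1) x"
    by (rule Hop_levy[OF W _ S(3), symmetric]) auto
  also have "\<dots> \<le> Hop W (\<lambda>v. 1) x" by (rule Hop_mono) (auto simp: indicator_def)
  also have "\<dots> \<le> 1" using emeasure_hm[of W x] by (simp add: Hop_hm)
  finally have "ennreal (inverse c) * emeasure m S * Uop W k x \<le> 1"
    by (simp add: Rop_om nn_integral_cmult)
  then have "ennreal c * (ennreal (inverse c) * emeasure m S * Uop W k x) \<le> ennreal c * 1"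
    by (rule mult_left_mono) simp
  moreover have "ennreal c * ennreal (inverse c) = 1" using c by (simp add: ennreal_mult[symmetric])
  ultimately have le: "emeasure m S * Uop W k x \<le> ennreal c" by (simp add: mult.assoc[symmetric])
  have S0: "0 < emeasure m S" by (rule open_m[OF S(1,2)])
  show ?thesis
  proof (cases "emeasure m S = \<infinity>")
    case True
    \<comment> \<open>If \<open>S\<close> has infinite mass, the bound \<open>le\<close> forces this
      potential to vanish.\<close>
    then have "Uop W k x = 0" using le by (auto simp: ennreal_top_mult top_unique split: if_splits)
    then show ?thesis using upper by simp
  next
    case False
    have "Uop W k x = (emeasure m S * Uop W k x) / emeasure m S"
      unfolding mult.commute[of "emeasure m S"] using S0 False by (subst ennreal_mult_divide_eq) auto
    also have "\<dots> \<le> ennreal c / emeasure m S" by (rule divide_right_mono_ennreal[OF le])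
    finally have "Uop W k x \<le> ennreal c / emeasure m S" .
    then have "ennreal c * I * Uop W k x \<le> ennreal c * I * (ennreal c / emeasure m S)" by (rule mult_left_mono) simp
    also have "\<dots> = ennreal (c * c) / emeasure m S * I"
      using c by (simp add: ennreal_mult ennreal_times_divide mult_ac divide_ennreal_def)
    finally show ?thesis using upper by (simp add: I_def)
  qed
qed

text \<open>The bound in \<open>exit_density_bounded\<close> is the same for all
  \<open>W \<inter> icell D k\<close>, so Fatou's lemma removes the compactness of the closure of
  \<open>W\<close>. This admits sets that reach the boundary of \<open>D\<close>.\<close>

lemma exit_density:
  assumes D: "open D" and W: "open W" "W \<subseteq> D" "x \<in> W" and S: "open S" "S \<noteq> {}" "S \<inter> closure W = {}"
    and c: "0 < c" and \<kappa>: "\<kappa> \<in> bfun" "\<And>u v. u \<in> W \<Longrightarrow> v \<in> S \<Longrightarrow> inverse c * \<kappa> u \<le> j u v \<and> j u v \<le> c * \<kappa> u"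
    and g: "g \<in> bfun" "\<And>v. v \<notin> D \<Longrightarrow> g v = 0"
  shows "Hop W (\<lambda>v. ind S v * g v) x \<le> ennreal (c * c) / emeasure m S * (\<integral>\<^sup>+v. ind S v * g v \<partial>m)"
proof -
  have [measurable]: "S \<in> sets borel" using S by simp
  note [measurable] = g(1)
  let ?G = "\<lambda>v. ind S v * g v"
  let ?W = "\<lambda>k. W \<inter> icell D k"
  have G [measurable]: "?G \<in> bfun" by measurable
  have "Hop W ?G x \<le> liminf (\<lambda>k. Hop (?W k) ?G x)"
    by (rule Hop_exhaust_liminf[OF D W(1,2) G]) (simp add: g(2))
  also have "\<dots> \<le> ennreal (c * c) / emeasure m S * (\<integral>\<^sup>+v. ind S v * g v \<partial>m)"
  proof (rule Liminf_le)
    obtain k0 where k0: "x \<in> cell D k0" using cell_exhaust[OF D] W by blast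
    have "Hop (?W k) ?G x \<le> ennreal (c * c) / emeasure m S * (\<integral>\<^sup>+v. ind S v * g v \<partial>m)" if "k \<ge> Suc k0" for k
    proof (rule exit_density_bounded)
      show "open (?W k)" using W by auto
      show "compact (closure (?W k))" by (rule compact_closure_cell)
      show "x \<in> ?W k" using W k0 cell_subset_interior[of D k0] interior_cell_mono[OF that, of D] by blast
      show "S \<inter> closure (?W k) = {}" using S(3) closure_mono[of "?W k" W] by blast
    qed (use S c \<kappa> g in auto)
    then show "\<forall>\<^sub>F k in sequentially. Hop (?W k) ?G x \<le> ennreal (c * c) / emeasure m S * (\<integral>\<^sup>+v. ind S v * g v \<partial>m)"
      by (auto simp: eventually_sequentially)
  qed simp
  finally show ?thesis .
qed

end

section \<open>Green functions near a boundary point\<close>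

lemma (in hunt_proc) Hop_at_outside:
  assumes "y \<notin> W"
  shows "Hop W g y = g y"
proof -
  have "Hop W g y = (\<integral>\<^sup>+w. g y \<partial>law X y)"
    unfolding Hop_path
  proof (rule nn_integral_cong_AE)
    show "AE w in law X y. ext0 g (path X (exitt W w) w) = g y"
      using AE_start[of y] AE_space
    proof eventually_elim
      fix w assume st: "path X 0 w = Some y" and "w \<in> space (law X y)"
      then have "exitt W w = 0" using exit_path_start[OF rc_pth, of w W] assms by auto
      then show "ext0 g (path X (exitt W w) w) = g y" using st by simp
    qed
  qed
  then show ?thesis by simp
qed

lemma eventually_ball_subset:
  fixes x :: "'a::metric_space"
  assumes "open S" "x \<in> S"
  shows "eventually (\<lambda>k. ball x (rn k) \<subseteq> S) sequentially"
proof -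
  obtain e where e: "0 < e" "ball x e \<subseteq> S" using assms by (meson open_contains_ball)
  obtain k0 where k0: "rn k0 < e" using e(1) nat_approx_posE by blast
  have "ball x (rn k) \<subseteq> S" if "k \<ge> k0" for k
  proof -
    have "rn k \<le> rn k0" using that by (intro divide_left_mono) auto
    then show ?thesis using subset_ball[of "rn k" e x] k0 e(2) by auto
  qed
  then show ?thesis by (auto simp: eventually_sequentially)
qed

context levy_proc begin

lemma emeasure_ball:
  assumes "0 < r" shows "0 < emeasure m (ball x r)" "emeasure m (ball x r) < \<infinity>"
proof -
  show "0 < emeasure m (ball x r)" by (rule open_m) (use assms in auto)
  have "emeasure m (ball x r) \<le> emeasure m (cball x r)" by (rule emeasure_mono) (auto simp: sets_m)
  also have "\<dots> < \<infinity>" by (intro compact_m heine_borel) auto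
  finally show "emeasure m (ball x r) < \<infinity>" .
qed

lemma average_tendsto:
  fixes h :: "'a \<Rightarrow> ennreal"
  assumes D: "open D" "x \<in> D" and h: "continuous_on D h" and x: "h x < \<infinity>"
  shows "(\<lambda>k. (\<integral>\<^sup>+u. h u * ind (ball x (rn k)) u \<partial>m) / emeasure m (ball x (rn k))) \<longlonglongrightarrow> h x"
proof -
  let ?b = "\<lambda>k. ball x (rn k)"
  let ?av = "\<lambda>k. (\<integral>\<^sup>+u. h u * ind (?b k) u \<partial>m) / emeasure m (?b k)"
  have c: "(h \<longlongrightarrow> h x) (nhds x)" using h D by (simp add: continuous_on_eq_continuous_at continuous_at isCont_def tendsto_at_iff_tendsto_nhds)
  note small = eventually_ball_subset
  have const: "(\<integral>\<^sup>+u. a * ind (ball x r) u \<partial>m) / emeasure m (ball x r) = a" if "0 < r" for a r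
    using emeasure_ball[OF that, of x] by (simp add: nn_integral_cmult_indicator sets_m ennreal_mult_divide_eq less_top[symmetric])
  show ?thesis
  proof (rule order_tendstoI)
    fix a assume "a < h x"
    then obtain a' where a': "a < a'" "a' < h x" using dense by blast
    from order_tendstoD(1)[OF c a'(2)] obtain S where S: "open S" "x \<in> S" "\<And>u. u \<in> S \<Longrightarrow> a' < h u"
      by (auto simp: eventually_nhds)
    show "\<forall>\<^sub>F k in sequentially. a < ?av k"
      using small[OF S(1,2)]
    proof eventually_elim
      fix k assume k: "?b k \<subseteq> S"
      have "a' = (\<integral>\<^sup>+u. a' * ind (?b k) u \<partial>m) / emeasure m (?b k)"
        by (rule const[symmetric]) simp
      also have "\<dots> \<le> ?av k"
        using k S(3) by (intro divide_right_mono_ennreal nn_integral_mono) (auto simp: indicator_def less_imp_le)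
      finally show "a < ?av k"
        using a'(1) by (simp del: of_nat_Suc)
    qed
  next
    fix a assume "h x < a"
    then obtain a' where a': "a' < a" "h x < a'" using dense by blast
    from order_tendstoD(2)[OF c a'(2)] obtain S where S: "open S" "x \<in> S" "\<And>u. u \<in> S \<Longrightarrow> h u < a'"
      by (auto simp: eventually_nhds)
    show "\<forall>\<^sub>F k in sequentially. ?av k < a"
      using small[OF S(1,2)]
    proof eventually_elim
      fix k assume k: "?b k \<subseteq> S"
      have "?av k \<le>
        (\<integral>\<^sup>+u. a' * ind (?b k) u \<partial>m) / emeasure m (?b k)"
        using k S(3) by (intro divide_right_mono_ennreal nn_integral_mono) (auto simp: indicator_def less_imp_le)
      also have "\<dots> = a'" by (rule const) simp
      finally show "?av k < a"
        using a'(1) by (simp del: of_nat_Suc)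
    qed
  qed
qed

end

text \<open>The radius \<open>3/8 r\<close> is \<open>a r/2\<close> for \<open>a = 3/4\<close>.\<close>

definition F1_const :: "'a::metric_space measure \<Rightarrow> ('w, 'a) proc \<Rightarrow> ('a \<Rightarrow> 'a \<Rightarrow> real) \<Rightarrow> 'a \<Rightarrow> real \<Rightarrow> real \<Rightarrow> bool" where
  "F1_const m X j z0 R C \<longleftrightarrow> (\<forall>r D f. 0 < r \<and> r \<le> R \<and> open D \<and> D \<subseteq> ball z0 r \<and> regular_harmonic X D f \<and>
     (\<forall>x\<in>ball z0 r \<inter> (- closure D \<union> reg_points X D). f x = 0) \<longrightarrow>
     (\<forall>x\<in>D \<inter> ball z0 (r / 8).
        let I = expct X x (exit_time X D) * (\<integral>\<^sup>+y\<in>- closure (ball z0 (3 / 8 * r)). ennreal (j z0 y) * f y \<partial>m)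
        in ennreal (inverse C) * I \<le> f x \<and> f x \<le> ennreal C * I))"

text \<open>F1 covers radii strictly below its own; one step inside, the range of radii becomes
  closed.\<close>

lemma F1_const_exists:
  assumes F1: "F1 m X j z0 R'" and R: "ereal R < R'"
  shows "\<exists>C\<ge>1. F1_const m X j z0 R C"
proof -
  have less: "ereal r < R'" if "r \<le> R" for r using that by (intro le_less_trans[OF _ R]) simp
  have 8: "3 / 4 * r / 2 = 3 / 8 * r" for r :: real by simp
  have "1 / 2 < (3 / 4 :: real) \<and> 3 / 4 < (1 :: real)" by simp
  from F1[unfolded F1_def, THEN spec, THEN mp, OF this] show ?thesis
    unfolding 8
    apply (elim ex_forward conj_forward)
     apply assumption
    subgoal premises H for C
      unfolding F1_const_def by (intro allI impI ballI, rule H[THEN spec, THEN spec, THEN spec, THEN mp, THEN bspec]) (use less in auto)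
    done
qed

text \<open>The hypotheses at one radius \<open>R1\<close>, small enough to keep \<open>x0\<close>
  outside the closed ball. \<open>C\<close> is the F1 constant of the dual process, and
  \<open>c\<close> the C1 constant for radii of ratio 2. \<open>M_cont\<close> is the trace of the
  Martin compactification: continuity of the normalised Green function in its pole.\<close>

locale martin_setup =
  XP: levy_proc TY X m j + YP: levy_proc TY Xh m jh
  for TY :: "'a::{metric_space, second_countable_topology} itself"
    and X :: "('w, 'a) proc" and Xh :: "('v, 'a) proc" and m j jh +
  fixes D :: "'a set" and G :: "'a \<Rightarrow> 'a \<Rightarrow> ennreal" and z0 x0 :: 'a and R1 C c :: real
  assumes D: "open D" "x0 \<in> D" "z0 \<in> frontier D"
    and G_meas: "(\<lambda>(x, y). G x y) \<in> borel_measurable (borel \<Otimes>\<^sub>M borel)"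
    and G_off: "x \<notin> D \<or> y \<notin> D \<Longrightarrow> G x y = 0"
    and G_fin: "x \<noteq> y \<Longrightarrow> G x y < \<infinity>"
    and green_X: "f \<in> bfun \<Longrightarrow> x \<in> D \<Longrightarrow> XP.Uop D f x = (\<integral>\<^sup>+y. G x y * f y \<partial>m)"
    and green_Y: "f \<in> bfun \<Longrightarrow> y \<in> D \<Longrightarrow> YP.Uop D f y = (\<integral>\<^sup>+x. G x y * f x \<partial>m)"
    and j_dual: "x \<noteq> y \<Longrightarrow> j x y = jh y x" and j_pos: "x \<noteq> y \<Longrightarrow> 0 < j x y"
    and R1: "0 < R1" "R1 < dist z0 x0"
    and C: "1 \<le> C"
    and F1: "F1_const m Xh jh z0 R1 C"
    and M_cont: "y \<in> D \<Longrightarrow> y \<noteq> x0 \<Longrightarrow> continuous_on D (\<lambda>x. G x y / G x0 y)"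
    and c: "0 < c"
    and C1: "\<lbrakk>0 < r; 2 * r \<le> R1; x \<in> ball z0 r; y \<notin> ball z0 (2 * r)\<rbrakk> \<Longrightarrow>
        inverse c * jh z0 y \<le> jh x y \<and> jh x y \<le> c * jh z0 y"
    and E1: "\<lbrakk>0 < q; q < R1; 1 < eta\<rbrakk> \<Longrightarrow> \<exists>\<delta>>0. \<forall>u v. dist z0 u < \<delta> \<and> u \<noteq> z0 \<and> q < dist z0 v \<longrightarrow>
        j v u \<le> eta * j v z0 \<and> j v z0 \<le> eta * j v u"
begin

abbreviation cb :: "real \<Rightarrow> 'a set" where "cb r \<equiv> closure (ball z0 (3 / 8 * r))"

lemma z0_notin: "z0 \<notin> D"
  using D(1,3) by (simp add: frontier_def interior_open)

definition Dr :: "real \<Rightarrow> 'a set" where "Dr r = D \<inter> ball z0 r"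

lemma Dr_simps: "open (Dr r)" "Dr r \<subseteq> D" "Dr r \<subseteq> ball z0 r"
  using D by (auto simp: Dr_def)

lemma Dr_mono: "r \<le> s \<Longrightarrow> Dr r \<subseteq> Dr s"
  by (auto simp: Dr_def)

lemma Dr_nonempty: "0 < r \<Longrightarrow> Dr r \<noteq> {}"
proof -
  assume "0 < r"
  have "z0 \<in> closure D" using D(3) by (simp add: frontier_def)
  then obtain y where "y \<in> D" "dist y z0 < r" using \<open>0 < r\<close> closure_approachable by blast
  then show ?thesis by (auto simp: Dr_def dist_commute)
qed

definition fpot :: "('a \<Rightarrow> ennreal) \<Rightarrow> 'a \<Rightarrow> ennreal" where
  "fpot phi y = (\<integral>\<^sup>+x. G x y * phi x \<partial>m)"

lemma measurable_G [measurable]: "(\<lambda>z. G (fst z) (snd z)) \<in> borel_measurable (borel \<Otimes>\<^sub>M borel)"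
  using G_meas by (simp add: case_prod_beta')

lemma measurable_G1 [measurable]: "(\<lambda>x. G x y) \<in> bfun"
  using measurable_compose[OF _ measurable_G, of "\<lambda>u. (u, y)" borel] by simp

lemma measurable_G2 [measurable]: "(\<lambda>y. G x y) \<in> bfun"
  using measurable_compose[OF _ measurable_G, of "\<lambda>u. (x, u)" borel] by simp

lemma pair_m_cong: "measurable (m \<Otimes>\<^sub>M m) N = measurable (borel \<Otimes>\<^sub>M borel) N"
  "measurable (borel \<Otimes>\<^sub>M m) N = measurable (borel \<Otimes>\<^sub>M borel) N"
  by (intro measurable_cong_sets sets_pair_measure_cong XP.sets_m refl)+

lemma fpot_Uop: "phi \<in> bfun \<Longrightarrow> YP.Uop D phi y = fpot phi y"
  unfolding fpot_def by (cases "y \<in> D") (auto simp: green_Y YP.Rop_outside G_off)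

lemma XUop: "f \<in> bfun \<Longrightarrow> XP.Uop D f x = (\<integral>\<^sup>+y. G x y * f y \<partial>m)"
  by (cases "x \<in> D") (auto simp: green_X XP.Rop_outside G_off)

lemma fpot_off: "y \<notin> D \<Longrightarrow> fpot phi y = 0"
  by (simp add: fpot_def G_off)

lemma measurable_fpot [measurable]:
  assumes "phi \<in> bfun"
  shows "fpot phi \<in> bfun"
proof -
  have "YP.Uop D phi = fpot phi" using fpot_Uop[OF assms] by (rule ext)
  then show ?thesis using YP.measurable_Rop[OF assms, of D 0] by simp
qed

text \<open>The mean exit time of the dual process (see \<open>Uop_1\<close>): the factor in F1 that
  depends on the point only.\<close>

definition et :: "real \<Rightarrow> 'a \<Rightarrow> ennreal" where
  "et r y = YP.Uop (Dr r) (\<lambda>_. 1) y"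

text \<open>The factor in F1 that depends on the function only. At \<open>r = 0\<close> the removed
  set is empty.\<close>

definition Jr :: "real \<Rightarrow> ('a \<Rightarrow> ennreal) \<Rightarrow> ennreal" where
  "Jr r f = (\<integral>\<^sup>+w. ennreal (jh z0 w) * (ind (- cb r) w * f w) \<partial>m)"

lemma et_pos: "y \<in> Dr r \<Longrightarrow> 0 < et r y"
  unfolding et_def using Dr_simps by (intro YP.Uop_positive) auto

text \<open>F1 without the finiteness requirement, by truncation of the boundary values.\<close>

lemma F1_Hop:
  assumes r: "0 < r" "r \<le> R1" and g [measurable]: "g \<in> bfun"
    and g0: "\<And>y. y \<in> ball z0 r \<Longrightarrow> g y = 0" and y: "y \<in> Dr (r / 8)"
  shows "ennreal (inverse C) * (et r y * Jr r (YP.Hop (Dr r) g)) \<le> YP.Hop (Dr r) g y"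
    and "YP.Hop (Dr r) g y \<le> ennreal C * (et r y * Jr r (YP.Hop (Dr r) g))"
proof -
  define gn where "gn n v = min (g v) (of_nat n)" for n v
  have gn [measurable]: "gn n \<in> bfun" for n unfolding gn_def by measurable
  have inc: "incseq gn" by (auto simp: incseq_def le_fun_def gn_def min.coboundedI2)
  define H where "H n = YP.Hop (Dr r) (gn n)" for n
  have H [measurable]: "H n \<in> bfun" for n unfolding H_def by measurable
  have incH: "incseq H" unfolding H_def incseq_def le_fun_def
    using inc by (auto intro!: YP.Hop_mono simp: incseq_def le_fun_def)
  have yr: "y \<in> Dr r" using y r Dr_mono[of "r / 8" r] by auto
  have et: "expct Xh y (exit_time Xh (Dr r)) = et r y"
    unfolding et_def by (rule YP.expct_exit_time[OF Dr_simps(1) yr])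
  have fin: "ennreal (inverse C) * (et r y * Jr r (H n)) \<le> H n y \<and> H n y \<le> ennreal C * (et r y * Jr r (H n))" for n
  proof -
    have "regular_harmonic Xh (Dr r) (H n)"
      unfolding regular_harmonic_def
    proof (intro conjI allI ballI)
      show "H n \<in> bfun" by measurable
      fix v
      have "H n v \<le> YP.Hop (Dr r) (\<lambda>_. of_nat n) v" unfolding H_def by (rule YP.Hop_mono) (simp add: gn_def)
      also have "\<dots> \<le> of_nat n * 1" using mult_left_mono[OF YP.emeasure_hm[of "Dr r" v], of "of_nat n"] by (simp add: YP.Hop_hm)
      finally show "H n v < \<infinity>" using of_nat_less_top[of n] by (simp add: less_top[symmetric] top_unique) (metis le_less_trans of_nat_less_top top.not_eq_extremum)
    next
      fix v assume v: "v \<in> Dr r"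
      have "H n v = YP.Hop (Dr r) (H n) v"
        unfolding H_def by (rule YP.Hop_outside_cong[OF Dr_simps(1)]) (simp add: YP.Hop_at_outside)
      then show "H n v = expct Xh v (\<lambda>w. if exit_time Xh (Dr r) w < lifetime Xh w then ext0 (H n) (path Xh (exit_time Xh (Dr r) w) w) else 0)"
        by (simp add: YP.expct_exit[OF Dr_simps(1) v])
    qed
    \<comment> \<open>Neither kind of point lies in the open set \<open>Dr r\<close>, and off that
      set the exit operator returns its argument, here a function that vanishes in the ball.\<close>
    moreover have "\<forall>x\<in>ball z0 r \<inter> (- closure (Dr r) \<union> reg_points Xh (Dr r)). H n x = 0"
    proof
      fix v assume v: "v \<in> ball z0 r \<inter> (- closure (Dr r) \<union> reg_points Xh (Dr r))"
      then have "v \<notin> Dr r" using Dr_simps(1)[of r] closure_subset[of "Dr r"]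
        by (auto simp: reg_points_def frontier_def interior_open)
      then show "H n v = 0" using g0 v by (simp add: H_def YP.Hop_at_outside gn_def)
    qed
    moreover have "y \<in> Dr r \<inter> ball z0 (r / 8)" using y yr by (auto simp: Dr_def)
    ultimately have "ennreal (inverse C) * (et r y *
        (\<integral>\<^sup>+y\<in>- cb r. ennreal (jh z0 y) * H n y \<partial>m)) \<le> H n y \<and>
      H n y \<le> ennreal C * (et r y * (\<integral>\<^sup>+y\<in>- cb r. ennreal (jh z0 y) * H n y \<partial>m))"
      using F1[unfolded F1_const_def Let_def, rule_format, of r "Dr r" "H n" y] r Dr_simps(1,3)[of r] unfolding et by blast
    moreover have "(\<integral>\<^sup>+y\<in>- cb r. ennreal (jh z0 y) * H n y \<partial>m) = Jr r (H n)"
      unfolding Jr_def by (intro nn_integral_cong) (simp add: mult_ac)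
    ultimately show ?thesis by simp
  qed
  have g_SUP: "(\<lambda>v. SUP n. gn n v) = g" by (simp add: gn_def YP.SUP_min_nat fun_eq_iff)
  have Hop_SUP: "YP.Hop (Dr r) g v = (SUP n. H n v)" for v
    unfolding H_def YP.Hop_SUP[OF inc gn, symmetric] g_SUP ..
  have Jr_SUP: "Jr r (YP.Hop (Dr r) g) = (SUP n. Jr r (H n))"
  proof -
    have "Jr r (YP.Hop (Dr r) g) = (\<integral>\<^sup>+w. (SUP n. ennreal (jh z0 w) * (ind (- cb r) w * H n w)) \<partial>m)"
      unfolding Jr_def Hop_SUP by (simp add: SUP_mult_left_ennreal)
    also have "\<dots> = (SUP n. Jr r (H n))"
      unfolding Jr_def
    proof (rule nn_integral_monotone_convergence_SUP)
      show "incseq (\<lambda>n w. ennreal (jh z0 w) * (ind (- cb r) w * H n w))"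
        using incH by (auto simp: incseq_def le_fun_def intro!: mult_left_mono)
    qed simp
    finally show ?thesis .
  qed
  have "ennreal (inverse C) * (et r y * Jr r (YP.Hop (Dr r) g)) = (SUP n. ennreal (inverse C) * (et r y * Jr r (H n)))"
    unfolding Jr_SUP by (simp add: SUP_mult_left_ennreal)
  also have "\<dots> \<le> (SUP n. H n y)" using fin by (intro SUP_mono) blast
  finally show "ennreal (inverse C) * (et r y * Jr r (YP.Hop (Dr r) g)) \<le> YP.Hop (Dr r) g y" unfolding Hop_SUP .
  have "(SUP n. H n y) \<le> (SUP n. ennreal C * (et r y * Jr r (H n)))" using fin by (intro SUP_mono) blast
  also have "\<dots> = ennreal C * (et r y * Jr r (YP.Hop (Dr r) g))"
    unfolding Jr_SUP by (simp add: SUP_mult_left_ennreal)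
  finally show "YP.Hop (Dr r) g y \<le> ennreal C * (et r y * Jr r (YP.Hop (Dr r) g))" unfolding Hop_SUP .
qed

text \<open>An exit from \<open>Dr r\<close> that stays in \<open>ball z0 r\<close> is an exit from
  \<open>D\<close>, where \<open>g\<close> vanishes.\<close>

lemma Hop_Dr_restrict:
  assumes "\<And>v. v \<notin> D \<Longrightarrow> g v = 0"
  shows "YP.Hop (Dr r) g y = YP.Hop (Dr r) (\<lambda>v. ind (- ball z0 r) v * g v) y"
  by (rule YP.Hop_outside_cong[OF Dr_simps(1)]) (use assms in \<open>auto simp: Dr_def indicator_def\<close>)

lemma fpot_split:
  assumes "phi \<in> bfun"
  shows "fpot phi y = YP.Uop (Dr r) phi y + YP.Hop (Dr r) (fpot phi) y"
  using YP.Uop_split[OF D(1) Dr_simps(1,2) assms, of y r] fpot_Uop[OF assms]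
  by (simp add: fpot_Uop[OF assms, abs_def])

lemma fpot_harmonic:
  assumes phi: "phi \<in> bfun" "\<And>x. x \<in> Dr r \<Longrightarrow> phi x = 0"
  shows "YP.Hop (Dr r) (\<lambda>v. ind (- ball z0 r) v * fpot phi v) = fpot phi"
proof
  fix y
  have "YP.Uop (Dr r) phi y = YP.Uop (Dr r) (\<lambda>_. 0) y" by (rule YP.Rop_cong) (rule phi(2))
  also have "\<dots> = 0" by (simp add: YP.Rop_om)
  finally have "fpot phi y = YP.Hop (Dr r) (fpot phi) y" using fpot_split[OF phi(1), of y r] by simp
  then show "YP.Hop (Dr r) (\<lambda>v. ind (- ball z0 r) v * fpot phi v) y = fpot phi y"
    using Hop_Dr_restrict[of "fpot phi" r y] by (simp add: fpot_off)
qed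

lemma F1_fpot:
  assumes r: "0 < r" "r \<le> R1" and phi: "phi \<in> bfun" "\<And>x. x \<in> Dr r \<Longrightarrow> phi x = 0" and y: "y \<in> Dr (r / 8)"
  shows "ennreal (inverse C) * (et r y * Jr r (fpot phi)) \<le> fpot phi y"
    and "fpot phi y \<le> ennreal C * (et r y * Jr r (fpot phi))"
proof -
  note [measurable] = phi(1)
  define g where "g v = ind (- ball z0 r) v * fpot phi v" for v
  have g: "g \<in> bfun" "\<And>v. v \<in> ball z0 r \<Longrightarrow> g v = 0" unfolding g_def by simp_all
  have eq: "YP.Hop (Dr r) g = fpot phi" unfolding g_def by (rule fpot_harmonic[OF phi])
  show "ennreal (inverse C) * (et r y * Jr r (fpot phi)) \<le> fpot phi y" "fpot phi y \<le> ennreal C * (et r y * Jr r (fpot phi))"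
    using F1_Hop[OF r g y] unfolding eq by auto
qed

text \<open>The product of the two mean exit times and the two functionals does not depend on which
  point is paired with which function. So the four bounds, each costing a factor \<open>C\<close>,
  can be cross-multiplied.\<close>

lemma bhp_algebra:
  fixes f1 f2 f1' f2' e e' J1 J2 :: ennreal
  assumes "f1 \<le> ennreal C * (e * J1)" "f2' \<le> ennreal C * (e' * J2)"
    "ennreal (inverse C) * (e' * J1) \<le> f1'" "ennreal (inverse C) * (e * J2) \<le> f2"
  shows "f1 * f2' \<le> ennreal (C ^ 4) * (f1' * f2)"
proof -
  have CC: "ennreal C * ennreal (inverse C) = 1" using C by (simp add: ennreal_mult[symmetric])
  have cancel: "ennreal C * (ennreal (inverse C) * a) = a" for a by (simp add: mult.assoc[symmetric] CC)
  have "f1 * f2' \<le> (ennreal C * (e * J1)) * (ennreal C * (e' * J2))" by (rule mult_mono) (use assms in auto)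
  also have "\<dots> = (ennreal C * ennreal C) * ((e' * J1) * (e * J2))" by (simp add: mult_ac)
  also have "(e' * J1) * (e * J2) = (ennreal C * (ennreal (inverse C) * (e' * J1))) * (ennreal C * (ennreal (inverse C) * (e * J2)))"
    unfolding cancel ..
  also have "\<dots> \<le> (ennreal C * f1') * (ennreal C * f2)"
    by (intro mult_mono mult_left_mono) (use assms in auto)
  finally have "f1 * f2' \<le> (ennreal C * ennreal C) * ((ennreal C * f1') * (ennreal C * f2))" by (simp add: mult_left_mono)
  also have "\<dots> = ennreal C ^ 4 * (f1' * f2)" by (simp add: power4_eq_xxxx mult_ac)
  also have "ennreal C ^ 4 = ennreal (C ^ 4)" using C by (intro ennreal_power) simp
  finally show ?thesis .
qed

lemma BHP_Hop:
  assumes r: "0 < r" "r \<le> R1" and g: "g1 \<in> bfun" "g2 \<in> bfun"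
    "\<And>y. y \<in> ball z0 r \<Longrightarrow> g1 y = 0" "\<And>y. y \<in> ball z0 r \<Longrightarrow> g2 y = 0" and y: "y \<in> Dr (r / 8)" "y' \<in> Dr (r / 8)"
  shows "YP.Hop (Dr r) g1 y * YP.Hop (Dr r) g2 y' \<le> ennreal (C ^ 4) * (YP.Hop (Dr r) g1 y' * YP.Hop (Dr r) g2 y)"
  by (rule bhp_algebra[OF F1_Hop(2)[OF r g(1,3) y(1)] F1_Hop(2)[OF r g(2,4) y(2)] F1_Hop(1)[OF r g(1,3) y(2)] F1_Hop(1)[OF r g(2,4) y(1)]])

lemma BHP_fpot:
  assumes r: "0 < r" "r \<le> R1" and g: "g1 \<in> bfun" "g2 \<in> bfun"
    "\<And>y. y \<in> Dr r \<Longrightarrow> g1 y = 0" "\<And>y. y \<in> Dr r \<Longrightarrow> g2 y = 0" and y: "y \<in> Dr (r / 8)" "y' \<in> Dr (r / 8)"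
  shows "fpot g1 y * fpot g2 y' \<le> ennreal (C ^ 4) * (fpot g1 y' * fpot g2 y)"
  by (rule bhp_algebra[OF F1_fpot(2)[OF r g(1,3) y(1)] F1_fpot(2)[OF r g(2,4) y(2)] F1_fpot(1)[OF r g(1,3) y(2)] F1_fpot(1)[OF r g(2,4) y(1)]])

text \<open>The set \<open>D\<close> may be disconnected, with \<open>O'\<close> far from
  \<open>x\<close>. Since the jump density is positive, the process can jump from a small ball
  around \<open>x\<close> directly into a small ball in \<open>O'\<close>, where the potential is
  positive.\<close>

lemma Green_mass_pos:
  assumes x: "x \<in> D" and O: "open O'" "O' \<noteq> {}" "O' \<subseteq> D"
  shows "0 < (\<integral>\<^sup>+y. G x y * ind O' y \<partial>m)"
proof -
  have ind: "(ind O') \<in> bfun" using O by simp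
  have U: "XP.Uop D (ind O') v = (\<integral>\<^sup>+y. G v y * ind O' y \<partial>m)" for v by (rule XUop[OF ind])
  have inO: "0 < XP.Uop D (ind O') v" if "v \<in> O'" for v
  proof -
    have "0 < XP.Uop O' (ind O') v" by (rule XP.Uop_positive[OF O(1) that ind]) auto
    also have "\<dots> \<le> XP.Uop D (ind O') v"
      using XP.Uop_split[OF D(1) O(1,3) ind, of v] by simp
    finally show ?thesis .
  qed
  show ?thesis
  proof (cases "x \<in> O'")
    case True then show ?thesis using inO[OF True] U by simp
  next
    case False
    obtain o' where o: "o' \<in> O'" using O by auto
    have "o' \<noteq> x" using o False by auto
    obtain e where e: "0 < e" "ball o' e \<subseteq> O'" using O(1) o by (meson open_contains_ball)
    obtain e' where e': "0 < e'" "ball x e' \<subseteq> D" using D(1) x by (meson open_contains_ball)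
    define d where "d = min (min e e') (dist x o') / 3"
    have d: "0 < d" using e e' \<open>o' \<noteq> x\<close> by (simp add: d_def)
    have d_le: "3 * d \<le> e" "3 * d \<le> e'" "3 * d \<le> dist x o'" by (auto simp: d_def)
    let ?W = "ball x d" and ?S = "ball o' d"
    have WD: "?W \<subseteq> D" using e'(2) d_le d subset_ball[of d e' x] by auto
    have SO: "?S \<subseteq> O'" using e(2) d_le d subset_ball[of d e o'] by auto
    have clW: "closure ?W \<subseteq> cball x d" by (rule closure_minimal) auto
    have disj: "?S \<inter> closure ?W = {}"
    proof -
      have False if "v \<in> ?S" "v \<in> cball x d" for v
        using that d_le(3) d dist_triangle[of x o' v] by (auto simp: dist_commute)
      then show ?thesis using clW by blast
    qed
    have cpt: "compact (closure ?W)"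
      using clW by (intro XP.heine_borel bounded_subset[OF _ clW]) auto
    define g where "g = XP.Uop D (ind O')"
    have g [measurable]: "g \<in> bfun" unfolding g_def by (rule XP.measurable_Rop[OF ind])
    have gS: "(\<lambda>v. ind ?S v * g v) \<in> bfun"
      by (rule borel_measurable_times_ennreal[OF borel_measurable_indicator[OF borel_open[OF open_ball]] g])
    have jgS: "(\<lambda>v. ennreal (j u v) * (ind ?S v * g v)) \<in> bfun" for u
      by (rule borel_measurable_times_ennreal[OF measurable_compose[OF XP.measurable_j_right measurable_ennreal] gS])
    have "0 < XP.Uop ?W (\<lambda>u. \<integral>\<^sup>+v. ennreal (j u v) * (ind ?S v * g v) \<partial>m) x"
    proof (rule XP.Uop_positive)
      from gS
      show "(\<lambda>u. \<integral>\<^sup>+v. ennreal (j u v) * (ind ?S v * g v) \<partial>m) \<in> bfun"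
        by (rule XP.measurable_jint)
      fix u assume u: "u \<in> ?W"
      show "0 < (\<integral>\<^sup>+v. ennreal (j u v) * (ind ?S v * g v) \<partial>m)"
      proof (rule ccontr)
        assume "\<not> 0 < (\<integral>\<^sup>+v. ennreal (j u v) * (ind ?S v * g v) \<partial>m)"
        then have "(\<integral>\<^sup>+v. ennreal (j u v) * (ind ?S v * g v) \<partial>m) = 0" by (simp add: not_gr_zero)
        then have "AE v in m. ennreal (j u v) * (ind ?S v * g v) = 0"
          by (subst (asm) nn_integral_0_iff_AE) (simp_all add: jgS)
        then have "AE v in m. v \<notin> ?S"
        proof eventually_elim
          fix v assume z: "ennreal (j u v) * (ind ?S v * g v) = 0"
          show "v \<notin> ?S"
          proof
            assume v: "v \<in> ?S"
            then have "u \<noteq> v" using disj u closure_subset[of ?W] by blast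
            then have "0 < j u v" by (rule j_pos)
            moreover have "0 < g v" unfolding g_def using inO SO v by auto
            ultimately show False using z v by (simp add: indicator_def)
          qed
        qed
        then have "emeasure m ?S = 0" by (subst (asm) AE_iff_measurable[of ?S]) (auto simp: XP.sets_m)
        then show False using XP.emeasure_ball(1)[OF d, of o'] by simp
      qed
    qed (use d in auto)
    also have "\<dots> = XP.Hop ?W (\<lambda>v. ind ?S v * g v) x"
      by (rule XP.Hop_levy[OF open_ball cpt _ borel_open[OF open_ball] disj g, symmetric]) (use d in simp)
    also have "\<dots> \<le> XP.Hop ?W g x" by (rule XP.Hop_mono) (auto simp: indicator_def)
    also have "\<dots> \<le> g x" unfolding g_def using XP.Uop_split[OF D(1) open_ball WD ind, of x] by simp
    finally show ?thesis using U unfolding g_def by simp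
  qed
qed

text \<open>The Fubini partner of \<open>Jr\<close> (see \<open>Jr_fpot\<close>). By duality of the
  jump densities \<open>kap 0 x\<close> is the Poisson kernel of \<open>D\<close> at
  \<open>z0\<close>.\<close>

definition kap :: "real \<Rightarrow> 'a \<Rightarrow> ennreal" where
  "kap r x = (\<integral>\<^sup>+w. ennreal (jh z0 w) * (ind (- cb r) w * G x w) \<partial>m)"

lemma Jr_fpot:
  assumes [measurable]: "phi \<in> bfun"
  shows "Jr r (fpot phi) = (\<integral>\<^sup>+x. kap r x * phi x \<partial>m)"
proof -
  interpret P: pair_sigma_finite m m
    by (simp add: pair_sigma_finite_def XP.sigma_finite_m)
  let ?F = "\<lambda>x w. ennreal (jh z0 w) * (ind (- cb r) w * G x w) * phi x"
  have "Jr r (fpot phi) = (\<integral>\<^sup>+w. \<integral>\<^sup>+x. ?F x w \<partial>m \<partial>m)"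
    unfolding Jr_def fpot_def
  proof (rule nn_integral_cong)
    fix w
    have "ennreal (jh z0 w) * (ind (- cb r) w * (\<integral>\<^sup>+x. G x w * phi x \<partial>m)) =
      (ennreal (jh z0 w) * ind (- cb r) w) * (\<integral>\<^sup>+x. G x w * phi x \<partial>m)"
      by (simp only: mult.assoc)
    also have "\<dots> = (\<integral>\<^sup>+x. (ennreal (jh z0 w) * ind (- cb r) w) * (G x w * phi x) \<partial>m)"
      by (rule nn_integral_cmult[symmetric]) simp
    finally show "ennreal (jh z0 w) * (ind (- cb r) w * (\<integral>\<^sup>+x. G x w * phi x \<partial>m)) =
      (\<integral>\<^sup>+x. ?F x w \<partial>m)"
      by (simp only: mult.assoc)
  qed
  also have "\<dots> = (\<integral>\<^sup>+x. \<integral>\<^sup>+w. ?F x w \<partial>m \<partial>m)"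
    by (rule P.Fubini') (simp add: case_prod_beta' pair_m_cong)
  also have "\<dots> = (\<integral>\<^sup>+x. kap r x * phi x \<partial>m)"
    unfolding kap_def by (intro nn_integral_cong nn_integral_multc) simp
  finally show ?thesis .
qed

lemma measurable_kap [measurable]: "kap r \<in> bfun"
proof -
  interpret sigma_finite_measure m by (rule XP.sigma_finite_m)
  have "(\<lambda>z. ennreal (jh z0 (snd z)) * (ind (- cb r) (snd z) * G (fst z) (snd z))) \<in> borel_measurable (borel \<Otimes>\<^sub>M m)"
    unfolding pair_m_cong by measurable
  from borel_measurable_nn_integral[of "\<lambda>x w. ennreal (jh z0 w) * (ind (- cb r) w * G x w)" borel] this
  show ?thesis unfolding kap_def by (simp add: case_prod_beta')
qed

lemma kap_pos:
  assumes x: "x \<in> D" and r: "0 < r" "r \<le> R1"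
  shows "0 < kap r x"
proof (rule ccontr)
  assume "\<not> 0 < kap r x"
  then have "kap r x = 0" by (simp add: not_gr_zero)
  then have "AE w in m. ennreal (jh z0 w) * (ind (- cb r) w * G x w) = 0"
    unfolding kap_def by (subst (asm) nn_integral_0_iff_AE) simp_all
  moreover define O' where "O' = D - cball z0 (3 / 8 * r)"
  have cl: "cb r \<subseteq> cball z0 (3 / 8 * r)" by (rule closure_minimal) auto
  have "AE w in m. G x w * ind O' w = 0"
    using calculation
  proof eventually_elim
    fix w assume z: "ennreal (jh z0 w) * (ind (- cb r) w * G x w) = 0"
    show "G x w * ind O' w = 0"
    proof (cases "w \<in> O'")
      case True
      then have "w \<noteq> z0" using z0_notin by (auto simp: O'_def)
      then have "0 < jh z0 w" using j_dual[of w z0] j_pos[of w z0] by simp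
      moreover have "w \<notin> cb r" using True cl by (auto simp: O'_def)
      ultimately show ?thesis using z by (auto simp: indicator_def)
    qed simp
  qed
  then have "(\<integral>\<^sup>+w. G x w * ind O' w \<partial>m) = 0"
  proof -
    assume *: "AE w in m. G x w * ind O' w = 0"
    have "(\<integral>\<^sup>+w. G x w * ind O' w \<partial>m) = (\<integral>\<^sup>+w. 0 \<partial>m)" by (rule nn_integral_cong_AE[OF *])
    then show ?thesis by simp
  qed
  moreover have "0 < (\<integral>\<^sup>+w. G x w * ind O' w \<partial>m)"
  proof (rule Green_mass_pos[OF x])
    show "open O'" using D(1) by (auto simp: O'_def open_Diff)
    show "O' \<noteq> {}" using D(2) R1 r by (auto simp: O'_def)
  qed (auto simp: O'_def)
  ultimately show False by simp
qed

lemma Jr_fpot_pos: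
  assumes r: "0 < r" "r \<le> R1" and B: "B \<in> sets borel" "B \<subseteq> D" "0 < emeasure m B"
  shows "0 < Jr r (fpot (ind B))"
proof (rule ccontr)
  assume "\<not> 0 < Jr r (fpot (ind B))"
  then have "(\<integral>\<^sup>+x. kap r x * ind B x \<partial>m) = 0" using B(1) by (simp add: Jr_fpot not_gr_zero)
  then have "AE x in m. kap r x * ind B x = 0"
    using B(1) by (subst (asm) nn_integral_0_iff_AE) simp_all
  then have "AE x in m. x \<notin> B"
    by eventually_elim (use kap_pos[OF _ r] B(2) in \<open>force simp: indicator_def split: if_splits\<close>)
  then have "emeasure m B = 0" using B(1) by (subst (asm) AE_iff_measurable[of B]) (auto simp: XP.sets_m)
  then show False using B(3) by simp
qed

lemma fpot_pos:
  assumes r: "0 < r" "r \<le> R1" and B: "B \<in> sets borel" "B \<subseteq> D" "B \<inter> Dr r = {}" "0 < emeasure m B" and y: "y \<in> Dr (r / 8)"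
  shows "0 < fpot (ind B) y"
proof -
  have "0 < ennreal (inverse C) * (et r y * Jr r (fpot (ind B)))"
    using C Jr_fpot_pos[OF r B(1,2,4)] et_pos[of y r] y Dr_mono[of "r / 8" r] r by (auto simp: ennreal_zero_less_mult_iff)
  also have "\<dots> \<le> fpot (ind B) y"
    by (rule F1_fpot(1)[OF r _ _ y]) (use B in \<open>auto simp: indicator_def\<close>)
  finally show ?thesis .
qed

lemma x0_far: "y \<in> Dr R1 \<Longrightarrow> y \<noteq> x0"
  using R1 by (auto simp: Dr_def)

text \<open>In \<open>ennreal\<close>, \<open>0 / 0 = 0\<close>, while a nonzero number divided by 0
  is infinite. If \<open>G x0 y\<close> were 0, continuity of the quotient at \<open>x0\<close>
  would force \<open>G x y = 0\<close> for all \<open>x\<close> near \<open>x0\<close>, against the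
  positivity of the potential of a small set around \<open>x0\<close>.\<close>

lemma G_x0_pos:
  assumes y: "y \<in> Dr (R1 / 8)"
  shows "0 < G x0 y" "G x0 y < \<infinity>"
proof -
  have yD: "y \<in> D" "y \<noteq> x0" using y x0_far Dr_mono[of "R1 / 8" R1] R1 by (auto simp: Dr_def)
  then show "G x0 y < \<infinity>" using G_fin by metis
  show "0 < G x0 y"
  proof (rule ccontr)
    assume "\<not> 0 < G x0 y"
    then have G0: "G x0 y = 0" by (simp add: not_gr_zero)
    have "continuous_on D (\<lambda>x. G x y / G x0 y)" by (rule M_cont[OF yD])
    then have "isCont (\<lambda>x. G x y / G x0 y) x0" using D by (simp add: continuous_on_eq_continuous_at)
    then have "((\<lambda>x. G x y / G x0 y) \<longlongrightarrow> G x0 y / G x0 y) (nhds x0)"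
      unfolding isCont_def tendsto_at_iff_tendsto_nhds[of "\<lambda>x. G x y / G x0 y" x0] .
    moreover have "G x0 y / G x0 y = 0" by (simp add: G0)
    ultimately have "((\<lambda>x. G x y / G x0 y) \<longlongrightarrow> 0) (nhds x0)" by (simp only:)
    then have "eventually (\<lambda>x. G x y / G x0 y < 1) (nhds x0)" by (rule order_tendstoD) simp
    then obtain S where S: "open S" "x0 \<in> S" "\<And>x. x \<in> S \<Longrightarrow> G x y / G x0 y < 1" by (auto simp: eventually_nhds)
    have zero: "G x y = 0" if "x \<in> S" for x
      using S(3)[OF that] by (cases "G x y = 0") (auto simp: G0 ennreal_divide_zero divide_ennreal_def ennreal_mult_top)
    define B where "B = S \<inter> (D - cball z0 R1)"
    have B: "open B" "x0 \<in> B" using S D R1 by (auto simp: B_def open_Diff)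
    have "0 < fpot (ind B) y"
    proof (rule fpot_pos[OF R1(1) _ _ _ _ _ y])
      show "0 < emeasure m B" using B by (intro XP.open_m) auto
    qed (use B in \<open>auto simp: B_def Dr_def\<close>)
    moreover have "fpot (ind B) y = (\<integral>\<^sup>+x. 0 \<partial>m)"
      unfolding fpot_def by (intro nn_integral_cong) (auto simp: B_def zero indicator_def)
    ultimately show False by simp
  qed
qed

lemma G_cont:
  assumes y: "y \<in> Dr (R1 / 8)"
  shows "continuous_on D (\<lambda>x. G x y)"
proof -
  have yD: "y \<in> D" "y \<noteq> x0" using y x0_far Dr_mono[of "R1 / 8" R1] R1 by (auto simp: Dr_def)
  note g0 = G_x0_pos[OF y]
  have "G x y = (G x y / G x0 y) * G x0 y" for x
    using g0 by (simp add: ennreal_divide_times ennreal_divide_self less_top[symmetric])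
  moreover have "continuous_on D (\<lambda>x. (G x y / G x0 y) * G x0 y)"
    using M_cont[OF yD] g0 unfolding continuous_on_def
    by (intro ballI tendsto_mult_ennreal tendsto_const) auto
  ultimately show ?thesis by simp
qed

lemma G_average:
  assumes y: "y \<in> Dr (R1 / 8)" and x: "x \<in> D" "x \<noteq> y"
  shows "(\<lambda>k. fpot (ind (ball x (rn k))) y / emeasure m (ball x (rn k))) \<longlonglongrightarrow> G x y"
  unfolding fpot_def by (rule XP.average_tendsto[OF D(1) x(1) G_cont[OF y] G_fin[OF x(2)]])

text \<open>Boundary Harnack principle for the Green function itself, by averaging in the pole.\<close>

lemma BHP_G:
  assumes rho: "0 < rho" "rho \<le> R1" and x: "x \<in> D - cball z0 rho" "x' \<in> D - cball z0 rho"
    and y: "y \<in> Dr (rho / 8)" "y' \<in> Dr (rho / 8)"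
  shows "G x y * G x' y' \<le> ennreal (C ^ 4) * (G x y' * G x' y)"
proof -
  have yR: "y \<in> Dr (R1 / 8)" "y' \<in> Dr (R1 / 8)" using y rho Dr_mono[of "rho / 8" "R1 / 8"] by auto
  have ne: "u \<noteq> v" if "u \<in> D - cball z0 rho" "v \<in> Dr (rho / 8)" for u v using that rho by (auto simp: Dr_def)
  let ?B = "\<lambda>x k. ball x (rn k)"
  let ?a = "\<lambda>x y k. fpot (ind (?B x k)) y / emeasure m (?B x k)"
  have lim: "?a u v \<longlonglongrightarrow> G u v" if "u \<in> D - cball z0 rho" "v \<in> Dr (rho / 8)" for u v
    using that ne[OF that] rho Dr_mono[of "rho / 8" "R1 / 8"] by (intro G_average) auto
  have fin: "G u v < \<infinity>" if "u \<in> D - cball z0 rho" "v \<in> Dr (rho / 8)" for u v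
    using ne[OF that] by (rule G_fin)
  have L: "(\<lambda>k. ?a x y k * ?a x' y' k) \<longlonglongrightarrow> G x y * G x' y'"
    by (intro tendsto_mult_ennreal lim x y) (use fin x y in \<open>auto simp: less_top\<close>)
  have "(\<lambda>k. ?a x y' k * ?a x' y k) \<longlonglongrightarrow> G x y' * G x' y"
    by (intro tendsto_mult_ennreal lim x y) (use fin x y in \<open>auto simp: less_top\<close>)
  then have Rl: "(\<lambda>k. ennreal (C ^ 4) * (?a x y' k * ?a x' y k)) \<longlonglongrightarrow> ennreal (C ^ 4) * (G x y' * G x' y)"
    by (rule tendsto_mult_ennreal[OF tendsto_const]) (use fin[OF x(1) y(2)] fin[OF x(2) y(1)] C in \<open>auto simp: ennreal_mult_eq_top_iff\<close>)
  have op: "open (D - cball z0 rho)" using D by (auto simp: open_Diff)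
  have "eventually (\<lambda>k. ?a x y k * ?a x' y' k \<le> ennreal (C ^ 4) * (?a x y' k * ?a x' y k)) sequentially"
    using eventually_ball_subset[OF op x(1)] eventually_ball_subset[OF op x(2)]
  proof eventually_elim
    fix k assume k: "?B x k \<subseteq> D - cball z0 rho" "?B x' k \<subseteq> D - cball z0 rho"
    have "fpot (ind (?B x k)) y * fpot (ind (?B x' k)) y' \<le>
      ennreal (C ^ 4) * (fpot (ind (?B x k)) y' * fpot (ind (?B x' k)) y)"
    proof -
      have ind: "(ind (?B u k)) \<in> bfun" for u by (rule borel_measurable_indicator) simp
      show ?thesis by (rule BHP_fpot[OF rho ind ind _ _ y]) (use k in \<open>auto simp: Dr_def indicator_def\<close>)
    qed
    then have "(fpot (ind (?B x k)) y * fpot (ind (?B x' k)) y') * (inverse (emeasure m (?B x k)) * inverse (emeasure m (?B x' k))) \<le>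
      (ennreal (C ^ 4) * (fpot (ind (?B x k)) y' * fpot (ind (?B x' k)) y)) * (inverse (emeasure m (?B x k)) * inverse (emeasure m (?B x' k)))"
      by (rule mult_right_mono) simp
    then show "?a x y k * ?a x' y' k \<le> ennreal (C ^ 4) * (?a x y' k * ?a x' y k)"
      unfolding divide_ennreal_def by (simp only: mult_ac)
  qed
  then show ?thesis by (rule tendsto_le[OF trivial_limit_sequentially Rl L])
qed

text \<open>A single zero would spread through \<open>BHP_G\<close> to all points near
  \<open>z0\<close>, against \<open>Green_mass_pos\<close>.\<close>

lemma G_pos:
  assumes rho: "0 < rho" "rho \<le> R1" and x: "x \<in> D - cball z0 rho" and y: "y \<in> Dr (rho / 8)"
  shows "0 < G x y"
proof (rule ccontr)
  assume "\<not> 0 < G x y"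
  then have G0: "G x y = 0" by (simp add: not_gr_zero)
  have x0: "x0 \<in> D - cball z0 rho" using D R1 rho by auto
  have "G x y' = 0" if y': "y' \<in> Dr (rho / 8)" for y'
  proof -
    have "G x0 y * G x y' \<le> 0" using BHP_G[OF rho x0 x y y'] G0 by simp
    moreover have "0 < G x0 y" using y rho Dr_mono[of "rho / 8" "R1 / 8"] by (intro G_x0_pos) auto
    ultimately show ?thesis by auto
  qed
  then have "(\<integral>\<^sup>+y. G x y * ind (Dr (rho / 8)) y \<partial>m) = (\<integral>\<^sup>+y. 0 \<partial>m)"
    by (intro nn_integral_cong) (auto simp: indicator_def)
  moreover have "0 < (\<integral>\<^sup>+y. G x y * ind (Dr (rho / 8)) y \<partial>m)"
    by (rule Green_mass_pos) (use x Dr_simps Dr_nonempty rho in auto)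
  ultimately show False by simp
qed

end

section \<open>The ratio limit\<close>

context martin_setup begin

lemma measurable_jh_z0 [measurable]: "(\<lambda>w. ennreal (jh z0 w)) \<in> bfun"
  by measurable

lemma Jr_antimono:
  assumes "r \<le> s" shows "Jr s f \<le> Jr r f"
proof -
  have "cb r \<subseteq> cb s"
    by (intro closure_mono subset_ball) (use assms in simp)
  then show ?thesis unfolding Jr_def
    by (intro nn_integral_mono mult_left_mono mult_right_mono) (auto simp: indicator_def)
qed

definition Af :: "real \<Rightarrow> ('a \<Rightarrow> ennreal) \<Rightarrow> ennreal" where
  "Af p f = (\<integral>\<^sup>+w. ennreal (jh z0 w) * (ind (- ball z0 p) w * f w) \<partial>m)"

definition Nf :: "real \<Rightarrow> ('a \<Rightarrow> ennreal) \<Rightarrow> ennreal" where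
  "Nf p f = (\<integral>\<^sup>+w. ennreal (jh z0 w) * (ind (ball z0 p) w * f w) \<partial>m)"

lemma Jr_0: "Jr 0 f = (\<integral>\<^sup>+w. ennreal (jh z0 w) * f w \<partial>m)"
  by (simp add: Jr_def)

lemma Af_Nf:
  assumes [measurable]: "f \<in> bfun"
  shows "Af p f + Nf p f = Jr 0 f"
  unfolding Af_def Nf_def Jr_0
  by (subst nn_integral_add[symmetric]) (auto intro!: nn_integral_cong simp: indicator_def)

lemma Af_le_Jr:
  assumes "0 < p" shows "Af p f \<le> Jr p f"
proof -
  have "cb p \<subseteq> cball z0 (3 / 8 * p)" by (rule closure_minimal) auto
  also have "\<dots> \<subseteq> ball z0 p" using assms by auto
  finally show ?thesis unfolding Af_def Jr_def
    by (intro nn_integral_mono mult_left_mono mult_right_mono) (auto simp: indicator_def)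
qed

lemma Jr_SUP:
  assumes [measurable]: "f \<in> bfun" and z: "f z0 = 0"
  shows "Jr 0 f = (SUP n. Jr (rn n) f)"
proof -
  let ?C = "\<lambda>n. cb (rn n)"
  let ?g = "\<lambda>n w. ennreal (jh z0 w) * (ind (- ?C n) w * f w)"
  have mono: "?C n \<subseteq> ?C k" if "k \<le> n" for k n
  proof (intro closure_mono subset_ball)
    have "rn n \<le> rn k" using that by (intro divide_left_mono) auto
    then show "3 / 8 * (rn n) \<le> 3 / 8 * (rn k)" by (intro mult_left_mono) auto
  qed
  have pt: "(SUP n. ?g n w) = ennreal (jh z0 w) * f w" for w
  proof (cases "w = z0")
    case True then show ?thesis by (simp add: z)
  next
    case False
    then have "0 < dist z0 w" by simp
    then obtain n where n: "rn n < dist z0 w" using nat_approx_posE by blast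
    have "?C n \<subseteq> cball z0 (3 / 8 * (rn n))" by (rule closure_minimal) auto
    moreover have "3 / 8 * (rn n) \<le> rn n" by (simp add: divide_simps)
    ultimately have "w \<notin> ?C n" using n by (auto simp del: of_nat_Suc)
    then have "ennreal (jh z0 w) * f w \<le> ?g n w" by simp
    then show ?thesis
      by (intro antisym SUP_least SUP_upper2[of n]) (auto simp: indicator_def)
  qed
  have "Jr 0 f = (\<integral>\<^sup>+w. (SUP n. ?g n w) \<partial>m)" unfolding Jr_0 pt ..
  also have "\<dots> = (SUP n. \<integral>\<^sup>+w. ?g n w \<partial>m)"
  proof (rule nn_integral_monotone_convergence_SUP)
    show "incseq ?g" using mono by (auto simp: incseq_def le_fun_def indicator_def intro!: mult_left_mono)
  qed simp
  finally show ?thesis by (simp add: Jr_def)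
qed

text \<open>Dominated convergence. The shrinking balls leave only \<open>z0\<close>, where
  \<open>f\<close> is 0, so an atom of \<open>m\<close> at \<open>z0\<close> does no harm.\<close>

lemma Nf_tendsto_0:
  assumes [measurable]: "f \<in> bfun" and z: "f z0 = 0" and fin: "Jr 0 f < \<infinity>" and e: "0 < e"
  shows "\<exists>p0>0. \<forall>p. 0 < p \<and> p \<le> p0 \<longrightarrow> Nf p f < e"
proof -
  let ?g = "\<lambda>n w. ennreal (jh z0 w) * (ind (ball z0 (rn n)) w * f w)"
  have "(\<lambda>n. \<integral>\<^sup>+w. ?g n w \<partial>m) \<longlonglongrightarrow> (\<integral>\<^sup>+w. 0 \<partial>m)"
  proof (rule nn_integral_dominated_convergence[where w = "\<lambda>w. ennreal (jh z0 w) * f w"])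
    show "AE w in m. (\<lambda>n. ?g n w) \<longlonglongrightarrow> 0"
    proof (rule AE_I2)
      fix w
      show "(\<lambda>n. ?g n w) \<longlonglongrightarrow> 0"
      proof (cases "w = z0")
        case True then show ?thesis by (simp add: z)
      next
        case False
        then have "0 < dist z0 w" by simp
        then obtain n0 where n0: "rn n0 < dist z0 w" using nat_approx_posE by blast
        have "?g n w = 0" if "n \<ge> n0" for n
        proof -
          have "rn n \<le> rn n0" using that by (intro divide_left_mono) auto
          then have "w \<notin> ball z0 (rn n)" using n0 by simp
          then show ?thesis by simp
        qed
        then have "eventually (\<lambda>n. ?g n w = 0) sequentially" unfolding eventually_sequentially by blast
        then show ?thesis by (rule tendsto_eventually)
      qed
    qed
  qed (use fin in \<open>auto simp: Jr_0 indicator_def\<close>)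
  then have "eventually (\<lambda>n. (\<integral>\<^sup>+w. ?g n w \<partial>m) < e) sequentially" using e by (intro order_tendstoD) auto
  then obtain n where n: "(\<integral>\<^sup>+w. ?g n w \<partial>m) < e" by (auto simp: eventually_sequentially)
  have "Nf p f < e" if "p \<le> rn n" for p
  proof -
    have "Nf p f \<le> (\<integral>\<^sup>+w. ?g n w \<partial>m)" unfolding Nf_def
      using that subset_ball[OF that, of z0] by (intro nn_integral_mono mult_left_mono mult_right_mono) (auto simp: indicator_def)
    then show ?thesis using n by (rule le_less_trans)
  qed
  then show ?thesis by (intro exI[of _ "rn n"]) auto
qed

definition far :: "real \<Rightarrow> real \<Rightarrow> ('a \<Rightarrow> ennreal) \<Rightarrow> 'a \<Rightarrow> ennreal" where
  "far r p f = YP.Hop (Dr r) (\<lambda>v. ind (- ball z0 p) v * f v)"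

definition near :: "real \<Rightarrow> real \<Rightarrow> ('a \<Rightarrow> ennreal) \<Rightarrow> 'a \<Rightarrow> ennreal" where
  "near r p f = YP.Hop (Dr r) (\<lambda>v. ind (ball z0 p - ball z0 r) v * f v)"

lemma measurable_shell [measurable]:
  assumes "f \<in> bfun"
  shows "(\<lambda>v. ind (ball z0 p - ball z0 r) v * f v :: ennreal) \<in> bfun"
proof -
  have "ball z0 p - ball z0 r \<in> sets borel" by (rule sets.Diff) auto
  then show ?thesis using assms by (intro borel_measurable_times_ennreal borel_measurable_indicator)
qed

lemma near_far:
  assumes f: "f \<in> bfun" "\<And>v. v \<notin> D \<Longrightarrow> f v = 0" and p: "r \<le> p"
  shows "YP.Hop (Dr r) f y = near r p f y + far r p f y"
proof -
  note [measurable] = f(1)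
  have *: "ind (ball z0 p - ball z0 r) v * f v + ind (- ball z0 p) v * f v = ind (- ball z0 r) v * f v" for v
    using subset_ball[OF p, of z0] by (auto simp: indicator_def)
  have "near r p f y + far r p f y = YP.Hop (Dr r) (\<lambda>v. ind (- ball z0 r) v * f v) y"
    unfolding near_def far_def *[symmetric]
    by (simp add: YP.Hop_hm nn_integral_add)
  then show ?thesis using Hop_Dr_restrict[of f r y] f(2) by simp
qed

lemma far_Uop:
  assumes f: "f \<in> bfun" and r: "0 < r" "r < p" and y: "y \<in> Dr r"
  shows "far r p f y = YP.Uop (Dr r) (\<lambda>u. \<integral>\<^sup>+v. ennreal (jh u v) * (ind (- ball z0 p) v * f v) \<partial>m) y"
  unfolding far_def
proof (rule YP.Hop_levy[OF Dr_simps(1) _ y _ _ f])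
  have cl: "closure (Dr r) \<subseteq> cball z0 r" by (rule closure_minimal) (use Dr_simps(3)[of r] in auto)
  show "compact (closure (Dr r))" by (rule XP.heine_borel[OF bounded_subset[OF bounded_cball cl]]) simp
  show "- ball z0 p \<inter> closure (Dr r) = {}" using cl r by auto
qed simp

lemma Uop_const: "YP.Uop (Dr r) (\<lambda>_. a) y = a * et r y"
  unfolding et_def by (simp add: YP.Rop_om)

lemma jint_mono:
  assumes [measurable]: "f \<in> bfun" "(\<lambda>v. ennreal (q v)) \<in> bfun"
    and a: "0 \<le> a" and b: "\<And>v. v \<notin> ball z0 p \<Longrightarrow> k v \<le> a * q v"
  shows "(\<integral>\<^sup>+v. ennreal (k v) * (ind (- ball z0 p) v * f v) \<partial>m) \<le> ennreal a * (\<integral>\<^sup>+v. ennreal (q v) * (ind (- ball z0 p) v * f v) \<partial>m)"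
proof -
  have "ennreal (k v) * (ind (- ball z0 p) v * f v) \<le> ennreal a * (ennreal (q v) * (ind (- ball z0 p) v * f v))" for v
  proof (cases "v \<in> ball z0 p")
    case False
    have "ennreal (k v) \<le> ennreal a * ennreal (q v)"
      using ennreal_leI[OF b[OF False]] a by (simp add: ennreal_mult')
    then show ?thesis unfolding mult.assoc[symmetric] by (intro mult_right_mono) auto
  qed simp
  then show ?thesis by (subst nn_integral_cmult[symmetric]) (auto intro!: nn_integral_mono)
qed

lemma far_upper:
  assumes f: "f \<in> bfun" and r: "0 < r" "r < p" and y: "y \<in> Dr r" and a: "0 \<le> a"
    and b: "\<And>u v. u \<in> Dr r \<Longrightarrow> v \<notin> ball z0 p \<Longrightarrow> jh u v \<le> a * jh z0 v"
  shows "far r p f y \<le> ennreal a * (et r y * Af p f)"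
proof -
  have "far r p f y \<le> YP.Uop (Dr r) (\<lambda>_. ennreal a * Af p f) y"
    unfolding far_Uop[OF f r y] Af_def by (intro YP.Rop_mono_on jint_mono f a b) auto
  then show ?thesis by (simp add: Uop_const mult_ac)
qed

lemma far_lower:
  assumes f: "f \<in> bfun" and r: "0 < r" "r < p" and y: "y \<in> Dr r" and a: "0 \<le> a"
    and b: "\<And>u v. u \<in> Dr r \<Longrightarrow> v \<notin> ball z0 p \<Longrightarrow> jh z0 v \<le> a * jh u v"
  shows "et r y * Af p f \<le> ennreal a * far r p f y"
proof -
  note [measurable] = f
  have [measurable]: "(\<lambda>u. \<integral>\<^sup>+v. ennreal (jh u v) * (ind (- ball z0 p) v * f v) \<partial>m) \<in> bfun"
    by (rule YP.measurable_jint) measurable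
  have "et r y * Af p f = YP.Uop (Dr r) (\<lambda>_. Af p f) y" by (simp add: Uop_const mult.commute)
  also have "\<dots> \<le> YP.Uop (Dr r) (\<lambda>u. ennreal a * (\<integral>\<^sup>+v. ennreal (jh u v) * (ind (- ball z0 p) v * f v) \<partial>m)) y"
    unfolding Af_def by (intro YP.Rop_mono_on jint_mono f a b) auto
  also have "\<dots> = ennreal a * far r p f y"
    unfolding far_Uop[OF f r y] by (simp add: YP.Rop_om nn_integral_cmult)
  finally show ?thesis .
qed

lemma far_C1:
  assumes f: "f \<in> bfun" and r: "0 < r" "2 * r \<le> p" "p \<le> R1" and y: "y \<in> Dr r"
  shows "far r p f y \<le> ennreal c * (et r y * Af p f)"
proof (rule far_upper[OF f r(1) _ y])
  fix u v assume "u \<in> Dr r" "v \<notin> ball z0 p"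
  then have "u \<in> ball z0 (p / 2)" "v \<notin> ball z0 (2 * (p / 2))" using r by (auto simp: Dr_def)
  then show "jh u v \<le> c * jh z0 v" using C1[of "p / 2" u v] r by auto
qed (use r c in auto)

text \<open>By E1 the density of a jump beyond \<open>p\<close> hardly depends on the starting point
  near \<open>z0\<close>, so the far part is nearly the mean exit time multiplied by a constant of
  the function. E1 is stated for \<open>j\<close>; duality transfers it to
  \<open>jh\<close>.\<close>

lemma far_E1:
  assumes f: "f \<in> bfun" and p: "0 < p" "p \<le> R1" and eta: "1 < eta"
  shows "\<exists>\<delta>>0. \<forall>r y. 0 < r \<and> r \<le> \<delta> \<and> y \<in> Dr r \<longrightarrow> far r p f y \<le> ennreal eta * (et r y * Af p f) \<and> et r y * Af p f \<le> ennreal eta * far r p f y"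
proof -
  \<comment> \<open>\<open>p / 2\<close> in place of \<open>p\<close>: E1 speaks of distances
    strictly larger than its radius, and the far part begins at distance \<open>p\<close>.\<close>
  obtain \<delta> where \<delta>: "0 < \<delta>" "\<And>u v. dist z0 u < \<delta> \<Longrightarrow> u \<noteq> z0 \<Longrightarrow> p / 2 < dist z0 v \<Longrightarrow> j v u \<le> eta * j v z0 \<and> j v z0 \<le> eta * j v u"
    using E1[of "p / 2" eta] p eta by auto
  have b: "jh u v \<le> eta * jh z0 v \<and> jh z0 v \<le> eta * jh u v" if "r \<le> \<delta>" "r \<le> p / 2" "u \<in> Dr r" "v \<notin> ball z0 p" for r u v
  proof -
    have "u \<noteq> z0" "u \<noteq> v" "v \<noteq> z0" "dist z0 u < \<delta>" "p / 2 < dist z0 v"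
      using that p z0_notin by (auto simp: Dr_def)
    then show ?thesis using \<delta>(2)[of u v] j_dual[of v u] j_dual[of v z0] by auto
  qed
  show ?thesis
  proof (intro exI[of _ "min \<delta> (p / 2)"] conjI allI impI)
    show "0 < min \<delta> (p / 2)" using \<delta> p by simp
    fix r y assume r: "0 < r \<and> r \<le> min \<delta> (p / 2) \<and> y \<in> Dr r"
    then show "far r p f y \<le> ennreal eta * (et r y * Af p f)"
      using b[of r] eta p by (intro far_upper[OF f]) auto
    show "et r y * Af p f \<le> ennreal eta * far r p f y"
      using r b[of r] eta p by (intro far_lower[OF f]) auto
  qed
qed

text \<open>F1 applied to the near part. Its functional integrates the near part itself, which is at
  most \<open>f\<close> and vanishes off \<open>ball z0 p\<close>, hence the bound by
  \<open>Nf p f\<close>.\<close>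

lemma near_upper:
  assumes f: "f \<in> bfun" "\<And>v. YP.Hop (Dr r) f v \<le> f v" "\<And>v. v \<notin> D \<Longrightarrow> f v = 0"
    and r: "0 < r" "r \<le> R1" "r \<le> p" and y: "y \<in> Dr (r / 8)"
  shows "near r p f y \<le> ennreal C * (et r y * Nf p f)"
proof -
  note [measurable] = f(1)
  let ?g = "\<lambda>v. ind (ball z0 p - ball z0 r) v * f v"
  have "near r p f y \<le> ennreal C * (et r y * Jr r (near r p f))"
    unfolding near_def by (rule F1_Hop(2)[OF r(1,2) measurable_shell[OF f(1)] _ y]) auto
  also have "Jr r (near r p f) \<le> Nf p f"
    unfolding Jr_def Nf_def
  proof (intro nn_integral_mono mult_left_mono)
    fix w
    have "near r p f w \<le> f w" using near_far[OF f(1,3) r(3), of w] f(2)[of w] by (metis add_increasing2 le_add_same_cancel1 order_trans zero_le dual_order.refl)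
    moreover have "near r p f w = 0" if "w \<notin> ball z0 p"
      using that r(3) unfolding near_def by (subst YP.Hop_at_outside) (auto simp: Dr_def)
    ultimately show "ind (- cb r) w * near r p f w \<le> ind (ball z0 p) w * f w"
      by (auto simp: indicator_def)
  qed simp
  finally show ?thesis by (simp add: mult_left_mono)
qed

end

text \<open>Two functions with ratio in \<open>[\<mu>, \<mu> + L]\<close> whose ``near parts'' satisfy the boundary Harnack
  inequality with constant \<open>C\<^sup>4\<close>; the far parts are an \<open>eps\<close>-fraction.\<close>

lemma osc_algebra:
  fixes F1 F2 n1 n2 F1' F2' n1' n2' \<mu> L eps C :: real
  assumes pos: "0 < F1" "0 < F2" "0 < F1'" "0 < F2'" and C: "1 \<le> C" and \<mu>: "0 \<le> \<mu>" "0 < L" and eps: "0 \<le> eps" "eps \<le> 1 / 2"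
    and n: "n1 \<le> F1" "n2 \<le> F2" "n1' \<le> F1'" "n2' \<le> F2'"
      "F1 \<le> n1 + eps * F1" "F2 \<le> n2 + eps * F2" "F1' \<le> n1' + eps * F1'" "F2' \<le> n2' + eps * F2'"
    and U: "\<mu> * n2 \<le> n1" "n1 \<le> (\<mu> + L) * n2" "\<mu> * n2' \<le> n1'" "n1' \<le> (\<mu> + L) * n2'"
    and bhp: "(n1 - \<mu> * n2) * ((\<mu> + L) * n2' - n1') \<le> C ^ 4 * ((n1' - \<mu> * n2') * ((\<mu> + L) * n2 - n1))"
  shows "F1 / F2 - F1' / F2' \<le> (1 - 1 / (1 + C\<^sup>2)) * L + 3 * eps * (\<mu> + L)"
proof -
  have npos: "0 < n2" "0 < n2'" "0 < n1" "0 < n1'"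
  proof -
    have *: "0 < n" if "0 < F" "F \<le> n + eps * F" for n F :: real
    proof -
      have "eps * F \<le> 1 / 2 * F" using eps that by (intro mult_right_mono) auto
      then show ?thesis using that by linarith
    qed
    show "0 < n2" "0 < n2'" "0 < n1" "0 < n1'" using * pos n by auto
  qed
  define R R' where "R = n1 / n2" and "R' = n1' / n2'"
  define a b where "a = R - \<mu>" and "b = R' - \<mu>"
  have ab: "0 \<le> a" "a \<le> L" "0 \<le> b" "b \<le> L"
    using U npos by (auto simp: a_def b_def R_def R'_def field_simps)
  have n1: "n1 = (\<mu> + a) * n2" "n1' = (\<mu> + b) * n2'" using npos by (auto simp: a_def b_def R_def R'_def)
  have "a * (L - b) * (n2 * n2') \<le> C ^ 4 * (b * (L - a)) * (n2 * n2')"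
    using bhp unfolding n1 by (simp add: algebra_simps)
  then have *: "a * (L - b) \<le> C ^ 4 * (b * (L - a))" using npos by (simp add: mult_le_cancel_right)
  \<comment> \<open>Chosen so that \<open>(1 - k) / k\<close> is the square root of the Harnack
    constant \<open>C ^ 4\<close>. An oscillation above \<open>(1 - k) * L\<close> would put
    \<open>a\<close> above \<open>(1 - k) * L\<close> and \<open>b\<close> below
    \<open>k * L\<close>, and the Harnack inequality would fail.\<close>
  define k where "k = 1 / (1 + C\<^sup>2)"
  have k: "0 < k" "1 - k = C\<^sup>2 * k"
  proof -
    have "0 < 1 + C\<^sup>2" by (simp add: add_pos_nonneg)
    then show "0 < k" "1 - k = C\<^sup>2 * k" by (auto simp: k_def field_simps)
  qed
  have "R - R' \<le> (1 - k) * L"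
  proof (rule ccontr)
    assume "\<not> R - R' \<le> (1 - k) * L"
    then have "(1 - k) * L < a - b" by (simp add: a_def b_def)
    then have bd: "b < k * L" "(1 - k) * L < a" "(1 - k) * L < L - b" "L - a < k * L"
      using ab by (auto simp: algebra_simps)
    have nn: "0 \<le> (1 - k) * L" unfolding k(2) using k \<mu> by simp
    have "((1 - k) * L) * ((1 - k) * L) < a * (L - b)"
      using bd nn by (intro mult_strict_mono) auto
    moreover have "b * (L - a) \<le> (k * L) * (k * L)"
      using bd ab by (intro mult_mono) auto
    then have "C ^ 4 * (b * (L - a)) \<le> C ^ 4 * ((k * L) * (k * L))" using C by (intro mult_left_mono) auto
    moreover have "((1 - k) * L) * ((1 - k) * L) = C ^ 4 * ((k * L) * (k * L))"
      unfolding k(2) by (simp add: power2_eq_square power4_eq_xxxx mult_ac)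
    ultimately show False using * by linarith
  qed
  \<comment> \<open>Returning from the near parts to the full functions costs \<open>2 * eps\<close>
    here and \<open>eps\<close> at the second point, each multiplied by
    \<open>\<mu> + L\<close>.\<close>
  moreover have "F1 / F2 \<le> R + 2 * eps * (\<mu> + L)"
  proof -
    have n1F: "F1 * (1 - eps) \<le> n1" using n by (simp add: algebra_simps)
    have "1 \<le> (1 - eps) * (1 + 2 * eps)" using mult_left_mono[of "2 * eps" 1 eps] eps by (simp add: algebra_simps)
    then have "F1 \<le> F1 * (1 - eps) * (1 + 2 * eps)" using mult_left_mono[of 1 "(1 - eps) * (1 + 2 * eps)" F1] pos by (simp add: mult.assoc)
    also have "\<dots> \<le> n1 * (1 + 2 * eps)" using eps by (intro mult_right_mono n1F) auto
    finally have "F1 \<le> n1 * (1 + 2 * eps)" .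
    then have "F1 / F2 \<le> n1 * (1 + 2 * eps) / n2" using n pos npos eps by (intro frac_le) auto
    also have "\<dots> = R + 2 * eps * R" by (simp add: R_def distrib_left add_divide_distrib mult_ac)
    also have "\<dots> \<le> R + 2 * eps * (\<mu> + L)" using ab eps by (auto simp: a_def intro!: mult_left_mono)
    finally show ?thesis .
  qed
  moreover have "R' - eps * (\<mu> + L) \<le> F1' / F2'"
  proof -
    have 1: "F2' * (1 - eps) \<le> n2'" using n by (simp add: algebra_simps)
    have "R' - eps * (\<mu> + L) \<le> R' * (1 - eps)" using mult_left_mono[of R' "\<mu> + L" eps] ab eps by (simp add: b_def algebra_simps)
    also have "R' * (1 - eps) \<le> n1' / F2'"
    proof -
      have "n1' * (1 - eps) * F2' \<le> n1' * n2'" using mult_left_mono[OF 1, of n1'] npos by (simp add: mult_ac)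
      then show ?thesis using npos pos by (simp add: R'_def field_simps)
    qed
    also have "\<dots> \<le> F1' / F2'" using n pos by (intro divide_right_mono) auto
    finally show ?thesis .
  qed
  ultimately show ?thesis unfolding k_def by (simp add: algebra_simps)
qed

context martin_setup begin

text \<open>Harmonicity is an equality of functions on the whole space; off \<open>Dr r\<close> it
  holds by itself (\<open>Hop_at_outside\<close>). Positivity and finiteness are asked on
  \<open>Dr (rho / 8)\<close>, where F1 gives bounds.\<close>

definition good :: "real \<Rightarrow> ('a \<Rightarrow> ennreal) \<Rightarrow> bool" where
  "good rho f \<longleftrightarrow> 0 < rho \<and> rho \<le> R1 \<and> f \<in> bfun \<and> (\<forall>v. v \<notin> D \<longrightarrow> f v = 0) \<and>
    (\<forall>r. 0 < r \<and> r \<le> rho \<longrightarrow> YP.Hop (Dr r) f = f) \<and> (\<forall>y\<in>Dr (rho / 8). 0 < f y \<and> f y < \<infinity>)"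

lemma goodD:
  assumes "good rho f"
  shows "0 < rho" "rho \<le> R1" "f \<in> bfun" "v \<notin> D \<Longrightarrow> f v = 0"
    "0 < r \<Longrightarrow> r \<le> rho \<Longrightarrow> YP.Hop (Dr r) f = f" "y \<in> Dr (rho / 8) \<Longrightarrow> 0 < f y" "y \<in> Dr (rho / 8) \<Longrightarrow> f y < \<infinity>"
  using assms unfolding good_def by blast+

lemma good_mono: "good rho f \<Longrightarrow> 0 < rho' \<Longrightarrow> rho' \<le> rho \<Longrightarrow> good rho' f"
  unfolding good_def using Dr_mono[of "rho' / 8" "rho / 8"] by auto

lemma F1_good:
  assumes f: "good rho f" and r: "0 < r" "r \<le> rho" and y: "y \<in> Dr (r / 8)"
  shows "ennreal (inverse C) * (et r y * Jr r f) \<le> f y" "f y \<le> ennreal C * (et r y * Jr r f)"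
proof -
  note [measurable] = goodD(3)[OF f]
  have eq: "YP.Hop (Dr r) (\<lambda>v. ind (- ball z0 r) v * f v) = f"
    using goodD(5)[OF f r] by (simp add: fun_eq_iff Hop_Dr_restrict[OF goodD(4)[OF f], symmetric])
  have rR: "r \<le> R1" using r goodD(2)[OF f] by simp
  have ms: "(\<lambda>v. ind (- ball z0 r) v * f v) \<in> bfun" by measurable
  have z: "v \<in> ball z0 r \<Longrightarrow> ind (- ball z0 r) v * f v = 0" for v by simp
  show "ennreal (inverse C) * (et r y * Jr r f) \<le> f y"
    by (rule F1_Hop(1)[OF r(1) rR ms z y, unfolded eq])
  show "f y \<le> ennreal C * (et r y * Jr r f)"
    by (rule F1_Hop(2)[OF r(1) rR ms z y, unfolded eq])
qed

lemma BHP_good: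
  assumes f: "good rho f1" "good rho f2" and y: "y \<in> Dr (rho / 8)" "y' \<in> Dr (rho / 8)"
  shows "f1 y * f2 y' \<le> ennreal (C ^ 4) * (f1 y' * f2 y)"
proof -
  have r: "0 < rho" "rho \<le> rho" using goodD(1)[OF f(1)] by auto
  show ?thesis
    by (rule bhp_algebra[OF F1_good(2)[OF f(1) r y(1)] F1_good(2)[OF f(2) r y(2)] F1_good(1)[OF f(1) r y(2)] F1_good(1)[OF f(2) r y(1)]])
qed

text \<open>F1 read backwards: a positive finite value at one point close to \<open>z0\<close> keeps
  the functional away from 0 and from infinity.\<close>

lemma Jr_good:
  assumes f: "good rho f" and r: "0 < r" "r \<le> rho"
  shows "0 < Jr r f" "Jr r f < \<infinity>"
proof -
  obtain y where y: "y \<in> Dr (r / 8)" using Dr_nonempty[of "r / 8"] r by auto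
  have yr: "y \<in> Dr r" "y \<in> Dr (rho / 8)" using y r Dr_mono[of "r / 8" r] Dr_mono[of "r / 8" "rho / 8"] by auto
  note F = F1_good[OF f r y]
  have "f y < \<infinity>" "0 < f y" using goodD[OF f] yr by auto
  show "0 < Jr r f"
  proof (rule ccontr)
    assume "\<not> 0 < Jr r f"
    then have "Jr r f = 0" by (simp add: not_gr_zero)
    then show False using F(2) \<open>0 < f y\<close> by simp
  qed
  show "Jr r f < \<infinity>"
  proof (rule ccontr)
    assume "\<not> Jr r f < \<infinity>"
    then have "Jr r f = \<infinity>" by (simp add: less_top[symmetric])
    then have "ennreal (inverse C) * (et r y * Jr r f) = \<infinity>"
      using et_pos[OF yr(1)] C by (simp add: ennreal_mult_eq_top_iff)
    then show False using F(1) \<open>f y < \<infinity>\<close> by simp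
  qed
qed

lemma good_near_far:
  assumes f: "good rho f" and r: "0 < r" "r \<le> p" "r \<le> rho"
  shows "f y = near r p f y + far r p f y"
proof -
  have "YP.Hop (Dr r) f y = near r p f y + far r p f y"
    by (rule near_far[OF goodD(3)[OF f] goodD(4)[OF f] r(2)])
  then show ?thesis unfolding goodD(5)[OF f r(1,3)] .
qed

lemma good_near_upper:
  assumes f: "good rho f" and r: "0 < r" "r \<le> p" "r \<le> rho" and y: "y \<in> Dr (r / 8)"
  shows "near r p f y \<le> ennreal C * (et r y * Nf p f)"
proof (rule near_upper[OF goodD(3)[OF f] _ goodD(4)[OF f] r(1) _ r(2) y])
  show "YP.Hop (Dr r) f v \<le> f v" for v unfolding goodD(5)[OF f r(1,3)] by simp
  show "r \<le> R1" using r(3) goodD(2)[OF f] by simp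
qed

text \<open>The inaccessible case: the far part dominates.\<close>

lemma inaccessible_asymp:
  assumes f: "good rho f" and fin: "Jr 0 f < \<infinity>" and eta: "1 < eta"
  shows "\<exists>r0>0. \<forall>r y. 0 < r \<and> r \<le> r0 \<and> y \<in> Dr (r / 8) \<longrightarrow>
    f y \<le> ennreal eta * (et r y * Jr 0 f) \<and> et r y * Jr 0 f \<le> ennreal eta * f y"
proof -
  note fm = goodD(3)[OF f] and rho = goodD(1,2)[OF f]
  define b where "b = enn2real (Jr 0 f)"
  have B: "Jr 0 f = ennreal b" using fin by (simp add: b_def less_top[symmetric])
  have "0 < Jr 0 f" using Jr_good(1)[OF f rho(1)] Jr_antimono[of 0 rho f] rho by (auto intro: less_le_trans)
  then have b: "0 < b" using B by simp
  define eta1 where "eta1 = sqrt eta"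
  have eta1: "1 < eta1" "eta1 * eta1 = eta" using eta by (auto simp: eta1_def)
  then have "eta1 < eta" using mult_strict_right_mono[of 1 eta1 eta1] by auto
  \<comment> \<open>The first bound lets the near part fit between \<open>eta1\<close> and
    \<open>eta\<close> in the upper estimate. The second allows \<open>Jr 0 f\<close> to be replaced
    by \<open>Af p f\<close> in the lower one, at the cost of a further factor
    \<open>eta1\<close>.\<close>
  define e where "e = min ((eta - eta1) * b / C) ((eta1 - 1) * b / eta1)"
  have e: "0 < e" "C * e \<le> (eta - eta1) * b" "eta1 * e \<le> (eta1 - 1) * b"
  proof -
    show "0 < e" using eta1 \<open>eta1 < eta\<close> b C by (simp add: e_def)
    have "C * e \<le> C * ((eta - eta1) * b / C)" using C by (intro mult_left_mono) (auto simp: e_def)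
    then show "C * e \<le> (eta - eta1) * b" using C by simp
    have "eta1 * e \<le> eta1 * ((eta1 - 1) * b / eta1)" using eta1 by (intro mult_left_mono) (auto simp: e_def)
    then show "eta1 * e \<le> (eta1 - 1) * b" using eta1 by simp
  qed
  obtain p0 where p0: "0 < p0" "\<And>p. 0 < p \<Longrightarrow> p \<le> p0 \<Longrightarrow> Nf p f < ennreal e"
    using Nf_tendsto_0[OF fm goodD(4)[OF f z0_notin] fin, of "ennreal e"] e(1) by auto
  define p where "p = min p0 rho"
  have p: "0 < p" "p \<le> p0" "p \<le> rho" "p \<le> R1" using p0 rho by (auto simp: p_def)
  define a n where "a = enn2real (Af p f)" and "n = enn2real (Nf p f)"
  have AN: "Af p f = ennreal a" "Nf p f = ennreal n"
  proof -
    have "Af p f \<le> Jr 0 f" "Nf p f \<le> Jr 0 f" unfolding Af_Nf[OF fm, of p, symmetric] by simp_all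
    then have "Af p f < \<infinity>" "Nf p f < \<infinity>" using fin by (auto intro: le_less_trans)
    then show "Af p f = ennreal a" "Nf p f = ennreal n" by (simp_all add: a_def n_def less_top[symmetric])
  qed
  have an: "0 \<le> a" "0 \<le> n" "a + n = b" "n < e"
  proof -
    show "0 \<le> a" "0 \<le> n" by (auto simp: a_def n_def)
    then show "a + n = b" using Af_Nf[OF fm, of p] b unfolding AN B by (simp add: ennreal_plus[symmetric] del: ennreal_plus)
    show "n < e" using p0(2)[OF p(1,2)] unfolding AN using \<open>0 \<le> n\<close> by (simp add: ennreal_less_iff)
  qed
  have i: "ennreal eta1 * Af p f + ennreal C * Nf p f \<le> ennreal eta * Jr 0 f"
  proof -
    have "eta1 * a + C * n \<le> eta1 * b + C * e" using an eta1 C by (intro add_mono mult_left_mono) auto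
    also have "\<dots> \<le> eta * b" using e(2) by (simp add: algebra_simps)
    finally show ?thesis unfolding AN B using an eta1 C eta b
      by (simp add: ennreal_mult[symmetric] ennreal_plus[symmetric] del: ennreal_plus)
  qed
  have ii: "Jr 0 f \<le> ennreal eta1 * Af p f"
  proof -
    have "eta1 * n \<le> eta1 * e" using an eta1 by (intro mult_left_mono) auto
    also note e(3)
    finally have "eta1 * n \<le> (eta1 - 1) * b" .
    moreover have "eta1 * a = eta1 * b - eta1 * n" using an(3) by (simp add: right_diff_distrib[symmetric])
    ultimately have "b \<le> eta1 * a" by (simp add: left_diff_distrib)
    then show ?thesis unfolding AN B using an eta1 by (simp add: ennreal_mult[symmetric])
  qed
  obtain \<delta> where \<delta>: "0 < \<delta>" "\<And>r y. 0 < r \<Longrightarrow> r \<le> \<delta> \<Longrightarrow> y \<in> Dr r \<Longrightarrow>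
      far r p f y \<le> ennreal eta1 * (et r y * Af p f) \<and> et r y * Af p f \<le> ennreal eta1 * far r p f y"
    using far_E1[OF fm p(1,4) eta1(1)] by auto
  show ?thesis
  proof (intro exI[of _ "min \<delta> p"] conjI allI impI)
    show "0 < min \<delta> p" using \<delta> p by simp
    fix r y assume r: "0 < r \<and> r \<le> min \<delta> p \<and> y \<in> Dr (r / 8)"
    then have r': "0 < r" "r \<le> \<delta>" "r \<le> p" "r \<le> rho" "y \<in> Dr (r / 8)" "y \<in> Dr r"
      using p Dr_mono[of "r / 8" r] by auto
    have f_eq: "f y = near r p f y + far r p f y" by (rule good_near_far[OF f r'(1,3,4)])
    have "f y \<le> ennreal C * (et r y * Nf p f) + ennreal eta1 * (et r y * Af p f)"
      unfolding f_eq using good_near_upper[OF f r'(1,3,4,5)] \<delta>(2)[OF r'(1,2,6)] by (intro add_mono) auto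
    also have "\<dots> = et r y * (ennreal eta1 * Af p f + ennreal C * Nf p f)" by (simp add: distrib_left mult_ac add.commute)
    also have "\<dots> \<le> et r y * (ennreal eta * Jr 0 f)" by (rule mult_left_mono[OF i]) simp
    finally show "f y \<le> ennreal eta * (et r y * Jr 0 f)" by (simp add: mult_ac)
    have "et r y * Jr 0 f \<le> et r y * (ennreal eta1 * Af p f)" by (rule mult_left_mono[OF ii]) simp
    also have "\<dots> = ennreal eta1 * (et r y * Af p f)" by (simp add: mult_ac)
    also have "\<dots> \<le> ennreal eta1 * (ennreal eta1 * far r p f y)" using \<delta>(2)[OF r'(1,2,6)] by (intro mult_left_mono) auto
    also have "\<dots> = ennreal eta * far r p f y" using eta1 by (simp add: ennreal_mult[symmetric] mult.assoc[symmetric])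
    also have "\<dots> \<le> ennreal eta * f y" unfolding f_eq by (intro mult_left_mono) auto
    finally show "et r y * Jr 0 f \<le> ennreal eta * f y" .
  qed
qed

lemma Jr_large:
  assumes f: "good rho f" and inf: "Jr 0 f = \<infinity>" and b: "b < \<infinity>"
  shows "\<exists>r0>0. \<forall>r. r \<le> r0 \<longrightarrow> b < Jr r f"
proof -
  have "b < (SUP n. Jr (rn n) f)"
    using Jr_SUP[OF goodD(3)[OF f] goodD(4)[OF f z0_notin]] inf b by simp
  then obtain n where n: "b < Jr (rn n) f" by (auto simp: less_SUP_iff)
  show ?thesis
  proof (intro exI[of _ "rn n"] conjI allI impI)
    fix r assume "r \<le> rn n"
    then show "b < Jr r f" by (rule less_le_trans[OF n Jr_antimono])
  qed simp
qed

text \<open>The accessible case: the far part is negligible.\<close>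

lemma accessible_far:
  assumes f: "good rho f" and inf: "Jr 0 f = \<infinity>" and p: "0 < p" "p \<le> rho" and eps: "0 < eps"
  shows "\<exists>r0>0. r0 \<le> p / 2 \<and> (\<forall>r y. 0 < r \<and> r \<le> r0 \<and> y \<in> Dr (r / 8) \<longrightarrow> far r p f y \<le> ennreal eps * f y)"
proof -
  note fm = goodD(3)[OF f] and rho = goodD(1,2)[OF f]
  have Af: "Af p f < \<infinity>" using Af_le_Jr[OF p(1), of f] Jr_good(2)[OF f p] by (rule le_less_trans)
  \<comment> \<open>Once \<open>Jr r f\<close> exceeds this threshold, the bound
    \<open>c * et r y * Af p f\<close> on the far part is at most \<open>eps\<close> times the lower
    bound in F1.\<close>
  define b where "b = ennreal (C * c / eps) * Af p f"
  have "b < \<infinity>" using Af unfolding b_def by (simp add: ennreal_mult_less_top)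
  have c_eq: "ennreal c = ennreal eps * (ennreal (inverse C) * ennreal (C * c / eps))"
  proof -
    have "c = eps * (inverse C * (C * c / eps))" using eps C by simp
    then have "ennreal c = ennreal (eps * (inverse C * (C * c / eps)))" by (rule arg_cong)
    also have "\<dots> = ennreal eps * (ennreal (inverse C) * ennreal (C * c / eps))"
      using eps C by (simp only: ennreal_mult' inverse_nonnegative_iff_nonnegative less_imp_le order_trans[OF zero_le_one])
    finally show ?thesis .
  qed
  from Jr_large[OF f inf \<open>b < \<infinity>\<close>] obtain r1 where r1: "0 < r1" "\<And>r. r \<le> r1 \<Longrightarrow> b < Jr r f" by auto
  show ?thesis
  proof (intro exI[of _ "min r1 (p / 2)"] conjI allI impI)
    show "0 < min r1 (p / 2)" using r1 p by simp
    fix r y assume r: "0 < r \<and> r \<le> min r1 (p / 2) \<and> y \<in> Dr (r / 8)"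
    then have r': "0 < r" "r \<le> r1" "2 * r \<le> p" "r \<le> rho" "y \<in> Dr (r / 8)" "y \<in> Dr r" "p \<le> R1"
      using p rho Dr_mono[of "r / 8" r] by auto
    have "far r p f y \<le> ennreal c * (et r y * Af p f)" by (rule far_C1[OF fm r'(1,3,7,6)])
    also have "\<dots> = ennreal eps * (ennreal (inverse C) * (et r y * b))"
      unfolding c_eq b_def by (simp only: mult_ac)
    also have "\<dots> \<le> ennreal eps * (ennreal (inverse C) * (et r y * Jr r f))"
      using r1(2)[OF r'(2)] by (intro mult_left_mono) auto
    also have "\<dots> \<le> ennreal eps * f y" using F1_good(1)[OF f r'(1,4,5)] by (intro mult_left_mono) auto
    finally show "far r p f y \<le> ennreal eps * f y" .
  qed simp
qed

end

context martin_setup begin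

text \<open>The bounds \<open>\<mu>\<close> and \<open>\<mu> + L\<close> for the ratio are known
  inside \<open>Dr p\<close> only. So the boundary Harnack principle is applied to the exit
  functions with the nonnegative boundary values \<open>F1 - \<mu> * F2\<close> and
  \<open>(\<mu> + L) * F2 - F1\<close> on the shell between the radii \<open>r\<close> and
  \<open>p\<close>, and the far parts enter as small errors.\<close>

lemma accessible_contract:
  assumes f: "good rho f1" "good rho f2" and inf: "Jr 0 f1 = \<infinity>" "Jr 0 f2 = \<infinity>"
    and p: "0 < p" "8 * p \<le> rho" and L: "0 \<le> \<mu>" "0 < L"
    and bd: "\<And>y. y \<in> Dr p \<Longrightarrow> \<mu> \<le> enn2real (f1 y) / enn2real (f2 y) \<and> enn2real (f1 y) / enn2real (f2 y) \<le> \<mu> + L"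
    and k: "k = 1 / (1 + C\<^sup>2)"
  shows "\<exists>r>0. \<forall>y\<in>Dr r. \<forall>y'\<in>Dr r. enn2real (f1 y) / enn2real (f2 y) - enn2real (f1 y') / enn2real (f2 y') \<le> (1 - k / 2) * L"
proof -
  define F1 F2 where "F1 y = enn2real (f1 y)" and "F2 y = enn2real (f2 y)" for y
  note fm [measurable] = goodD(3)[OF f(1)] goodD(3)[OF f(2)] and rho = goodD(1,2)[OF f(1)]
  have p': "p \<le> rho" using p by simp
  have Dp: "Dr p \<subseteq> Dr (rho / 8)" using p by (intro Dr_mono) simp
  have F: "f1 y = ennreal (F1 y)" "f2 y = ennreal (F2 y)" "0 < F1 y" "0 < F2 y" if "y \<in> Dr p" for y
  proof -
    have y: "y \<in> Dr (rho / 8)" using that Dp by blast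
    show "f1 y = ennreal (F1 y)" "f2 y = ennreal (F2 y)"
      using goodD(7)[OF f(1) y] goodD(7)[OF f(2) y] by (simp_all add: F1_def F2_def less_top[symmetric])
    show "0 < F1 y" "0 < F2 y"
      using goodD(6,7)[OF f(1) y] goodD(6,7)[OF f(2) y] by (simp_all add: F1_def F2_def enn2real_positive_iff)
  qed
  have F0: "0 \<le> F1 y" "0 \<le> F2 y" for y by (simp_all add: F1_def F2_def)
  have [measurable]: "F1 \<in> bfun" "F2 \<in> bfun" unfolding F1_def F2_def by measurable
  have k0: "0 < k" using k by (simp add: add_pos_nonneg)
  \<comment> \<open>Makes the error \<open>3 * eps * (\<mu> + L)\<close> of
    \<open>osc_algebra\<close> at most half of the gain \<open>k * L\<close>; hence the factor
    \<open>1 - k / 2\<close>.\<close>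
  define eps where "eps = min (1 / 2) (k * L / (6 * (\<mu> + L)))"
  have eps: "0 < eps" "eps \<le> 1 / 2" "3 * eps * (\<mu> + L) \<le> k / 2 * L"
  proof -
    show "0 < eps" using k0 L by (simp add: eps_def)
    show "eps \<le> 1 / 2" unfolding eps_def by (rule min.cobounded1)
    have "eps * (6 * (\<mu> + L)) \<le> k * L / (6 * (\<mu> + L)) * (6 * (\<mu> + L))" using L by (intro mult_right_mono) (auto simp: eps_def)
    also have "\<dots> = k * L" using L by simp
    finally show "3 * eps * (\<mu> + L) \<le> k / 2 * L" by (simp add: algebra_simps)
  qed
  obtain r1 where r1: "0 < r1" "r1 \<le> p / 2" "\<And>r y. 0 < r \<Longrightarrow> r \<le> r1 \<Longrightarrow> y \<in> Dr (r / 8) \<Longrightarrow> far r p f1 y \<le> ennreal eps * f1 y"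
    using accessible_far[OF f(1) inf(1) p(1) p' eps(1)] by auto
  obtain r2 where r2: "0 < r2" "r2 \<le> p / 2" "\<And>r y. 0 < r \<Longrightarrow> r \<le> r2 \<Longrightarrow> y \<in> Dr (r / 8) \<Longrightarrow> far r p f2 y \<le> ennreal eps * f2 y"
    using accessible_far[OF f(2) inf(2) p(1) p' eps(1)] by auto
  define r where "r = min r1 r2"
  have r: "0 < r" "r \<le> r1" "r \<le> r2" "r \<le> p" "r \<le> rho" "r \<le> R1" using r1 r2 p p' rho by (auto simp: r_def)
  define n1 n2 where "n1 y = enn2real (near r p f1 y)" and "n2 y = enn2real (near r p f2 y)" for y
  have Drp: "Dr (r / 8) \<subseteq> Dr p" using r by (intro Dr_mono) simp
  have near: "near r p f1 y = ennreal (n1 y)" "near r p f2 y = ennreal (n2 y)"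
    "n1 y \<le> F1 y" "n2 y \<le> F2 y" "F1 y \<le> n1 y + eps * F1 y" "F2 y \<le> n2 y + eps * F2 y" if y: "y \<in> Dr (r / 8)" for y
  proof -
    have yp: "y \<in> Dr p" using y Drp by blast
    note Fy = F[OF yp]
    note nf1 = good_near_far[OF f(1) r(1,4,5), of y] and nf2 = good_near_far[OF f(2) r(1,4,5), of y]
    have "near r p f1 y \<le> ennreal (F1 y)" "near r p f2 y \<le> ennreal (F2 y)"
      unfolding Fy(1,2)[symmetric] nf1 nf2 by simp_all
    moreover from this have "near r p f1 y < \<infinity>" "near r p f2 y < \<infinity>" by (auto intro: le_less_trans)
    ultimately show 1: "near r p f1 y = ennreal (n1 y)" "near r p f2 y = ennreal (n2 y)"
      and "n1 y \<le> F1 y" "n2 y \<le> F2 y"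
      using F0 by (simp_all add: n1_def n2_def less_top[symmetric] enn2real_leI)
    have n0: "0 \<le> n1 y" "0 \<le> n2 y" by (simp_all add: n1_def n2_def)
    have "ennreal (F1 y) \<le> ennreal (n1 y) + ennreal eps * ennreal (F1 y)"
      using nf1 add_left_mono[OF r1(3)[OF r(1,2) y], of "near r p f1 y"] unfolding 1 Fy(1) by simp
    then show "F1 y \<le> n1 y + eps * F1 y" using n0 F0[of y] eps(1)
      by (simp add: ennreal_mult[symmetric] ennreal_plus[symmetric] del: ennreal_plus)
    have "ennreal (F2 y) \<le> ennreal (n2 y) + ennreal eps * ennreal (F2 y)"
      using nf2 add_left_mono[OF r2(3)[OF r(1,3) y], of "near r p f2 y"] unfolding 1 Fy(2) by simp
    then show "F2 y \<le> n2 y + eps * F2 y" using n0 F0[of y] eps(1)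
      by (simp add: ennreal_mult[symmetric] ennreal_plus[symmetric] del: ennreal_plus)
  qed
  define A where "A = ball z0 p - ball z0 r"
  have [measurable]: "A \<in> sets borel" unfolding A_def by (rule sets.Diff) auto
  define g1 g2 where "g1 v = ind A v * ennreal (F1 v - \<mu> * F2 v)"
    and "g2 v = ind A v * ennreal ((\<mu> + L) * F2 v - F1 v)" for v
  have gm [measurable]: "g1 \<in> bfun" "g2 \<in> bfun" unfolding g1_def g2_def by measurable
  have g0: "g1 v = 0" "g2 v = 0" if "v \<in> ball z0 r" for v using that by (auto simp: g1_def g2_def A_def)
  define u v where "u = YP.Hop (Dr r) g1" and "v = YP.Hop (Dr r) g2"
  have ineq: "\<mu> * F2 w \<le> F1 w" "F1 w \<le> (\<mu> + L) * F2 w" if "w \<in> Dr p" for w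
    using bd[OF that] F(4)[OF that] unfolding F1_def[symmetric] F2_def[symmetric] by (auto simp: field_simps)
  have fz: "f1 w = 0" "f2 w = 0" "F1 w = 0" "F2 w = 0" if "w \<notin> D" for w
    using goodD(4)[OF f(1) that] goodD(4)[OF f(2) that] by (simp_all add: F1_def F2_def)
  have e1: "ind A w * f1 w = ennreal \<mu> * (ind A w * f2 w) + g1 w"
    and e2: "ennreal (\<mu> + L) * (ind A w * f2 w) = ind A w * f1 w + g2 w" for w
  proof -
    consider "w \<notin> A" | "w \<notin> D" | "w \<in> A" "w \<in> Dr p" by (auto simp: A_def Dr_def)
    then have "ind A w * f1 w = ennreal \<mu> * (ind A w * f2 w) + g1 w \<and>
      ennreal (\<mu> + L) * (ind A w * f2 w) = ind A w * f1 w + g2 w"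
    proof cases
      case 3
      then show ?thesis using F[OF 3(2)] ineq[OF 3(2)] L
        by (simp add: g1_def g2_def ennreal_mult[symmetric] ennreal_plus[symmetric] del: ennreal_plus)
    qed (simp_all add: g1_def g2_def fz)
    then show "ind A w * f1 w = ennreal \<mu> * (ind A w * f2 w) + g1 w"
      "ennreal (\<mu> + L) * (ind A w * f2 w) = ind A w * f1 w + g2 w" by auto
  qed
  have n_eq: "near r p f1 y = ennreal \<mu> * near r p f2 y + u y" "ennreal (\<mu> + L) * near r p f2 y = near r p f1 y + v y" for y
  proof -
    have m1: "(\<lambda>w. ind A w * f1 w) \<in> bfun" "(\<lambda>w. ind A w * f2 w) \<in> bfun" by measurable
    show "near r p f1 y = ennreal \<mu> * near r p f2 y + u y"
      unfolding near_def u_def A_def[symmetric] e1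
      using m1 by (simp add: YP.Hop_hm nn_integral_add nn_integral_cmult)
    have "ennreal (\<mu> + L) * near r p f2 y = YP.Hop (Dr r) (\<lambda>w. ennreal (\<mu> + L) * (ind A w * f2 w)) y"
      unfolding near_def A_def[symmetric] using m1 by (simp add: YP.Hop_hm nn_integral_cmult)
    also have "\<dots> = near r p f1 y + v y"
      unfolding near_def v_def A_def[symmetric] e2 using m1 by (simp add: YP.Hop_hm nn_integral_add)
    finally show "ennreal (\<mu> + L) * near r p f2 y = near r p f1 y + v y" .
  qed
  have uv: "u y = ennreal (n1 y - \<mu> * n2 y)" "v y = ennreal ((\<mu> + L) * n2 y - n1 y)" "\<mu> * n2 y \<le> n1 y" "n1 y \<le> (\<mu> + L) * n2 y"
    if y: "y \<in> Dr (r / 8)" for y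
  proof -
    note N = near[OF y]
    have n0: "0 \<le> n1 y" "0 \<le> n2 y" by (simp_all add: n1_def n2_def)
    have a: "ennreal (n1 y) = ennreal (\<mu> * n2 y) + u y" "ennreal ((\<mu> + L) * n2 y) = ennreal (n1 y) + v y"
      using n_eq[of y] L n0 unfolding N(1,2) by (simp_all add: ennreal_mult)
    have "ennreal (\<mu> * n2 y) \<le> ennreal (n1 y)" "ennreal (n1 y) \<le> ennreal ((\<mu> + L) * n2 y)"
      unfolding a by simp_all
    then show le: "\<mu> * n2 y \<le> n1 y" "n1 y \<le> (\<mu> + L) * n2 y" using n0 L by (simp_all add: ennreal_le_iff)
    have "ennreal (\<mu> * n2 y) + u y = ennreal (\<mu> * n2 y) + ennreal (n1 y - \<mu> * n2 y)"
      using a(1) le L n0 by (simp add: ennreal_plus[symmetric] del: ennreal_plus)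
    then show "u y = ennreal (n1 y - \<mu> * n2 y)" by (simp add: ennreal_add_left_cancel)
    have "ennreal (n1 y) + v y = ennreal (n1 y) + ennreal ((\<mu> + L) * n2 y - n1 y)"
      using a(2) le L n0 by (simp add: ennreal_plus[symmetric] del: ennreal_plus)
    then show "v y = ennreal ((\<mu> + L) * n2 y - n1 y)" by (simp add: ennreal_add_left_cancel)
  qed
  show ?thesis
  proof (intro exI[of _ "r / 8"] conjI ballI)
    show "0 < r / 8" using r by simp
    fix y y' assume y: "y \<in> Dr (r / 8)" and y': "y' \<in> Dr (r / 8)"
    have yp: "y \<in> Dr p" "y' \<in> Dr p" using y y' Drp by auto
    have "u y * v y' \<le> ennreal (C ^ 4) * (u y' * v y)"
      unfolding u_def v_def by (rule BHP_Hop[OF r(1,6) gm g0 y y'])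
    then have bhp: "(n1 y - \<mu> * n2 y) * ((\<mu> + L) * n2 y' - n1 y') \<le> C ^ 4 * ((n1 y' - \<mu> * n2 y') * ((\<mu> + L) * n2 y - n1 y))"
      unfolding uv[OF y] uv[OF y'] using uv(3,4)[OF y] uv(3,4)[OF y'] C
      by (simp add: ennreal_mult[symmetric] ennreal_le_iff)
    have "F1 y / F2 y - F1 y' / F2 y' \<le> (1 - 1 / (1 + C\<^sup>2)) * L + 3 * eps * (\<mu> + L)"
      by (rule osc_algebra[OF F(3,4)[OF yp(1)] F(3,4)[OF yp(2)] C L less_imp_le[OF eps(1)] eps(2)
          near(3,4)[OF y] near(3,4)[OF y'] near(5,6)[OF y] near(5,6)[OF y'] uv(3,4)[OF y] uv(3,4)[OF y'] bhp])
    also have "\<dots> \<le> (1 - k) * L + k / 2 * L" using eps(3) unfolding k by simp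
    also have "\<dots> = (1 - k / 2) * L" by (simp add: algebra_simps)
    finally show "enn2real (f1 y) / enn2real (f2 y) - enn2real (f1 y') / enn2real (f2 y') \<le> (1 - k / 2) * L"
      unfolding F1_def F2_def .
  qed
qed

lemma accessible_ratio:
  assumes f: "good rho f1" "good rho f2" and inf: "Jr 0 f1 = \<infinity>" "Jr 0 f2 = \<infinity>" and eta: "1 < eta"
  shows "\<exists>\<delta>>0. \<forall>y\<in>Dr \<delta>. \<forall>y'\<in>Dr \<delta>. f1 y * f2 y' \<le> ennreal eta * (f1 y' * f2 y)"
proof -
  define phi where "phi y = enn2real (f1 y) / enn2real (f2 y)" for y
  have rho: "0 < rho" by (rule goodD(1)[OF f(1)])
  obtain y0 where y0: "y0 \<in> Dr (rho / 8)" using Dr_nonempty[of "rho / 8"] rho by auto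
  have F: "f1 y = ennreal (enn2real (f1 y))" "f2 y = ennreal (enn2real (f2 y))" "0 < enn2real (f1 y)" "0 < enn2real (f2 y)" "0 < phi y"
    if y: "y \<in> Dr (rho / 8)" for y
  proof -
    show "f1 y = ennreal (enn2real (f1 y))" "f2 y = ennreal (enn2real (f2 y))"
      using goodD(7)[OF f(1) y] goodD(7)[OF f(2) y] by (simp_all add: less_top[symmetric])
    show "0 < enn2real (f1 y)" "0 < enn2real (f2 y)"
      using goodD(6,7)[OF f(1) y] goodD(6,7)[OF f(2) y] by (simp_all add: enn2real_positive_iff)
    then show "0 < phi y" by (simp add: phi_def)
  qed
  have C0: "0 < C ^ 4" using C by simp
  have bhp: "phi y \<le> C ^ 4 * phi y'" if y: "y \<in> Dr (rho / 8)" "y' \<in> Dr (rho / 8)" for y y'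
  proof -
    note A = F[OF y(1)] and B = F[OF y(2)]
    have "ennreal (enn2real (f1 y)) * ennreal (enn2real (f2 y')) \<le> ennreal (C ^ 4) * (ennreal (enn2real (f1 y')) * ennreal (enn2real (f2 y)))"
      using BHP_good[OF f y] unfolding A(1)[symmetric] A(2)[symmetric] B(1)[symmetric] B(2)[symmetric] .
    then have "enn2real (f1 y) * enn2real (f2 y') \<le> C ^ 4 * (enn2real (f1 y') * enn2real (f2 y))"
      using C by (simp add: ennreal_mult[symmetric] ennreal_le_iff)
    then show ?thesis using A B by (simp add: phi_def field_simps)
  qed
  \<comment> \<open>All oscillation bounds attained on some neighbourhood. As the set is stable
    under multiplication by \<open>1 - k / 2\<close>, its infimum is 0, and no sequence of radii has
    to be constructed.\<close>
  define \<Omega> where "\<Omega> = {L. 0 < L \<and> (\<exists>p>0. 8 * p \<le> rho \<and> (\<forall>y\<in>Dr p. \<forall>y'\<in>Dr p. phi y - phi y' \<le> L))}"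
  define k where "k = 1 / (1 + C\<^sup>2)"
  have k: "0 < k" "k \<le> 1" by (auto simp: k_def add_pos_nonneg divide_simps)
  have step: "(1 - k / 2) * L \<in> \<Omega>" if L: "L \<in> \<Omega>" for L
  proof -
    from L obtain p where p: "0 < L" "0 < p" "8 * p \<le> rho" "\<And>y y'. y \<in> Dr p \<Longrightarrow> y' \<in> Dr p \<Longrightarrow> phi y - phi y' \<le> L"
      by (auto simp: \<Omega>_def)
    have sub: "Dr p \<subseteq> Dr (rho / 8)" using p by (intro Dr_mono) simp
    define \<mu> where "\<mu> = Inf (phi ` Dr p)"
    have ne: "phi ` Dr p \<noteq> {}" using Dr_nonempty[OF p(2)] by simp
    have bb: "bdd_below (phi ` Dr p)" using F(5) sub by (intro bdd_belowI[of _ 0]) (auto intro: less_imp_le)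
    have \<mu>0: "0 \<le> \<mu>" unfolding \<mu>_def using ne F(5) sub by (intro cInf_greatest) (auto intro: less_imp_le)
    have bd: "\<mu> \<le> phi y \<and> phi y \<le> \<mu> + L" if y: "y \<in> Dr p" for y
    proof
      show "\<mu> \<le> phi y" unfolding \<mu>_def using bb y by (intro cInf_lower) auto
      have "phi y - L \<le> \<mu>" unfolding \<mu>_def
      proof (rule cInf_greatest[OF ne])
        fix z assume "z \<in> phi ` Dr p"
        then obtain y' where "y' \<in> Dr p" "z = phi y'" by auto
        then show "phi y - L \<le> z" using p(4)[OF y, of y'] by simp
      qed
      then show "phi y \<le> \<mu> + L" by simp
    qed
    from accessible_contract[OF f inf p(2,3) \<mu>0 p(1) _ k_def] bd
    obtain r where r: "0 < r" "\<And>y y'. y \<in> Dr r \<Longrightarrow> y' \<in> Dr r \<Longrightarrow> phi y - phi y' \<le> (1 - k / 2) * L"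
      unfolding phi_def by blast
    have "Dr (min r (rho / 8)) \<subseteq> Dr r" by (rule Dr_mono) simp
    then show ?thesis using r rho p(1) k by (auto simp: \<Omega>_def intro!: exI[of _ "min r (rho / 8)"])
  qed
  have ne: "\<Omega> \<noteq> {}"
  proof -
    have "phi y - phi y' \<le> C ^ 4 * phi y0" if "y \<in> Dr (rho / 8)" "y' \<in> Dr (rho / 8)" for y y'
      using bhp[OF that(1) y0] F(5)[OF that(2)] by simp
    then have "C ^ 4 * phi y0 \<in> \<Omega>" using C0 F(5)[OF y0] rho by (auto simp: \<Omega>_def intro!: exI[of _ "rho / 8"])
    then show ?thesis by blast
  qed
  have bb: "bdd_below \<Omega>" by (rule bdd_belowI[of _ 0]) (auto simp: \<Omega>_def)
  define \<omega> where "\<omega> = Inf \<Omega>"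
  have "0 \<le> \<omega>" unfolding \<omega>_def using ne by (intro cInf_greatest) (auto simp: \<Omega>_def)
  have "\<omega> \<le> 0"
  proof (rule ccontr)
    assume "\<not> \<omega> \<le> 0"
    then have "\<omega> < \<omega> / (1 - k / 2)" using k by (simp add: field_simps)
    then obtain L where L: "L \<in> \<Omega>" "L < \<omega> / (1 - k / 2)" unfolding \<omega>_def using ne bb by (subst (asm) cInf_less_iff) auto
    have "\<omega> \<le> (1 - k / 2) * L" unfolding \<omega>_def by (rule cInf_lower[OF step[OF L(1)] bb])
    then show False using L(2) k by (simp add: field_simps)
  qed
  \<comment> \<open>By the boundary Harnack principle the ratio is at least
    \<open>phi y0 / C ^ 4\<close>, so an additive oscillation below \<open>l\<close> amounts to a
    factor of at most \<open>eta\<close>.\<close>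
  define l where "l = (eta - 1) * (phi y0 / C ^ 4)"
  have "0 < l" using eta F(5)[OF y0] C0 by (simp add: l_def)
  then have "\<omega> < l" using \<open>\<omega> \<le> 0\<close> by simp
  then obtain L where L: "L \<in> \<Omega>" "L < l" unfolding \<omega>_def using ne bb by (subst (asm) cInf_less_iff) auto
  then obtain p where p: "0 < p" "8 * p \<le> rho" "\<And>y y'. y \<in> Dr p \<Longrightarrow> y' \<in> Dr p \<Longrightarrow> phi y - phi y' \<le> L"
    by (auto simp: \<Omega>_def)
  have sub: "Dr p \<subseteq> Dr (rho / 8)" using p by (intro Dr_mono) simp
  show ?thesis
  proof (intro exI[of _ p] conjI ballI p(1))
    fix y y' assume y: "y \<in> Dr p" and y': "y' \<in> Dr p"
    have yy: "y \<in> Dr (rho / 8)" "y' \<in> Dr (rho / 8)" using y y' sub by auto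
    note A = F[OF yy(1)] and B = F[OF yy(2)]
    have "phi y0 / C ^ 4 \<le> phi y'" using bhp[OF y0 yy(2)] C0 by (simp add: field_simps)
    then have "l \<le> (eta - 1) * phi y'" unfolding l_def using eta by (intro mult_left_mono) auto
    then have "phi y \<le> eta * phi y'" using p(3)[OF y y'] L(2) by (simp add: algebra_simps)
    then have "enn2real (f1 y) * enn2real (f2 y') \<le> eta * (enn2real (f1 y') * enn2real (f2 y))"
      using A B by (simp add: phi_def field_simps)
    then have "ennreal (enn2real (f1 y)) * ennreal (enn2real (f2 y')) \<le> ennreal eta * (ennreal (enn2real (f1 y')) * ennreal (enn2real (f2 y)))"
      using eta by (simp add: ennreal_mult[symmetric] ennreal_le_iff)
    then show "f1 y * f2 y' \<le> ennreal eta * (f1 y' * f2 y)"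
      unfolding A(1)[symmetric] A(2)[symmetric] B(1)[symmetric] B(2)[symmetric] .
  qed
qed

lemma inaccessible_ratio:
  assumes f: "good rho f1" "good rho f2" and fin: "Jr 0 f1 < \<infinity>" "Jr 0 f2 < \<infinity>" and eta: "1 < eta"
  shows "\<exists>\<delta>>0. \<forall>y\<in>Dr \<delta>. \<forall>y'\<in>Dr \<delta>. f1 y * f2 y' \<le> ennreal eta * (f1 y' * f2 y)"
proof -
  \<comment> \<open>A fourth root: the asymptotics is used for two functions at two points.\<close>
  define q where "q = sqrt (sqrt eta)"
  have q: "1 < q" "q * q * (q * q) = eta" using eta by (auto simp: q_def)
  obtain r1 where r1: "0 < r1" "\<And>r y. 0 < r \<Longrightarrow> r \<le> r1 \<Longrightarrow> y \<in> Dr (r / 8) \<Longrightarrow>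
      f1 y \<le> ennreal q * (et r y * Jr 0 f1) \<and> et r y * Jr 0 f1 \<le> ennreal q * f1 y"
    using inaccessible_asymp[OF f(1) fin(1) q(1)] by auto
  obtain r2 where r2: "0 < r2" "\<And>r y. 0 < r \<Longrightarrow> r \<le> r2 \<Longrightarrow> y \<in> Dr (r / 8) \<Longrightarrow>
      f2 y \<le> ennreal q * (et r y * Jr 0 f2) \<and> et r y * Jr 0 f2 \<le> ennreal q * f2 y"
    using inaccessible_asymp[OF f(2) fin(2) q(1)] by auto
  define r where "r = min r1 r2"
  have r: "0 < r" "r \<le> r1" "r \<le> r2" using r1 r2 by (auto simp: r_def)
  show ?thesis
  proof (intro exI[of _ "r / 8"] conjI ballI)
    show "0 < r / 8" using r by simp
    fix y y' assume y: "y \<in> Dr (r / 8)" and y': "y' \<in> Dr (r / 8)"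
    have "f1 y * f2 y' \<le> (ennreal q * (et r y * Jr 0 f1)) * (ennreal q * (et r y' * Jr 0 f2))"
      using r1(2)[OF r(1,2) y] r2(2)[OF r(1,3) y'] by (intro mult_mono) auto
    also have "\<dots> = ennreal (q * q) * ((et r y' * Jr 0 f1) * (et r y * Jr 0 f2))"
      using q by (simp add: ennreal_mult mult_ac)
    also have "\<dots> \<le> ennreal (q * q) * ((ennreal q * f1 y') * (ennreal q * f2 y))"
      using r1(2)[OF r(1,2) y'] r2(2)[OF r(1,3) y] by (intro mult_left_mono[OF mult_mono]) auto
    also have "\<dots> = ennreal eta * (f1 y' * f2 y)"
      unfolding q(2)[symmetric] using q(1) by (simp add: ennreal_mult mult_ac)
    finally show "f1 y * f2 y' \<le> ennreal eta * (f1 y' * f2 y)" .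
  qed
qed

end

section \<open>Test sets and the dichotomy for the ratio limit\<close>

context martin_setup begin

text \<open>The compact set keeps \<open>E\<close> at a distance from \<open>z0\<close> and makes
  its potential finite near \<open>z0\<close>; positive measure makes the potential positive
  there.\<close>

definition test :: "'a set \<Rightarrow> bool" where
  "test E \<longleftrightarrow> E \<in> sets borel \<and> 0 < emeasure m E \<and> (\<exists>S. compact S \<and> E \<subseteq> S \<and> S \<subseteq> D)"

lemma LIMSEQ_Dr:
  assumes "\<And>n. y n \<in> Dr (min r (rn n))" shows "range y \<subseteq> D" "y \<longlonglongrightarrow> z0"
proof -
  show "range y \<subseteq> D" using assms by (auto simp: Dr_def)
  have "dist (y n) z0 \<le> rn n" for n
    using assms[of n] by (simp add: Dr_def dist_commute del: of_nat_Suc)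
  then show "y \<longlonglongrightarrow> z0"
    unfolding tendsto_dist_iff[of y z0]
    by (intro tendsto_sandwich[OF _ _ tendsto_const LIMSEQ_Suc[OF lim_1_over_n]] always_eventually allI) auto
qed

lemma compact_far:
  assumes "compact S" "S \<subseteq> D"
  shows "\<exists>rho>0. rho \<le> R1 \<and> S \<inter> cball z0 rho = {}"
proof -
  have "open (- S)" "z0 \<in> - S" using assms z0_notin by (auto simp: compact_imp_closed)
  then obtain e where e: "0 < e" "cball z0 e \<subseteq> - S" by (meson open_contains_cball)
  have "cball z0 (min e R1) \<subseteq> cball z0 e" by auto
  then show ?thesis using e R1 by (intro exI[of _ "min e R1"]) auto
qed

text \<open>Continuity in the pole gives \<open>G\<close> a finite maximum over a compact set of
  poles that avoids \<open>y\<close>.\<close>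

lemma fpot_finite:
  assumes S: "compact S" "S \<subseteq> D" "S \<inter> cball z0 rho = {}" and E: "E \<in> sets borel" "E \<subseteq> S"
    and rho: "0 < rho" "rho \<le> R1" and y: "y \<in> Dr (rho / 8)"
  shows "fpot (ind E) y < \<infinity>"
proof (cases "S = {}")
  case True
  then show ?thesis using E by (simp add: fpot_def)
next
  case False
  have yR: "y \<in> Dr (R1 / 8)" using y rho Dr_mono[of "rho / 8" "R1 / 8"] by auto
  have "continuous_on S (\<lambda>x. G x y)" by (rule continuous_on_subset[OF G_cont[OF yR] S(2)])
  from continuous_attains_sup[OF S(1) False this] obtain x where x: "x \<in> S" "\<And>u. u \<in> S \<Longrightarrow> G u y \<le> G x y" by auto
  have "x \<noteq> y" using x S(3) y rho by (auto simp: Dr_def)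
  have "fpot (ind E) y \<le> (\<integral>\<^sup>+u. G x y * ind S u \<partial>m)"
    unfolding fpot_def using x(2) E(2) by (intro nn_integral_mono) (auto simp: indicator_def)
  also have "\<dots> = G x y * emeasure m S"
    using S(1) by (intro nn_integral_cmult_indicator) (simp add: XP.sets_m borel_compact)
  also have "\<dots> < \<infinity>" using G_fin[OF \<open>x \<noteq> y\<close>] XP.compact_m[OF S(1)] by (simp add: ennreal_mult_less_top)
  finally show ?thesis .
qed

lemma test_good:
  assumes "test E"
  shows "\<exists>rho. E \<inter> cball z0 rho = {} \<and> good rho (fpot (ind E))"
proof -
  from assms obtain S where S: "compact S" "E \<subseteq> S" "S \<subseteq> D" and E: "E \<in> sets borel" "0 < emeasure m E"
    by (auto simp: test_def)
  obtain rho where rho: "0 < rho" "rho \<le> R1" "S \<inter> cball z0 rho = {}" using compact_far[OF S(1,3)] by auto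
  have ind: "(ind E) \<in> bfun" using E by simp
  have EDr: "ind E x = (0 :: ennreal)" if "x \<in> Dr r" "r \<le> rho" for x r
    using that rho S by (auto simp: Dr_def indicator_def)
  have "good rho (fpot (ind E))"
    unfolding good_def
  proof (intro conjI allI impI ballI rho measurable_fpot ind)
    show "fpot (ind E) v = 0" if "v \<notin> D" for v using that by (rule fpot_off)
    fix r assume r: "0 < r \<and> r \<le> rho"
    show "YP.Hop (Dr r) (fpot (ind E)) = fpot (ind E)"
    proof
      fix y
      have "YP.Hop (Dr r) (\<lambda>v. ind (- ball z0 r) v * fpot (ind E) v) = fpot (ind E)"
        by (rule fpot_harmonic[OF ind EDr]) (use r in auto)
      moreover have "YP.Hop (Dr r) (fpot (ind E)) y = YP.Hop (Dr r) (\<lambda>v. ind (- ball z0 r) v * fpot (ind E) v) y"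
        by (rule Hop_Dr_restrict) (rule fpot_off)
      ultimately show "YP.Hop (Dr r) (fpot (ind E)) y = fpot (ind E) y" by simp
    qed
  next
    fix y assume y: "y \<in> Dr (rho / 8)"
    show "fpot (ind E) y < \<infinity>" by (rule fpot_finite[OF S(1,3) rho(3) E(1) S(2) rho(1,2) y])
    show "0 < fpot (ind E) y"
      by (rule fpot_pos[OF rho(1,2) E(1) _ _ E(2) y]) (use S rho in \<open>auto simp: Dr_def\<close>)
  qed
  then show ?thesis using S rho by blast
qed

lemma BHP_G_fpot:
  assumes rho: "0 < rho" "rho \<le> R1" and E: "E \<in> sets borel" "E \<subseteq> D - cball z0 rho" and x1: "x1 \<in> D - cball z0 rho"
    and y1: "y1 \<in> Dr (rho / 8)" and w: "w \<in> Dr (rho / 8)"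
  shows "G x1 y1 * fpot (ind E) w \<le> ennreal (C ^ 4) * (fpot (ind E) y1 * G x1 w)"
proof -
  have "G x1 y1 * fpot (ind E) w = (\<integral>\<^sup>+x. G x1 y1 * (G x w * ind E x) \<partial>m)"
    unfolding fpot_def using E(1) by (intro nn_integral_cmult[symmetric]) simp
  also have "\<dots> \<le> (\<integral>\<^sup>+x. (ennreal (C ^ 4) * G x1 w) * (G x y1 * ind E x) \<partial>m)"
  proof (rule nn_integral_mono)
    fix x
    show "G x1 y1 * (G x w * ind E x) \<le> (ennreal (C ^ 4) * G x1 w) * (G x y1 * ind E x)"
    proof (cases "x \<in> E")
      case True
      then show ?thesis using BHP_G[OF rho _ x1 w y1, of x] E(2) by (auto simp: mult_ac)
    qed simp
  qed
  also have "\<dots> = (ennreal (C ^ 4) * G x1 w) * fpot (ind E) y1"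
    unfolding fpot_def using E(1) by (intro nn_integral_cmult) simp
  finally show ?thesis by (simp add: mult_ac)
qed

lemma Jr_test_infinite:
  assumes E: "test E" and inf: "\<And>x. x \<in> D \<Longrightarrow> kap 0 x = \<infinity>"
  shows "Jr 0 (fpot (ind E)) = \<infinity>"
proof -
  have ED: "E \<subseteq> D" "E \<in> sets borel" "0 < emeasure m E" using E by (auto simp: test_def)
  have "Jr 0 (fpot (ind E)) = (\<integral>\<^sup>+x. kap 0 x * ind E x \<partial>m)" using ED by (simp add: Jr_fpot)
  also have "\<dots> = (\<integral>\<^sup>+x. \<infinity> * ind E x \<partial>m)"
    using inf ED by (intro nn_integral_cong) (auto simp: indicator_def)
  also have "\<dots> = \<infinity> * emeasure m E" using ED by (intro nn_integral_cmult_indicator) (simp add: XP.sets_m)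
  finally show ?thesis using ED by (simp add: ennreal_top_mult)
qed

text \<open>One finite value of the Poisson kernel suffices: near \<open>z0\<close> the potential is
  at most a multiple of \<open>G x1\<close> by the boundary Harnack principle, which bounds the near
  part through \<open>kap 0 x1\<close>, and the rest is finite by \<open>Jr_good\<close>.\<close>

lemma Jr_test_finite:
  assumes E: "test E" and x1: "x1 \<in> D" "kap 0 x1 < \<infinity>"
  shows "Jr 0 (fpot (ind E)) < \<infinity>"
proof -
  define f where "f = fpot (ind E)"
  have Eb: "E \<in> sets borel" "E \<subseteq> D" using E by (auto simp: test_def)
  obtain rho1 where rho1: "E \<inter> cball z0 rho1 = {}" "good rho1 f" using test_good[OF E] by (auto simp: f_def)
  have "0 < dist z0 x1" using x1 z0_notin by auto
  define rho where "rho = min rho1 (dist z0 x1 / 2)"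
  have rho: "0 < rho" "rho \<le> rho1" "rho \<le> R1" "x1 \<in> D - cball z0 rho" "E \<subseteq> D - cball z0 rho"
    using \<open>0 < dist z0 x1\<close> goodD(1,2)[OF rho1(2)] x1 Eb rho1(1) by (auto simp: rho_def)
  note f = good_mono[OF rho1(2) rho(1,2)]
  have [measurable]: "f \<in> bfun" by (rule goodD(3)[OF f])
  obtain y1 where y1: "y1 \<in> Dr (rho / 8)" using Dr_nonempty[of "rho / 8"] rho by auto
  have A: "Af (rho / 8) f < \<infinity>"
    using rho by (intro le_less_trans[OF Af_le_Jr Jr_good(2)[OF f]]) auto
  have pt: "G x1 y1 * f w \<le> ennreal (C ^ 4) * (f y1 * G x1 w)" if w: "w \<in> Dr (rho / 8)" for w
    unfolding f_def by (rule BHP_G_fpot[OF rho(1,3) Eb(1) rho(5,4) y1 w])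
  have "G x1 y1 * Nf (rho / 8) f = (\<integral>\<^sup>+w. G x1 y1 * (ennreal (jh z0 w) * (ind (ball z0 (rho / 8)) w * f w)) \<partial>m)"
    unfolding Nf_def
    by (rule nn_integral_cmult[symmetric])
      (simp add: borel_measurable_times_ennreal borel_measurable_indicator goodD(3)[OF f])
  also have "\<dots> \<le> (\<integral>\<^sup>+w. (ennreal (C ^ 4) * f y1) * (ennreal (jh z0 w) * G x1 w) \<partial>m)"
  proof (rule nn_integral_mono)
    fix w
    show "G x1 y1 * (ennreal (jh z0 w) * (ind (ball z0 (rho / 8)) w * f w)) \<le> (ennreal (C ^ 4) * f y1) * (ennreal (jh z0 w) * G x1 w)"
    proof (cases "w \<in> Dr (rho / 8)")
      case True
      then show ?thesis using mult_left_mono[OF pt[OF True], of "ennreal (jh z0 w)"] by (simp add: mult_ac Dr_def)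
    next
      case False
      then show ?thesis using goodD(4)[OF f, of w] by (auto simp: Dr_def indicator_def)
    qed
  qed
  also have "\<dots> = (ennreal (C ^ 4) * f y1) * kap 0 x1"
    unfolding kap_def by (simp add: nn_integral_cmult)
  also have "\<dots> < \<infinity>" using goodD(7)[OF f y1] x1(2) by (simp add: ennreal_mult_less_top)
  finally have "Nf (rho / 8) f < \<infinity>"
    using G_pos[OF rho(1,3,4) y1] by (auto simp: ennreal_mult_less_top)
  then show ?thesis using A Af_Nf[of f "rho / 8"] unfolding f_def[symmetric] by (simp add: less_top[symmetric]) (metis ennreal_add_eq_top infinity_ennreal_def)
qed

text \<open>Either the Poisson kernel at \<open>z0\<close> is infinite on all of \<open>D\<close>,
  and both functionals are infinite, or it is finite somewhere, and both are finite. The mixed case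
  does not arise.\<close>

lemma ratio_limit:
  assumes E: "test A" "test B" and eta: "1 < eta"
  shows "\<exists>\<delta>>0. \<forall>y\<in>Dr \<delta>. \<forall>y'\<in>Dr \<delta>.
    fpot (ind A) y * fpot (ind B) y' \<le> ennreal eta * (fpot (ind A) y' * fpot (ind B) y)"
proof -
  obtain rho1 rho2 where rho: "good rho1 (fpot (ind A))" "good rho2 (fpot (ind B))"
    using test_good[OF E(1)] test_good[OF E(2)] by auto
  have min: "0 < min rho1 rho2" using goodD(1)[OF rho(1)] goodD(1)[OF rho(2)] by simp
  have g: "good (min rho1 rho2) (fpot (ind A))" "good (min rho1 rho2) (fpot (ind B))"
    by (rule good_mono[OF rho(1) min], simp, rule good_mono[OF rho(2) min], simp)
  show ?thesis
  proof (cases "\<forall>x\<in>D. kap 0 x = \<infinity>")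
    case True
    then show ?thesis by (intro accessible_ratio[OF g _ _ eta] Jr_test_infinite E) auto
  next
    case False
    then obtain x1 where "x1 \<in> D" "kap 0 x1 < \<infinity>" by (auto simp: less_top)
    then show ?thesis by (intro inaccessible_ratio[OF g _ _ eta] Jr_test_finite E)
  qed
qed

end

lemma martin_spaceD:
  assumes "martin_space X D G x0 \<T> B K"
  shows "topspace \<T> = Inl ` D \<union> Inr ` B" "compact_space \<T>" "metrizable_space \<T>" "embedding_map (top_of_set D) \<T> Inl"
    and "x \<in> D \<Longrightarrow> y \<in> D \<Longrightarrow> y \<noteq> x0 \<Longrightarrow> K x (Inl y) = G x y / G x0 y"
    and "x \<in> D \<Longrightarrow> w \<in> B \<Longrightarrow> limitin euclidean (K x) (K x (Inr w)) (atin_within \<T> (Inr w) (Inl ` D))"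
    and "w \<in> B \<Longrightarrow> excessive X D (\<lambda>x. K x (Inr w))"
    and "w1 \<in> B \<Longrightarrow> w2 \<in> B \<Longrightarrow> w1 \<noteq> w2 \<Longrightarrow> \<exists>x\<in>D. K x (Inr w1) \<noteq> K x (Inr w2)"
    and "v \<in> topspace \<T> - {Inl x0} \<Longrightarrow> continuous_on D (\<lambda>x. K x v)"
proof -
  note 1 = assms[unfolded martin_space_def]
  note 2 = conjunct2[OF 1] note 3 = conjunct2[OF 2] note 4 = conjunct2[OF 3] note 5 = conjunct2[OF 4] note 6 = conjunct2[OF 5]
  note 7 = conjunct2[OF 6] note 8 = conjunct2[OF 7] note 9 = conjunct2[OF 8] note 10 = conjunct2[OF 9] note 11 = conjunct2[OF 10]
  show top: "topspace \<T> = Inl ` D \<union> Inr ` B" by (rule conjunct1[OF 1])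
  show "compact_space \<T>" "metrizable_space \<T>" "embedding_map (top_of_set D) \<T> Inl"
    by (rule conjunct1[OF 2], rule conjunct1[OF 3], rule conjunct1[OF 6])
  show "x \<in> D \<Longrightarrow> y \<in> D \<Longrightarrow> y \<noteq> x0 \<Longrightarrow> K x (Inl y) = G x y / G x0 y"
    by (rule conjunct1[OF 7, rule_format]) auto
  show "x \<in> D \<Longrightarrow> w \<in> B \<Longrightarrow> limitin euclidean (K x) (K x (Inr w)) (atin_within \<T> (Inr w) (Inl ` D))"
    by (rule conjunct1[OF 8, rule_format])
  show "w \<in> B \<Longrightarrow> excessive X D (\<lambda>x. K x (Inr w))"
    by (rule conjunct1[OF 9, rule_format]) (simp add: top)
  show "w1 \<in> B \<Longrightarrow> w2 \<in> B \<Longrightarrow> w1 \<noteq> w2 \<Longrightarrow> \<exists>x\<in>D. K x (Inr w1) \<noteq> K x (Inr w2)"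
    by (rule 11[rule_format])
  assume "v \<in> topspace \<T> - {Inl x0}"
  then have "continuous_map (top_of_set D) (prod_topology (top_of_set D) (subtopology \<T> (topspace \<T> - {Inl x0}))) (\<lambda>x. (x, v))"
    by (simp add: continuous_map_paired)
  from continuous_map_compose[OF this conjunct1[OF 10]] show "continuous_on D (\<lambda>x. K x v)" by (simp add: o_def)
qed

section \<open>Uniqueness of the associated boundary point\<close>

locale martin_kernel = martin_setup +
  fixes \<T> :: "('a + 'e) topology" and B :: "'e set" and K :: "'a \<Rightarrow> 'a + 'e \<Rightarrow> ennreal"
  assumes martin: "martin_space X D G x0 \<T> B K"
begin

lemmas martin_facts = martin_spaceD[OF martin]
lemmas K_Inl = martin_facts(5) and K_limit = martin_facts(6) and K_excessive = martin_facts(7)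
  and K_separates = martin_facts(8)

lemma K_cont: "w \<in> B \<Longrightarrow> continuous_on D (\<lambda>x. K x (Inr w))"
  by (rule martin_facts(9)) (simp add: martin_facts(1))

lemma measurable_K [measurable]:
  assumes "w \<in> B" shows "(\<lambda>x. K x (Inr w) * ind D x) \<in> bfun"
  using K_excessive[OF assms] D borel_measurable_restrict_space_iff_ennreal[of D borel "\<lambda>x. K x (Inr w)"]
  by (simp add: excessive_def)

lemma Dr_eventually:
  assumes "range y \<subseteq> D" "y \<longlonglongrightarrow> z0" "0 < r"
  shows "eventually (\<lambda>n. y n \<in> Dr r) sequentially"
proof -
  have "eventually (\<lambda>n. dist z0 (y n) < r) sequentially"
    by (rule order_tendstoD(2)[OF tendsto_dist[OF tendsto_const assms(2)]]) (use assms(3) in simp)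
  then show ?thesis by eventually_elim (use assms(1) in \<open>auto simp: Dr_def\<close>)
qed

lemma boundary_limit:
  assumes w: "w \<in> B" and y: "range y \<subseteq> D" "limitin \<T> (\<lambda>n. Inl (y n)) (Inr w) sequentially" "y \<longlonglongrightarrow> z0" and x: "x \<in> D"
  shows "(\<lambda>n. G x (y n) / G x0 (y n)) \<longlonglongrightarrow> K x (Inr w)"
proof -
  note lim = K_limit[OF x w]
  have fl: "filterlim (\<lambda>n. Inl (y n)) (atin_within \<T> (Inr w) (Inl ` D)) sequentially"
    unfolding filterlim_iff
  proof (intro allI impI)
    fix P assume "eventually P (atin_within \<T> (Inr w) (Inl ` D))"
    then obtain U where U: "openin \<T> U" "Inr w \<in> U" "\<And>z. z \<in> U \<Longrightarrow> z \<in> Inl ` D \<Longrightarrow> z \<noteq> Inr w \<Longrightarrow> P z"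
      unfolding eventually_atin_within using limitin_topspace[OF y(2)] by auto
    have "eventually (\<lambda>n. Inl (y n) \<in> U) sequentially" using y(2) U by (auto simp: limitin_def)
    then show "eventually (\<lambda>n. P (Inl (y n))) sequentially"
      by eventually_elim (use y(1) U(3) in auto)
  qed
  have "(\<lambda>n. K x (Inl (y n))) \<longlonglongrightarrow> K x (Inr w)"
    using filterlim_compose[OF _ fl] lim by simp
  moreover have "eventually (\<lambda>n. K x (Inl (y n)) = G x (y n) / G x0 (y n)) sequentially"
  proof -
    have "eventually (\<lambda>n. y n \<in> Dr R1) sequentially" by (rule Dr_eventually[OF y(1,3) R1(1)])
    then have "eventually (\<lambda>n. y n \<noteq> x0) sequentially" by eventually_elim (rule x0_far)
    then show ?thesis by eventually_elim (use y(1) x in \<open>auto intro: K_Inl\<close>)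
  qed
  ultimately show ?thesis by (rule Lim_transform_eventually)
qed

lemma K_x0:
  assumes w: "w \<in> B" and y: "range y \<subseteq> D" "limitin \<T> (\<lambda>n. Inl (y n)) (Inr w) sequentially" "y \<longlonglongrightarrow> z0"
  shows "K x0 (Inr w) = 1"
proof -
  have "eventually (\<lambda>n. y n \<in> Dr (R1 / 8)) sequentially" by (rule Dr_eventually[OF y(1,3)]) (use R1 in simp)
  then have "eventually (\<lambda>n. G x0 (y n) / G x0 (y n) = 1) sequentially"
  proof eventually_elim
    case (elim n)
    then show ?case using G_x0_pos[OF elim] by (intro ennreal_divide_self) auto
  qed
  then have "(\<lambda>n. G x0 (y n) / G x0 (y n)) \<longlonglongrightarrow> 1" by (rule tendsto_eventually)
  with boundary_limit[OF w y D(2)] show ?thesis by (rule LIMSEQ_unique)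
qed

text \<open>\<open>BHP_G\<close> with second pole \<open>x0\<close>. The bound does not depend on
  \<open>y\<close>, so it dominates the normalised kernels along sequences tending to
  \<open>z0\<close>.\<close>

lemma kernel_bound:
  assumes rho: "0 < rho" "rho \<le> R1" and x: "x \<in> D - cball z0 rho" and y: "y \<in> Dr (rho / 8)" "y1 \<in> Dr (rho / 8)"
  shows "G x y / G x0 y \<le> ennreal (C ^ 4) * (G x y1 / G x0 y1)"
proof -
  have x0: "x0 \<in> D - cball z0 rho" using D R1 rho by auto
  have g: "0 < G x0 y" "G x0 y < \<infinity>" "0 < G x0 y1" "G x0 y1 < \<infinity>"
  proof -
    have "y \<in> Dr (R1 / 8)" "y1 \<in> Dr (R1 / 8)" using y rho Dr_mono[of "rho / 8" "R1 / 8"] by auto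
    then show "0 < G x0 y" "G x0 y < \<infinity>" "0 < G x0 y1" "G x0 y1 < \<infinity>" by (simp_all only: G_x0_pos)
  qed
  have "G x y * G x0 y1 * (inverse (G x0 y) * inverse (G x0 y1)) \<le> ennreal (C ^ 4) * (G x y1 * G x0 y) * (inverse (G x0 y) * inverse (G x0 y1))"
    by (rule mult_right_mono[OF BHP_G[OF rho x x0 y]]) simp
  moreover have 1: "G x0 y * inverse (G x0 y) = 1" "G x0 y1 * inverse (G x0 y1) = 1"
    using g by (auto simp: divide_ennreal_def[symmetric] intro!: ennreal_divide_self)
  have "G x y * G x0 y1 * (inverse (G x0 y) * inverse (G x0 y1)) = (G x y / G x0 y) * (G x0 y1 * inverse (G x0 y1))"
    "ennreal (C ^ 4) * (G x y1 * G x0 y) * (inverse (G x0 y) * inverse (G x0 y1)) = ennreal (C ^ 4) * (G x y1 / G x0 y1) * (G x0 y * inverse (G x0 y))"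
    unfolding divide_ennreal_def by (simp_all only: mult_ac)
  ultimately show ?thesis unfolding 1 by simp
qed

text \<open>The poles stay in \<open>E\<close>, at a distance from \<open>z0\<close>, so
  \<open>kernel_bound\<close> dominates the normalised kernels by a function integrable over
  \<open>E\<close>.\<close>

lemma integral_limit:
  assumes w: "w \<in> B" and y: "range y \<subseteq> D" "limitin \<T> (\<lambda>n. Inl (y n)) (Inr w) sequentially" "y \<longlonglongrightarrow> z0" and E: "test E"
  shows "(\<lambda>n. fpot (ind E) (y n) / G x0 (y n)) \<longlonglongrightarrow> (\<integral>\<^sup>+x. K x (Inr w) * ind E x \<partial>m)"
    and "(\<integral>\<^sup>+x. K x (Inr w) * ind E x \<partial>m) < \<infinity>"
proof -
  have Eb [measurable]: "E \<in> sets borel" and ED: "E \<subseteq> D" using E by (auto simp: test_def)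
  obtain rho where rho': "E \<inter> cball z0 rho = {}" "good rho (fpot (ind E))" using test_good[OF E] by auto
  note rho = goodD(1,2)[OF rho'(2)]
  obtain y1 where y1: "y1 \<in> Dr (rho / 8)" using Dr_nonempty[of "rho / 8"] rho by auto
  obtain N where N: "\<And>n. n \<ge> N \<Longrightarrow> y n \<in> Dr (rho / 8)"
    using Dr_eventually[OF y(1,3), of "rho / 8"] rho by (auto simp: eventually_sequentially)
  let ?u = "\<lambda>n x. G x (y (n + N)) / G x0 (y (n + N)) * ind E x"
  let ?b = "\<lambda>x. ennreal (C ^ 4) * (G x y1 / G x0 y1) * ind E x"
  have Km: "(\<lambda>x. K x (Inr w) * ind E x) = (\<lambda>x. K x (Inr w) * ind D x * ind E x)"
    using ED by (auto simp: fun_eq_iff indicator_def)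
  have [measurable]: "(\<lambda>x. K x (Inr w) * ind E x) \<in> bfun"
    unfolding Km using measurable_K[OF w] by measurable
  have lim: "(\<lambda>n. ?u n x) \<longlonglongrightarrow> K x (Inr w) * ind E x" for x
  proof (cases "x \<in> E")
    case True
    then show ?thesis using LIMSEQ_ignore_initial_segment[OF boundary_limit[OF w y, of x], of N] ED by auto
  qed simp
  have bd: "?u n x \<le> ?b x" for n x
  proof (cases "x \<in> E")
    case True
    then have "x \<in> D - cball z0 rho" using rho'(1) ED by blast
    from kernel_bound[OF rho this N y1] True show ?thesis by simp
  qed simp
  have b: "(\<integral>\<^sup>+x. ?b x \<partial>m) < \<infinity>"
  proof -
    have "(\<integral>\<^sup>+x. ?b x \<partial>m) = (\<integral>\<^sup>+x. (ennreal (C ^ 4) * inverse (G x0 y1)) * (G x y1 * ind E x) \<partial>m)"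
      by (intro nn_integral_cong) (simp add: divide_ennreal_def mult_ac)
    also have "\<dots> = (ennreal (C ^ 4) * inverse (G x0 y1)) * fpot (ind E) y1"
      unfolding fpot_def by (rule nn_integral_cmult) simp
    also have "\<dots> < \<infinity>"
    proof -
      have "0 < G x0 y1" using y1 rho Dr_mono[of "rho / 8" "R1 / 8"] by (intro G_x0_pos) auto
      then show ?thesis using goodD(7)[OF rho'(2) y1]
        by (auto simp: less_top[symmetric] ennreal_mult_eq_top_iff ennreal_inverse_eq_top_iff)
    qed
    finally show ?thesis .
  qed
  have "(\<lambda>n. \<integral>\<^sup>+x. ?u n x \<partial>m) \<longlonglongrightarrow> (\<integral>\<^sup>+x. K x (Inr w) * ind E x \<partial>m)"
    by (rule nn_integral_dominated_convergence[where w = ?b]) (use lim bd b in auto)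
  moreover have "(\<integral>\<^sup>+x. ?u n x \<partial>m) = fpot (ind E) (y (n + N)) / G x0 (y (n + N))" for n
  proof -
    have "(\<integral>\<^sup>+x. ?u n x \<partial>m) = (\<integral>\<^sup>+x. G x (y (n + N)) * ind E x / G x0 (y (n + N)) \<partial>m)"
      by (intro nn_integral_cong) (simp add: divide_ennreal_def mult_ac)
    also have "\<dots> = fpot (ind E) (y (n + N)) / G x0 (y (n + N))"
      unfolding fpot_def by (rule nn_integral_divide) simp
    finally show ?thesis .
  qed
  ultimately have "(\<lambda>n. fpot (ind E) (y (n + N)) / G x0 (y (n + N))) \<longlonglongrightarrow> (\<integral>\<^sup>+x. K x (Inr w) * ind E x \<partial>m)"
    by simp
  then show "(\<lambda>n. fpot (ind E) (y n) / G x0 (y n)) \<longlonglongrightarrow> (\<integral>\<^sup>+x. K x (Inr w) * ind E x \<partial>m)"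
    by (rule LIMSEQ_offset)
  have "K x (Inr w) * ind E x \<le> ?b x" for x
    by (rule LIMSEQ_le_const2[OF lim]) (use bd in blast)
  then have "(\<integral>\<^sup>+x. K x (Inr w) * ind E x \<partial>m) \<le> (\<integral>\<^sup>+x. ?b x \<partial>m)" by (rule nn_integral_mono)
  then show "(\<integral>\<^sup>+x. K x (Inr w) * ind E x \<partial>m) < \<infinity>" using b by (rule le_less_trans)
qed

lemma ratio_cancel:
  fixes a1 a2 b1 b2 g g' q :: ennreal
  assumes "a1 * b2 \<le> q * (b1 * a2)"
  shows "(a1 / g) * (b2 / g') \<le> q * ((b1 / g') * (a2 / g))"
  using mult_right_mono[OF assms, of "inverse g * inverse g'"] by (simp add: divide_ennreal_def mult_ac)

lemma ennreal_le_mult_all: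
  fixes a b :: ennreal
  assumes "\<And>eta. 1 < eta \<Longrightarrow> a \<le> ennreal eta * b" and b: "b < \<infinity>"
  shows "a \<le> b"
proof (rule ennreal_le_epsilon)
  fix e :: real assume e: "0 < e"
  define r where "r = enn2real b"
  have r: "b = ennreal r" "0 \<le> r" using b by (simp_all add: r_def less_top[symmetric])
  have "a \<le> ennreal (1 + e / (r + 1)) * b" using e r by (intro assms) (simp add: add_pos_nonneg)
  also have "\<dots> = ennreal ((1 + e / (r + 1)) * r)" unfolding r(1) using r e by (simp add: ennreal_mult)
  also have "\<dots> \<le> ennreal (r + e)"
  proof (rule ennreal_leI)
    have "e / (r + 1) * r \<le> e" using r e by (simp add: field_simps)
    then show "(1 + e / (r + 1)) * r \<le> r + e" by (simp add: algebra_simps)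
  qed
  finally show "a \<le> b + ennreal e" unfolding r(1) using r e by simp
qed

lemma K_finite:
  assumes u: "u \<in> D" and w: "w \<in> B" and y: "range y \<subseteq> D" "limitin \<T> (\<lambda>n. Inl (y n)) (Inr w) sequentially" "y \<longlonglongrightarrow> z0"
  shows "K u (Inr w) < \<infinity>"
proof -
  have "0 < dist z0 u" using u z0_notin by auto
  define rho where "rho = min R1 (dist z0 u / 2)"
  have rho: "0 < rho" "rho \<le> R1" "u \<in> D - cball z0 rho" using \<open>0 < dist z0 u\<close> R1 u by (auto simp: rho_def)
  obtain y1 where y1: "y1 \<in> Dr (rho / 8)" using Dr_nonempty[of "rho / 8"] rho by auto
  have "u \<noteq> y1" using y1 rho by (auto simp: Dr_def)
  have "eventually (\<lambda>n. G u (y n) / G x0 (y n) \<le> ennreal (C ^ 4) * (G u y1 / G x0 y1)) sequentially"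
    using Dr_eventually[OF y(1,3), of "rho / 8"] rho(1)
    by (auto elim!: eventually_mono intro: kernel_bound[OF rho _ y1])
  then have "K u (Inr w) \<le> ennreal (C ^ 4) * (G u y1 / G x0 y1)"
    by (intro tendsto_upperbound[OF boundary_limit[OF w y u]]) simp_all
  also have "\<dots> < \<infinity>" using G_fin[OF \<open>u \<noteq> y1\<close>] G_x0_pos(1)[of y1] y1 rho Dr_mono[of "rho / 8" "R1 / 8"]
    by (auto simp: ennreal_mult_eq_top_iff ennreal_divide_eq_top_iff less_top[symmetric])
  finally show ?thesis .
qed

text \<open>\<open>ratio_limit\<close> compares values at two points, so it can be used along the
  two approximating sequences at once. It makes the integrals of the two kernels over test sets
  proportional; averaging over balls carries this to the values of the kernels, and the common value
  1 at \<open>x0\<close> fixes the factor.\<close>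

lemma associated_unique:
  assumes w: "w1 \<in> B" "w2 \<in> B" "martin_associated D \<T> w1 z0" "martin_associated D \<T> w2 z0"
  shows "w1 = w2"
proof (rule ccontr)
  assume "w1 \<noteq> w2"
  from w(3) obtain y where y: "range y \<subseteq> D" "limitin \<T> (\<lambda>n. Inl (y n)) (Inr w1) sequentially" "y \<longlonglongrightarrow> z0"
    unfolding martin_associated_def by blast
  from w(4) obtain y' where y': "range y' \<subseteq> D" "limitin \<T> (\<lambda>n. Inl (y' n)) (Inr w2) sequentially" "y' \<longlonglongrightarrow> z0"
    unfolding martin_associated_def by blast
  let ?I = "\<lambda>w E. \<integral>\<^sup>+x. K x (Inr w) * ind E x \<partial>m"
  have I: "?I w1 E * ?I w2 F \<le> ?I w2 E * ?I w1 F" if E: "test E" "test F" for E F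
  proof (rule ennreal_le_mult_all)
    note L = integral_limit[OF w(1) y E(1)] integral_limit[OF w(2) y' E(1)] integral_limit[OF w(1) y E(2)] integral_limit[OF w(2) y' E(2)]
    show "?I w2 E * ?I w1 F < \<infinity>" using L(4,6) by (simp add: ennreal_mult_less_top)
    fix eta :: real assume eta: "1 < eta"
    obtain \<delta> where \<delta>: "0 < \<delta>" "\<And>y y'. y \<in> Dr \<delta> \<Longrightarrow> y' \<in> Dr \<delta> \<Longrightarrow>
      fpot (ind E) y * fpot (ind F) y' \<le> ennreal eta * (fpot (ind E) y' * fpot (ind F) y)"
      using ratio_limit[OF E eta] by blast
    have "(\<lambda>n. fpot (ind E) (y n) / G x0 (y n) * (fpot (ind F) (y' n) / G x0 (y' n))) \<longlonglongrightarrow> ?I w1 E * ?I w2 F"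
      by (intro tendsto_mult_ennreal L(1,7)) (use L(2,8) in auto)
    moreover have "(\<lambda>n. ennreal eta * (fpot (ind E) (y' n) / G x0 (y' n) * (fpot (ind F) (y n) / G x0 (y n)))) \<longlonglongrightarrow>
        ennreal eta * (?I w2 E * ?I w1 F)"
    proof (rule tendsto_mult_ennreal[OF tendsto_const])
      show "(\<lambda>n. fpot (ind E) (y' n) / G x0 (y' n) * (fpot (ind F) (y n) / G x0 (y n))) \<longlonglongrightarrow> ?I w2 E * ?I w1 F"
        by (intro tendsto_mult_ennreal L(3,5)) (use L(4,6) in auto)
    qed (use L(4,6) in \<open>auto simp: ennreal_mult_eq_top_iff\<close>)
    moreover have "eventually (\<lambda>n. fpot (ind E) (y n) / G x0 (y n) * (fpot (ind F) (y' n) / G x0 (y' n)) \<le>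
        ennreal eta * (fpot (ind E) (y' n) / G x0 (y' n) * (fpot (ind F) (y n) / G x0 (y n)))) sequentially"
      using Dr_eventually[OF y(1,3) \<delta>(1)] Dr_eventually[OF y'(1,3) \<delta>(1)]
    proof eventually_elim
      case (elim n)
      show ?case by (rule ratio_cancel[OF \<delta>(2)[OF elim]])
    qed
    ultimately show "?I w1 E * ?I w2 F \<le> ennreal eta * (?I w2 E * ?I w1 F)"
      by (intro tendsto_le[OF trivial_limit_sequentially])
  qed
  have "K x (Inr w1) = K x (Inr w2)" if x: "x \<in> D" for x
  proof -
    let ?b = "\<lambda>x k. ball x (rn k)"
    let ?av = "\<lambda>w x k. ?I w (?b x k) / emeasure m (?b x k)"
    have test_ev: "eventually (\<lambda>k. test (?b u k)) sequentially" if u: "u \<in> D" for u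
    proof -
      obtain e where e: "0 < e" "cball u e \<subseteq> D" using D(1) u by (meson open_contains_cball)
      have cp: "compact (cball u e)" by (rule XP.heine_borel) auto
      have "eventually (\<lambda>k. ?b u k \<subseteq> ball u e) sequentially" using e(1) by (intro eventually_ball_subset) auto
      then show ?thesis
      proof eventually_elim
        case (elim k)
        have "?b u k \<subseteq> cball u e" using elim ball_subset_cball by blast
        moreover have "0 < emeasure m (?b u k)" by (rule XP.emeasure_ball(1)) simp
        ultimately show ?case using e(2) cp by (auto simp: test_def intro!: exI[of _ "cball u e"])
      qed
    qed
    note fin = K_finite
    have av: "?av w1 u \<longlonglongrightarrow> K u (Inr w1)" "?av w2 u \<longlonglongrightarrow> K u (Inr w2)" if u: "u \<in> D" for u
      by (rule XP.average_tendsto[OF D(1) u K_cont[OF w(1)] fin[OF u w(1) y]],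
          rule XP.average_tendsto[OF D(1) u K_cont[OF w(2)] fin[OF u w(2) y']])
    have le: "K u (Inr w1) * K v (Inr w2) \<le> K u (Inr w2) * K v (Inr w1)" if uv: "u \<in> D" "v \<in> D" for u v
    proof -
      have "(\<lambda>k. ?av w1 u k * ?av w2 v k) \<longlonglongrightarrow> K u (Inr w1) * K v (Inr w2)"
        by (intro tendsto_mult_ennreal av uv) (use fin[OF uv(1) w(1) y] fin[OF uv(2) w(2) y'] in auto)
      moreover have "(\<lambda>k. ?av w2 u k * ?av w1 v k) \<longlonglongrightarrow> K u (Inr w2) * K v (Inr w1)"
        by (intro tendsto_mult_ennreal av uv) (use fin[OF uv(2) w(1) y] fin[OF uv(1) w(2) y'] in auto)
      moreover have "eventually (\<lambda>k. ?av w1 u k * ?av w2 v k \<le> ?av w2 u k * ?av w1 v k) sequentially"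
        using test_ev[OF uv(1)] test_ev[OF uv(2)]
      proof eventually_elim
        case (elim k)
        show ?case using mult_right_mono[OF I[OF elim], of "inverse (emeasure m (?b u k)) * inverse (emeasure m (?b v k))"]
          unfolding divide_ennreal_def by (simp only: mult_ac) simp
      qed
      ultimately show ?thesis by (intro tendsto_le[OF trivial_limit_sequentially])
    qed
    show ?thesis
      using le[OF x D(2)] le[OF D(2) x] unfolding K_x0[OF w(1) y] K_x0[OF w(2) y'] by simp
  qed
  then show False using K_separates[OF w(1,2) \<open>w1 \<noteq> w2\<close>] by blast
qed

text \<open>Compactness of the Martin space gives a limit. It cannot lie in \<open>D\<close>: the
  embedding of \<open>D\<close> would make the subsequence converge there, while it tends to
  \<open>z0\<close>, a point outside \<open>D\<close>.\<close>

lemma associated_subsequence: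
  assumes y: "range y \<subseteq> D" "y \<longlonglongrightarrow> z0"
  shows "\<exists>w r. w \<in> B \<and> strict_mono r \<and> limitin \<T> (\<lambda>n. Inl (y (r n))) (Inr w) sequentially \<and> martin_associated D \<T> w z0"
proof -
  obtain M d where M: "Metric_space M d" "\<T> = Metric_space.mtopology M d"
    using martin_facts(3) unfolding metrizable_space_def by blast
  interpret M: Metric_space M d by (rule M(1))
  have "range (\<lambda>n. Inl (y n)) \<subseteq> M" using y(1) martin_facts(1) unfolding M(2) by auto
  then obtain l r where l: "l \<in> M" "strict_mono r" "limitin \<T> ((\<lambda>n. Inl (y n)) \<circ> r) l sequentially"
    using martin_facts(2) unfolding M(2) M.compact_space_sequentially by blast
  have yr: "range (y \<circ> r) \<subseteq> D" "(y \<circ> r) \<longlonglongrightarrow> z0" using y LIMSEQ_subseq_LIMSEQ[OF y(2) l(2)] by auto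
  have "l \<in> topspace \<T>" using l(1) unfolding M(2) by simp
  then consider u where "u \<in> D" "l = Inl u" | w where "w \<in> B" "l = Inr w" using martin_facts(1) by auto
  then show ?thesis
  proof cases
    case 1
    from martin_facts(4) obtain g where "homeomorphic_maps (top_of_set D) (subtopology \<T> (Inl ` D)) Inl g"
      unfolding embedding_map_def homeomorphic_map_maps by auto
    then have g: "continuous_map (subtopology \<T> (Inl ` D)) (top_of_set D) g" "\<And>u. u \<in> D \<Longrightarrow> g (Inl u) = u"
      unfolding homeomorphic_maps_def by auto
    have "limitin (subtopology \<T> (Inl ` D)) ((\<lambda>n. Inl (y n)) \<circ> r) l sequentially"
      unfolding limitin_subtopology using 1 l(3) y(1) by (auto simp: image_subset_iff intro!: always_eventually)
    from continuous_map_limit[OF g(1) this] have "limitin (top_of_set D) (g \<circ> ((\<lambda>n. Inl (y n)) \<circ> r)) (g l) sequentially" .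
    then have "(g \<circ> ((\<lambda>n. Inl (y n)) \<circ> r)) \<longlonglongrightarrow> u" using g(2) 1 D(1) by simp
    moreover have "g \<circ> ((\<lambda>n. Inl (y n)) \<circ> r) = y \<circ> r" using g(2) y(1) by (auto simp: fun_eq_iff)
    ultimately have "u = z0" using yr(2) LIMSEQ_unique by metis
    then show ?thesis using 1 z0_notin by simp
  next
    case 2
    have "martin_associated D \<T> w z0"
      unfolding martin_associated_def using yr l(3) 2 by (intro exI[of _ "y \<circ> r"]) (auto simp: o_def)
    then show ?thesis using 2 l by (auto simp: o_def)
  qed
qed

lemma associated_exists: "\<exists>w. w \<in> B \<and> martin_associated D \<T> w z0"
proof -
  have "z0 \<in> closure D" using D(3) by (simp add: frontier_def)
  then obtain y where "\<And>n. y n \<in> D" "y \<longlonglongrightarrow> z0" unfolding closure_sequential by blast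
  then show ?thesis using associated_subsequence[of y] by blast
qed

text \<open>By compactness any subsequence has a further subsequence converging to an associated
  boundary point, and by uniqueness this point is always \<open>w\<close>.\<close>

lemma martin_limit:
  assumes w: "w \<in> B" "martin_associated D \<T> w z0" and x: "x \<in> D" and y: "range y \<subseteq> D" "y \<longlonglongrightarrow> z0"
  shows "(\<lambda>n. G x (y n) / G x0 (y n)) \<longlonglongrightarrow> K x (Inr w)"
proof (rule topological_tendstoI, rule ccontr)
  fix S assume S: "open S" "K x (Inr w) \<in> S"
    and "\<not> eventually (\<lambda>n. G x (y n) / G x0 (y n) \<in> S) sequentially"
  then obtain q :: "nat \<Rightarrow> nat" where q: "strict_mono q" "\<And>n. G x (y (q n)) / G x0 (y (q n)) \<notin> S"
    using not_eventually_sequentiallyD[of "\<lambda>n. G x (y n) / G x0 (y n) \<in> S"] by blast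
  have yq: "range (y \<circ> q) \<subseteq> D" "(y \<circ> q) \<longlonglongrightarrow> z0" using y LIMSEQ_subseq_LIMSEQ[OF y(2) q(1)] by auto
  from associated_subsequence[OF yq] obtain w' r where w': "w' \<in> B" "strict_mono r"
    "limitin \<T> (\<lambda>n. Inl ((y \<circ> q) (r n))) (Inr w') sequentially" "martin_associated D \<T> w' z0" by blast
  have "w' = w" by (rule associated_unique[OF w'(1) w(1) w'(4) w(2)])
  have yqr: "range ((y \<circ> q) \<circ> r) \<subseteq> D" "((y \<circ> q) \<circ> r) \<longlonglongrightarrow> z0" using yq LIMSEQ_subseq_LIMSEQ[OF yq(2) w'(2)] by auto
  have "(\<lambda>n. G x (((y \<circ> q) \<circ> r) n) / G x0 (((y \<circ> q) \<circ> r) n)) \<longlonglongrightarrow> K x (Inr w)"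
    by (rule boundary_limit[OF w(1) yqr(1) _ yqr(2) x]) (use w'(3) \<open>w' = w\<close> in \<open>simp add: o_def\<close>)
  from topological_tendstoD[OF this S] have "eventually (\<lambda>n. False) sequentially"
    by eventually_elim (use q(2) in auto)
  then show False by simp
qed

end

section \<open>Harmonic functions as limits of potentials\<close>

context hunt_proc begin

text \<open>\<open>V\<close> may reach the boundary of \<open>D\<close>, so the equality, known for
  its relatively compact parts, passes to the limit only as an inequality, by Fatou's lemma.\<close>

lemma harmonic_Hop_le:
  assumes h: "harmonic X D h" "open D" and V: "open V" "V \<subseteq> D" "x \<in> V"
  shows "Hop V (\<lambda>y. h y * ind D y) x \<le> h x"
proof -
  let ?V = "\<lambda>k. V \<inter> icell D k"
  have "Hop V (\<lambda>y. h y * ind D y) x \<le> liminf (\<lambda>k. Hop (?V k) (\<lambda>y. h y * ind D y) x)"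
    by (rule Hop_exhaust_liminf[OF h(2) V(1,2) harmonic_measurable[OF h]]) simp
  also have "\<dots> \<le> h x"
  proof (rule Liminf_le)
    obtain k0 where k0: "x \<in> cell D k0" using cell_exhaust[OF h(2)] V by blast
    have "Hop (?V k) (\<lambda>y. h y * ind D y) x = h x" if k: "k \<ge> Suc k0" for k
    proof (rule harmonic_Hop[OF h, symmetric])
      show "closure (?V k) \<subseteq> D" using compact_closure_cell(2)[of V D k] cell_subset[of D k] by blast
      show "x \<in> ?V k" using V k0 cell_subset_interior[of D k0] interior_cell_mono[OF k, of D] by blast
    qed (use V compact_closure_cell in auto)
    then show "\<forall>\<^sub>F k in sequentially. Hop (?V k) (\<lambda>y. h y * ind D y) x \<le> h x"
      unfolding eventually_sequentially by (metis order_refl)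
  qed simp
  finally show ?thesis .
qed

text \<open>Both orders give the same double time integral of the semigroup at time
  \<open>s + t\<close>.\<close>

lemma Rop_commute:
  assumes f: "f \<in> bfun"
  shows "Rop D \<alpha> (Rop D \<beta> f) x = Rop D \<beta> (Rop D \<alpha> f) x"
proof -
  define F where "F t = Pop D (ennreal t) f x" for t
  have [measurable]: "F \<in> bfun" unfolding F_def by (rule measurable_Pop_time[OF f])
  define H where "H \<alpha> \<beta> s t = ind {0..} s * ennreal (exp (- \<alpha> * s)) * (ind {0..} t * ennreal (exp (- \<beta> * t))) * F (s + t)"
    for \<alpha> \<beta> s t :: real
  have eq: "Rop D \<alpha> (Rop D \<beta> f) x = (\<integral>\<^sup>+s. \<integral>\<^sup>+t. H \<alpha> \<beta> s t \<partial>lborel \<partial>lborel)" for \<alpha> \<beta>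
    unfolding Rop_Pop[OF measurable_Rop[OF f], of D \<alpha>] Pop_Rop[OF f]
  proof (rule nn_integral_cong)
    fix s :: real
    have "(\<integral>\<^sup>+t. H \<alpha> \<beta> s t \<partial>lborel) = ind {0..} s * ennreal (exp (- \<alpha> * s)) * (\<integral>\<^sup>+t. ind {0..} t * (ennreal (exp (- \<beta> * t)) * F (s + t)) \<partial>lborel)"
      unfolding H_def by (subst nn_integral_cmult[symmetric]) (simp_all add: mult_ac)
    moreover have "(\<integral>\<^sup>+t. ind {0..} t * (ennreal (exp (- \<beta> * t)) * F (s + t)) \<partial>lborel) =
      (\<integral>\<^sup>+t. ind {0..} t * (ennreal (exp (- \<beta> * t)) * Pop D (ennreal s + ennreal t) f x) \<partial>lborel)" if "0 \<le> s"
      using that by (intro nn_integral_cong) (auto simp: F_def indicator_def)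
    ultimately show "ind {0..} s * (ennreal (exp (- \<alpha> * s)) * (\<integral>\<^sup>+t. ind {0..} t * (ennreal (exp (- \<beta> * t)) * Pop D (ennreal s + ennreal t) f x) \<partial>lborel)) =
      (\<integral>\<^sup>+t. H \<alpha> \<beta> s t \<partial>lborel)"
      by (cases "0 \<le> s") (simp_all add: mult.assoc)
  qed
  have "(\<integral>\<^sup>+s. \<integral>\<^sup>+t. H \<alpha> \<beta> s t \<partial>lborel \<partial>lborel) = (\<integral>\<^sup>+t. \<integral>\<^sup>+s. H \<alpha> \<beta> s t \<partial>lborel \<partial>lborel)"
    by (rule lborel_pair.Fubini') (simp add: H_def case_prod_beta')
  also have "\<dots> = (\<integral>\<^sup>+t. \<integral>\<^sup>+s. H \<beta> \<alpha> t s \<partial>lborel \<partial>lborel)"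
    by (intro nn_integral_cong) (simp add: H_def mult_ac add.commute)
  finally show ?thesis unfolding eq .
qed

lemma Rop_tendsto_Uop:
  assumes f: "f \<in> bfun" and n: "0 < n"
  shows "(\<lambda>i. Rop D (n / real (Suc i)) f x) \<longlonglongrightarrow> Uop D f x"
  unfolding Rop_Pop[OF f]
proof (rule nn_integral_LIMSEQ)
  note [measurable] = measurable_Pop_time[OF f, of D x]
  show "(\<lambda>t. ind {0..} t * (ennreal (exp (- (n / real (Suc i)) * t)) * Pop D (ennreal t) f x)) \<in> borel_measurable lborel" for i
    by measurable
  show "incseq (\<lambda>i t. ind {0..} t * (ennreal (exp (- (n / real (Suc i)) * t)) * Pop D (ennreal t) f x))"
  proof (intro incseq_SucI le_funI)
    fix i and t :: real
    have "n / real (Suc (Suc i)) * t \<le> n / real (Suc i) * t" if "0 \<le> t"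
      using that n by (intro mult_right_mono divide_left_mono) auto
    then show "ind {0..} t * (ennreal (exp (- (n / real (Suc i)) * t)) * Pop D (ennreal t) f x)
       \<le> ind {0..} t * (ennreal (exp (- (n / real (Suc (Suc i))) * t)) * Pop D (ennreal t) f x)"
      by (cases "0 \<le> t") (auto intro!: mult_right_mono ennreal_leI simp del: of_nat_Suc)
  qed
  fix t :: real
  have "(\<lambda>i. exp (- (n / real (Suc i)) * t)) \<longlonglongrightarrow> exp (- 0 * t)"
    by (intro tendsto_exp tendsto_mult tendsto_minus tendsto_const LIMSEQ_Suc[OF lim_const_over_n])
  then have "(\<lambda>i. ennreal (exp (- (n / real (Suc i)) * t)) * Pop D (ennreal t) f x) \<longlonglongrightarrow> ennreal (exp (- 0 * t)) * Pop D (ennreal t) f x"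
    by (intro tendsto_mult_ennreal tendsto_ennrealI tendsto_const) auto
  then show "(\<lambda>i. ind {0..} t * (ennreal (exp (- (n / real (Suc i)) * t)) * Pop D (ennreal t) f x)) \<longlonglongrightarrow>
      ind {0..} t * (ennreal (exp (- 0 * t)) * Pop D (ennreal t) f x)"
    by (cases "0 \<le> t") auto
qed

lemma Rop_cmult: "f \<in> bfun \<Longrightarrow> Rop W \<alpha> (\<lambda>y. k * f y) x = k * Rop W \<alpha> f x"
  by (simp add: Rop_om nn_integral_cmult)

text \<open>A solution of \<open>b = n R\<^sub>n (e + b)\<close> dominated by a finite potential is the potential of \<open>n e\<close>:
  the invariant part vanishes because \<open>\<lambda> R\<^sub>\<lambda> b \<rightarrow> 0\<close>.\<close>

lemma resolvent_charge:
  assumes m: "b \<in> bfun" "e \<in> bfun" "phi \<in> bfun" and n: "0 < n"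
    and b: "\<And>y. b y = ennreal n * Rop D n (\<lambda>v. e v + b v) y"
    and bd: "\<And>y. b y \<le> k * Uop D phi y" and fin: "Uop D phi x < \<infinity>" and k: "k < \<infinity>"
  shows "b x = ennreal n * Uop D e x"
proof -
  note [measurable] = m
  \<comment> \<open>The double successor gives \<open>?l i < n\<close> for all \<open>i\<close>,
    including 0, as the resolvent equation between \<open>?l i\<close> and \<open>n\<close>
    requires.\<close>
  let ?l = "\<lambda>i. n / real (Suc (Suc i))"
  have l: "0 < ?l i" "?l i < n" for i
  proof -
    show "0 < ?l i" using n by simp
    have "n / real (Suc (Suc i)) < n / 1" using n by (intro divide_strict_left_mono) auto
    then show "?l i < n" by simp
  qed
  have U: "Uop D phi x = Rop D (?l i) phi x + ennreal (?l i) * Rop D (?l i) (Uop D phi) x" for i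
    using resolvent_equation[OF m(3), of 0 "?l i" D x] l[of i] by simp
  have bl: "ennreal (?l i) * Rop D (?l i) b x \<le> k * (ennreal (?l i) * Rop D (?l i) (Uop D phi) x)" for i
  proof -
    have "Rop D (?l i) b x \<le> Rop D (?l i) (\<lambda>y. k * Uop D phi y) x" by (rule Rop_mono_on[OF bd])
    also have "\<dots> = k * Rop D (?l i) (Uop D phi) x" by (rule Rop_cmult) simp
    finally show ?thesis using mult_left_mono by (metis mult.left_commute zero_le)
  qed
  have split: "b x = ennreal n * Rop D (?l i) e x + ennreal (?l i) * Rop D (?l i) b x" for i
  proof -
    let ?g = "\<lambda>v. e v + b v"
    have gm: "?g \<in> bfun" by measurable
    have bfun: "(\<lambda>y. ennreal n * Rop D n ?g y) = b" using b by (intro ext) (rule sym)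
    have "Rop D (?l i) b x = ennreal n * Rop D (?l i) (Rop D n ?g) x"
      using Rop_cmult[OF measurable_Rop[OF gm], of D "?l i" "ennreal n" D n x] unfolding bfun .
    then have Rb: "ennreal n * Rop D n (Rop D (?l i) ?g) x = Rop D (?l i) b x"
      unfolding Rop_commute[OF gm, of D n "?l i"] by simp
    have "Rop D (?l i) ?g x = Rop D n ?g x + ennreal (n - ?l i) * Rop D n (Rop D (?l i) ?g) x"
      by (rule resolvent_equation[OF gm]) (use l[of i] in auto)
    then have "ennreal n * Rop D (?l i) ?g x = ennreal n * Rop D n ?g x + ennreal (n - ?l i) * (ennreal n * Rop D n (Rop D (?l i) ?g) x)"
      by (simp only: distrib_left mult.left_commute)
    also note Rb
    also have "ennreal n * Rop D n ?g x = b x" by (rule b[symmetric])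
    finally have 1: "ennreal n * Rop D (?l i) ?g x = b x + ennreal (n - ?l i) * Rop D (?l i) b x" .
    have "Rop D (?l i) ?g x = Rop D (?l i) e x + Rop D (?l i) b x" by (simp add: Rop_om nn_integral_add)
    moreover have "ennreal n = ennreal (n - ?l i) + ennreal (?l i)" using l[of i] by (simp add: ennreal_plus[symmetric] del: ennreal_plus)
    ultimately have 2: "ennreal (n - ?l i) * Rop D (?l i) b x + (ennreal n * Rop D (?l i) e x + ennreal (?l i) * Rop D (?l i) b x) =
        ennreal (n - ?l i) * Rop D (?l i) b x + b x"
      using 1 by (simp add: distrib_left distrib_right ac_simps)
    \<comment> \<open>Domination by a finite potential makes the term common to both sides of
      \<open>2\<close> finite, so that it may be cancelled.\<close>
    have "ennreal (?l i) * Rop D (?l i) (Uop D phi) x \<le> Uop D phi x" unfolding U[of i] by simp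
    then have "ennreal (?l i) * Rop D (?l i) (Uop D phi) x < \<infinity>" using fin by (rule le_less_trans)
    then have "k * (ennreal (?l i) * Rop D (?l i) (Uop D phi) x) < \<infinity>"
      using k unfolding infinity_ennreal_def by (rule ennreal_mult_less_top[THEN iffD2, OF disjI2, OF disjI2, OF conjI, rotated])
    then have "ennreal (?l i) * Rop D (?l i) b x < \<infinity>" using bl[of i] by (rule le_less_trans[rotated])
    then have "Rop D (?l i) b x \<noteq> \<infinity>" using l[of i] by (auto simp: ennreal_mult_top)
    then have "ennreal (n - ?l i) * Rop D (?l i) b x \<noteq> \<infinity>" by (simp add: ennreal_mult_eq_top_iff)
    then show ?thesis using 2 by (simp add: ennreal_add_left_cancel)
  qed
  have R0: "(\<lambda>i. ennreal (?l i) * Rop D (?l i) (Uop D phi) x) \<longlonglongrightarrow> 0"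
  proof -
    have "(\<lambda>i. Uop D phi x - Rop D (?l i) phi x) \<longlonglongrightarrow> Uop D phi x - Uop D phi x"
      by (rule tendsto_diff_ennreal[OF tendsto_const LIMSEQ_Suc[OF Rop_tendsto_Uop[OF m(3) n]]]) (use fin in auto)
    moreover have "Uop D phi x - Rop D (?l i) phi x = ennreal (?l i) * Rop D (?l i) (Uop D phi) x" for i
    proof -
      have "Rop D (?l i) phi x \<noteq> \<infinity>" using U[of i] fin by auto
      then show ?thesis by (subst U[of i]) simp
    qed
    moreover have "Uop D phi x - Uop D phi x = 0" using fin by (intro diff_eq_0_ennreal) auto
    ultimately show ?thesis by simp
  qed
  have b0: "(\<lambda>i. ennreal (?l i) * Rop D (?l i) b x) \<longlonglongrightarrow> 0"
  proof (rule tendsto_sandwich[OF _ _ tendsto_const])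
    show "(\<lambda>i. k * (ennreal (?l i) * Rop D (?l i) (Uop D phi) x)) \<longlonglongrightarrow> 0"
      using tendsto_mult_ennreal[OF tendsto_const R0, of k] k by simp
  qed (use bl in auto)
  have "(\<lambda>i. ennreal n * Rop D (?l i) e x + ennreal (?l i) * Rop D (?l i) b x) \<longlonglongrightarrow> ennreal n * Uop D e x + 0"
    by (intro tendsto_add b0 tendsto_mult_ennreal tendsto_const LIMSEQ_Suc[OF Rop_tendsto_Uop[OF m(2) n]]) (use n in auto)
  then have "(\<lambda>i. b x) \<longlonglongrightarrow> ennreal n * Uop D e x" unfolding split[symmetric] by simp
  then show ?thesis by (simp add: LIMSEQ_const_iff)
qed

text \<open>For the sub-Markov chain with kernel \<open>n * Rop D n\<close>, the limit
  \<open>b\<close> of the iterates is the expectation of \<open>u\<close> at the first return to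
  \<open>A\<close>. With the difference \<open>e\<close> of \<open>u\<close> and \<open>b\<close> on
  \<open>A\<close> it satisfies \<open>b = n * Rop D n (e + b)\<close>, so
  \<open>resolvent_charge\<close> represents \<open>b\<close> as the potential of a charge carried
  by \<open>A\<close>.\<close>

lemma charge_exists:
  assumes m: "u \<in> bfun" "phi \<in> bfun" and A: "A \<in> sets borel" and n: "0 < n"
    and sup: "\<And>y. ennreal n * Rop D n u y \<le> u y"
    and bd: "\<And>y. u y \<le> k * Uop D phi y" and fin: "\<And>y. Uop D phi y < \<infinity>" and k: "k < \<infinity>"
  shows "\<exists>e. e \<in> bfun \<and> (\<forall>y. y \<notin> A \<longrightarrow> e y = 0) \<and>
    (\<forall>x. ennreal n * Rop D n (\<lambda>y. ind A y * u y) x \<le> Uop D e x \<and> Uop D e x \<le> u x)"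
proof -
  note [measurable] = m A
  define T where "T b = (\<lambda>x. ennreal n * Rop D n (\<lambda>y. ind A y * u y + ind (- A) y * b y) x)" for b
  have T_mono: "T b x \<le> T b' x" if "\<And>y. b y \<le> b' y" for b b' x
    unfolding T_def using that by (intro mult_left_mono Rop_mono_on add_left_mono) auto
  define bi where "bi i = (T ^^ i) (\<lambda>_. 0)" for i
  have bi_Suc: "bi (Suc i) = T (bi i)" for i by (simp add: bi_def)
  have bi_m [measurable]: "bi i \<in> bfun" for i
  proof (induction i)
    case (Suc i)
    then have "(\<lambda>y. ind A y * u y + ind (- A) y * bi i y) \<in> bfun" by measurable
    then show ?case unfolding bi_Suc T_def by measurable
  qed (simp add: bi_def)
  have bi_le: "bi i y \<le> u y" for i y
  proof (induction i arbitrary: y)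
    case (Suc i)
    have "bi (Suc i) y \<le> ennreal n * Rop D n u y"
      unfolding bi_Suc T_def using Suc by (intro mult_left_mono Rop_mono_on) (auto simp: indicator_def)
    then show ?case using sup[of y] by (rule order_trans)
  qed (simp add: bi_def)
  have bi_inc: "bi i y \<le> bi (Suc i) y" for i y
  proof (induction i arbitrary: y)
    case (Suc i)
    show ?case unfolding bi_Suc by (rule T_mono) (rule Suc[unfolded bi_Suc])
  qed (simp add: bi_def)
  define b where "b y = (SUP i. bi i y)" for y
  have [measurable]: "b \<in> bfun" unfolding b_def by measurable
  have b_le: "b y \<le> u y" for y unfolding b_def by (rule SUP_least) (rule bi_le)
  define e where "e y = ind A y * (u y - b y)" for y
  have [measurable]: "e \<in> bfun" unfolding e_def by measurable
  have eb: "ind A y * u y + ind (- A) y * b y = e y + b y" for y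
    using b_le[of y] by (simp add: e_def indicator_def diff_add_cancel_ennreal)
  have Tb: "b x = ennreal n * Rop D n (\<lambda>y. e y + b y) x" for x
  proof -
    let ?h = "\<lambda>i y. ind A y * u y + ind (- A) y * bi i y"
    have "(\<lambda>y. e y + b y) = (\<lambda>y. SUP i. ?h i y)"
    proof
      fix y show "e y + b y = (SUP i. ?h i y)" unfolding eb[symmetric] by (cases "y \<in> A") (simp_all add: b_def)
    qed
    moreover have "Rop D n (\<lambda>y. SUP i. ?h i y) x = (SUP i. Rop D n (?h i) x)"
    proof -
      have 1: "incseq ?h" by (intro incseq_SucI le_funI add_left_mono mult_left_mono bi_inc) auto
      have 2: "?h i \<in> bfun" for i by measurable
      then have 3: "(\<lambda>y. SUP i. ?h i y) \<in> bfun" by measurable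
      show ?thesis unfolding Rop_om[OF 3] Rop_om[OF 2] by (rule nn_integral_monotone_convergence_SUP[OF 1]) (use 2 in simp)
    qed
    ultimately have "ennreal n * Rop D n (\<lambda>y. e y + b y) x = (SUP i. bi (Suc i) x)"
      unfolding bi_Suc T_def by (simp add: SUP_mult_left_ennreal)
    also have "\<dots> = b x" unfolding b_def
      by (rule antisym; rule SUP_mono) (use bi_inc in auto)
    finally show ?thesis by simp
  qed
  have be: "b x = ennreal n * Uop D e x" for x
    by (rule resolvent_charge[OF _ _ m(2) n Tb _ fin k]) (use b_le bd in \<open>auto intro: order_trans\<close>)
  show ?thesis
  proof (intro exI[of _ "\<lambda>y. ennreal n * e y"] conjI allI impI)
    fix x
    have Ue: "Uop D (\<lambda>y. ennreal n * e y) x = b x" unfolding be by (simp add: Rop_om nn_integral_cmult)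
    show "Uop D (\<lambda>y. ennreal n * e y) x \<le> u x" unfolding Ue by (rule b_le)
    have "Rop D n (\<lambda>y. ind A y * u y) x \<le> Rop D n (\<lambda>y. e y + b y) x"
      by (rule Rop_mono_on) (simp add: eb[symmetric])
    then show "ennreal n * Rop D n (\<lambda>y. ind A y * u y) x \<le> Uop D (\<lambda>y. ennreal n * e y) x"
      unfolding Ue by (subst Tb) (rule mult_left_mono, auto)
  qed (auto simp: e_def)
qed

text \<open>A set of potential zero is charged by the killed transition measures at almost no time,
  so functions that differ only there cannot be told apart at suitable arbitrarily small
  times.\<close>

lemma Pop_eq_small_times:
  assumes m: "f \<in> bfun" "g \<in> bfun"
    and N: "Uop D (ind {y. f y \<noteq> g y}) x = 0" and \<delta>: "0 < \<delta>"
  shows "\<exists>t. 0 < t \<and> t < \<delta> \<and> Pop D (ennreal t) f x = Pop D (ennreal t) g x"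
proof (rule ccontr)
  note [measurable] = m
  let ?N = "{y. f y \<noteq> g y}"
  assume neg: "\<not> (\<exists>t. 0 < t \<and> t < \<delta> \<and> Pop D (ennreal t) f x = Pop D (ennreal t) g x)"
  have [measurable]: "?N \<in> sets borel" by measurable
  have [measurable]: "(\<lambda>t. Pop D (ennreal t) (ind ?N) x) \<in> bfun" by (rule measurable_Pop_time) measurable
  have "(\<integral>\<^sup>+t. ind {0..} t * Pop D (ennreal t) (ind ?N) x \<partial>lborel) = 0"
    using N by (simp add: Rop_Pop)
  then have "AE t in lborel. ind {0..} t * Pop D (ennreal t) (ind ?N) x = 0"
    by (subst (asm) nn_integral_0_iff_AE) simp_all
  then have "AE t in lborel. t \<notin> {0<..<\<delta>}"
  proof eventually_elim
    fix t assume z: "ind {0..} t * Pop D (ennreal t) (ind ?N) x = (0 :: ennreal)"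
    show "t \<notin> {0<..<\<delta>}"
    proof
      assume t: "t \<in> {0<..<\<delta>}"
      then have "(\<integral>\<^sup>+y. ind ?N y \<partial>pm D (ennreal t) x) = 0" using z by (simp add: Pop_pm)
      then have "AE y in pm D (ennreal t) x. ind ?N y = (0 :: ennreal)"
        by (subst (asm) nn_integral_0_iff_AE) simp_all
      then have "AE y in pm D (ennreal t) x. f y = g y" by eventually_elim (auto simp: indicator_def split: if_splits)
      then have "Pop D (ennreal t) f x = Pop D (ennreal t) g x"
        by (simp add: Pop_pm) (rule nn_integral_cong_AE)
      then show False using neg t by auto
    qed
  qed
  then have "emeasure lborel {0<..<\<delta>} = 0" by (subst (asm) AE_iff_measurable[of "{0<..<\<delta>}"]) auto
  then show False using \<delta> by simp
qed

text \<open>Applied to a potential, the semigroup removes the part of the occupation integral before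
  time \<open>t k\<close>; the tails are bounded by the whole, and Fatou's lemma gives the other
  direction.\<close>

lemma potential_Pop_tendsto:
  assumes phi: "phi \<in> bfun" and t: "\<And>k. 0 \<le> t k" "t \<longlonglongrightarrow> 0"
  shows "(\<lambda>k. Pop D (ennreal (t k)) (Uop D phi) x) \<longlonglongrightarrow> Uop D phi x"
proof -
  define F where "F t = Pop D (ennreal t) phi x" for t
  have [measurable]: "F \<in> bfun" unfolding F_def by (rule measurable_Pop_time[OF phi])
  have U: "Uop D phi x = (\<integral>\<^sup>+s. ind {0..} s * F s \<partial>lborel)" by (simp add: Rop_Pop[OF phi] F_def)
  have P: "Pop D (ennreal (t k)) (Uop D phi) x = (\<integral>\<^sup>+s. ind {t k..} s * F s \<partial>lborel)" for k
  proof -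
    have "Pop D (ennreal (t k)) (Uop D phi) x = (\<integral>\<^sup>+s. ind {0..} s * F (t k + s) \<partial>lborel)"
      unfolding Pop_Rop[OF phi] F_def using t(1)[of k] by (intro nn_integral_cong) (auto simp: indicator_def)
    also have "\<dots> = (\<integral>\<^sup>+s. ind {t k..} s * F s \<partial>lborel)" by (rule nn_integral_shift_ge[symmetric]) simp
    finally show ?thesis .
  qed
  have "(\<integral>\<^sup>+s. ind {0..} s * F s \<partial>lborel) \<le> (\<integral>\<^sup>+s. liminf (\<lambda>k. ind {t k..} s * F s) \<partial>lborel)"
  proof (rule nn_integral_mono_AE)
    have "AE s in lborel. s \<noteq> (0::real)" by (rule AE_lborel_singleton)
    then show "AE s in lborel. ind {0..} s * F s \<le> liminf (\<lambda>k. ind {t k..} s * F s)"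
    proof eventually_elim
      fix s :: real assume "s \<noteq> 0"
      show "ind {0..} s * F s \<le> liminf (\<lambda>k. ind {t k..} s * F s)"
      proof (cases "0 < s")
        case True
        have "eventually (\<lambda>k. ind {0..} s * F s \<le> ind {t k..} s * F s) sequentially"
          using order_tendstoD(2)[OF t(2) True] by eventually_elim (auto simp: indicator_def)
        then show ?thesis by (rule Liminf_bounded)
      qed (use \<open>s \<noteq> 0\<close> in auto)
    qed
  qed
  also have "\<dots> \<le> liminf (\<lambda>k. \<integral>\<^sup>+s. ind {t k..} s * F s \<partial>lborel)" by (rule nn_integral_liminf) simp
  finally have 1: "Uop D phi x \<le> liminf (\<lambda>k. Pop D (ennreal (t k)) (Uop D phi) x)" unfolding U P .
  have "Pop D (ennreal (t k)) (Uop D phi) x \<le> Uop D phi x" for k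
    unfolding U P using t(1)[of k] by (intro nn_integral_mono) (auto simp: indicator_def)
  then have "limsup (\<lambda>k. Pop D (ennreal (t k)) (Uop D phi) x) \<le> Uop D phi x" by (intro Limsup_bounded always_eventually allI)
  with 1 show ?thesis
    using Liminf_le_Limsup[of sequentially "\<lambda>k. Pop D (ennreal (t k)) (Uop D phi) x"]
    by (intro Liminf_eq_Limsup) (auto intro: antisym order_trans)
qed

end

section \<open>The inaccessible case\<close>

locale martin_point = martin_kernel +
  fixes w
  assumes w: "w \<in> B" "martin_associated D \<T> w z0"
begin

definition M :: "'a \<Rightarrow> ennreal" where "M x = K x (Inr w) * ind D x"

lemma M_simps: "x \<in> D \<Longrightarrow> M x = K x (Inr w)" "x \<notin> D \<Longrightarrow> M x = 0"
  by (simp_all add: M_def)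

lemma measurable_M [measurable]: "M \<in> bfun"
  using measurable_K[OF w(1)] by (simp add: M_def[abs_def])

lemma M_finite: "M x < \<infinity>" and M_x0: "M x0 = 1"
proof -
  from w(2) obtain y where y: "range y \<subseteq> D" "limitin \<T> (\<lambda>n. Inl (y n)) (Inr w) sequentially" "y \<longlonglongrightarrow> z0"
    unfolding martin_associated_def by blast
  show "M x < \<infinity>" using K_finite[OF _ w(1) y] by (cases "x \<in> D") (simp_all add: M_simps)
  show "M x0 = 1" using K_x0[OF w(1) y] D(2) by (simp add: M_simps)
qed

lemma M_limit:
  assumes "range y \<subseteq> D" "y \<longlonglongrightarrow> z0"
  shows "(\<lambda>n. G x (y n) / G x0 (y n)) \<longlonglongrightarrow> M x"
  using martin_limit[OF w _ assms, of x] by (cases "x \<in> D") (simp_all add: M_simps G_off)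

lemma M_Pop_tendsto:
  assumes x: "x \<in> D" and t: "\<And>k. 0 < t k" "t \<longlonglongrightarrow> 0"
  shows "(\<lambda>k. XP.Pop D (ennreal (t k)) M x) \<longlonglongrightarrow> M x"
proof -
  have "((\<lambda>t. expct X x (\<lambda>\<omega>. ext0 (\<lambda>x. K x (Inr w)) (killed_path X D t \<omega>))) \<longlongrightarrow> K x (Inr w)) (at_right 0)"
    using K_excessive[OF w(1)] x by (simp add: excessive_def)
  moreover have "expct X x (\<lambda>\<omega>. ext0 (\<lambda>x. K x (Inr w)) (killed_path X D t \<omega>)) = XP.Pop D t M x" for t
    unfolding XP.expct_killed[OF D(1) x] by (rule XP.Pop_cong) (simp add: M_simps)
  moreover have "filterlim (\<lambda>k. ennreal (t k)) (at_right 0) sequentially"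
    unfolding filterlim_at using tendsto_ennrealI[OF t(2)] t(1)
    by (auto simp: ennreal_eq_0_iff not_le intro!: always_eventually)
  ultimately show ?thesis using x filterlim_compose by (fastforce simp: M_simps)
qed

lemma small_ball: "\<exists>e>0. cball x0 e \<subseteq> D" "0 < e \<Longrightarrow> cball x0 e \<subseteq> D \<Longrightarrow> test (ball x0 e)"
proof -
  show "\<exists>e>0. cball x0 e \<subseteq> D" using D by (meson open_contains_cball)
  assume e: "0 < e" "cball x0 e \<subseteq> D"
  have "compact (cball x0 e)" by (rule XP.heine_borel) auto
  then show "test (ball x0 e)"
    using e XP.emeasure_ball(1)[OF e(1), of x0] by (auto simp: test_def intro!: exI[of _ "cball x0 e"])
qed

definition IM :: "'a set \<Rightarrow> ennreal" where "IM E = (\<integral>\<^sup>+x. M x * ind E x \<partial>m)"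

lemma IM_eq: "test E \<Longrightarrow> IM E = (\<integral>\<^sup>+x. K x (Inr w) * ind E x \<partial>m)"
  unfolding IM_def by (intro nn_integral_cong) (auto simp: test_def indicator_def M_def)

lemma IM_finite: "test E \<Longrightarrow> IM E < \<infinity>"
  using w(2) integral_limit(2)[OF w(1)] unfolding IM_eq martin_associated_def by blast

lemma IM_limit: "test E \<Longrightarrow> range y \<subseteq> D \<Longrightarrow> limitin \<T> (\<lambda>n. Inl (y n)) (Inr w) sequentially \<Longrightarrow> y \<longlonglongrightarrow> z0 \<Longrightarrow>
    (\<lambda>n. fpot (ind E) (y n) / G x0 (y n)) \<longlonglongrightarrow> IM E"
  unfolding IM_eq by (rule integral_limit(1)[OF w(1)])

text \<open>Both potentials are asymptotic to the same mean exit time multiplied by their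
  functionals, so the mean exit time drops out of the ratio.\<close>

lemma inaccessible_proportional:
  assumes E: "test E" "test F" and fin: "Jr 0 (fpot (ind E)) < \<infinity>" "Jr 0 (fpot (ind F)) < \<infinity>"
  shows "IM F * Jr 0 (fpot (ind E)) \<le> IM E * Jr 0 (fpot (ind F))"
proof (rule ennreal_le_mult_all)
  let ?f = "\<lambda>E. fpot (ind E)"
  show "IM E * Jr 0 (?f F) < \<infinity>" using fin IM_finite[OF E(1)] by (simp add: ennreal_mult_less_top)
  fix eta :: real assume eta: "1 < eta"
  define q where "q = sqrt eta"
  have q: "1 < q" "q * q = eta" using eta by (auto simp: q_def)
  obtain rho1 rho2 where rho: "good rho1 (?f E)" "good rho2 (?f F)"
    using test_good[OF E(1)] test_good[OF E(2)] by auto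
  obtain r1 where r1: "0 < r1" "\<And>r y. 0 < r \<Longrightarrow> r \<le> r1 \<Longrightarrow> y \<in> Dr (r / 8) \<Longrightarrow> et r y * Jr 0 (?f E) \<le> ennreal q * ?f E y"
    using inaccessible_asymp[OF rho(1) fin(1) q(1)] by auto
  obtain r2 where r2: "0 < r2" "\<And>r y. 0 < r \<Longrightarrow> r \<le> r2 \<Longrightarrow> y \<in> Dr (r / 8) \<Longrightarrow> ?f F y \<le> ennreal q * (et r y * Jr 0 (?f F))"
    using inaccessible_asymp[OF rho(2) fin(2) q(1)] by auto
  define r where "r = min r1 r2"
  have r: "0 < r" "r \<le> r1" "r \<le> r2" using r1 r2 by (auto simp: r_def)
  have pt: "?f F y / G x0 y * Jr 0 (?f E) \<le> ennreal eta * (?f E y / G x0 y * Jr 0 (?f F))" if y: "y \<in> Dr (r / 8)" for y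
  proof -
    have "?f F y * Jr 0 (?f E) \<le> ennreal q * (et r y * Jr 0 (?f F)) * Jr 0 (?f E)"
      by (rule mult_right_mono[OF r2(2)[OF r(1,3) y]]) simp
    also have "\<dots> = ennreal q * Jr 0 (?f F) * (et r y * Jr 0 (?f E))" by (simp only: mult_ac)
    also have "\<dots> \<le> ennreal q * Jr 0 (?f F) * (ennreal q * ?f E y)"
      by (rule mult_left_mono[OF r1(2)[OF r(1,2) y]]) simp
    also have "\<dots> = ennreal eta * (?f E y * Jr 0 (?f F))"
      unfolding q(2)[symmetric] using q(1) by (simp add: ennreal_mult mult_ac)
    finally show ?thesis using mult_right_mono[of _ _ "inverse (G x0 y)"] by (fastforce simp: divide_ennreal_def mult_ac)
  qed
  from w(2) obtain y where y: "range y \<subseteq> D" "limitin \<T> (\<lambda>n. Inl (y n)) (Inr w) sequentially" "y \<longlonglongrightarrow> z0"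
    unfolding martin_associated_def by blast
  have "(\<lambda>n. ?f F (y n) / G x0 (y n) * Jr 0 (?f E)) \<longlonglongrightarrow> IM F * Jr 0 (?f E)"
    by (intro tendsto_mult_ennreal IM_limit E y tendsto_const) (use fin IM_finite[OF E(2)] in auto)
  moreover have "(\<lambda>n. ennreal eta * (?f E (y n) / G x0 (y n) * Jr 0 (?f F))) \<longlonglongrightarrow> ennreal eta * (IM E * Jr 0 (?f F))"
    by (rule tendsto_mult_ennreal[OF tendsto_const tendsto_mult_ennreal[OF IM_limit[OF E(1) y] tendsto_const]])
      (use fin IM_finite[OF E(1)] in \<open>auto simp: ennreal_mult_eq_top_iff\<close>)
  moreover have "eventually (\<lambda>n. ?f F (y n) / G x0 (y n) * Jr 0 (?f E) \<le> ennreal eta * (?f E (y n) / G x0 (y n) * Jr 0 (?f F))) sequentially"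
    using Dr_eventually[OF y(1,3), of "r / 8"] r(1) by (auto elim!: eventually_mono intro: pt)
  ultimately show "IM F * Jr 0 (?f E) \<le> ennreal eta * (IM E * Jr 0 (?f F))"
    by (intro tendsto_le[OF trivial_limit_sequentially])
qed

lemma kap_Uop: "kap 0 x = XP.Uop D (\<lambda>v. ennreal (jh z0 v)) x"
  unfolding XUop[OF measurable_jh_z0] kap_def by (intro nn_integral_cong) (simp add: mult.commute)

text \<open>Over a test set, \<open>IM\<close> and \<open>Jr 0\<close> of the potential are the
  integrals of \<open>M\<close> and of \<open>kap 0\<close>. Proportional integrals over all test
  sets force proportional densities.\<close>

lemma inaccessible_density:
  assumes x1: "x1 \<in> D" "kap 0 x1 < \<infinity>"
  shows "\<exists>q. q < \<infinity> \<and> (AE x in m. M x = q * kap 0 x)"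
proof -
  let ?J = "\<lambda>E. Jr 0 (fpot (ind E))"
  obtain e where e: "0 < e" "cball x0 e \<subseteq> D" using small_ball(1) by blast
  define F where "F = ball x0 e"
  have F: "test F" unfolding F_def by (rule small_ball(2)[OF e])
  have J: "?J E < \<infinity>" if "test E" for E by (rule Jr_test_finite[OF that x1])
  obtain rho where rho: "good rho (fpot (ind F))" using test_good[OF F] by auto
  have J0: "0 < ?J F"
    using Jr_good(1)[OF rho goodD(1)[OF rho]] Jr_antimono[of 0 rho] goodD(1)[OF rho] by (auto intro: less_le_trans)
  define q where "q = IM F / ?J F"
  have q: "q < \<infinity>" using J0 IM_finite[OF F] by (auto simp: q_def less_top[symmetric] ennreal_divide_eq_top_iff)
  have IM_J: "IM E = q * ?J E" if E: "test E" for E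
  proof -
    have "IM E * ?J F = IM F * ?J E"
      by (rule antisym) (rule inaccessible_proportional[OF F E J[OF F] J[OF E]], rule inaccessible_proportional[OF E F J[OF E] J[OF F]])
    then have "IM E * ?J F / ?J F = q * ?J E" by (simp add: q_def divide_ennreal_def mult_ac)
    then show ?thesis using J0 J[OF F] by (simp add: ennreal_mult_divide_eq)
  qed
  interpret sigma_finite_measure m by (rule XP.sigma_finite_m)
  \<comment> \<open>Within a cell every Borel set of positive measure is a test set.\<close>
  have "AE x in m. M x * ind (cell D k) x = q * kap 0 x * ind (cell D k) x" for k
  proof (rule density_unique)
    have [measurable]: "cell D k \<in> sets borel" by (rule borel_closed[OF closed_cell])
    show 1: "(\<lambda>x. M x * ind (cell D k) x) \<in> borel_measurable m" by simp
    show 2: "(\<lambda>x. q * kap 0 x * ind (cell D k) x) \<in> borel_measurable m" by simp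
    show "density m (\<lambda>x. M x * ind (cell D k) x) = density m (\<lambda>x. q * kap 0 x * ind (cell D k) x)"
    proof (rule measure_eqI)
      fix A assume "A \<in> sets (density m (\<lambda>x. M x * ind (cell D k) x))"
      then have A [measurable]: "A \<in> sets borel" by (simp add: XP.sets_m)
      have eqs: "emeasure (density m (\<lambda>x. f x * ind (cell D k) x)) A = (\<integral>\<^sup>+x. f x * ind (A \<inter> cell D k) x \<partial>m)"
        if [measurable]: "f \<in> bfun" for f
        by (subst emeasure_density) (auto simp: XP.sets_m indicator_def intro!: nn_integral_cong)
      have "IM (A \<inter> cell D k) = (\<integral>\<^sup>+x. q * kap 0 x * ind (A \<inter> cell D k) x \<partial>m)"
      proof (cases "emeasure m (A \<inter> cell D k) = 0")
        case True
        then have "AE x in m. x \<notin> A \<inter> cell D k" by (intro AE_not_in) (auto simp: null_sets_def XP.sets_m)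
        then have "AE x in m. M x * ind (A \<inter> cell D k) x = q * kap 0 x * ind (A \<inter> cell D k) x"
          by eventually_elim auto
        then show ?thesis unfolding IM_def by (rule nn_integral_cong_AE)
      next
        case False
        then have "test (A \<inter> cell D k)"
          using XP.compact_cell[of D k] cell_subset[of D k] by (auto simp: test_def zero_less_iff_neq_zero intro!: exI[of _ "cell D k"])
        from IM_J[OF this] show ?thesis by (simp add: Jr_fpot nn_integral_cmult mult.assoc)
      qed
      then show "emeasure (density m (\<lambda>x. M x * ind (cell D k) x)) A = emeasure (density m (\<lambda>x. q * kap 0 x * ind (cell D k) x)) A"
        unfolding IM_def using eqs[of M] eqs[of "\<lambda>x. q * kap 0 x"] by simp
    qed simp
  qed
  then have "AE x in m. \<forall>k. M x * ind (cell D k) x = q * kap 0 x * ind (cell D k) x" by (simp add: AE_all_countable)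
  then have "AE x in m. M x = q * kap 0 x"
  proof eventually_elim
    fix x assume *: "\<forall>k. M x * ind (cell D k) x = q * kap 0 x * ind (cell D k) x"
    show "M x = q * kap 0 x"
    proof (cases "x \<in> D")
      case True
      then obtain k where "x \<in> cell D k" using cell_exhaust[OF D(1)] by blast
      then show ?thesis using *[rule_format, of k] by simp
    next
      case False
      then show ?thesis by (simp add: M_simps kap_def G_off)
    qed
  qed
  then show ?thesis using q by blast
qed

text \<open>Almost everywhere, and then everywhere because both sides are recovered by the semigroup
  at small times, \<open>M\<close> is a multiple of the potential \<open>P\<close>. Dynkin's formula
  on a ball around \<open>x0\<close> leaves a strictly positive occupation term, so \<open>P\<close>
  fails the mean value property there.\<close>

lemma inaccessible_not_harmonic:
  assumes x1: "x1 \<in> D" "kap 0 x1 < \<infinity>"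
  shows "\<not> harmonic X D (\<lambda>x. K x (Inr w))"
proof
  assume harm: "harmonic X D (\<lambda>x. K x (Inr w))"
  define phi where "phi v = ennreal (jh z0 v)" for v
  have phim [measurable]: "phi \<in> bfun" unfolding phi_def by (rule measurable_jh_z0)
  define P where "P = XP.Uop D phi"
  have [measurable]: "P \<in> bfun" unfolding P_def by measurable
  have P: "kap 0 x = P x" for x unfolding P_def phi_def by (rule kap_Uop)
  obtain q where q: "q < \<infinity>" and ae: "AE x in m. M x = q * P x"
    using inaccessible_density[OF x1] unfolding P by blast
  define N where "N = {x. M x \<noteq> q * P x}"
  have [measurable]: "N \<in> sets borel" unfolding N_def by measurable
  have UN: "XP.Uop D (ind N) x = 0" for x
  proof -
    have "XP.Uop D (ind N) x = (\<integral>\<^sup>+y. G x y * ind N y \<partial>m)" by (rule XUop) simp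
    also have "\<dots> = (\<integral>\<^sup>+y. 0 \<partial>m)"
      by (rule nn_integral_cong_AE) (use ae in eventually_elim, auto simp: N_def)
    finally show ?thesis by simp
  qed
  \<comment> \<open>At these times the killed semigroup does not see the exceptional set
    \<open>N\<close>, so equality almost everywhere becomes an equality at each \<open>x\<close>
    before the limit is taken.\<close>
  have approx: "\<exists>t. (\<forall>k. 0 < t k) \<and> t \<longlonglongrightarrow> 0 \<and> (\<forall>k. XP.Pop D (ennreal (t k)) M x = q * XP.Pop D (ennreal (t k)) P x)" for x
  proof -
    have "\<exists>t. 0 < t \<and> t < rn k \<and> XP.Pop D (ennreal t) M x = XP.Pop D (ennreal t) (\<lambda>y. q * P y) x" for k
      by (rule XP.Pop_eq_small_times) (use UN[of x] in \<open>simp_all add: N_def\<close>)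
    then obtain t where t: "\<And>k. 0 < t k" "\<And>k. t k < rn k"
      "\<And>k. XP.Pop D (ennreal (t k)) M x = XP.Pop D (ennreal (t k)) (\<lambda>y. q * P y) x" by metis
    have "t \<longlonglongrightarrow> 0"
      by (rule tendsto_sandwich[OF _ _ tendsto_const LIMSEQ_Suc[OF lim_1_over_n]]) (use t in \<open>auto intro!: always_eventually less_imp_le\<close>)
    moreover have "XP.Pop D (ennreal (t k)) (\<lambda>y. q * P y) x = q * XP.Pop D (ennreal (t k)) P x" for k
      by (simp add: XP.Pop_pm nn_integral_cmult)
    ultimately show ?thesis using t by (intro exI[of _ t]) auto
  qed
  have Pt: "(\<lambda>k. XP.Pop D (ennreal (t k)) P x) \<longlonglongrightarrow> P x" if "\<forall>k. 0 < t k" "t \<longlonglongrightarrow> 0" for t x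
    unfolding P_def by (rule XP.potential_Pop_tendsto[OF phim _ that(2)]) (use that(1) in \<open>auto intro: less_imp_le\<close>)
  \<comment> \<open>A vanishing factor would make \<open>M x0\<close> equal to 0 instead of
    1.\<close>
  have q0: "q \<noteq> 0"
  proof
    assume "q = 0"
    from approx[of x0] obtain t where t: "\<forall>k. 0 < t k" "t \<longlonglongrightarrow> 0" "\<And>k. XP.Pop D (ennreal (t k)) M x0 = q * XP.Pop D (ennreal (t k)) P x0" by blast
    have "(\<lambda>k. XP.Pop D (ennreal (t k)) M x0) \<longlonglongrightarrow> M x0" using t by (intro M_Pop_tendsto D(2)) auto
    then show False using t(3) \<open>q = 0\<close> by (simp add: M_x0 LIMSEQ_const_iff)
  qed
  have eq: "M x = q * P x" for x
  proof (cases "x \<in> D")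
    case True
    from approx[of x] obtain t where t: "\<forall>k. 0 < t k" "t \<longlonglongrightarrow> 0" "\<And>k. XP.Pop D (ennreal (t k)) M x = q * XP.Pop D (ennreal (t k)) P x" by blast
    have "(\<lambda>k. XP.Pop D (ennreal (t k)) M x) \<longlonglongrightarrow> M x" using t by (intro M_Pop_tendsto True) auto
    moreover have "(\<lambda>k. q * XP.Pop D (ennreal (t k)) P x) \<longlonglongrightarrow> q * P x"
      by (rule tendsto_mult_ennreal[OF tendsto_const Pt[OF t(1,2)]]) (use q q0 in auto)
    ultimately show ?thesis unfolding t(3) by (rule LIMSEQ_unique)
  qed (simp add: M_simps P_def XP.Rop_outside)
  obtain e where e: "0 < e" "cball x0 e \<subseteq> D" using small_ball(1) by blast
  define W where "W = ball x0 e"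
  have W: "open W" "x0 \<in> W" "W \<subseteq> D" "closure W \<subseteq> D" "compact (closure W)"
  proof -
    have cl: "closure W \<subseteq> cball x0 e" unfolding W_def by (rule closure_minimal) auto
    then show "closure W \<subseteq> D" "compact (closure W)"
      using e(2) by (auto intro!: XP.heine_borel bounded_subset[OF _ cl])
    then show "W \<subseteq> D" using closure_subset by blast
  qed (use e in \<open>auto simp: W_def\<close>)
  have "1 = XP.Hop W M x0"
    using XP.harmonic_Hop[OF harm D(1) W(1,5,4,2)] M_x0 D(2) by (simp add: M_def[abs_def])
  also have "\<dots> = q * XP.Hop W P x0" unfolding eq[abs_def] by (simp add: XP.Hop_hm nn_integral_cmult)
  finally have 1: "q * XP.Hop W P x0 = 1" by simp
  have "q * P x0 = 1" using eq[of x0] M_x0 by simp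
  moreover have "P x0 = XP.Uop W phi x0 + XP.Hop W P x0" unfolding P_def by (rule XP.Uop_split[OF D(1) W(1,3) phim])
  ultimately have "1 + q * XP.Uop W phi x0 = 1 + 0" using 1 by (simp add: distrib_left add.commute)
  then have "q * XP.Uop W phi x0 = 0" unfolding ennreal_add_left_cancel by simp
  moreover have "0 < XP.Uop W phi x0"
  proof (rule XP.Uop_positive[OF W(1,2) phim])
    fix v assume "v \<in> W"
    then have "v \<noteq> z0" using W(3) z0_notin by auto
    then show "0 < phi v" using j_dual[of v z0] j_pos[of v z0] by (simp add: phi_def)
  qed
  ultimately show False using q0 by simp
qed

end

section \<open>The accessible case\<close>

locale martin_accessible = martin_point +
  assumes acc: "x \<in> D \<Longrightarrow> kap 0 x = \<infinity>"
    and bnd: "0 < r \<Longrightarrow> r \<le> R1 \<Longrightarrow> \<exists>b<\<infinity>. \<forall>x\<in>Dr (r / 2). \<forall>y. y \<notin> ball z0 r \<longrightarrow> G x y \<le> b \<and> G y x \<le> b"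
    and C1X: "0 < r \<Longrightarrow> 2 * r \<le> R1 \<Longrightarrow> x \<in> ball z0 r \<Longrightarrow> y \<notin> ball z0 (2 * r) \<Longrightarrow> j z0 y \<le> c * j x y"
begin

text \<open>The sets \<open>Dr rho\<close> shrink to the empty set, as \<open>z0\<close> is not in
  \<open>D\<close>; so this holds even if \<open>m\<close> has an atom at \<open>z0\<close>.\<close>

lemma measure_Dr_small:
  assumes "0 < e" shows "\<exists>rho0>0. \<forall>rho\<le>rho0. emeasure m (Dr rho) < e"
proof -
  let ?A = "\<lambda>n. Dr (rn n)"
  have "(\<lambda>n. emeasure m (?A n)) \<longlonglongrightarrow> emeasure m (\<Inter>n. ?A n)"
  proof (rule Lim_emeasure_decseq)
    show "range ?A \<subseteq> sets m" using Dr_simps(1) by (auto simp: XP.sets_m)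
    show "decseq ?A" unfolding decseq_def by (intro allI impI Dr_mono divide_left_mono) auto
    show "emeasure m (?A n) \<noteq> \<infinity>" for n
    proof -
      have "emeasure m (?A n) \<le> emeasure m (ball z0 (rn n))"
        by (rule emeasure_mono) (use Dr_simps(3) in \<open>auto simp: XP.sets_m\<close>)
      also have "\<dots> < \<infinity>" by (rule XP.emeasure_ball(2)) simp
      finally show ?thesis by simp
    qed
  qed
  moreover have "(\<Inter>n. ?A n) = {}"
  proof -
    have False if v: "\<And>n. v \<in> ?A n" for v
    proof -
      have "v \<noteq> z0" using v[of 0] z0_notin by (auto simp: Dr_def)
      then have "0 < dist z0 v" by simp
      then obtain n where "rn n < dist z0 v" using nat_approx_posE by blast
      then show False using v[of n] by (simp add: Dr_def del: of_nat_Suc)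
    qed
    then show ?thesis by blast
  qed
  ultimately have "eventually (\<lambda>n. emeasure m (?A n) < e) sequentially" using assms by (intro order_tendstoD) auto
  then obtain n where n: "emeasure m (?A n) < e" by (auto simp: eventually_sequentially)
  show ?thesis
  proof (intro exI[of _ "rn n"] conjI allI impI)
    fix rho assume "rho \<le> rn n"
    then have "emeasure m (Dr rho) \<le> emeasure m (?A n)"
      using Dr_simps(1) by (intro emeasure_mono Dr_mono) (auto simp: XP.sets_m)
    then show "emeasure m (Dr rho) < e" using n by (rule le_less_trans)
  qed simp
qed

text \<open>\<open>BHP_G_fpot\<close> with one reference point \<open>y1\<close> compares the
  potential of \<open>E\<close> with \<open>G x0\<close>, uniformly near \<open>z0\<close>.\<close>

lemma test_bound:
  assumes E: "test E"
  shows "\<exists>rho>0. \<exists>b>0. \<forall>y\<in>Dr rho. fpot (ind E) y \<le> ennreal b * G x0 y"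
proof -
  obtain rho where rho': "E \<inter> cball z0 rho = {}" "good rho (fpot (ind E))" using test_good[OF E] by auto
  note rho = goodD(1,2)[OF rho'(2)]
  obtain y1 where y1: "y1 \<in> Dr (rho / 8)" using Dr_nonempty[of "rho / 8"] rho by auto
  have "y1 \<in> Dr (R1 / 8)" using y1 rho Dr_mono[of "rho / 8" "R1 / 8"] by auto
  note g = G_x0_pos[OF this]
  define b where "b = enn2real (ennreal (C ^ 4) * (fpot (ind E) y1 / G x0 y1))"
  have "ennreal (C ^ 4) * (fpot (ind E) y1 / G x0 y1) < \<infinity>"
    using g goodD(7)[OF rho'(2) y1] by (auto simp: less_top[symmetric] ennreal_mult_eq_top_iff ennreal_divide_eq_top_iff)
  then have b: "ennreal (C ^ 4) * (fpot (ind E) y1 / G x0 y1) = ennreal b" by (simp add: b_def less_top[symmetric])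
  have "fpot (ind E) y \<le> ennreal (b + 1) * G x0 y" if y: "y \<in> Dr (rho / 8)" for y
  proof -
    have "G x0 y1 * fpot (ind E) y \<le> ennreal (C ^ 4) * (fpot (ind E) y1 * G x0 y)"
      by (rule BHP_G_fpot[OF rho _ _ _ y1 y]) (use E rho'(1) D R1 rho in \<open>auto simp: test_def\<close>)
    then have "G x0 y1 * fpot (ind E) y / G x0 y1 \<le> ennreal (C ^ 4) * (fpot (ind E) y1 * G x0 y) / G x0 y1"
      by (rule divide_right_mono_ennreal)
    also have "\<dots> = ennreal b * G x0 y" unfolding b[symmetric] by (simp add: divide_ennreal_def mult_ac)
    also have "\<dots> \<le> ennreal (b + 1) * G x0 y" by (intro mult_right_mono ennreal_leI) auto
    also have "G x0 y1 * fpot (ind E) y / G x0 y1 = fpot (ind E) y"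
      using g by (subst mult.commute, intro ennreal_mult_divide_eq) auto
    finally show ?thesis .
  qed
  then show ?thesis using rho by (intro exI[of _ "rho / 8"] conjI exI[of _ "b + 1"]) (auto simp: b_def add_nonneg_pos)
qed

text \<open>The potential of a small neighbourhood of \<open>z\<^sub>0\<close> is negligible against \<open>G(x\<^sub>0, \<cdot>)\<close> near \<open>z\<^sub>0\<close>; this
  fails at inaccessible points.\<close>

lemma near_small:
  assumes eps: "0 < eps"
  shows "\<exists>rho>0. \<exists>\<delta>>0. \<forall>rho'\<le>rho. \<forall>y\<in>Dr \<delta>. fpot (ind (Dr rho')) y \<le> ennreal eps * G x0 y"
proof -
  obtain e where e: "0 < e" "cball x0 e \<subseteq> D" using small_ball(1) by blast
  define f0 where "f0 = fpot (ind (ball x0 e))"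
  have F: "test (ball x0 e)" by (rule small_ball(2)[OF e])
  obtain rho0 where g0: "good rho0 f0" using test_good[OF F] by (auto simp: f0_def)
  note rho0 = goodD(1,2)[OF g0]
  have inf: "Jr 0 f0 = \<infinity>" unfolding f0_def by (rule Jr_test_infinite[OF F acc])
  obtain rhob b where b: "0 < rhob" "0 < b" "\<And>y. y \<in> Dr rhob \<Longrightarrow> f0 y \<le> ennreal b * G x0 y"
    using test_bound[OF F] by (auto simp: f0_def)
  \<comment> \<open>Half of \<open>eps\<close> is spent on the occupation before the exit from
    \<open>Dr s\<close> and half on the part after it; \<open>b\<close> converts the comparison
    function \<open>f0\<close> into \<open>G x0\<close>.\<close>
  define eps1 where "eps1 = eps / (2 * b)"
  have eps1: "0 < eps1" "(eps1 + eps1) * b = eps" using eps b by (auto simp: eps1_def field_simps)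
  obtain r0 where r0: "0 < r0" "\<And>r. r \<le> r0 \<Longrightarrow> ennreal (C / eps1) < Jr r f0" using Jr_large[OF g0 inf, of "ennreal (C / eps1)"] by auto
  define s where "s = min r0 rho0"
  have s: "0 < s" "s \<le> r0" "s \<le> rho0" "s \<le> R1" using r0 rho0 by (auto simp: s_def)
  \<comment> \<open>The occupation before the exit is at most the mean exit time. F1 compares the
    latter with \<open>f0\<close> through \<open>Jr s f0\<close>, which is large for small
    \<open>s\<close> because \<open>Jr 0 f0\<close> is infinite.\<close>
  have first: "et s y \<le> ennreal eps1 * f0 y" if y: "y \<in> Dr (s / 8)" for y
  proof -
    have "et s y = ennreal eps1 * (ennreal (inverse C) * (et s y * ennreal (C / eps1)))"
    proof -
      have "eps1 * (inverse C * (C / eps1)) = 1" using C eps1 by simp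
      then have "ennreal eps1 * (ennreal (inverse C) * ennreal (C / eps1)) = 1"
        using C eps1(1) by (metis ennreal_1 ennreal_mult' inverse_nonnegative_iff_nonnegative less_imp_le order_trans zero_le_one)
      then show ?thesis by (metis mult.left_commute mult.right_neutral)
    qed
    also have "\<dots> \<le> ennreal eps1 * (ennreal (inverse C) * (et s y * Jr s f0))"
      using r0(2)[OF s(2)] by (intro mult_left_mono) auto
    also have "\<dots> \<le> ennreal eps1 * f0 y" using F1_good(1)[OF g0 s(1,3) y] by (intro mult_left_mono) auto
    finally show ?thesis .
  qed
  obtain y1 where y1: "y1 \<in> Dr (s / 8)" using Dr_nonempty[of "s / 8"] s by auto
  have f0y1: "0 < f0 y1" "f0 y1 < \<infinity>" using goodD(6,7)[OF g0, of y1] y1 s Dr_mono[of "s / 8" "rho0 / 8"] by auto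
  define r where "r = dist z0 y1"
  have r: "0 < r" "r \<le> R1" using y1 z0_notin s by (auto simp: r_def Dr_def)
  obtain \<kappa> where \<kappa>: "\<kappa> < \<infinity>" "\<And>x. x \<in> Dr (r / 2) \<Longrightarrow> G x y1 \<le> \<kappa>" using bnd[OF r] by (auto simp: r_def)
  \<comment> \<open>The summand 1 keeps \<open>a\<close> positive, so that the division in
    \<open>d\<close> is proper.\<close>
  define a where "a = ennreal (C ^ 4) * (\<kappa> + 1)"
  have "0 < \<kappa> + 1" by (rule add_nonneg_pos[OF zero_le zero_less_one])
  then have a: "a < \<infinity>" "0 < a" using \<kappa>(1) C by (auto simp: a_def ennreal_mult_less_top ennreal_zero_less_mult_iff)
  define d where "d = ennreal eps1 * f0 y1 / a"
  have "0 < d" using eps1 f0y1 a by (auto simp: d_def ennreal_zero_less_divide ennreal_zero_less_mult_iff)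
  then obtain rho1 where rho1: "0 < rho1" "\<And>rho. rho \<le> rho1 \<Longrightarrow> emeasure m (Dr rho) < d" using measure_Dr_small by blast
  have main: "fpot (ind (Dr rho)) y \<le> ennreal eps * G x0 y" if rho: "rho \<le> rho1" "rho \<le> r / 2" and y: "y \<in> Dr (s / 8)" "y \<in> Dr rhob" for rho y
  proof -
    define q where "q = fpot (ind (Dr rho))"
    have ind: "(ind (Dr rho)) \<in> bfun" using Dr_simps(1) by simp
    have qm [measurable]: "q \<in> bfun" unfolding q_def by (rule measurable_fpot[OF ind])
    note f0m [measurable] = goodD(3)[OF g0]
    have split: "q v = YP.Uop (Dr s) (ind (Dr rho)) v + YP.Hop (Dr s) q v" for v
      unfolding q_def by (rule fpot_split[OF ind])
    have "ennreal (C ^ 4) * q y1 \<le> ennreal (C ^ 4) * (\<kappa> * emeasure m (Dr rho))"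
    proof (rule mult_left_mono)
      have "q y1 \<le> (\<integral>\<^sup>+x. \<kappa> * ind (Dr rho) x \<partial>m)"
        unfolding q_def fpot_def using \<kappa>(2) Dr_mono[OF rho(2)] by (intro nn_integral_mono) (auto simp: indicator_def)
      then show "q y1 \<le> \<kappa> * emeasure m (Dr rho)" using Dr_simps(1) by (simp add: nn_integral_cmult_indicator XP.sets_m)
    qed simp
    also have "\<dots> \<le> a * emeasure m (Dr rho)" by (simp add: a_def distrib_left distrib_right mult.assoc)
    also have "\<dots> \<le> a * d" using rho1(2)[OF rho(1)] by (intro mult_left_mono) auto
    also have "\<dots> = ennreal eps1 * f0 y1" using a by (simp add: d_def ennreal_times_divide mult.commute[of a] ennreal_mult_divide_eq)
    finally have q1: "ennreal (C ^ 4) * q y1 \<le> ennreal eps1 * f0 y1" .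
    let ?off = "\<lambda>g v. ind (- ball z0 s) v * g v"
    have Hq: "YP.Hop (Dr s) q v = YP.Hop (Dr s) (?off q) v" for v
      by (rule Hop_Dr_restrict) (simp add: q_def fpot_off)
    have Hf: "f0 v = YP.Hop (Dr s) (?off f0) v" for v
      using Hop_Dr_restrict[of f0 s v] goodD(5)[OF g0 s(1,3)] by (simp add: f0_def fpot_off)
    \<comment> \<open>The boundary Harnack principle reduces the estimate near \<open>z0\<close> to
      the fixed point \<open>y1\<close>, where the small measure of \<open>Dr rho\<close> makes
      \<open>q\<close> small.\<close>
    have "YP.Hop (Dr s) (?off q) y * YP.Hop (Dr s) (?off f0) y1 \<le>
        ennreal (C ^ 4) * (YP.Hop (Dr s) (?off q) y1 * YP.Hop (Dr s) (?off f0) y)"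
      by (rule BHP_Hop[OF s(1,4) _ _ _ _ y(1) y1]) simp_all
    then have "YP.Hop (Dr s) q y * f0 y1 \<le> ennreal (C ^ 4) * (YP.Hop (Dr s) q y1 * f0 y)"
      unfolding Hq[symmetric] Hf[symmetric] .
    also have "\<dots> \<le> ennreal (C ^ 4) * (q y1 * f0 y)" unfolding split[of y1] by (intro mult_left_mono mult_right_mono) auto
    also have "\<dots> \<le> (ennreal eps1 * f0 y1) * f0 y" using mult_right_mono[OF q1, of "f0 y"] by (simp add: mult_ac)
    finally have "f0 y1 * YP.Hop (Dr s) q y \<le> f0 y1 * (ennreal eps1 * f0 y)" by (simp add: mult_ac)
    then have second: "YP.Hop (Dr s) q y \<le> ennreal eps1 * f0 y"
      using f0y1 by (subst (asm) ennreal_mult_le_mult_iff) auto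
    have "YP.Uop (Dr s) (ind (Dr rho)) y \<le> et s y" unfolding et_def by (rule YP.Rop_mono_on) (simp add: indicator_def)
    then have "q y \<le> ennreal eps1 * f0 y + ennreal eps1 * f0 y"
      unfolding split[of y] using first[OF y(1)] second by (intro add_mono) auto
    also have "\<dots> = ennreal (eps1 + eps1) * f0 y" using eps1(1) by (subst ennreal_plus) (auto simp: distrib_right)
    also have "\<dots> \<le> ennreal (eps1 + eps1) * (ennreal b * G x0 y)" by (rule mult_left_mono[OF b(3)[OF y(2)]]) simp
    also have "\<dots> = ennreal ((eps1 + eps1) * b) * G x0 y" using eps1(1) b(2) by (subst ennreal_mult) (auto simp: mult.assoc)
    also have "\<dots> = ennreal eps * G x0 y" unfolding eps1(2) ..
    finally show ?thesis unfolding q_def .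
  qed
  have "\<forall>rho'\<le>min rho1 (r / 2). \<forall>y\<in>Dr (min (s / 8) rhob). fpot (ind (Dr rho')) y \<le> ennreal eps * G x0 y"
    using Dr_mono[OF min.cobounded1, of "s / 8" rhob] Dr_mono[OF min.cobounded2, of "s / 8" rhob]
    by (intro allI impI ballI main) auto
  moreover have "0 < min rho1 (r / 2)" "0 < min (s / 8) rhob" using rho1 r s b by auto
  ultimately show ?thesis by blast
qed

text \<open>Dynkin's formula tests the Green function only after integration in \<open>y\<close>,
  hence the restriction to almost every \<open>y\<close>. This is enough, since \<open>M\<close> may
  be approached along any sequence tending to \<open>z0\<close>.\<close>

lemma G_Hop_AE:
  assumes W: "open W" "W \<subseteq> D" "W \<inter> ball z0 r = {}"
  shows "AE y in m. y \<in> Dr r \<longrightarrow> G x y = XP.Hop W (\<lambda>v. G v y) x"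
proof -
  interpret sigma_finite_measure m by (rule XP.sigma_finite_m)
  interpret H: finite_measure "XP.hm W x" by (rule XP.finite_hm)
  interpret P: pair_sigma_finite "XP.hm W x" m
    by (simp add: pair_sigma_finite_def H.sigma_finite_measure_axioms sigma_finite_measure_axioms)
  note Dr_simps(1)[of r, THEN borel_open, measurable]
  have Hop_eq: "XP.Hop W (\<lambda>v. G v y) x = (\<integral>\<^sup>+v. G v y \<partial>XP.hm W x)" for y by (rule XP.Hop_hm) simp
  have Hm [measurable]: "(\<lambda>y. \<integral>\<^sup>+v. G v y \<partial>XP.hm W x) \<in> bfun"
  proof -
    have "(\<lambda>z. G (snd z) (fst z)) \<in> borel_measurable (borel \<Otimes>\<^sub>M borel)"
      using measurable_compose[OF measurable_pair_swap' measurable_G] by (simp add: case_prod_beta')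
    then have "(\<lambda>z. G (snd z) (fst z)) \<in> borel_measurable (borel \<Otimes>\<^sub>M XP.hm W x)"
      by (simp add: measurable_cong_sets[OF sets_pair_measure_cong[OF refl XP.sets_kernels(1)] refl])
    from H.borel_measurable_nn_integral[of "\<lambda>y v. G v y" borel] this show ?thesis by (simp add: case_prod_beta')
  qed
  have "AE y in m. G x y * ind (Dr r) y = (\<integral>\<^sup>+v. G v y \<partial>XP.hm W x) * ind (Dr r) y"
  proof (rule density_unique)
    show "density m (\<lambda>y. G x y * ind (Dr r) y) = density m (\<lambda>y. (\<integral>\<^sup>+v. G v y \<partial>XP.hm W x) * ind (Dr r) y)"
    proof (rule measure_eqI)
      fix A assume "A \<in> sets (density m (\<lambda>y. G x y * ind (Dr r) y))"
      then have A [measurable]: "A \<in> sets borel" by (simp add: XP.sets_m)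
      let ?I = "ind (Dr r \<inter> A) :: 'a \<Rightarrow> ennreal"
      have I: "?I \<in> bfun" by measurable
      have W0: "XP.Uop W ?I x = 0"
      proof -
        have "XP.Uop W ?I x = XP.Uop W (\<lambda>_. 0) x"
        proof (rule XP.Rop_cong)
          fix y assume "y \<in> W"
          then have "y \<notin> Dr r \<inter> A" using W(3) by (auto simp: Dr_def)
          then show "?I y = 0" by simp
        qed
        then show ?thesis by (simp add: XP.Rop_om)
      qed
      have "emeasure (density m (\<lambda>y. G x y * ind (Dr r) y)) A = (\<integral>\<^sup>+y. G x y * ?I y \<partial>m)"
        by (subst emeasure_density) (auto simp: XP.sets_m indicator_def intro!: nn_integral_cong)
      also have "\<dots> = XP.Uop D ?I x" by (rule XUop[OF I, symmetric])
      also have "\<dots> = XP.Hop W (XP.Uop D ?I) x" using XP.Uop_split[OF D(1) W(1,2) I, of x] W0 by simp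
      also have "\<dots> = (\<integral>\<^sup>+v. \<integral>\<^sup>+y. G v y * ?I y \<partial>m \<partial>XP.hm W x)"
        unfolding XP.Hop_hm[OF XP.measurable_Rop[OF I]] XUop[OF I] ..
      also have "\<dots> = (\<integral>\<^sup>+y. \<integral>\<^sup>+v. G v y * ?I y \<partial>XP.hm W x \<partial>m)"
      proof (rule P.Fubini'[symmetric])
        have "(\<lambda>(v, y). G v y * ?I y) \<in> borel_measurable (borel \<Otimes>\<^sub>M borel)"
          unfolding case_prod_beta' by measurable
        then show "(\<lambda>(v, y). G v y * ?I y) \<in> borel_measurable (XP.hm W x \<Otimes>\<^sub>M m)"
          by (simp add: measurable_cong_sets[OF sets_pair_measure_cong[OF XP.sets_kernels(1) XP.sets_m] refl])
      qed
      also have "\<dots> = (\<integral>\<^sup>+y. (\<integral>\<^sup>+v. G v y \<partial>XP.hm W x) * ?I y \<partial>m)" by (simp add: nn_integral_multc)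
      also have "\<dots> = emeasure (density m (\<lambda>y. (\<integral>\<^sup>+v. G v y \<partial>XP.hm W x) * ind (Dr r) y)) A"
        by (subst emeasure_density) (auto simp: XP.sets_m indicator_def intro!: nn_integral_cong)
      finally show "emeasure (density m (\<lambda>y. G x y * ind (Dr r) y)) A =
        emeasure (density m (\<lambda>y. (\<integral>\<^sup>+v. G v y \<partial>XP.hm W x) * ind (Dr r) y)) A" .
    qed simp
  qed simp_all
  then show ?thesis unfolding Hop_eq by eventually_elim (auto simp: indicator_def)
qed

text \<open>\<open>W\<close> may touch the boundary of \<open>D\<close> away from \<open>z0\<close>.
  Fatou's lemma gives one inequality. For the other, no mass may escape at \<open>z0\<close>: the
  exit distribution has a bounded density near \<open>z0\<close>, so \<open>near_small\<close> makes
  the contribution of a small ball uniformly small, and elsewhere \<open>kernel_bound\<close>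
  dominates.\<close>

lemma M_Hop:
  assumes W: "open W" "W \<subseteq> D" "W \<inter> ball z0 r = {}" and r: "0 < r" "r \<le> R1" and x: "x \<in> W"
  shows "XP.Hop W M x = M x"
proof -
  have xD: "x \<in> D - cball z0 (r / 2)" using x W r by (auto simp: mem_ball)
  note ae = G_Hop_AE[OF W, of x]
  \<comment> \<open>Every set \<open>Dr d\<close> with \<open>d > 0\<close> has positive measure, so
    it contains a point where the almost sure identity holds.\<close>
  have "\<exists>y. y \<in> Dr (min r (rn n)) \<and> G x y = XP.Hop W (\<lambda>v. G v y) x" for n
  proof (rule ccontr)
    let ?d = "min r (rn n)"
    assume neg: "\<not> (\<exists>y. y \<in> Dr ?d \<and> G x y = XP.Hop W (\<lambda>v. G v y) x)"
    have "AE y in m. y \<notin> Dr ?d" using ae by eventually_elim (use neg Dr_mono[of ?d r] in auto)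
    then have "emeasure m (Dr ?d) = 0"
      using Dr_simps(1) by (subst (asm) AE_iff_measurable[of "Dr ?d"]) (auto simp: XP.sets_m)
    moreover have "0 < emeasure m (Dr ?d)" using r by (intro XP.open_m Dr_simps Dr_nonempty) auto
    ultimately show False by simp
  qed
  then obtain y where y: "\<And>n. y n \<in> Dr (min r (rn n))" "\<And>n. G x (y n) = XP.Hop W (\<lambda>v. G v (y n)) x" by metis
  note yD = LIMSEQ_Dr(1)[OF y(1)] and yz = LIMSEQ_Dr(2)[OF y(1)]
  define g where "g n v = G v (y n) / G x0 (y n)" for n v
  have gm [measurable]: "g n \<in> bfun" for n unfolding g_def by measurable
  have g_lim: "(\<lambda>n. g n v) \<longlonglongrightarrow> M v" for v unfolding g_def by (rule M_limit[OF yD yz])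
  have g_off: "g n v = 0" if "v \<notin> D" for n v using that by (simp add: g_def G_off)
  have g_Hop: "g n x = (\<integral>\<^sup>+v. g n v \<partial>XP.hm W x)" for n
  proof -
    have "g n x = (\<integral>\<^sup>+v. G v (y n) \<partial>XP.hm W x) / G x0 (y n)" using y(2)[of n] by (simp add: g_def XP.Hop_hm)
    then show ?thesis unfolding g_def by (simp add: nn_integral_divide)
  qed
  have "(\<integral>\<^sup>+v. liminf (\<lambda>n. g n v) \<partial>XP.hm W x) \<le> liminf (\<lambda>n. \<integral>\<^sup>+v. g n v \<partial>XP.hm W x)" by (rule nn_integral_liminf) simp
  moreover have "liminf (\<lambda>n. g n v) = M v" for v by (rule lim_imp_Liminf[OF trivial_limit_sequentially g_lim])
  ultimately have upper: "XP.Hop W M x \<le> M x" by (simp add: XP.Hop_hm g_Hop[symmetric])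
  let ?S = "ball z0 (r / 2)"
  define Q where "Q = ennreal (c * c) / emeasure m ?S"
  have S0: "0 < emeasure m ?S" by (rule XP.emeasure_ball(1)) (use r in simp)
  have Qfin: "Q < \<infinity>" using S0 by (auto simp: Q_def less_top[symmetric] ennreal_divide_eq_top_iff)
  have clW: "?S \<inter> closure W = {}"
  proof -
    have "closure W \<subseteq> - ball z0 r" by (rule closure_minimal) (use W in auto)
    moreover have "?S \<subseteq> ball z0 r" using r by (intro subset_ball) simp
    ultimately show ?thesis by blast
  qed
  have dens: "XP.Hop W (\<lambda>v. ind ?S v * h v) x \<le> Q * (\<integral>\<^sup>+v. ind ?S v * h v \<partial>m)"
    if h: "h \<in> bfun" "\<And>v. v \<notin> D \<Longrightarrow> h v = 0" for h
    unfolding Q_def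
  proof (rule XP.exit_density[OF D(1) W(1,2) x open_ball _ clW c, where \<kappa> = "jh z0"])
    show "jh z0 \<in> bfun" by (rule YP.measurable_j_right)
    fix u v assume uv: "u \<in> W" "v \<in> ?S"
    have "u \<notin> ball z0 r" using uv W by auto
    then have "u \<noteq> v" "u \<notin> ball z0 (2 * (r / 2))" using uv r by auto
    then show "inverse c * jh z0 u \<le> j u v \<and> j u v \<le> c * jh z0 u"
      using C1[of "r / 2" v u] uv(2) r j_dual[of u v] by auto
  qed (use h r in auto)
  have lower: "M x \<le> XP.Hop W M x + ennreal eps" if eps: "0 < eps" for eps
  proof -
    define Q' where "Q' = enn2real Q + 1"
    have Q': "0 < Q'" "Q \<le> ennreal Q'"
    proof -
      show "0 < Q'" by (simp add: Q'_def add_nonneg_pos)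
      have "Q = ennreal (enn2real Q)" using Qfin by (simp add: less_top[symmetric])
      also have "\<dots> \<le> ennreal Q'" by (rule ennreal_leI) (simp add: Q'_def)
      finally show "Q \<le> ennreal Q'" .
    qed
    obtain rho1 \<delta> where rho1: "0 < rho1" "0 < \<delta>" "\<And>rho y. rho \<le> rho1 \<Longrightarrow> y \<in> Dr \<delta> \<Longrightarrow> fpot (ind (Dr rho)) y \<le> ennreal (eps / Q') * G x0 y"
      using near_small[of "eps / Q'"] eps Q' by auto
    define rho where "rho = min rho1 (r / 2)"
    have rho: "0 < rho" "rho \<le> rho1" "rho \<le> r / 2" "0 < rho / 2" "rho / 2 \<le> R1" using rho1 r by (auto simp: rho_def)
    have ev: "eventually (\<lambda>n. y n \<in> Dr \<delta>) sequentially" "eventually (\<lambda>n. y n \<in> Dr (R1 / 8)) sequentially"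
      using Dr_eventually[OF yD yz] rho1(2) R1 by auto
    obtain N where N: "\<And>n. n \<ge> N \<Longrightarrow> y n \<in> Dr (rho / 2 / 8)"
      using Dr_eventually[OF yD yz, of "rho / 2 / 8"] rho by (auto simp: eventually_sequentially)
    let ?far = "\<lambda>n v. ind (- ball z0 rho) v * g n v" and ?near = "\<lambda>n v. ind (ball z0 rho) v * g n v"
    have near: "eventually (\<lambda>n. (\<integral>\<^sup>+v. ?near n v \<partial>XP.hm W x) \<le> ennreal eps) sequentially"
      using ev
    proof eventually_elim
      case (elim n)
      have sub: "ball z0 rho \<subseteq> ?S" using rho by (intro subset_ball) simp
      have "(\<integral>\<^sup>+v. ?near n v \<partial>XP.hm W x) = XP.Hop W (\<lambda>v. ind ?S v * ?near n v) x"
        using sub by (subst XP.Hop_hm) (auto simp: indicator_def intro!: nn_integral_cong)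
      also have "\<dots> \<le> Q * (\<integral>\<^sup>+v. ind ?S v * ?near n v \<partial>m)" by (rule dens) (auto simp: g_off intro!: borel_measurable_times_ennreal borel_measurable_indicator)
      also have "(\<integral>\<^sup>+v. ind ?S v * ?near n v \<partial>m) = (\<integral>\<^sup>+v. G v (y n) * ind (Dr rho) v / G x0 (y n) \<partial>m)"
        using sub by (intro nn_integral_cong) (auto simp: indicator_def g_def Dr_def G_off)
      also have "\<dots> = fpot (ind (Dr rho)) (y n) / G x0 (y n)"
        unfolding fpot_def using Dr_simps(1) by (intro nn_integral_divide) simp
      also have "\<dots> \<le> ennreal (eps / Q') * G x0 (y n) / G x0 (y n)"
        using rho1(3)[OF rho(2) elim(1)] by (rule divide_right_mono_ennreal)
      also have "\<dots> = ennreal (eps / Q')" using G_x0_pos[OF elim(2)] by (intro ennreal_mult_divide_eq) auto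
      finally have "(\<integral>\<^sup>+v. ?near n v \<partial>XP.hm W x) \<le> Q * ennreal (eps / Q')" by (simp add: mult_left_mono)
      also have "\<dots> \<le> ennreal Q' * ennreal (eps / Q')" by (rule mult_right_mono[OF Q'(2)]) simp
      also have "\<dots> = ennreal eps" using Q' eps by (simp add: ennreal_mult[symmetric])
      finally show ?case .
    qed
    have far: "(\<lambda>n. \<integral>\<^sup>+v. ?far (n + N) v \<partial>XP.hm W x) \<longlonglongrightarrow> (\<integral>\<^sup>+v. ind (- ball z0 rho) v * M v \<partial>XP.hm W x)"
    \<comment> \<open>Up to a constant the dominating function is itself a normalised kernel, whose
      exit integral is the finite number \<open>g N x\<close>.\<close>
    proof (rule nn_integral_dominated_convergence[where w = "\<lambda>v. ennreal (C ^ 4) * g N v"])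
      show "AE v in XP.hm W x. ?far (n + N) v \<le> ennreal (C ^ 4) * g N v" for n
      proof (rule AE_I2)
        fix v
        show "?far (n + N) v \<le> ennreal (C ^ 4) * g N v"
        proof (cases "v \<in> D - cball z0 (rho / 2)")
          case True
          then show ?thesis using kernel_bound[OF rho(4,5) True N N, of "n + N" N] by (auto simp: g_def indicator_def)
        next
          case False
          then show ?thesis using rho g_off[of v] by (auto simp: indicator_def)
        qed
      qed
      have "g N x < \<infinity>"
      proof -
        have "y N \<in> Dr (R1 / 8)" using N[of N] Dr_mono[of "rho / 2 / 8" "R1 / 8"] rho by auto
        note G_x0_pos[OF this]
        moreover have "x \<noteq> y N" using x W y(1)[of N] by (auto simp: Dr_def)
        ultimately show ?thesis using G_fin[of x "y N"] by (auto simp: g_def less_top[symmetric] ennreal_divide_eq_top_iff)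
      qed
      then show "(\<integral>\<^sup>+v. ennreal (C ^ 4) * g N v \<partial>XP.hm W x) < \<infinity>"
        by (simp add: nn_integral_cmult g_Hop[symmetric] ennreal_mult_less_top)
      show "AE v in XP.hm W x. (\<lambda>n. ?far (n + N) v) \<longlonglongrightarrow> ind (- ball z0 rho) v * M v"
      proof (rule AE_I2)
        fix v
        show "(\<lambda>n. ?far (n + N) v) \<longlonglongrightarrow> ind (- ball z0 rho) v * M v"
          using LIMSEQ_ignore_initial_segment[OF g_lim[of v], of N] by (cases "v \<in> ball z0 rho") auto
      qed
    qed simp_all
    have "eventually (\<lambda>n. g (n + N) x \<le> (\<integral>\<^sup>+v. ?far (n + N) v \<partial>XP.hm W x) + ennreal eps) sequentially"
      using sequentially_offset[OF near, of N]
    proof eventually_elim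
      case (elim n)
      have "g (n + N) x = (\<integral>\<^sup>+v. ?far (n + N) v \<partial>XP.hm W x) + (\<integral>\<^sup>+v. ?near (n + N) v \<partial>XP.hm W x)"
        unfolding g_Hop by (subst nn_integral_add[symmetric]) (auto simp: indicator_def intro!: nn_integral_cong)
      then show ?case using elim by (simp add: add_left_mono)
    qed
    then have "M x \<le> (\<integral>\<^sup>+v. ind (- ball z0 rho) v * M v \<partial>XP.hm W x) + ennreal eps"
      by (rule tendsto_le[OF trivial_limit_sequentially tendsto_add[OF far tendsto_const] LIMSEQ_ignore_initial_segment[OF g_lim]])
    also have "\<dots> \<le> XP.Hop W M x + ennreal eps"
      by (subst XP.Hop_hm) (auto intro!: add_right_mono nn_integral_mono simp: indicator_def)
    finally show ?thesis .
  qed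
  show ?thesis by (rule antisym[OF upper ennreal_le_epsilon]) (rule lower)
qed

lemma M_harmonic: "harmonic X D (\<lambda>x. K x (Inr w))"
  unfolding harmonic_def
proof (intro conjI allI impI ballI)
  show "(\<lambda>x. K x (Inr w)) \<in> borel_measurable (restrict_space borel D)"
    using K_excessive[OF w(1)] by (simp add: excessive_def)
  show "K x (Inr w) < \<infinity>" if "x \<in> D" for x using M_finite[of x] that by (simp add: M_simps)
  fix U x assume U: "open U \<and> compact (closure U) \<and> closure U \<subseteq> D" and x: "x \<in> U"
  have UD: "U \<subseteq> D" using U closure_subset by blast
  obtain rho where rho: "0 < rho" "rho \<le> R1" "closure U \<inter> cball z0 rho = {}" using compact_far[of "closure U"] U by auto
  have "U \<inter> ball z0 rho = {}" using rho(3) closure_subset ball_subset_cball by blast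
  from M_Hop[OF _ UD this rho(1,2) x] show "K x (Inr w) = expct X x (\<lambda>\<omega>. if exit_time X U \<omega> < lifetime X \<omega>
      then ext0 (\<lambda>x. K x (Inr w)) (killed_path X D (exit_time X U \<omega>) \<omega>) else 0)"
    using U UD x by (subst XP.expct_killed_exit[OF _ x D(1) UD]) (auto simp: M_def[abs_def])
qed

end

section \<open>Minimality of the Martin kernel\<close>

lemma nn_integral_exp_Ici:
  assumes c: "0 < c"
  shows "(\<integral>\<^sup>+t. ennreal (exp (- c * t)) * ind {0..} t \<partial>lborel) = ennreal (1 / c)"
proof -
  have "((\<lambda>t. - exp (- c * t) / c) \<longlongrightarrow> 0) at_top"
    using c by real_asymp
  moreover have "((\<lambda>t. - exp (- c * t) / c) has_real_derivative exp (- c * x)) (at x)" for x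
    using c by (auto intro!: derivative_eq_intros)
  ultimately show ?thesis
    using nn_integral_FTC_atLeast[of "\<lambda>t. exp (- c * t)" 0 "\<lambda>t. - exp (- c * t) / c" 0] by simp
qed

context martin_accessible begin

text \<open>From all points of \<open>Dr (R1 / 2)\<close> jumps into a ball around \<open>x0\<close>
  occur at a rate of at least \<open>\<kappa> / c\<close>. Since the probability of leaving by such
  a jump is at most 1, the mean exit time is at most \<open>c / \<kappa>\<close>.\<close>

lemma exit_time_bound: "\<exists>b<\<infinity>. \<forall>x. XP.Uop (Dr (R1 / 2)) (\<lambda>_. 1) x \<le> b"
proof -
  let ?W = "Dr (R1 / 2)"
  define S where "S = ball x0 (dist z0 x0 - R1)"
  have S: "open S" "x0 \<in> S" "S \<inter> cball z0 R1 = {}"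
  proof -
    have False if "v \<in> S" "v \<in> cball z0 R1" for v
      using that dist_triangle[of z0 x0 v] by (auto simp: S_def dist_commute)
    then show "S \<inter> cball z0 R1 = {}" by blast
  qed (use R1 in \<open>auto simp: S_def\<close>)
  have cl: "closure ?W \<subseteq> cball z0 (R1 / 2)" by (rule closure_minimal) (use Dr_simps(3)[of "R1 / 2"] in auto)
  have Sm [measurable]: "S \<in> sets borel" using S by simp
  define \<kappa> where "\<kappa> = (\<integral>\<^sup>+v. ennreal (j z0 v) * ind S v \<partial>m)"
  have z0S: "z0 \<notin> S" using S(3) R1 by auto
  have "\<kappa> \<noteq> 0"
  proof
    assume "\<kappa> = 0"
    then have "AE v in m. ennreal (j z0 v) * ind S v = 0"
      unfolding \<kappa>_def by (subst (asm) nn_integral_0_iff_AE) simp_all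
    then have "AE v in m. v \<notin> S"
    proof eventually_elim
      fix v assume z: "ennreal (j z0 v) * ind S v = 0"
      show "v \<notin> S"
      proof
        assume "v \<in> S"
        then have "z0 \<noteq> v" using z0S by auto
        then show False using j_pos[of z0 v] z \<open>v \<in> S\<close> by simp
      qed
    qed
    then have "emeasure m S = 0" by (subst (asm) AE_iff_measurable[of S]) (auto simp: XP.sets_m)
    then show False using XP.open_m[OF S(1)] S(2) by auto
  qed
  have bound: "\<kappa> * XP.Uop ?W (\<lambda>_. 1) x \<le> ennreal c" for x
  proof (cases "x \<in> ?W")
    case True
    have "\<kappa> * XP.Uop ?W (\<lambda>_. 1) x = XP.Uop ?W (\<lambda>_. \<kappa>) x" by (simp add: XP.Rop_om)
    also have "\<dots> \<le> XP.Uop ?W (\<lambda>u. ennreal c * (\<integral>\<^sup>+v. ennreal (j u v) * (ind S v * 1) \<partial>m)) x"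
    proof (rule XP.Rop_mono_on)
      fix u assume u: "u \<in> ?W"
      have "\<kappa> \<le> (\<integral>\<^sup>+v. ennreal c * (ennreal (j u v) * (ind S v * 1)) \<partial>m)"
        unfolding \<kappa>_def
      proof (rule nn_integral_mono)
        fix v
        have "ennreal (j z0 v) \<le> ennreal c * ennreal (j u v)" if "v \<in> S"
        proof -
          have "v \<notin> cball z0 R1" using S(3) that by blast
          then have "j z0 v \<le> c * j u v" using C1X[of "R1 / 2" u v] u R1 by (auto simp: Dr_def)
          then show ?thesis using c by (simp add: ennreal_mult'[symmetric] ennreal_leI)
        qed
        then show "ennreal (j z0 v) * ind S v \<le> ennreal c * (ennreal (j u v) * (ind S v * 1))"
          by (simp add: indicator_def)
      qed
      then show "\<kappa> \<le> ennreal c * (\<integral>\<^sup>+v. ennreal (j u v) * (ind S v * 1) \<partial>m)" by (simp add: nn_integral_cmult)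
    qed
    also have "\<dots> = ennreal c * XP.Uop ?W (\<lambda>u. \<integral>\<^sup>+v. ennreal (j u v) * (ind S v * 1) \<partial>m) x"
      by (rule XP.Rop_cmult[OF XP.measurable_jint]) simp
    also have "XP.Uop ?W (\<lambda>u. \<integral>\<^sup>+v. ennreal (j u v) * (ind S v * 1) \<partial>m) x = XP.Hop ?W (\<lambda>v. ind S v * 1) x"
    proof (rule XP.Hop_levy[OF Dr_simps(1) _ True Sm, symmetric])
      show "compact (closure ?W)" by (rule XP.heine_borel[OF bounded_subset[OF bounded_cball cl]]) simp
      show "S \<inter> closure ?W = {}" using cl S(3) R1 by fastforce
    qed simp
    also have "\<dots> \<le> XP.Hop ?W (\<lambda>_. 1) x" by (rule XP.Hop_mono) (simp add: indicator_def)
    also have "\<dots> \<le> 1" using XP.emeasure_hm[of ?W x] by (simp add: XP.Hop_hm)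
    finally show ?thesis by (simp add: mult_left_mono)
  qed (simp add: XP.Rop_outside)
  have "XP.Uop ?W (\<lambda>_. 1) x \<le> ennreal c / \<kappa>" for x
  proof (cases "\<kappa> = \<infinity>")
    case True
    then have "XP.Uop ?W (\<lambda>_. 1) x = 0" using bound[of x] by (auto simp: ennreal_top_mult top_unique split: if_splits)
    then show ?thesis by simp
  next
    case False
    then have "XP.Uop ?W (\<lambda>_. 1) x = \<kappa> * XP.Uop ?W (\<lambda>_. 1) x / \<kappa>"
      using \<open>\<kappa> \<noteq> 0\<close> by (subst mult.commute, intro ennreal_mult_divide_eq[symmetric]) auto
    also have "\<dots> \<le> ennreal c / \<kappa>" by (rule divide_right_mono_ennreal[OF bound])
    finally show ?thesis .
  qed
  moreover have "ennreal c / \<kappa> < \<infinity>" using \<open>\<kappa> \<noteq> 0\<close> by (simp add: less_top[symmetric] ennreal_divide_eq_top_iff)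
  ultimately show ?thesis by blast
qed

text \<open>Dynkin's formula at the exit from \<open>Dr (R1 / 2)\<close>: up to the exit the mean
  exit time bounds the potential, after it the assumed bound on the Green function does. This
  provides the finite potential against which harmonic functions are truncated.\<close>

lemma U_Dr_finite: "XP.Uop D (ind (Dr (R1 / 4))) x < \<infinity>"
proof -
  let ?phi = "ind (Dr (R1 / 4)) :: 'a \<Rightarrow> ennreal"
  have phi [measurable]: "?phi \<in> bfun" using Dr_simps(1) by simp
  obtain b1 where b1: "b1 < \<infinity>" "\<And>x. XP.Uop (Dr (R1 / 2)) (\<lambda>_. 1) x \<le> b1" using exit_time_bound by blast
  obtain b2 where b2: "b2 < \<infinity>" "\<And>v y. y \<in> Dr (R1 / 2 / 2) \<Longrightarrow> v \<notin> ball z0 (R1 / 2) \<Longrightarrow> G v y \<le> b2"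
    using bnd[of "R1 / 2"] R1 by auto
  define b3 where "b3 = b2 * emeasure m (Dr (R1 / 4))"
  have "emeasure m (Dr (R1 / 4)) \<le> emeasure m (ball z0 (R1 / 4))"
    by (rule emeasure_mono) (use Dr_simps(3) in \<open>auto simp: XP.sets_m\<close>)
  then have b3: "b3 < \<infinity>" using b2(1) XP.emeasure_ball(2)[of "R1 / 4" z0] R1 by (auto simp: b3_def ennreal_mult_less_top intro: le_less_trans)
  have far: "XP.Uop D ?phi v \<le> b3" if v: "v \<notin> Dr (R1 / 2)" for v
  proof (cases "v \<in> D")
    case True
    have "XP.Uop D ?phi v = (\<integral>\<^sup>+y. G v y * ?phi y \<partial>m)" by (rule XUop[OF phi])
    also have "\<dots> \<le> (\<integral>\<^sup>+y. b2 * ind (Dr (R1 / 4)) y \<partial>m)"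
      using b2(2)[of _ v] v True by (intro nn_integral_mono) (auto simp: indicator_def Dr_def)
    also have "\<dots> = b3" unfolding b3_def using Dr_simps(1) by (intro nn_integral_cmult_indicator) (simp add: XP.sets_m)
    finally show ?thesis .
  qed (simp add: XP.Rop_outside)
  have "XP.Uop D ?phi x = XP.Uop (Dr (R1 / 2)) ?phi x + XP.Hop (Dr (R1 / 2)) (XP.Uop D ?phi) x"
    by (rule XP.Uop_split[OF D(1) Dr_simps(1,2) phi])
  also have "\<dots> \<le> b1 + b3"
  proof (rule add_mono)
    have "XP.Uop (Dr (R1 / 2)) ?phi x \<le> XP.Uop (Dr (R1 / 2)) (\<lambda>_. 1) x" by (rule XP.Rop_mono_on) (simp add: indicator_def)
    then show "XP.Uop (Dr (R1 / 2)) ?phi x \<le> b1" using b1(2) by (rule order_trans)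
    have "XP.Hop (Dr (R1 / 2)) (XP.Uop D ?phi) x = XP.Hop (Dr (R1 / 2)) (\<lambda>v. if v \<in> Dr (R1 / 2) then 0 else XP.Uop D ?phi v) x"
      by (rule XP.Hop_outside_cong[OF Dr_simps(1)]) simp
    also have "\<dots> \<le> XP.Hop (Dr (R1 / 2)) (\<lambda>_. b3) x" using far by (intro XP.Hop_mono) auto
    also have "\<dots> \<le> b3" using mult_left_mono[OF XP.emeasure_hm[of "Dr (R1 / 2)" x], of b3] by (simp add: XP.Hop_hm)
    finally show "XP.Hop (Dr (R1 / 2)) (XP.Uop D ?phi) x \<le> b3" .
  qed
  also have "\<dots> < \<infinity>" using b1(1) b3 by simp
  finally show ?thesis .
qed

text \<open>\<open>h \<le> M\<close> and the finiteness of the exit integral of \<open>h\<close>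
  make the truncated subtraction of extended numbers exact.\<close>

lemma harmonic_diff:
  assumes h: "harmonic X D h" and le: "\<And>x. x \<in> D \<Longrightarrow> h x \<le> M x"
  shows "harmonic X D (\<lambda>x. M x - h x)"
  unfolding harmonic_def
proof (intro conjI allI impI ballI)
  note [measurable] = XP.harmonic_measurable[OF h D(1)]
  have "h \<in> borel_measurable (restrict_space borel D)" using h by (simp add: harmonic_def)
  moreover have "M \<in> borel_measurable (restrict_space borel D)" by (rule measurable_restrict_space1) measurable
  ultimately show "(\<lambda>x. M x - h x) \<in> borel_measurable (restrict_space borel D)" by measurable
  show "M x - h x < \<infinity>" for x using M_finite[of x] by (simp add: less_top[symmetric])
  fix U x assume U: "open U \<and> compact (closure U) \<and> closure U \<subseteq> D" and x: "x \<in> U"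
  have UD: "U \<subseteq> D" using U closure_subset by blast
  let ?h = "\<lambda>y. h y * ind D y"
  have hx: "h x = XP.Hop U ?h x" using XP.harmonic_Hop[OF h D(1)] U x by blast
  have Mx: "M x = XP.Hop U M x"
    using XP.harmonic_Hop[OF M_harmonic D(1), of U x] U x UD by (auto simp: M_def[abs_def])
  have hle: "?h y \<le> M y" for y using le[of y] by (cases "y \<in> D") auto
  have "h x < \<infinity>" using h x UD by (auto simp: harmonic_def)
  then have "XP.Hop U M x - XP.Hop U ?h x = (\<integral>\<^sup>+y. M y - ?h y \<partial>XP.hm U x)"
    using hx hle by (simp add: XP.Hop_hm nn_integral_diff)
  also have "\<dots> = XP.Hop U (\<lambda>y. (M y - h y) * ind D y) x"
  proof -
    have eq: "(\<lambda>y. (M y - h y) * ind D y) = (\<lambda>y. M y - ?h y)" by (auto simp: fun_eq_iff indicator_def M_simps)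
    show ?thesis unfolding eq by (rule XP.Hop_hm[symmetric]) simp
  qed
  finally have "M x - h x = XP.Hop U (\<lambda>y. (M y - h y) * ind D y) x" unfolding hx[symmetric] Mx[symmetric] .
  also have "\<dots> = expct X x (\<lambda>\<omega>. if exit_time X U \<omega> < lifetime X \<omega>
      then ext0 (\<lambda>x. M x - h x) (killed_path X D (exit_time X U \<omega>) \<omega>) else 0)"
    by (rule XP.expct_killed_exit[OF _ x D(1) UD, symmetric]) (use U in simp)
  finally show "M x - h x = expct X x (\<lambda>\<omega>. if exit_time X U \<omega> < lifetime X \<omega>
      then ext0 (\<lambda>x. M x - h x) (killed_path X D (exit_time X U \<omega>) \<omega>) else 0)" .
qed

text \<open>Neither \<open>h\<close> nor \<open>M - h\<close> can gain on leaving
  \<open>D - cball z0 s\<close>, and their sum \<open>M\<close> loses nothing by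
  \<open>M_Hop\<close>; so \<open>h\<close> loses nothing either.\<close>

lemma harmonic_Hop_far:
  assumes h: "harmonic X D h" and le: "\<And>x. x \<in> D \<Longrightarrow> h x \<le> M x" and s: "0 < s" "s \<le> R1" and x: "x \<in> D - cball z0 s"
  shows "XP.Hop (D - cball z0 s) (\<lambda>y. h y * ind D y) x = h x"
proof -
  let ?V = "D - cball z0 s" and ?h = "\<lambda>y. h y * ind D y" and ?k = "\<lambda>y. (M y - h y) * ind D y"
  have V: "open ?V" "?V \<subseteq> D" "?V \<inter> ball z0 s = {}" using D by (auto simp: open_Diff)
  note hd = harmonic_diff[OF h le]
  note [measurable] = XP.harmonic_measurable[OF h D(1)] XP.harmonic_measurable[OF hd D(1)]
  have eq: "M = (\<lambda>y. ?h y + ?k y)"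
    using le by (auto simp: fun_eq_iff indicator_def M_simps add_diff_inverse_ennreal)
  have "M x = XP.Hop ?V M x" by (rule M_Hop[OF V s x, symmetric])
  also have "\<dots> = XP.Hop ?V ?h x + XP.Hop ?V ?k x" by (subst eq) (simp add: XP.Hop_hm nn_integral_add)
  finally have sum: "M x = XP.Hop ?V ?h x + XP.Hop ?V ?k x" .
  have b: "XP.Hop ?V ?h x \<le> h x" "XP.Hop ?V ?k x \<le> M x - h x"
    by (rule XP.harmonic_Hop_le[OF h D(1) V(1,2) x], rule XP.harmonic_Hop_le[OF hd D(1) V(1,2) x])
  have "h x + (M x - h x) = M x" using le x by (intro add_diff_inverse_ennreal) auto
  also note sum
  also have "XP.Hop ?V ?h x + XP.Hop ?V ?k x \<le> XP.Hop ?V ?h x + (M x - h x)" by (rule add_left_mono[OF b(2)])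
  finally have "h x + (M x - h x) \<le> XP.Hop ?V ?h x + (M x - h x)" .
  moreover have "M x - h x \<noteq> \<infinity>" using M_finite[of x] by (simp add: less_top[symmetric])
  ultimately have "h x \<le> XP.Hop ?V ?h x" by (simp add: ennreal_add_left_cancel_le add.commute[of _ "M x - h x"])
  then show ?thesis using b(1) by (rule antisym[rotated])
qed

text \<open>A neighbourhood version of \<open>M_limit\<close>: its failure would produce a sequence
  tending to \<open>z0\<close> along which the quotients stay above
  \<open>M x + eps\<close>.\<close>

lemma kernel_near:
  assumes eps: "0 < (eps::real)"
  shows "\<exists>r>0. \<forall>y\<in>Dr r. G x y \<le> (M x + ennreal eps) * G x0 y"
proof (rule ccontr)
  assume neg: "\<not> ?thesis"
  have "\<exists>y. y \<in> Dr (min (R1 / 8) (rn n)) \<and> (M x + ennreal eps) * G x0 y < G x y" for n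
  proof -
    have "0 < min (R1 / 8) (rn n)" using R1 by simp
    then have "\<exists>y\<in>Dr (min (R1 / 8) (rn n)). \<not> G x y \<le> (M x + ennreal eps) * G x0 y" using neg by blast
    then show ?thesis unfolding not_le by blast
  qed
  then obtain y where y: "\<And>n. y n \<in> Dr (min (R1 / 8) (rn n))" "\<And>n. (M x + ennreal eps) * G x0 (y n) < G x (y n)" by metis
  note yD = LIMSEQ_Dr(1)[OF y(1)] and yz = LIMSEQ_Dr(2)[OF y(1)]
  have "M x + ennreal eps \<le> G x (y n) / G x0 (y n)" for n
  proof -
    have "y n \<in> Dr (R1 / 8)" using y(1)[of n] by (auto simp: Dr_def)
    note g = G_x0_pos[OF this]
    have "M x + ennreal eps = (M x + ennreal eps) * G x0 (y n) / G x0 (y n)" using g by (intro ennreal_mult_divide_eq[symmetric]) auto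
    also have "\<dots> \<le> G x (y n) / G x0 (y n)" by (rule divide_right_mono_ennreal) (use y(2)[of n] in simp)
    finally show ?thesis .
  qed
  then have "M x + ennreal eps \<le> M x" by (intro LIMSEQ_le_const[OF M_limit[OF yD yz]]) blast
  moreover have "M x < M x + ennreal eps"
    using M_finite[of x] eps ennreal_add_left_cancel_less[of "M x" 0 "ennreal eps"] by simp
  ultimately show False by simp
qed

text \<open>On leaving \<open>D - cball z0 s\<close> within \<open>D\<close> the process is in
  \<open>Dr r\<close>, so \<open>h x\<close> is recovered from approximations of \<open>h\<close>
  there. Truncations of each approximation are bounded by potentials of charges on
  \<open>Dr r\<close>, for which \<open>kernel_near\<close> compares the values at \<open>x\<close>
  and at \<open>x0\<close>; at \<open>x0\<close> these potentials are at most
  \<open>h x0\<close>.\<close>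

lemma harmonic_le_kernel:
  assumes h: "harmonic X D h" and le: "\<And>x. x \<in> D \<Longrightarrow> h x \<le> M x" and x: "x \<in> D"
  shows "h x \<le> M x * h x0"
proof (rule ennreal_le_epsilon)
  fix eps :: real assume eps: "0 < eps"
  obtain r where r: "0 < r" "\<And>y. y \<in> Dr r \<Longrightarrow> G x y \<le> (M x + ennreal eps) * G x0 y" using kernel_near[OF eps] by blast
  have "0 < dist z0 x" using x z0_notin by auto
  define s where "s = min (min (r / 2) (dist z0 x / 2)) R1"
  have s: "0 < s" "s \<le> R1" "s < r" "x \<in> D - cball z0 s" using r \<open>0 < dist z0 x\<close> R1 x by (auto simp: s_def)
  let ?V = "D - cball z0 s" and ?A = "Dr r" and ?h = "\<lambda>y. h y * ind D y"
  have V: "open ?V" "?V \<subseteq> D" using D by (auto simp: open_Diff)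
  note hm [measurable] = XP.harmonic_measurable[OF h D(1)]
  have Am [measurable]: "?A \<in> sets borel" using Dr_simps(1) by simp
  define phi where "phi = (ind (Dr (R1 / 4)) :: 'a \<Rightarrow> ennreal)"
  have phim [measurable]: "phi \<in> bfun" unfolding phi_def using Dr_simps(1) by simp
  define U where "U = XP.Uop D phi"
  have Um [measurable]: "U \<in> bfun" unfolding U_def by measurable
  have Ufin: "U y < \<infinity>" for y unfolding U_def phi_def by (rule U_Dr_finite)
  have Upos: "0 < U y" if "y \<in> D" for y
    using Green_mass_pos[OF that, of "Dr (R1 / 4)"] Dr_simps[of "R1 / 4"] Dr_nonempty[of "R1 / 4"] R1
    unfolding U_def XUop[OF phim] by (simp add: phi_def)
  \<comment> \<open>\<open>charge_exists\<close> asks for domination by a finite potential, which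
    \<open>h\<close> itself may lack; the truncations increase to \<open>h\<close> because
    \<open>U\<close> is positive on \<open>D\<close>.\<close>
  define u where "u k y = min (?h y) (of_nat k * U y)" for k y
  have um [measurable]: "u k \<in> bfun" for k unfolding u_def by measurable
  have nR_h: "ennreal (real n) * XP.Rop D (real n) ?h y \<le> ?h y" if n: "0 < n" for n :: nat and y
  proof (cases "y \<in> D")
    case True
    have "XP.Rop D (real n) ?h y \<le> (\<integral>\<^sup>+t. ind {0..} t * (ennreal (exp (- real n * t)) * h y) \<partial>lborel)"
      unfolding XP.Rop_Pop[OF hm] by (intro nn_integral_mono mult_left_mono XP.harmonic_Pop_le[OF h D(1) True]) auto
    also have "\<dots> = (\<integral>\<^sup>+t. ennreal (exp (- real n * t)) * ind {0..} t \<partial>lborel) * h y"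
      by (subst nn_integral_multc[symmetric]) (auto simp: mult_ac intro!: nn_integral_cong)
    also have "(\<integral>\<^sup>+t. ennreal (exp (- real n * t)) * ind {0..} t \<partial>lborel) = ennreal (1 / real n)"
      using nn_integral_exp_Ici[of "real n"] n by simp
    finally have "ennreal (real n) * XP.Rop D (real n) ?h y \<le> ennreal (real n) * (ennreal (1 / real n) * h y)" by (rule mult_left_mono) simp
    also have "\<dots> = h y" using n by (simp add: mult.assoc[symmetric] ennreal_mult[symmetric])
    finally show ?thesis using True by simp
  qed (simp add: XP.Rop_outside)
  have nR_U: "ennreal (real n) * XP.Rop D (real n) U y \<le> U y" if "0 < n" for n :: nat and y
    using XP.resolvent_equation[OF phim, of 0 "real n" D y] that by (simp add: U_def)
  have nR_u: "ennreal (real n) * XP.Rop D (real n) (u k) y \<le> u k y" if n: "0 < n" for n k :: nat and y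
    unfolding u_def
  proof (rule min.boundedI)
    have "ennreal (real n) * XP.Rop D (real n) (\<lambda>y. min (?h y) (of_nat k * U y)) y \<le> ennreal (real n) * XP.Rop D (real n) ?h y"
      by (intro mult_left_mono XP.Rop_mono_on) auto
    then show "ennreal (real n) * XP.Rop D (real n) (\<lambda>y. min (?h y) (of_nat k * U y)) y \<le> ?h y"
      using nR_h[OF n] by (rule order_trans)
    have "ennreal (real n) * XP.Rop D (real n) (\<lambda>y. min (?h y) (of_nat k * U y)) y \<le> ennreal (real n) * XP.Rop D (real n) (\<lambda>y. of_nat k * U y) y"
      by (intro mult_left_mono XP.Rop_mono_on) auto
    also have "\<dots> = of_nat k * (ennreal (real n) * XP.Rop D (real n) U y)" by (simp add: XP.Rop_cmult mult.left_commute)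
    also have "\<dots> \<le> of_nat k * U y" by (intro mult_left_mono nR_U n) simp
    finally show "ennreal (real n) * XP.Rop D (real n) (\<lambda>y. min (?h y) (of_nat k * U y)) y \<le> of_nat k * U y" .
  qed
  let ?N = "\<lambda>n f y. ennreal (real n) * XP.Rop D (real n) (\<lambda>v. ind ?A v * f v) y"
  have step: "XP.Hop ?V (?N n (u k)) x \<le> (M x + ennreal eps) * h x0" if n: "0 < n" for n k :: nat
  proof -
    obtain e where e: "e \<in> bfun" "\<And>y. y \<notin> ?A \<Longrightarrow> e y = 0"
      "\<And>y. ?N n (u k) y \<le> XP.Uop D e y" "\<And>y. XP.Uop D e y \<le> u k y"
    proof -
      have "u k y \<le> of_nat k * XP.Uop D phi y" for y by (simp add: u_def U_def)
      moreover have "0 < real n" "of_nat k < (\<infinity> :: ennreal)" using n of_nat_less_top by simp_all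
      ultimately show thesis
        using XP.charge_exists[OF um phim Am _ nR_u[OF n] _ Ufin[unfolded U_def]] that by blast
    qed
    note [measurable] = e(1)
    have "XP.Hop ?V (?N n (u k)) x \<le> XP.Hop ?V (XP.Uop D e) x" by (rule XP.Hop_mono) (rule e(3))
    also have "\<dots> \<le> XP.Uop D e x" using XP.Uop_split[OF D(1) V e(1), of x] by simp
    also have "\<dots> = (\<integral>\<^sup>+y. G x y * e y \<partial>m)" by (rule XUop[OF e(1)])
    also have "\<dots> \<le> (\<integral>\<^sup>+y. (M x + ennreal eps) * (G x0 y * e y) \<partial>m)"
    proof (rule nn_integral_mono)
      fix y show "G x y * e y \<le> (M x + ennreal eps) * (G x0 y * e y)"
        using mult_right_mono[OF r(2)[of y], of "e y"] e(2)[of y] by (cases "y \<in> ?A") (auto simp: mult.assoc)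
    qed
    also have "\<dots> = (M x + ennreal eps) * XP.Uop D e x0" unfolding XUop[OF e(1)] by (rule nn_integral_cmult) simp
    also have "\<dots> \<le> (M x + ennreal eps) * h x0"
      using e(4)[of x0] D(2) by (intro mult_left_mono) (auto simp: u_def intro: order_trans)
    finally show ?thesis .
  qed
  have u_SUP: "(SUP k. u k y) = ?h y" for y
  proof (cases "y \<in> D")
    case True
    define a b where "a = enn2real (h y)" and "b = enn2real (U y)"
    have hfin: "h y < \<infinity>" using h True by (auto simp: harmonic_def)
    then have a: "h y = ennreal a" by (simp add: a_def less_top[symmetric])
    have b: "U y = ennreal b" "0 < b" using Ufin[of y] Upos[OF True] by (auto simp: b_def less_top[symmetric] enn2real_positive_iff)
    obtain k where "a / b \<le> real k" using real_arch_simple by blast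
    then have "a \<le> real k * b" using b(2) by (simp add: field_simps)
    then have "h y \<le> of_nat k * U y" unfolding a b(1) by (simp add: ennreal_of_nat_eq_real_of_nat ennreal_mult'[symmetric] ennreal_leI)
    then have "u k y = ?h y" using True by (simp add: u_def min_absorb1)
    then show ?thesis by (intro antisym SUP_least SUP_upper2[of k]) (auto simp: u_def)
  qed (simp add: u_def)
  have step2: "XP.Hop ?V (?N n ?h) x \<le> (M x + ennreal eps) * h x0" if n: "0 < n" for n :: nat
  proof -
    have u_Suc: "u k v \<le> u (Suc k) v" for k v
      unfolding u_def by (intro min.mono order_refl mult_right_mono) simp_all
    have inc: "incseq (\<lambda>k v. ind ?A v * u k v)" by (intro incseq_SucI le_funI mult_left_mono u_Suc) simp
    have mm: "(\<lambda>v. ind ?A v * u k v) \<in> bfun" for k by measurable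
    have "?N n ?h y = (SUP k. ?N n (u k) y)" for y
      unfolding u_SUP[symmetric] SUP_mult_left_ennreal XP.Rop_SUP[OF inc mm] ..
    then have "XP.Hop ?V (?N n ?h) x = XP.Hop ?V (\<lambda>y. SUP k. ?N n (u k) y) x" by simp
    also have "\<dots> = (SUP k. XP.Hop ?V (?N n (u k)) x)"
    proof (rule XP.Hop_SUP)
      show "incseq (\<lambda>k y. ?N n (u k) y)"
        by (intro incseq_SucI le_funI mult_left_mono XP.Rop_mono_on u_Suc) simp_all
      show "(\<lambda>y. ?N n (u k) y) \<in> bfun" for k using mm[of k] by measurable
    qed
    also have "\<dots> \<le> (M x + ennreal eps) * h x0" using step[OF n] by (rule SUP_least)
    finally show ?thesis .
  qed
  have Nm [measurable]: "(\<lambda>y. ?N n ?h y) \<in> bfun" for n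
  proof -
    have "(\<lambda>v. ind ?A v * ?h v) \<in> bfun" by measurable
    then show ?thesis by measurable
  qed
  have hA: "(\<lambda>v. ind ?A v * ?h v) = (\<lambda>v. h v * ind ?A v)"
    using Dr_simps(2)[of r] by (auto simp: fun_eq_iff indicator_def)
  have "h x = XP.Hop ?V ?h x" by (rule harmonic_Hop_far[OF h le s(1,2,4), symmetric])
  also have "\<dots> = XP.Hop ?V (\<lambda>y. ind (- ?V) y * ?h y) x" by (rule XP.Hop_outside_cong[OF V(1)]) auto
  also have "\<dots> \<le> XP.Hop ?V (\<lambda>y. liminf (\<lambda>n. ?N n ?h y)) x"
  proof (rule XP.Hop_mono)
    fix y
    consider "y \<in> ?V" | "y \<notin> D" | "y \<in> ?A"
      using s(3) by (cases "dist z0 y \<le> s") (auto simp: Dr_def)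
    then show "ind (- ?V) y * ?h y \<le> liminf (\<lambda>n. ?N n ?h y)"
    proof cases
      case 3
      have "ind (- ?V) y * ?h y \<le> h y" by (simp add: indicator_def)
      also have "\<dots> \<le> liminf (\<lambda>n. ?N n ?h y)"
        unfolding hA by (rule XP.harmonic_resolvent_liminf[OF h D(1) Dr_simps(1,2) 3])
      finally show ?thesis .
    qed simp_all
  qed
  also have "\<dots> \<le> liminf (\<lambda>n. XP.Hop ?V (?N n ?h) x)"
  proof -
    have "(\<lambda>y. liminf (\<lambda>n. ?N n ?h y)) \<in> bfun" by measurable
    then show ?thesis unfolding XP.Hop_hm[OF Nm] by (subst XP.Hop_hm) (auto intro!: nn_integral_liminf)
  qed
  also have "\<dots> \<le> (M x + ennreal eps) * h x0"
  proof (rule Liminf_le)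
    show "\<forall>\<^sub>F n in sequentially. XP.Hop ?V (?N n ?h) x \<le> (M x + ennreal eps) * h x0"
      by (rule eventually_mono[OF eventually_gt_at_top[of 0]]) (rule step2)
  qed simp
  \<comment> \<open>Here \<open>h x0 \<le> M x0 = 1\<close> absorbs the factor of
    \<open>eps\<close>.\<close>
  also have "\<dots> \<le> M x * h x0 + ennreal eps"
    using mult_left_mono[of "h x0" 1 "ennreal eps"] le[OF D(2)] M_x0 by (simp add: distrib_right add_left_mono)
  finally show "h x \<le> M x * h x0 + ennreal eps" .
qed

lemma M_minimal: "minimal_harmonic X D (\<lambda>x. K x (Inr w))"
  unfolding minimal_harmonic_def
proof (intro conjI allI impI M_harmonic)
  fix g assume g: "harmonic X D g \<and> (\<forall>x\<in>D. g x \<le> K x (Inr w))"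
  then have le: "\<And>x. x \<in> D \<Longrightarrow> g x \<le> M x" by (simp add: M_simps)
  \<comment> \<open>The factor has to be the value at \<open>x0\<close>, where \<open>M\<close> is
    1.\<close>
  define a where "a = enn2real (g x0)"
  have g0: "g x0 \<le> 1" using le[OF D(2)] M_x0 by simp
  moreover have "g x0 < \<infinity>" using g0 by (rule le_less_trans) simp
  ultimately have a: "g x0 = ennreal a" "0 \<le> a" "a \<le> 1"
    by (simp_all add: a_def less_top[symmetric] enn2real_leI)
  have "g x = ennreal a * K x (Inr w)" if x: "x \<in> D" for x
  proof -
    define \<mu> b where "\<mu> = enn2real (M x)" and "b = enn2real (g x)"
    have \<mu>: "M x = ennreal \<mu>" "0 \<le> \<mu>" using M_finite[of x] by (simp_all add: \<mu>_def less_top[symmetric])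
    have "g x < \<infinity>" using le[OF x] M_finite[of x] by (rule le_less_trans)
    then have b: "g x = ennreal b" "0 \<le> b" by (simp_all add: b_def less_top[symmetric])
    have "b \<le> \<mu>" using le[OF x] \<mu> b by simp
    have 1: "b \<le> \<mu> * a"
      using harmonic_le_kernel[OF conjunct1[OF g] le x] \<mu> b a by (simp add: ennreal_mult[symmetric])
    have "M x - g x \<le> M x * (M x0 - g x0)"
      by (rule harmonic_le_kernel[OF harmonic_diff[OF conjunct1[OF g] le] _ x]) (auto simp: diff_le_self_ennreal)
    then have "ennreal (\<mu> - b) \<le> ennreal (\<mu> * (1 - a))"
      unfolding M_x0 \<mu>(1) b(1) a(1) using \<mu>(2) b(2) a(2,3) by (simp add: ennreal_minus ennreal_mult[symmetric] ennreal_1[symmetric] del: ennreal_1)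
    then have "\<mu> - b \<le> \<mu> * (1 - a)" using \<mu> a by (simp add: ennreal_le_iff)
    then have "b = a * \<mu>" using 1 by (simp add: algebra_simps)
    then show ?thesis using x b(1) \<mu> a by (simp add: ennreal_mult M_simps)
  qed
  then show "\<exists>c. 0 \<le> c \<and> (\<forall>x\<in>D. g x = ennreal c * K x (Inr w))" using a(2) by blast
qed

end

section \<open>Reduction of the stated conditions to the setting at one radius\<close>

lemma E1_bounds:
  assumes E1: "E1 j z0 R" and pos: "\<And>x y. x \<noteq> y \<Longrightarrow> 0 < j x y" and q: "0 < q" "ereal q < R" and eta: "1 < (eta::real)"
  shows "\<exists>\<delta>>0. \<forall>u v. dist z0 u < \<delta> \<and> u \<noteq> z0 \<and> q < dist z0 v \<longrightarrow> j v u \<le> eta * j v z0 \<and> j v z0 \<le> eta * j v u"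
proof -
  let ?Z = "{z. q < dist z0 z}"
  have "((\<lambda>y. SUP z\<in>?Z. ereal (j z z0 / j z y)) \<longlongrightarrow> 1) (at z0)" "((\<lambda>y. INF z\<in>?Z. ereal (j z z0 / j z y)) \<longlongrightarrow> 1) (at z0)"
    using E1 q unfolding E1_def by blast+
  then have "eventually (\<lambda>y. (SUP z\<in>?Z. ereal (j z z0 / j z y)) < ereal eta) (at z0)"
    "eventually (\<lambda>y. ereal (1 / eta) < (INF z\<in>?Z. ereal (j z z0 / j z y))) (at z0)"
    using eta by (auto intro: order_tendstoD simp: one_ereal_def)
  then have "eventually (\<lambda>y. (SUP z\<in>?Z. ereal (j z z0 / j z y)) < ereal eta \<and> ereal (1 / eta) < (INF z\<in>?Z. ereal (j z z0 / j z y))) (at z0)"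
    by (rule eventually_conj)
  then obtain d where d: "0 < d" "\<And>y. y \<noteq> z0 \<Longrightarrow> dist y z0 < d \<Longrightarrow>
      (SUP z\<in>?Z. ereal (j z z0 / j z y)) < ereal eta \<and> ereal (1 / eta) < (INF z\<in>?Z. ereal (j z z0 / j z y))"
    by (auto simp: eventually_at)
  show ?thesis
  \<comment> \<open>The minimum with \<open>q\<close> keeps \<open>u\<close> closer to
    \<open>z0\<close> than \<open>v\<close>, so the two points differ and the densities are
    positive.\<close>
  proof (intro exI[of _ "min d q"] conjI allI impI)
    show "0 < min d q" using d q by simp
    fix u v assume uv: "dist z0 u < min d q \<and> u \<noteq> z0 \<and> q < dist z0 v"
    then have vZ: "v \<in> ?Z" and "v \<noteq> u" "v \<noteq> z0" using q by auto
    note j = pos[OF this(2)] pos[OF this(3)]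
    have "ereal (j v z0 / j v u) \<le> (SUP z\<in>?Z. ereal (j z z0 / j z u))" by (rule SUP_upper[OF vZ])
    also have "\<dots> < ereal eta" using d(2)[of u] uv by (simp add: dist_commute)
    finally show "j v z0 \<le> eta * j v u" using j by (simp add: field_simps)
    have "ereal (1 / eta) < (INF z\<in>?Z. ereal (j z z0 / j z u))" using d(2)[of u] uv by (simp add: dist_commute)
    also have "\<dots> \<le> ereal (j v z0 / j v u)" by (rule INF_lower[OF vZ])
    finally show "j v u \<le> eta * j v z0" using j eta by (simp add: field_simps)
  qed
qed

theorem theorem1p2:
  fixes m :: "'a::{metric_space, second_countable_topology} measure"
    and X :: "('w, 'a) proc" and Xh :: "('v, 'a) proc"
    and j jh :: "'a \<Rightarrow> 'a \<Rightarrow> real"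
    and R0 R :: ereal
    and D :: "'a set" and z0 x0 :: 'a
    and G :: "'a \<Rightarrow> 'a \<Rightarrow> ennreal"
    and \<T> :: "('a + 'b) topology" and B :: "'b set" and K :: "'a \<Rightarrow> 'a + 'b \<Rightarrow> ennreal"
  assumes setting: "dual_setting m X Xh j jh R0"
    and D: "open D"
    and green: "green_function m X D G" "green_function m Xh D (\<lambda>x y. G y x)"
    and greenian: "greenian G"
    and martin: "x0 \<in> D" "martin_space X D G x0 \<T> B K"
    and z0: "z0 \<in> frontier D"
    and R: "0 < R" "R \<le> R0"
    and C1: "C1 j jh z0 R"
    and E1: "E1 j z0 R"
    and F1h: "F1 m Xh jh z0 R"
  shows "(\<exists>!w. w \<in> B \<and> martin_associated D \<T> w z0) \<and>
    (cond_G X D G \<and>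
     F1 m X j z0 R \<and>
     (\<forall>r. 0 < r \<and> ereal r \<le> R \<longrightarrow>
        (SUP x\<in>D \<inter> ball z0 (r / 2). SUP y\<in>- ball z0 r. max (G x y) (G y x)) < \<infinity>) \<and>
     (\<not> bounded D \<longrightarrow> (\<forall>r. 0 < r \<and> ereal r \<le> R \<longrightarrow> (\<forall>y\<in>D \<inter> ball z0 r.
        ((\<lambda>x. G x y) \<longlongrightarrow> 0) (filtercomap (\<lambda>x. dist z0 x) at_top)))) \<longrightarrow>
     (\<forall>w\<in>B. martin_associated D \<T> w z0 \<longrightarrow>
        (martin_minimal X D K w \<longleftrightarrow> accessible m j D G z0)))"
proof -
  let ?s = "\<lambda>r. SUP x\<in>D \<inter> ball z0 (r / 2). SUP y\<in>- ball z0 r. max (G x y) (G y x)"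
  interpret S: dual_setting m X Xh j jh R0 by (rule setting)
  have mms: "sets m = sets borel" "\<And>K. compact K \<Longrightarrow> emeasure m K < \<infinity>" "\<And>U. open U \<Longrightarrow> U \<noteq> {} \<Longrightarrow> 0 < emeasure m U"
    "\<And>S :: 'a set. bounded S \<Longrightarrow> closed S \<Longrightarrow> compact S"
    using S.mms unfolding metric_measure_space_def by blast+
  interpret XP: levy_proc "TYPE('a)" X m j
    by unfold_locales (use mms S.hunt S.levy S.j_measurable in auto)
  interpret YP: levy_proc "TYPE('a)" Xh m jh
    by unfold_locales (use mms S.hunt S.levy S.j_measurable in auto)
  have z0D: "z0 \<notin> D" using D z0 by (simp add: frontier_def interior_open)
  obtain r0 where r0: "0 < ereal r0" "ereal r0 < R" using ereal_dense2[OF R(1)] by auto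
  \<comment> \<open>At most \<open>r0 < R\<close>, because C1, E1 and F1 speak of radii strictly
    less than \<open>R\<close>, and at most half the distance to \<open>x0\<close>, so that
    \<open>x0\<close> stays outside the closed ball.\<close>
  define R1 where "R1 = min r0 (dist z0 x0 / 2)"
  have R1: "0 < R1" "R1 < dist z0 x0" "ereal R1 < R"
  proof -
    have "0 < dist z0 x0" using z0D martin(1) by auto
    moreover have "R1 \<le> dist z0 x0 / 2" unfolding R1_def by (rule min.cobounded2)
    ultimately show "R1 < dist z0 x0" by linarith
    show "0 < R1" using r0 \<open>0 < dist z0 x0\<close> by (simp add: R1_def)
    have "ereal R1 \<le> ereal r0" by (simp add: R1_def)
    then show "ereal R1 < R" using r0(2) by (rule le_less_trans)
  qed
  have le_R: "ereal r < R" if "r \<le> R1" for r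
    by (rule le_less_trans[OF _ R1(3)]) (use that in simp)
  obtain C where C: "1 \<le> C" "F1_const m Xh jh z0 R1 C" using F1_const_exists[OF F1h R1(3)] by blast
  obtain c where c: "\<And>r1 r2. 0 < r1 \<Longrightarrow> r1 < r2 \<Longrightarrow> ereal r2 < R \<Longrightarrow> 0 < c (r2 / r1) \<and>
     (\<forall>x\<in>ball z0 r1. \<forall>y\<in>- ball z0 r2.
        inverse (c (r2 / r1)) * j z0 y \<le> j x y \<and> j x y \<le> c (r2 / r1) * j z0 y \<and>
        inverse (c (r2 / r1)) * jh z0 y \<le> jh x y \<and> jh x y \<le> c (r2 / r1) * jh z0 y)"
    using C1 unfolding C1_def by blast
  \<comment> \<open>The constant of C1 depends on the ratio of the radii, which is always 2 here;
    one number \<open>c 2\<close> serves all scales.\<close>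
  have c2: "0 < c 2" using c[of "R1 / 4" "R1 / 2"] R1 le_R[of "R1 / 2"] by simp
  have C1': "inverse (c 2) * j z0 y \<le> j x y \<and> inverse (c 2) * jh z0 y \<le> jh x y \<and> jh x y \<le> c 2 * jh z0 y"
    if "0 < r" "2 * r \<le> R1" "x \<in> ball z0 r" "y \<notin> ball z0 (2 * r)" for r x y
    using c[of r "2 * r"] that le_R[of "2 * r"] by auto
  note g = green[unfolded green_function_def]
  have goff: "G x y = 0" if "x \<notin> D \<or> y \<notin> D" for x y using g(1) that by blast
  interpret MS: martin_setup "TYPE('a)" X Xh m j jh D G z0 x0 R1 C "c 2"
  proof unfold_locales
    show "(\<lambda>(x, y). G x y) \<in> borel_measurable (borel \<Otimes>\<^sub>M borel)" using g(1) by blast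
    show "G x y < \<infinity>" if "x \<noteq> y" for x y using greenian that unfolding greenian_def by blast
    show "XP.Uop D f x = (\<integral>\<^sup>+y. G x y * f y \<partial>m)" if f: "f \<in> bfun" and x: "x \<in> D" for f x
    proof -
      have "XP.Uop D f x = (\<integral>\<^sup>+y\<in>D. G x y * f y \<partial>m)"
        using g(1) f x unfolding XP.expct_occupation[OF D x, symmetric] by blast
      also have "\<dots> = (\<integral>\<^sup>+y. G x y * f y \<partial>m)" by (intro nn_integral_cong) (auto simp: indicator_def goff)
      finally show ?thesis .
    qed
    show "YP.Uop D f y = (\<integral>\<^sup>+x. G x y * f x \<partial>m)" if f: "f \<in> bfun" and y: "y \<in> D" for f y
    proof -
      have "YP.Uop D f y = (\<integral>\<^sup>+x\<in>D. G x y * f x \<partial>m)"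
        using g(2) f y unfolding YP.expct_occupation[OF D y, symmetric] by blast
      also have "\<dots> = (\<integral>\<^sup>+x. G x y * f x \<partial>m)" by (intro nn_integral_cong) (auto simp: indicator_def goff)
      finally show ?thesis .
    qed
    show "continuous_on D (\<lambda>x. G x y / G x0 y)" if y: "y \<in> D" "y \<noteq> x0" for y
    proof -
      have "Inl y \<in> topspace \<T> - {Inl x0}" using martin_spaceD(1)[OF martin(2)] y by auto
      from martin_spaceD(9)[OF martin(2) this] show ?thesis
        using martin_spaceD(5)[OF martin(2) _ y] by (simp cong: continuous_on_cong)
    qed
    show "inverse (c 2) * jh z0 y \<le> jh x y \<and> jh x y \<le> c 2 * jh z0 y"
      if "0 < r" "2 * r \<le> R1" "x \<in> ball z0 r" "y \<notin> ball z0 (2 * r)" for r x y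
      using C1'[OF that] by blast
    show "\<exists>\<delta>>0. \<forall>u v. dist z0 u < \<delta> \<and> u \<noteq> z0 \<and> q < dist z0 v \<longrightarrow> j v u \<le> eta * j v z0 \<and> j v z0 \<le> eta * j v u"
      if "0 < q" "q < R1" "1 < eta" for q eta
      by (rule E1_bounds[OF E1 S.j_pos that(1) le_R that(3)]) (use that in auto)
  qed (use D martin z0 R1 C c2 goff S.j_dual S.j_pos in auto)
  interpret MK: martin_kernel "TYPE('a)" X Xh m j jh D G z0 x0 R1 C "c 2" \<T> B K
    by unfold_locales (rule martin(2))
  \<comment> \<open>At radius 0 the excluded ball is empty, so \<open>MS.kap 0\<close> integrates
    over all of \<open>D\<close>; off the diagonal the jump densities are dual, and
    \<open>z0\<close> is not in \<open>D\<close>.\<close>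
  have kap: "poisson_kernel m j D G x z0 = MS.kap 0 x" for x
    unfolding poisson_kernel_def MS.kap_def
  proof (rule nn_integral_cong)
    fix y show "G x y * ennreal (j y z0) * ind D y = ennreal (jh z0 y) * (ind (- closure (ball z0 (3 / 8 * 0))) y * G x y)"
    proof (cases "y \<in> D")
      case True
      then have "y \<noteq> z0" using z0D by auto
      then show ?thesis using True S.j_dual[of y z0] by (simp add: mult.commute)
    qed (simp add: goff)
  qed
  have unique: "\<exists>!w. w \<in> B \<and> martin_associated D \<T> w z0"
    using MK.associated_exists MK.associated_unique by blast
  have main: "martin_minimal X D K w \<longleftrightarrow> accessible m j D G z0"
    if w: "w \<in> B" "martin_associated D \<T> w z0"
      and bnd: "\<And>r. 0 < r \<Longrightarrow> ereal r \<le> R \<Longrightarrow> ?s r < \<infinity>" for w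
  proof -
    interpret MP: martin_point "TYPE('a)" X Xh m j jh D G z0 x0 R1 C "c 2" \<T> B K w
      by unfold_locales (rule w)+
    show ?thesis
    proof (cases "accessible m j D G z0")
      case True
      interpret MA: martin_accessible "TYPE('a)" X Xh m j jh D G z0 x0 R1 C "c 2" \<T> B K w
      proof unfold_locales
        show "MS.kap 0 x = \<infinity>" if "x \<in> D" for x
          using True that unfolding accessible_def kap by blast
        show "\<exists>b<\<infinity>. \<forall>x\<in>MS.Dr (r / 2). \<forall>y. y \<notin> ball z0 r \<longrightarrow> G x y \<le> b \<and> G y x \<le> b" if r: "0 < r" "r \<le> R1" for r
        proof (intro exI conjI ballI allI impI)
          show "?s r < \<infinity>"
            by (rule bnd[OF r(1) less_imp_le[OF le_R[OF r(2)]]])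
          fix x y assume "x \<in> MS.Dr (r / 2)" "y \<notin> ball z0 r"
          then have "max (G x y) (G y x) \<le> ?s r"
            by (intro SUP_upper2[of x] SUP_upper) (auto simp: MS.Dr_def)
          then show "G x y \<le> ?s r"
            "G y x \<le> ?s r" by auto
        qed
        show "j z0 y \<le> c 2 * j x y" if "0 < r" "2 * r \<le> R1" "x \<in> ball z0 r" "y \<notin> ball z0 (2 * r)" for r x y
          using C1'[OF that] c2 by (simp add: field_simps)
      qed
      show ?thesis using MA.M_minimal True by (simp add: martin_minimal_def)
    next
      case False
      then obtain x1 where "x1 \<in> D" "MS.kap 0 x1 < \<infinity>" unfolding accessible_def kap by (auto simp: less_top)
      from MP.inaccessible_not_harmonic[OF this] show ?thesis
        using False by (simp add: martin_minimal_def minimal_harmonic_def)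
    qed
  qed
  show ?thesis
  proof (intro conjI impI ballI, rule unique, elim conjE)
    fix w assume "w \<in> B" "martin_associated D \<T> w z0"
      and bnd: "\<forall>r. 0 < r \<and> ereal r \<le> R \<longrightarrow> ?s r < \<infinity>"
    then show "martin_minimal X D K w \<longleftrightarrow> accessible m j D G z0" by (intro main) simp_all
  qed
qed

end
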